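(* Let $\omega$ be a radial weight on $\mathbb{D}$, $\nu\in\mathcal{D}$ and $1<p<\infty$. Then the following statements are equivalent: (i) $P_\omega:L^p_\nu\to L^p_\nu$ is bounded; (ii) $P^+_\omega:L^p_\nu\to L^p_\nu$ is bounded; (iii) $D_p(\omega,\nu)<\infty$; (iv) $A_p(\omega,\nu)<\infty$ and $\omega\in\widehat{\mathcal{D}}$.
   Context: Let $\mathbb{D}=\{z\in\mathbb{C}:|z|<1\}$, let $dA=\frac{dx\,dy}{\pi}$ be normalized area measure on $\mathbb{D}$, and let $\mathcal{H}(\mathbb{D})$ be the space of analytic functions in $\mathbb{D}$. A radial weight is a non-negative function $\omega\in L^1(\mathbb{D})$ with $\omega(z)=\omega(|z|)$ for all $z\in\mathbb{D}$; throughout it is assumed that $\widehat{\omega}(z)=\int_{|z|}^1\omega(s)\,ds>0$ for all $z\in\mathbb{D}$. For $0<p<\infty$, $L^p_\omega$ is the space of complex-valued measurable $f$ on $\mathbb{D}$ with $\|f\|_{L^p_\omega}^p=\int_{\mathbb{D}}|f|^p\omega\,dA<\infty$, and $A^p_\omega=L^p_\omega\cap\mathcal{H}(\mathbb{D})$. $B^\omega_z\in A^2_\omega$ denotes the reproducing kernel of $A^2_\omega$ at $z\in\mathbb{D}$: $f(z)=\int_{\mathbb{D}}f(\zeta)\overline{B^\omega_z(\zeta)}\omega(\zeta)\,dA(\zeta)$ for all $f\in A^2_\omega$. Equivalently $B^\omega_z(\zeta)=\sum_{n=0}^\infty\frac{(\overline z\zeta)^n}{2\omega_{2n+1}}$,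 where $\omega_x=\int_0^1r^x\omega(r)\,dr$. The Bergman projection and the maximal Bergman projection are $$P_\omega(f)(z)=\int_{\mathbb{D}}f(\zeta)\overline{B^\omega_z(\zeta)}\,\omega(\zeta)\,dA(\zeta),\qquad P^+_\omega(f)(z)=\int_{\mathbb{D}}f(\zeta)|B^\omega_z(\zeta)|\,\omega(\zeta)\,dA(\zeta),\quad z\in\mathbb{D}.$$ Boundedness of an operator $T:L^p_\nu\to L^p_\nu$ means that $T(f)$ is well defined for every $f\in L^p_\nu$ and $\|T(f)\|_{L^p_\nu}\le C\|f\|_{L^p_\nu}$ for some constant $C$. Classes of radial weights: $\omega\in\widehat{\mathcal{D}}$ if there is $C>0$ such that $\widehat\omega(r)\le C\widehat\omega\left(\frac{1+r}2\right)$ for all $r$ sufficiently close to $1$; $\omega\in\check{\mathcal{D}}$ if there are $K>1$ and $C>1$ such that $\widehat\omega(r)\ge C\widehat\omega\left(1-\frac{1-r}K\right)$ for all $r$ sufficiently close to $1$; $\mathcal{D}=\widehat{\mathcal{D}}\cap\check{\mathcal{D}}$. Further, $p'=\frac p{p-1}$, $\sigma=\left(\frac{\omega}{\nu^{1/p}}\right)^{p'}=\frac{\omega^{\frac p{p-1}}}{\nu^{\frac1{p-1}}}$ (with $\sigma=0$ where $\omega=\nu=0$ and $\sigma=\infty$ where $\nu=0<\omega$), and, with $\mathbb{N}=\{1,2,\dots\}$ and moments $\nu_x,\sigma_x$ defined as for $\omega$ (possibly $+\infty$ for $\sigma$), $$D_p(\omega,\nu)=\sup_{n\in\mathbb{N}\cup\{0\}}\frac{(\nu_{np+1})^{\frac1p}(\sigma_{np'+1})^{\frac1{p'}}}{\omega_{2n+1}},\qquad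 A_p(\omega,\nu)=\sup_{0\le r<1}\frac{\left(\int_r^1\nu(t)t\,dt\right)^{\frac1p}\left(\int_r^1\sigma(t)t\,dt\right)^{\frac1{p'}}}{\int_r^1\omega(t)t\,dt}.$$ *)

theory Defs
  imports "HOL-Analysis.Analysis" "HOL-Complex_Analysis.Complex_Analysis"
begin

abbreviation unit_disc :: "complex set" where
  "unit_disc \<equiv> ball 0 1"

definition disc_area :: "complex measure" where
  "disc_area = density (lebesgue_on unit_disc) (\<lambda>_. ennreal (1 / pi))"

text \<open>The value \<open>\<infinity>\<close> has to be kept under real powers, which is why \<open>powr\<close> on
  \<open>real\<close> is lifted by hand. This is the intended power only for exponents \<open>a > 0\<close>.\<close>

definition epowr :: "ennreal \<Rightarrow> real \<Rightarrow> ennreal" where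
  "epowr x a = (if x = \<infinity> then \<infinity> else ennreal (enn2real x powr a))"


subsection \<open>Radial weights\<close>

text \<open>For a radial function \<open>w\<close> on the disc, only its values on the radius \<open>[0,1)\<close> enter
  the following one-dimensional integrals. They are taken in \<open>[0,\<infinity>]\<close>: a weight that is
  area-integrable on the disc may fail to be integrable in \<open>r\<close> near \<open>0\<close>.\<close>

definition tail :: "(complex \<Rightarrow> ennreal) \<Rightarrow> real \<Rightarrow> ennreal" where
  "tail w r = (\<integral>\<^sup>+ s \<in> {r..<1}. w (of_real s) \<partial>lebesgue)"

definition tail1 :: "(complex \<Rightarrow> ennreal) \<Rightarrow> real \<Rightarrow> ennreal" where
  "tail1 w r = (\<integral>\<^sup>+ t \<in> {r..<1}. w (of_real t) * ennreal t \<partial>lebesgue)"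

definition moment :: "(complex \<Rightarrow> ennreal) \<Rightarrow> real \<Rightarrow> ennreal" where
  "moment w x = (\<integral>\<^sup>+ r \<in> {0..<1}. ennreal (r powr x) * w (of_real r) \<partial>lebesgue)"

definition radial_weight :: "(complex \<Rightarrow> real) \<Rightarrow> bool" where
  "radial_weight \<omega> \<longleftrightarrow>
     (\<forall>z\<in>unit_disc. 0 \<le> \<omega> z) \<and>
     (\<forall>z\<in>unit_disc. \<omega> z = \<omega> (of_real (norm z))) \<and>
     integrable disc_area \<omega> \<and>
     (\<forall>z\<in>unit_disc. tail (\<lambda>z. ennreal (\<omega> z)) (norm z) > 0)"

definition D_hat :: "(complex \<Rightarrow> real) set" where
  "D_hat = {\<omega>. radial_weight \<omega> \<and>
     (\<exists>C>0. \<forall>\<^sub>F r in at_left 1. tail (\<lambda>z. ennreal (\<omega> z)) r \<le> ennreal C * tail (\<lambda>z. ennreal (\<omega> z)) ((1 + r) / 2))}"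

definition D_check :: "(complex \<Rightarrow> real) set" where
  "D_check = {\<omega>. radial_weight \<omega> \<and>
     (\<exists>K>1. \<exists>C>1. \<forall>\<^sub>F r in at_left 1. tail (\<lambda>z. ennreal (\<omega> z)) r \<ge> ennreal C * tail (\<lambda>z. ennreal (\<omega> z)) (1 - (1 - r) / K))}"

definition D_class :: "(complex \<Rightarrow> real) set" where
  "D_class = D_hat \<inter> D_check"


subsection \<open>Weighted Lebesgue and Bergman spaces\<close>

definition Lp :: "real \<Rightarrow> (complex \<Rightarrow> real) \<Rightarrow> (complex \<Rightarrow> complex) set" where
  "Lp p \<omega> = {f. f \<in> borel_measurable disc_area \<and>
     (\<integral>\<^sup>+ z. ennreal (norm (f z) powr p * \<omega> z) \<partial>disc_area) < \<infinity>}"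

definition Lp_norm :: "real \<Rightarrow> (complex \<Rightarrow> real) \<Rightarrow> (complex \<Rightarrow> complex) \<Rightarrow> real" where
  "Lp_norm p \<omega> f = (\<integral>z. norm (f z) powr p * \<omega> z \<partial>disc_area) powr (1 / p)"

definition Bergman_space :: "real \<Rightarrow> (complex \<Rightarrow> real) \<Rightarrow> (complex \<Rightarrow> complex) set" where
  "Bergman_space p \<omega> = Lp p \<omega> \<inter> {f. f holomorphic_on unit_disc}"


subsection \<open>Bergman kernel and projections\<close>

text \<open>For a radial weight the reproducing kernel at \<open>z\<close> in the disc exists, and its values on
  the disc are unique; the choice below only concerns values outside the disc, which are never
  used.\<close>

definition Bergman_kernel :: "(complex \<Rightarrow> real) \<Rightarrow> complex \<Rightarrow> complex \<Rightarrow> complex" where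
  "Bergman_kernel \<omega> z = (SOME B. B \<in> Bergman_space 2 \<omega> \<and>
     (\<forall>f\<in>Bergman_space 2 \<omega>.
        f z = (\<integral>\<zeta>. f \<zeta> * cnj (B \<zeta>) * of_real (\<omega> \<zeta>) \<partial>disc_area)))"

definition Bergman_projection ::
  "(complex \<Rightarrow> real) \<Rightarrow> (complex \<Rightarrow> complex) \<Rightarrow> complex \<Rightarrow> complex" where
  "Bergman_projection \<omega> f z =
     (\<integral>\<zeta>. f \<zeta> * cnj (Bergman_kernel \<omega> z \<zeta>) * of_real (\<omega> \<zeta>) \<partial>disc_area)"

definition maximal_Bergman_projection ::
  "(complex \<Rightarrow> real) \<Rightarrow> (complex \<Rightarrow> complex) \<Rightarrow> complex \<Rightarrow> complex" where
  "maximal_Bergman_projection \<omega> f z =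
     (\<integral>\<zeta>. f \<zeta> * of_real (norm (Bergman_kernel \<omega> z \<zeta>)) * of_real (\<omega> \<zeta>) \<partial>disc_area)"

text \<open>The Bochner integral is \<open>0\<close> for non-integrable functions, so well-definedness of the
  projections has to be demanded separately.\<close>

definition Bergman_projection_defined ::
  "(complex \<Rightarrow> real) \<Rightarrow> (complex \<Rightarrow> complex) \<Rightarrow> bool" where
  "Bergman_projection_defined \<omega> f \<longleftrightarrow> (\<forall>z\<in>unit_disc. integrable disc_area
     (\<lambda>\<zeta>. f \<zeta> * cnj (Bergman_kernel \<omega> z \<zeta>) * of_real (\<omega> \<zeta>)))"

definition maximal_Bergman_projection_defined ::
  "(complex \<Rightarrow> real) \<Rightarrow> (complex \<Rightarrow> complex) \<Rightarrow> bool" where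
  "maximal_Bergman_projection_defined \<omega> f \<longleftrightarrow> (\<forall>z\<in>unit_disc. integrable disc_area
     (\<lambda>\<zeta>. f \<zeta> * of_real (norm (Bergman_kernel \<omega> z \<zeta>)) * of_real (\<omega> \<zeta>)))"

text \<open>Here \<open>wd f\<close> says that \<open>T f\<close> is well defined.\<close>

definition bounded_on_Lp ::
  "real \<Rightarrow> (complex \<Rightarrow> real) \<Rightarrow> ((complex \<Rightarrow> complex) \<Rightarrow> bool) \<Rightarrow>
   ((complex \<Rightarrow> complex) \<Rightarrow> complex \<Rightarrow> complex) \<Rightarrow> bool" where
  "bounded_on_Lp p \<nu> wd T \<longleftrightarrow>
     (\<forall>f\<in>Lp p \<nu>. wd f \<and> T f \<in> Lp p \<nu>) \<and>
     (\<exists>C. \<forall>f\<in>Lp p \<nu>. Lp_norm p \<nu> (T f) \<le> C * Lp_norm p \<nu> f)"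


subsection \<open>The two-weight conditions\<close>

definition conj_exp :: "real \<Rightarrow> real" where
  "conj_exp p = p / (p - 1)"

definition dual_weight ::
  "real \<Rightarrow> (complex \<Rightarrow> real) \<Rightarrow> (complex \<Rightarrow> real) \<Rightarrow> complex \<Rightarrow> ennreal" where
  "dual_weight p \<omega> \<nu> z =
     (if \<nu> z = 0 then (if \<omega> z = 0 then 0 else \<infinity>)
      else ennreal ((\<omega> z / \<nu> z powr (1 / p)) powr conj_exp p))"

text \<open>The denominators below are positive and finite for a radial weight \<open>\<omega>\<close>, and the
  \<open>\<nu>\<close>-factors are positive and finite for a radial weight \<open>\<nu>\<close>, so no convention about
  \<open>0 * \<infinity>\<close> or division by \<open>0\<close> is involved.\<close>

definition D_const :: "real \<Rightarrow> (complex \<Rightarrow> real) \<Rightarrow> (complex \<Rightarrow> real) \<Rightarrow> ennreal" where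
  "D_const p \<omega> \<nu> = (SUP n::nat.
     epowr (moment (\<lambda>z. ennreal (\<nu> z)) (real n * p + 1)) (1 / p) *
     epowr (moment (dual_weight p \<omega> \<nu>) (real n * conj_exp p + 1)) (1 / conj_exp p) /
     moment (\<lambda>z. ennreal (\<omega> z)) (2 * real n + 1))"

definition A_const :: "real \<Rightarrow> (complex \<Rightarrow> real) \<Rightarrow> (complex \<Rightarrow> real) \<Rightarrow> ennreal" where
  "A_const p \<omega> \<nu> = (SUP r\<in>{0..<1}.
     epowr (tail1 (\<lambda>z. ennreal (\<nu> z)) r) (1 / p) *
     epowr (tail1 (dual_weight p \<omega> \<nu>) r) (1 / conj_exp p) /
     tail1 (\<lambda>z. ennreal (\<omega> z)) r)"

end

theory Submission
  imports Defs
begin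

text \<open>
  \<^emph>\<open>Idea of the proof.\<close> All weights are integrated against the area measure, whose rotation invariance
  replaces integrals over circles by averages over the rotations \<open>sgn u\<close>, with \<open>u\<close> in the disc.

  (i) implies (iii): on \<open>f(\<zeta>) = sgn(\<zeta>)\<^sup>n h(\<zeta>)\<close> with \<open>h\<close> radial the projection is a multiple of \<open>z\<^sup>n\<close>, and
  the extremal \<open>h\<close> of Hoelder's inequality, truncated where \<open>\<omega>/\<nu>\<close> is large, yields the bound for \<open>D\<^sub>p\<close>.

  (iii) implies (iv): Hoelder's inequality for \<open>\<omega> = \<nu>\<^bsup>1/p\<^esup> \<sigma>\<^bsup>1/q\<^esup>\<close> with the exponents \<open>k\<close> and \<open>2k\<close>, and the doubling of the
  moments of \<open>\<nu>\<close>, bound the moment of order \<open>3k\<close> of \<open>\<omega>\<close> by a constant times that of order \<open>4k\<close>. Iterating, the loss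
  is geometric in the number of steps while the gain outside \<open>|z| \<ge> (1+r)/2\<close> is doubly exponential, so that
  moments are dominated by tails.

  (iv) implies (ii): the condition \<open>A\<^sub>p\<close> transfers from \<open>\<nu>\<close> to \<open>\<sigma>\<close> and \<open>\<omega>\<close> both the doubling of the tails and their
  decay. Then the mean of \<open>|B\<^sub>z(\<zeta>)|\<close> over rotations is at most a constant over the tail of \<open>\<omega>\<close> at
  \<open>min |z| |\<zeta>|\<close>, and Schur's test applies to the two halves \<open>|z| \<le> |\<zeta>|\<close> and \<open>|\<zeta>| \<le> |z|\<close> of the kernel; the second half is
  the first one for \<open>(q, \<sigma>, \<nu>)\<close> instead of \<open>(p, \<nu>, \<sigma>)\<close>.
\<close>

section \<open>The area measure of the disc\<close>

text \<open>Only \<nu> is assumed to be regular: \<omega> is an arbitrary radial weight, and the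
  dual weight may a priori be infinite on a set of positive measure. Each of (i), (iii), (iv)
  therefore has to yield the integrability of the dual weight first. Then it is replaced by a real
  weight \<sigma>, and the estimates rest on the factorization of \<omega> in
  \<open>weight_triple\<close>, which is symmetric in (p, \<nu>) and (q, \<sigma>).

  The unequal exponents k and 2k come from the same lack of information: the moment of \<nu> may be
  doubled, that of \<sigma> may not, and doubling it makes both orders match those in
  \<open>D_const\<close>.

  The weight classes are defined by linear tails, which may be infinite at 0, whereas Hoelder and
  Fubini act on area integrals. All estimates use the area versions \<open>wtail\<close> and
  \<open>wmom\<close>; the tails have to be compared near 1 only.

  The kernel has positive coefficients but no sign, so its means are not read off from coefficients.
  The factor 1 - z tames the coefficients of its derivative enough for an L2 argument, and
  integration along the radius returns to the kernel; the decay of the tails makes that integral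
  converge geometrically.\<close>

lemma distr_vec_complex: "distr lborel borel (\<lambda>x::real^2. Complex (x$1) (x$2)) = lborel"
proof (rule lborel_eqI[symmetric])
  fix l u :: complex assume lu: "\<And>b. b \<in> Basis \<Longrightarrow> l \<bullet> b \<le> u \<bullet> b"
  have le: "Re l \<le> Re u" "Im l \<le> Im u"
    using lu[of 1] lu[of \<i>] by (auto simp: Basis_complex_def)
  have B: "(Basis :: (real^2) set) = {axis 1 1, axis 2 1}"
    by (auto simp: Basis_vec_def UNIV_2)
  have ne: "axis 1 1 \<noteq> (axis 2 1 :: real^2)" by (simp add: axis_eq_axis)
  have meas: "(\<lambda>x::real^2. Complex (x$1) (x$2)) \<in> borel_measurable borel"
    by (auto simp: borel_measurable_complex_iff)
  have "(\<lambda>x::real^2. Complex (x$1) (x$2)) -` box l u = box (vector [Re l, Im l]) (vector [Re u, Im u])"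
    by (auto simp: mem_box_cart in_box_complex_iff forall_2 vector_2)
  then have "emeasure (distr lborel borel (\<lambda>x::real^2. Complex (x$1) (x$2))) (box l u)
    = emeasure lborel (box (vector [Re l, Im l]) (vector [Re u, Im u] :: real^2))"
    using meas by (subst emeasure_distr) auto
  also have "\<dots> = ennreal (\<Prod>b\<in>Basis. (u - l) \<bullet> b)"
    by (subst emeasure_lborel_box)
       (use le ne in \<open>auto simp: B inner_axis vector_2 Basis_complex_def ennreal_mult' algebra_simps\<close>)
  finally show "emeasure (distr lborel borel (\<lambda>x::real^2. Complex (x$1) (x$2))) (box l u)
    = ennreal (\<Prod>b\<in>Basis. (u - l) \<bullet> b)" .
qed simp

text \<open>Boxes determine the measure, and the preimage of a box is its image under the inverse
  map, which is again orthogonal and hence keeps the volume.\<close>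

lemma distr_lborel_orthogonal:
  fixes T :: "real^2 \<Rightarrow> real^2"
  assumes T: "orthogonal_transformation T"
  shows "distr lborel borel T = lborel"
proof (rule lborel_eqI[symmetric])
  fix l u :: "real^2" assume lu: "\<And>b. b \<in> Basis \<Longrightarrow> l \<bullet> b \<le> u \<bullet> b"
  have [measurable]: "T \<in> borel_measurable borel"
    using T by (intro borel_measurable_continuous_onI linear_continuous_on)
      (auto simp: orthogonal_transformation_linear linear_linear)
  have bij: "bij T" using T by (rule orthogonal_transformation_bij)
  have inv: "orthogonal_transformation (inv T)" using T by (rule orthogonal_transformation_inv)
  have eq: "T -` box l u = inv T ` box l u" using bij by (rule bij_vimage_eq_inv_image)
  have "emeasure (distr lborel borel T) (box l u) = emeasure lebesgue (inv T ` box l u)"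
  proof -
    have "T -` box l u \<in> sets borel" using measurable_sets[OF \<open>T \<in> _\<close>, of "box l u"] by simp
    then show ?thesis
      by (subst emeasure_distr) (auto simp: eq)
  qed
  also have "\<dots> = emeasure lebesgue (box l u)"
    using measure_orthogonal_image[OF inv, of "box l u"] measurable_orthogonal_image[OF inv, of "box l u"]
    by (simp add: emeasure_eq_measure2)
  also have "\<dots> = ennreal (\<Prod>b\<in>Basis. (u - l) \<bullet> b)"
    using lu by (simp add: emeasure_lborel_box)
  finally show "emeasure (distr lborel borel T) (box l u) = ennreal (\<Prod>b\<in>Basis. (u - l) \<bullet> b)" .
qed simp

text \<open>In real coordinates, multiplication by a unimodular number is an orthogonal map of
  \<open>real^2\<close>; \<open>distr_vec_complex\<close> carries its invariance over to
  \<open>complex\<close>.\<close>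

lemma distr_lborel_rotation:
  assumes c: "norm (c::complex) = 1"
  shows "distr lborel borel ((*) c) = lborel"
proof -
  let ?V = "\<lambda>x::real^2. Complex (x$1) (x$2)"
  define T :: "real^2 \<Rightarrow> real^2" where "T x = vector [Re (c * ?V x), Im (c * ?V x)]" for x
  have [measurable]: "?V \<in> borel_measurable borel" 
    by (auto simp: borel_measurable_complex_iff)
  have nV: "norm x = norm (?V x)" for x :: "real^2"
    by (simp add: norm_vec_def L2_set_def UNIV_2 cmod_def)
  have VT: "?V (T x) = c * ?V x" for x by (simp add: T_def vector_2 complex_eq_iff)
  have "linear T"
    by (rule linearI) (simp_all add: T_def vec_eq_iff forall_2 algebra_simps)
  moreover have "norm (T x) = norm x" for x
    using c by (simp only: nV VT norm_mult)
  ultimately have T: "orthogonal_transformation T" by (simp add: orthogonal_transformation)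
  have [measurable]: "T \<in> borel_measurable borel"
    using T by (intro borel_measurable_continuous_onI linear_continuous_on)
      (auto simp: orthogonal_transformation_linear linear_linear)
  have "distr lborel borel ((*) c) = distr (distr lborel borel ?V) borel ((*) c)"
    by (simp add: distr_vec_complex)
  also have "\<dots> = distr (distr lborel borel T) borel ?V"
    by (subst (1 2) distr_distr) (auto simp: o_def VT)
  also have "\<dots> = lborel" by (simp add: distr_lborel_orthogonal[OF T] distr_vec_complex)
  finally show ?thesis .
qed

section \<open>Measurability and rotation invariance on the disc\<close>

lemma space_disc_area [simp]: "space disc_area = ball 0 1"
  by (simp add: disc_area_def)

lemma sets_disc_area: "sets disc_area = sets (lebesgue_on (ball 0 1))"
  by (simp add: disc_area_def)

lemma measurable_disc_area: "measurable disc_area N = measurable (lebesgue_on (ball 0 1)) N"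
  by (intro measurable_cong_sets) (auto simp: disc_area_def)

text \<open>\<open>disc_area\<close> lives on Lebesgue sets, so Borel functions of the whole plane
  are measurable for it; explicit functions of \<open>z\<close> are handled below by this
  reduction.\<close>

lemma borel_measurable_disc_area [measurable (raw)]:
  assumes "f \<in> measurable borel N" shows "f \<in> measurable disc_area N"
proof -
  have "f \<in> measurable lebesgue N"
    using assms by (auto intro: measurable_completion)
  then show ?thesis unfolding measurable_disc_area by (rule measurable_restrict_space1)
qed

lemma continuous_on_measurable_disc_area:
  fixes f :: "complex \<Rightarrow> 'a::{second_countable_topology, metric_space}"
  shows "continuous_on (ball 0 1) f \<Longrightarrow> f \<in> borel_measurable disc_area"
  unfolding measurable_disc_area
proof -
  assume "continuous_on (ball 0 1) f"
  then have "f \<in> borel_measurable (restrict_space borel (ball 0 1))"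
    by (rule borel_measurable_continuous_on_restrict)
  then show "f \<in> borel_measurable (lebesgue_on (ball 0 1))"
    by (auto simp: measurable_def space_restrict_space sets_restrict_space) 
qed

lemma nn_integral_disc_area:
  assumes "f \<in> borel_measurable disc_area"
  shows "(\<integral>\<^sup>+z. f z \<partial>disc_area) = ennreal (1/pi) * (\<integral>\<^sup>+z. f z * indicator (ball 0 1) z \<partial>lebesgue)"
  using assms unfolding measurable_disc_area unfolding disc_area_def
  by (subst nn_integral_density) (auto simp: nn_integral_cmult nn_integral_restrict_space)

text \<open>\<open>lebesgue\<close> is a completion, so a measurable set is a Borel set together
  with a part of a Borel null set. The preimage of that null set is null by the invariance of
  \<open>lborel\<close>.\<close>

lemma measurable_lebesgue_rotation:
  assumes c: "norm (c::complex) = 1"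
  shows "(*) c \<in> lebesgue \<rightarrow>\<^sub>M lebesgue"
proof (rule measurableI)
  fix A :: "complex set" assume "A \<in> sets lebesgue"
  then obtain S N N' where A: "A = S \<union> N" "S \<in> sets lborel" "N \<subseteq> N'" "N' \<in> null_sets lborel"
    by (auto elim: sets_completionE)
  have [measurable]: "((*) c) \<in> borel_measurable borel" by measurable
  have "(*) c -` S \<in> sets borel" using measurable_sets[OF \<open>(*) c \<in> _\<close>, of S] A by simp
  moreover have "(*) c -` N' \<in> null_sets lborel"
  proof -
    have "N' \<in> null_sets (distr lborel borel ((*) c))" using A by (simp add: distr_lborel_rotation[OF c])
    then show ?thesis by (simp add: null_sets_distr_iff)
  qed
  moreover have "(*) c -` A = (*) c -` S \<union> (*) c -` N" using A by auto
  ultimately show "(*) c -` A \<inter> space lebesgue \<in> sets lebesgue"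
    using A(3) by (auto intro!: sets_completionI[of _ "(*) c -` S" "(*) c -` N" "(*) c -` N'"])
qed simp

lemma distr_lebesgue_rotation:
  assumes c: "norm (c::complex) = 1"
  shows "distr lebesgue lebesgue ((*) c) = lebesgue"
proof (rule measure_eqI)
  fix A assume "A \<in> sets (distr lebesgue lebesgue ((*) c))"
  then have "A \<in> sets lebesgue" by simp
  then obtain S N N' where A: "A = S \<union> N" "S \<in> sets lborel" "N \<subseteq> N'" "N' \<in> null_sets lborel"
    by (auto elim: sets_completionE)
  have [measurable]: "((*) c) \<in> borel_measurable borel" by measurable
  have "(*) c -` S \<in> sets borel" using measurable_sets[OF \<open>(*) c \<in> _\<close>, of S] A by simp
  have "(*) c -` N' \<in> null_sets lborel"
  proof -
    have "N' \<in> null_sets (distr lborel borel ((*) c))" using A by (simp add: distr_lborel_rotation[OF c])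
    then show ?thesis by (simp add: null_sets_distr_iff)
  qed
  then have n: "(*) c -` N \<in> null_sets lebesgue"
    using A(3) by (meson null_sets_completion_iff2 null_sets_completionI null_sets_completion_subset vimage_mono)
  have n2: "N \<in> null_sets lebesgue" using A by (meson null_sets_completionI null_sets_completion_subset)
  have "emeasure (distr lebesgue lebesgue ((*) c)) A = emeasure lebesgue ((*) c -` S \<union> (*) c -` N)"
    using A \<open>A \<in> sets lebesgue\<close> by (subst emeasure_distr) (auto simp: measurable_lebesgue_rotation[OF c])
  also have "\<dots> = emeasure lborel ((*) c -` S)"
    using n \<open>(*) c -` S \<in> sets borel\<close> by (subst emeasure_Un_null_set) auto
  also have "\<dots> = emeasure (distr lborel borel ((*) c)) S"
    using A by (subst emeasure_distr) auto
  also have "\<dots> = emeasure lebesgue (S \<union> N)"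
    using A n2 by (subst emeasure_Un_null_set) (auto simp: distr_lborel_rotation[OF c])
  finally show "emeasure (distr lebesgue lebesgue ((*) c)) A = emeasure lebesgue A" using A by simp
qed simp

lemma measurable_disc_rotation [measurable]:
  assumes c: "norm (c::complex) = 1"
  shows "(*) c \<in> disc_area \<rightarrow>\<^sub>M disc_area"
proof -
  have "(*) c \<in> lebesgue_on (ball 0 1) \<rightarrow>\<^sub>M lebesgue_on (ball 0 1)"
    by (rule measurable_restrict_space3[OF measurable_lebesgue_rotation[OF c]])
       (use c in \<open>auto simp: norm_mult\<close>)
  then show ?thesis
    by (simp add: disc_area_def measurable_def)
qed

lemma nn_integral_disc_rotation:
  assumes c: "norm (c::complex) = 1" and f: "f \<in> borel_measurable disc_area"
  shows "(\<integral>\<^sup>+z. f (c * z) \<partial>disc_area) = (\<integral>\<^sup>+z. f z \<partial>disc_area)"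
proof -
  have f': "(\<lambda>z. f z * indicator (ball 0 1) z) \<in> borel_measurable lebesgue"
    using f unfolding measurable_disc_area by (subst (asm) borel_measurable_restrict_space_iff_ennreal) auto
  have "(\<lambda>z. f (c * z)) \<in> borel_measurable disc_area"
    using measurable_compose[OF measurable_disc_rotation[OF c] f] by simp
  then have "(\<integral>\<^sup>+z. f (c * z) \<partial>disc_area) 
      = ennreal (1/pi) * (\<integral>\<^sup>+z. f (c*z) * indicator (ball 0 1) z \<partial>lebesgue)"
    by (rule nn_integral_disc_area)
  also have "(\<integral>\<^sup>+z. f (c*z) * indicator (ball 0 1) z \<partial>lebesgue)
     = (\<integral>\<^sup>+z. f (c*z) * indicator (ball 0 1) (c * z) \<partial>lebesgue)"
    using c by (intro nn_integral_cong) (auto simp: norm_mult split: split_indicator)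
  also have "\<dots> = (\<integral>\<^sup>+z. f z * indicator (ball 0 1) z \<partial>distr lebesgue lebesgue ((*) c))"
    using f' by (subst nn_integral_distr[OF measurable_lebesgue_rotation[OF c]]) auto
  also have "\<dots> = (\<integral>\<^sup>+z. f z * indicator (ball 0 1) z \<partial>lebesgue)"
    by (simp add: distr_lebesgue_rotation[OF c])
  finally show ?thesis using nn_integral_disc_area[OF f] by simp
qed

lemma distr_disc_rotation:
  assumes c: "norm (c::complex) = 1"
  shows "distr disc_area disc_area ((*) c) = disc_area"
proof (rule measure_eqI)
  fix A assume "A \<in> sets (distr disc_area disc_area ((*) c))"
  then have A: "A \<in> sets disc_area" by simp
  have "emeasure (distr disc_area disc_area ((*) c)) A 
      = (\<integral>\<^sup>+z. indicator A z \<partial>distr disc_area disc_area ((*) c))"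
    using A by simp
  also have "\<dots> = emeasure disc_area A"
    using A nn_integral_disc_rotation[OF c, of "indicator A"]
    by (subst nn_integral_distr[OF measurable_disc_rotation[OF c]]) auto
  finally show "emeasure (distr disc_area disc_area ((*) c)) A = emeasure disc_area A" .
qed simp

lemma integral_disc_rotation:
  fixes f :: "complex \<Rightarrow> 'a::{banach, second_countable_topology}"
  assumes c: "norm (c::complex) = 1" and f: "f \<in> borel_measurable disc_area"
  shows "(\<integral>z. f (c * z) \<partial>disc_area) = (\<integral>z. f z \<partial>disc_area)"
  using integral_distr[OF measurable_disc_rotation[OF c] f] by (simp add: distr_disc_rotation[OF c])

text \<open>Polar coordinates in the form of a law: the modulus has density 2t on [0,1). Finite
  measures on the line are determined by the half-lines, where both sides have the value 1 - x^2 for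
  x in [0,1), once by areas of discs and once by an antiderivative.\<close>

lemma distr_disc_norm:
  "distr disc_area borel norm = density lborel (\<lambda>t. ennreal (2 * t) * indicator {0..<1} t)"
proof (rule measure_eqI_lessThan)
  let ?N = "density lborel (\<lambda>t. ennreal (2 * t) * indicator {0..<1} t)"
  have F: "emeasure (distr disc_area borel norm) {x<..} = 
     (if x < 0 then 1 else if x < 1 then ennreal (1 - x^2) else 0)" for x
  proof -
    have [measurable]: "{z::complex. x < norm z} \<in> sets borel" by measurable
    have "emeasure (distr disc_area borel norm) {x<..} = emeasure disc_area (norm -` {x<..} \<inter> ball 0 1)"
      by (subst emeasure_distr) auto
    also have "\<dots> = (\<integral>\<^sup>+z. indicator {z. x < norm z} z \<partial>disc_area)"
    proof -
      have "{z::complex. x < norm z} \<in> sets borel" by measurable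
      then have "norm -` {x<..} \<inter> ball 0 1 \<in> sets disc_area"
        using measurable_sets[OF borel_measurable_disc_area[of norm borel], of "{x<..}"] by simp
      then have "emeasure disc_area (norm -` {x<..} \<inter> ball 0 1)
          = (\<integral>\<^sup>+z. indicator (norm -` {x<..} \<inter> ball 0 1) z \<partial>disc_area)"
        by simp
      also have "\<dots> = (\<integral>\<^sup>+z. indicator {z. x < norm z} z \<partial>disc_area)"
        by (intro nn_integral_cong) (auto split: split_indicator)
      finally show ?thesis .
    qed
    also have "\<dots> = ennreal (1/pi) * (\<integral>\<^sup>+z. indicator {z. x < norm z} z * indicator (ball (0::complex) 1) z \<partial>lebesgue)"
      by (rule nn_integral_disc_area) (auto intro!: borel_measurable_disc_area)
    also have "(\<integral>\<^sup>+z. indicator {z. x < norm z} z * indicator (ball (0::complex) 1) z \<partial>lebesgue)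
       = emeasure lborel (ball (0::complex) 1 - cball 0 x)"
    proof -
      have "(\<integral>\<^sup>+z. indicator {z. x < norm z} z * indicator (ball (0::complex) 1) z \<partial>lebesgue)
        = (\<integral>\<^sup>+z. indicator (ball (0::complex) 1 - cball 0 x) z \<partial>lebesgue)"
        by (intro nn_integral_cong) (auto split: split_indicator)
      then show ?thesis by simp
    qed
    also have "\<dots> = (if x < 0 then ennreal pi else if x < 1 then ennreal (pi - pi*x^2) else 0)"
    proof -
      have "emeasure lborel (ball (0::complex) 1 - cball 0 x) = emeasure lborel (ball (0::complex) 1) - emeasure lborel (cball (0::complex) x)"
        if "0 \<le> x" "x < 1"
        using that by (intro emeasure_Diff) (auto simp: emeasure_cball)
      moreover have "ball (0::complex) 1 - cball 0 x = ball 0 1" if "x < 0" using that by auto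
      moreover have "emeasure lborel (ball (0::complex) 1 - cball 0 x) = 0" if "\<not> x < 1"
      proof -
        have e: "ball (0::complex) 1 - cball 0 x = {}" using that by auto
        show ?thesis unfolding e by simp
      qed
      moreover have "pi * x\<^sup>2 \<le> pi" if "0 \<le> x" "x < 1" using that by (simp add: power_le_one)
      ultimately show ?thesis
        by (auto simp: emeasure_ball emeasure_cball unit_ball_vol_2 ennreal_minus)
    qed
    also have "ennreal (1/pi) * \<dots> = (if x < 0 then 1 else if x < 1 then ennreal (1 - x^2) else 0)"
      by (auto simp: ennreal_mult'[symmetric] algebra_simps)
    finally show ?thesis .
  qed
  have G: "emeasure ?N {x<..} = (if x < 0 then 1 else if x < 1 then ennreal (1 - x^2) else 0)" for x
  proof -
    have "emeasure ?N {x<..} = (\<integral>\<^sup>+t. ennreal (2 * t) * indicator {0..<1} t * indicator {x<..} t \<partial>lborel)"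
      by (subst emeasure_density) auto
    \<comment> \<open>The intervals differ only at the null points \<open>x\<close> and 1; the
      closed interval is the form in which the antiderivative is applied.\<close>
    also have "\<dots> = (if x < 1 then \<integral>\<^sup>+t. ennreal (2 * t) * indicator {max 0 x..1} t \<partial>lborel else 0)"
    proof (cases "x < 1")
      case True
      have "AE t in lborel. t \<noteq> x \<and> t \<noteq> 1"
        using AE_lborel_singleton[of x] AE_lborel_singleton[of 1] by auto
      then show ?thesis using True
        by (auto intro!: nn_integral_cong_AE split: split_indicator)
    qed (auto simp: nn_integral_0_iff_AE split: split_indicator)
    also have "\<dots> = (if x < 1 then ennreal (1 - (max 0 x)^2) else 0)"
    proof -
      have "(\<integral>\<^sup>+t. ennreal (2 * t) * indicator {max 0 x..1} t \<partial>lborel) = ennreal (1^2 - (max 0 x)^2)" if "x < 1"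
        by (rule nn_integral_FTC_Icc[where F="\<lambda>t. t^2"]) (use that in \<open>auto intro!: derivative_eq_intros\<close>)
      then show ?thesis by simp
    qed
    finally show ?thesis by (auto simp: max_def)
  qed
  show "emeasure (distr disc_area borel norm) {x<..} = emeasure ?N {x<..}" for x
    by (simp add: F G)
  show "emeasure (distr disc_area borel norm) {x<..} < \<infinity>" for x by (simp add: F)
qed auto

text \<open>Total mass one is what makes an integral over an auxiliary variable \<open>u\<close> in
  the disc an average.\<close>

lemma emeasure_disc_area: "emeasure disc_area (ball 0 1) = 1"
proof -
  have "emeasure disc_area (ball 0 1) = ennreal (1/pi) * emeasure lborel (ball (0::complex) 1)"
    using nn_integral_disc_area[of "\<lambda>_. 1"] by simp
  then show ?thesis by (simp add: emeasure_ball unit_ball_vol_2 ennreal_mult'[symmetric])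
qed

interpretation disc: finite_measure disc_area
  by standard (simp add: emeasure_disc_area)

section \<open>Radial functions and their tails\<close>

definition radial_fun :: "(complex \<Rightarrow> ennreal) \<Rightarrow> bool" where
  "radial_fun w \<longleftrightarrow> w \<in> borel_measurable disc_area \<and>
     (\<forall>z\<in>ball 0 1. w z = w (of_real (norm z)))"

lemma radial_funD:
  assumes "radial_fun w"
  shows "w \<in> borel_measurable disc_area" "norm z < 1 \<Longrightarrow> w (of_real (norm z)) = w z"
proof -
  show "w \<in> borel_measurable disc_area" using assms unfolding radial_fun_def by blast
  have *: "\<forall>z\<in>ball 0 1. w z = w (of_real (norm z))" using assms unfolding radial_fun_def by blast
  show "w (of_real (norm z)) = w z" if "norm z < 1"
    by (rule bspec[OF *, symmetric]) (simp add: that)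
qed

lemma radial_funI:
  assumes "w \<in> borel_measurable disc_area" "\<And>z. norm z < 1 \<Longrightarrow> w (of_real (norm z)) = w z"
  shows "radial_fun w"
  unfolding radial_fun_def
proof (intro conjI ballI)
  fix z :: complex assume "z \<in> ball 0 1"
  then have "norm z < 1" by simp
  then show "w z = w (of_real (norm z))" by (rule assms(2)[symmetric])
qed (rule assms(1))

text \<open>Both the radial set and its complement are, up to null sets, unions of countably many compact
  sets; the norm maps these to Borel sets which enclose \<open>E\<close> up to a null set.\<close>

lemma radial_set_lebesgue:
  fixes E :: "real set"
  assumes E: "E \<subseteq> {0..<1}" and S: "{z::complex. norm z \<in> E} \<in> sets lebesgue"
  shows "E \<in> sets lebesgue"
proof -
  let ?S = "{z::complex. norm z \<in> E}"
  have fs: "norm ` C \<in> sets borel" if fC: "fsigma C" for C :: "complex set"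
  proof -
    obtain F :: "nat \<Rightarrow> complex set" where F: "range F \<subseteq> Collect compact" "C = \<Union>(F ` UNIV)"
      using fC fsigma_Union_compact by metis
    have "norm ` C = (\<Union>n. norm ` F n)" using F by auto
    moreover have "norm ` F n \<in> sets borel" for n
      using F by (intro borel_closed compact_imp_closed compact_continuous_image continuous_intros) auto
    ultimately show ?thesis by auto
  qed
  obtain C N where C: "fsigma C" "N \<in> null_sets lebesgue" "C \<union> N = ?S"
    using lebesgue_set_almost_fsigma[OF S] by metis
  have "- ?S \<in> sets lebesgue" using sets.compl_sets[OF S] unfolding Compl_eq_Diff_UNIV by simp
  then obtain C' N' where C': "fsigma C'" "N' \<in> null_sets lebesgue" "C' \<union> N' = - ?S"
    using lebesgue_set_almost_fsigma by metis
  define D where "D = norm ` C"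
  define D' where "D' = norm ` C'"
  have D: "D \<in> sets borel" "D' \<in> sets borel" using fs C C' by (auto simp: D_def D'_def)
  have DE: "D \<subseteq> E" "D' \<inter> E = {}" using C C' by (auto simp: D_def D'_def)
  \<comment> \<open>\<open>Q\<close> collects the radii on which neither image decides; a point of
    such modulus lies in neither \<open>C\<close> nor \<open>C'\<close>, hence in \<open>N\<close>
    or \<open>N'\<close>.\<close>
  define Q where "Q = {0..<1} - D - D'"
  have Q: "Q \<in> sets borel" using D by (auto simp: Q_def)
  have sub: "norm -` Q \<subseteq> N \<union> N'" 
    using C(3) C'(3) by (auto simp: Q_def D_def D'_def)
  have null: "N \<union> N' \<in> null_sets lebesgue" using C C' by auto
  have Qm: "norm -` Q \<in> sets (borel :: complex measure)"
    using measurable_sets[of norm "borel :: complex measure" borel Q] Q by simp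
  have "emeasure (distr disc_area borel norm) Q = 0"
  proof -
    have "emeasure (distr disc_area borel norm) Q = (\<integral>\<^sup>+t. indicator Q t \<partial>distr disc_area borel norm)"
      using Q by simp
    also have "\<dots> = (\<integral>\<^sup>+z. indicator Q (norm z) \<partial>disc_area)"
      using Q by (subst nn_integral_distr) auto
    also have "\<dots> = ennreal (1/pi) * (\<integral>\<^sup>+z. indicator Q (norm z) * indicator (ball (0::complex) 1) z \<partial>lebesgue)"
    proof (rule nn_integral_disc_area)
      show "(\<lambda>z. indicator Q (norm z)) \<in> borel_measurable disc_area"
        using Q by (intro borel_measurable_disc_area) auto
    qed
    also have "(\<integral>\<^sup>+z. indicator Q (norm z) * indicator (ball (0::complex) 1) z \<partial>lebesgue) = 0"
    proof -
      have "(\<integral>\<^sup>+z. indicator Q (norm z) * indicator (ball (0::complex) 1) z \<partial>lebesgue) \<le> (\<integral>\<^sup>+z. indicator (N \<union> N') z \<partial>lebesgue)"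
        using sub by (intro nn_integral_mono) (auto split: split_indicator)
      also have "\<dots> = 0" using null null_setsD1[OF null] by (subst nn_integral_indicator) auto
      finally show ?thesis by simp
    qed
    finally show ?thesis by simp
  qed
  then have "(\<integral>\<^sup>+t. ennreal (2 * t) * indicator {0..<1} t * indicator Q t \<partial>lborel) = 0"
    using Q by (simp add: distr_disc_norm emeasure_density)
  then have "AE t in lborel. ennreal (2 * t) * indicator {0..<1} t * indicator Q t = (0::ennreal)"
    using Q by (subst (asm) nn_integral_0_iff_AE) auto
  \<comment> \<open>The density 2t vanishes only at 0, so vanishing of the integral over
    \<open>Q\<close> makes \<open>Q\<close> a null set.\<close>
  moreover have "AE t in lborel. t \<noteq> (0::real)" by (rule AE_lborel_singleton)
  ultimately have "AE t in lborel. t \<notin> Q"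
  proof eventually_elim
    case (elim t)
    then show ?case by (auto simp: Q_def split: split_indicator_asm)
  qed
  then have nQ: "Q \<in> null_sets lborel" using Q by (subst AE_iff_null_sets) auto
  have "E = D \<union> (E - D)" using DE by auto
  moreover have "E - D \<subseteq> Q" using E DE by (auto simp: Q_def)
  ultimately show ?thesis
    using nQ D by (intro sets_completionI[of _ D "E - D" Q]) auto
qed

text \<open>Preimages under a radial function are radial sets, which
  \<open>radial_set_lebesgue\<close> carries over to the radius. The indicator adds the complement
  of [0,1) whenever 0 lies in the target set.\<close>

lemma radial_fun_lebesgue:
  assumes "radial_fun w"
  shows "(\<lambda>t. w (of_real t) * indicator {0..<1} t) \<in> borel_measurable lebesgue"
proof (rule measurableI)
  fix B :: "ennreal set" assume B: "B \<in> sets borel"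
  define E where "E = {t\<in>{0..<1}. w (of_real t) \<in> B}"
  have "w -` B \<inter> ball 0 1 \<in> sets disc_area"
    using radial_funD(1)[OF assms] B measurable_sets[of w disc_area borel B] by simp
  then have "w -` B \<inter> ball 0 1 \<in> sets lebesgue"
    by (simp add: sets_disc_area sets_restrict_space_iff)
  moreover have "w -` B \<inter> ball 0 1 = {z. norm z \<in> E}"
  proof -
    have *: "z \<in> w -` B \<inter> ball 0 1 \<longleftrightarrow> norm z \<in> E" for z
      using radial_funD(2)[OF assms, of z] by (cases "norm z < 1") (auto simp: E_def)
    show ?thesis by (rule set_eqI, unfold mem_Collect_eq, rule *)
  qed
  ultimately have E: "E \<in> sets lebesgue" by (intro radial_set_lebesgue) (auto simp: E_def)
  have "(\<lambda>t. w (of_real t) * indicator {0..<1} t) -` B = E \<union> (if 0 \<in> B then - {0..<1} else {})"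
  proof (rule set_eqI)
    fix t :: real
    show "t \<in> (\<lambda>t. w (of_real t) * indicator {0..<1} t) -` B \<longleftrightarrow> t \<in> E \<union> (if 0 \<in> B then - {0..<1} else {})"
      by (cases "t \<in> {0..<1}") (auto simp: E_def)
  qed
  moreover have "- {0..<1::real} \<in> sets lebesgue" using sets.compl_sets[of "{0..<1::real}" lebesgue] unfolding Compl_eq_Diff_UNIV by simp
  ultimately show "(\<lambda>t. w (of_real t) * indicator {0..<1} t) -` B \<inter> space lebesgue \<in> sets lebesgue"
    using E by auto
qed simp

text \<open>\<open>distr_disc_norm\<close> gives polar coordinates for Borel profiles; the Lebesgue
  measurable profile is replaced by a Borel version, and the exceptional null set of radii is null
  for the law of the modulus.\<close>

lemma nn_integral_radial:
  assumes "radial_fun w"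
  shows "(\<integral>\<^sup>+z. w z \<partial>disc_area) = (\<integral>\<^sup>+t. ennreal (2 * t) * (w (of_real t) * indicator {0..<1} t) \<partial>lebesgue)"
proof -
  let ?h = "\<lambda>t. w (of_real t) * indicator {0..<1} t"
  obtain h where h [measurable]: "h \<in> borel_measurable lborel" and eq: "AE t in lborel. ?h t = h t"
    using completion_ex_borel_measurable[OF radial_fun_lebesgue[OF assms]] by auto
  have "AE t in distr disc_area borel norm. ?h t = h t"
    unfolding distr_disc_norm using eq by (subst AE_density) auto
  then have "AE z in disc_area. ?h (norm z) = h (norm z)"
    by (rule AE_distrD[rotated]) auto
  then have "(\<integral>\<^sup>+z. w z \<partial>disc_area) = (\<integral>\<^sup>+z. h (norm z) \<partial>disc_area)"
    by (intro nn_integral_cong_AE) (elim AE_mp, auto simp: radial_funD(2)[OF assms] intro!: AE_I2)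
  also have "\<dots> = (\<integral>\<^sup>+t. h t \<partial>distr disc_area borel norm)"
    using h by (subst nn_integral_distr) auto
  also have "\<dots> = (\<integral>\<^sup>+t. ennreal (2 * t) * indicator {0..<1} t * h t \<partial>lborel)"
    unfolding distr_disc_norm using h by (subst nn_integral_density) auto
  also have "\<dots> = (\<integral>\<^sup>+t. ennreal (2 * t) * indicator {0..<1} t * h t \<partial>lebesgue)"
    using h by (subst nn_integral_completion) auto
  also have "\<dots> = (\<integral>\<^sup>+t. ennreal (2 * t) * ?h t \<partial>lebesgue)"
    using AE_completion[OF eq] 
    by (intro nn_integral_cong_AE, elim AE_mp) (auto intro!: AE_I2 split: split_indicator)
  finally show ?thesis .
qed

text \<open>The area version of \<open>tail1\<close>: by the density 2t it is exactly twice as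
  large.\<close>

definition rtail :: "(complex \<Rightarrow> ennreal) \<Rightarrow> real \<Rightarrow> ennreal" where
  "rtail w r = (\<integral>\<^sup>+z. w z * indicator {z. r \<le> norm z} z \<partial>disc_area)"

text \<open>The order is lower by one than in \<open>moment\<close>, because the area element
  supplies one factor t. For \<open>x = 0\<close> the integrand is 0 at the origin, as
  \<open>0 powr 0 = 0\<close>; this concerns a null set only.\<close>

definition rmom :: "(complex \<Rightarrow> ennreal) \<Rightarrow> real \<Rightarrow> ennreal" where
  "rmom w x = (\<integral>\<^sup>+z. ennreal (norm z powr x) * w z \<partial>disc_area)"

lemma radial_fun_mult_norm:
  assumes "radial_fun w" "g \<in> borel_measurable borel"
  shows "radial_fun (\<lambda>z. g (norm z) * w z)"
proof -
  have "(\<lambda>z. g (norm z)) \<in> borel_measurable disc_area"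
    using assms(2) by (intro borel_measurable_disc_area) auto
  then show ?thesis
    using radial_funD[OF assms(1)] by (intro radial_funI) (auto intro!: borel_measurable_times_ennreal)
qed

lemma rtail_eq_tail1:
  assumes w: "radial_fun w" and r: "0 \<le> r"
  shows "rtail w r = 2 * tail1 w r"
proof -
  have "rtail w r = (\<integral>\<^sup>+z. indicator {r..} (norm z) * w z \<partial>disc_area)"
    unfolding rtail_def by (intro nn_integral_cong) (auto split: split_indicator)
  also have "\<dots> = (\<integral>\<^sup>+t. ennreal (2 * t) * ((indicator {r..} (norm (complex_of_real t)) * w (of_real t)) * indicator {0..<1} t) \<partial>lebesgue)"
    by (rule nn_integral_radial[OF radial_fun_mult_norm[OF w]]) auto
  also have "\<dots> = (\<integral>\<^sup>+t. 2 * (w (of_real t) * ennreal t * indicator {r..<1} t) \<partial>lebesgue)"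
    using r by (intro nn_integral_cong) (auto simp: ennreal_mult' mult_ac split: split_indicator)
  also have "\<dots> = 2 * tail1 w r"
    unfolding tail1_def
  proof (rule nn_integral_cmult)
    have "(\<lambda>t. ennreal t * indicator {r..} t * (w (of_real t) * indicator {0..<1} t)) \<in> borel_measurable lebesgue"
      by (intro borel_measurable_times_ennreal[OF _ radial_fun_lebesgue[OF w]] measurable_completion) auto
    also have "(\<lambda>t. ennreal t * indicator {r..} t * (w (of_real t) * indicator {0..<1} t)) =
      (\<lambda>t. w (of_real t) * ennreal t * indicator {r..<1} t)"
      using r by (auto simp: mult_ac split: split_indicator)
    finally show "(\<lambda>t. w (of_real t) * ennreal t * indicator {r..<1} t) \<in> borel_measurable lebesgue" .
  qed
  finally show ?thesis .
qed

lemma rmom_eq_moment: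
  assumes w: "radial_fun w"
  shows "rmom w x = 2 * moment w (x + 1)"
proof -
  have "rmom w x = (\<integral>\<^sup>+t. ennreal (2 * t) * ((ennreal (norm (complex_of_real t) powr x) * w (of_real t)) * indicator {0..<1} t) \<partial>lebesgue)"
    unfolding rmom_def
    by (rule nn_integral_radial[OF radial_fun_mult_norm[OF w, where g="\<lambda>t. ennreal (t powr x)"]]) auto
  also have "\<dots> = (\<integral>\<^sup>+t. 2 * (ennreal (t powr (x+1)) * w (of_real t) * indicator {0..<1} t) \<partial>lebesgue)"
  proof (rule nn_integral_cong)
    fix t :: real
    have "0 \<le> t \<Longrightarrow> t powr (x + 1) = t * t powr x"
      by (subst add.commute, rule powr_mult_base[symmetric])
    then have "0 \<le> t \<Longrightarrow> ennreal (t powr (x + 1)) = ennreal t * ennreal (t powr x)"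
      by (simp add: ennreal_mult')
    then show "ennreal (2 * t) * ((ennreal (norm (complex_of_real t) powr x) * w (of_real t)) * indicator {0..<1} t)
      = 2 * (ennreal (t powr (x+1)) * w (of_real t) * indicator {0..<1} t)"
      by (cases "0 \<le> t") (simp_all add: ennreal_mult' mult_ac)
  qed
  also have "\<dots> = 2 * moment w (x + 1)"
    unfolding moment_def
  proof (rule nn_integral_cmult)
    have "(\<lambda>t. ennreal (t powr (x + 1)) * (w (of_real t) * indicator {0..<1} t)) \<in> borel_measurable lebesgue"
      by (intro borel_measurable_times_ennreal[OF _ radial_fun_lebesgue[OF w]] measurable_completion) auto
    then show "(\<lambda>t. ennreal (t powr (x + 1)) * w (of_real t) * indicator {0..<1} t) \<in> borel_measurable lebesgue"
      by (simp add: mult_ac)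
  qed
  finally show ?thesis .
qed

lemma rtail_antimono: "r \<le> r' \<Longrightarrow> rtail w r' \<le> rtail w r"
  unfolding rtail_def by (intro nn_integral_mono) (auto split: split_indicator)

text \<open>On [r,1) the factor t lies between r and 1. This makes the linear tail comparable to the
  area tail away from 0, where the linear one may be infinite.\<close>

lemma tail_bounds:
  assumes w: "radial_fun w" and r: "0 < r"
  shows "ennreal r * tail w r \<le> tail1 w r" "tail1 w r \<le> tail w r"
proof -
  have m: "(\<lambda>t. w (of_real t) * indicator {r..<1} t) \<in> borel_measurable lebesgue"
  proof -
    have "(\<lambda>t. indicator {r..} t * (w (of_real t) * indicator {0..<1} t)) \<in> borel_measurable lebesgue"
      by (intro borel_measurable_times_ennreal[OF _ radial_fun_lebesgue[OF w]] measurable_completion) auto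
    also have "(\<lambda>t. indicator {r..} t * (w (of_real t) * indicator {0..<1} t)) =
      (\<lambda>t. w (of_real t) * indicator {r..<1} t)"
      using r by (auto simp: mult_ac split: split_indicator)
    finally show ?thesis .
  qed
  have "ennreal r * tail w r = (\<integral>\<^sup>+t. ennreal r * (w (of_real t) * indicator {r..<1} t) \<partial>lebesgue)"
    unfolding tail_def using m by (subst nn_integral_cmult) auto
  also have "\<dots> \<le> tail1 w r"
    unfolding tail1_def 
    by (intro nn_integral_mono) (auto simp: mult_ac intro!: mult_right_mono ennreal_leI split: split_indicator)
  finally show "ennreal r * tail w r \<le> tail1 w r" .
  have "w (of_real t) * ennreal t \<le> w (of_real t) * ennreal 1" if "t < 1" for t
    using that by (intro mult_left_mono ennreal_leI) auto
  then show "tail1 w r \<le> tail w r"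
    unfolding tail_def tail1_def by (intro nn_integral_mono) (auto split: split_indicator)
qed

section \<open>Real-valued area tails of radial weights\<close>

lemma ennreal_half_two: "ennreal (1/2) * (2 * x) = x"
proof -
  have "ennreal (1/2) * 2 = ennreal (1/2) * ennreal 2" by simp
  also have "\<dots> = 1" by (subst ennreal_mult[symmetric]) auto
  finally show ?thesis by (simp add: mult.assoc[symmetric])
qed

text \<open>This real area tail takes the place of the linear tail that defines the weight classes.
  Conversion to a real number is faithful for radial weights, whose total mass is finite.\<close>

definition wtail :: "(complex \<Rightarrow> real) \<Rightarrow> real \<Rightarrow> real" where
  "wtail w r = enn2real (rtail (\<lambda>z. ennreal (w z)) r)"

lemma radial_weight_unfold:
  assumes "radial_weight w"
  shows "(\<forall>z\<in>unit_disc. 0 \<le> w z) \<and> (\<forall>z\<in>unit_disc. w z = w (of_real (norm z))) \<and>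
     integrable disc_area w \<and> (\<forall>z\<in>unit_disc. tail (\<lambda>z. ennreal (w z)) (norm z) > 0)"
  using assms unfolding radial_weight_def .

lemmas radial_weightD =
  radial_weight_unfold[THEN conjunct1]
  radial_weight_unfold[THEN conjunct2, THEN conjunct1]
  radial_weight_unfold[THEN conjunct2, THEN conjunct2, THEN conjunct1]
  radial_weight_unfold[THEN conjunct2, THEN conjunct2, THEN conjunct2]

lemma radial_weight_measurable: "radial_weight w \<Longrightarrow> w \<in> borel_measurable disc_area"
  using radial_weightD(3) by (rule borel_measurable_integrable)

lemma radial_weight_radial_fun:
  assumes "radial_weight w" shows "radial_fun (\<lambda>z. ennreal (w z))"
proof (rule radial_funI)
  show "(\<lambda>z. ennreal (w z)) \<in> borel_measurable disc_area"
    using radial_weight_measurable[OF assms] by simp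
  show "ennreal (w (of_real (norm z))) = ennreal (w z)" if "norm z < 1" for z
    using bspec[OF radial_weightD(2)[OF assms], of z] that by simp
qed

lemma radial_weight_nonneg: "radial_weight w \<Longrightarrow> norm z < 1 \<Longrightarrow> 0 \<le> w z"
  using bspec[OF radial_weightD(1), of w z] by simp

lemma radial_weight_nn_integral_finite:
  assumes "radial_weight w" shows "(\<integral>\<^sup>+z. ennreal (w z) \<partial>disc_area) < \<infinity>"
proof -
  have "integrable disc_area w" by (rule radial_weightD(3)[OF assms])
  then have "(\<integral>\<^sup>+z. ennreal (norm (w z)) \<partial>disc_area) < \<infinity>" by (simp add: integrable_iff_bounded)
  moreover have "(\<integral>\<^sup>+z. ennreal (norm (w z)) \<partial>disc_area) = (\<integral>\<^sup>+z. ennreal (w z) \<partial>disc_area)"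
    using assms by (intro nn_integral_cong) (simp add: radial_weight_nonneg[OF assms])
  ultimately show ?thesis by simp
qed

lemma rtail_le_integral: "rtail w r \<le> (\<integral>\<^sup>+z. w z \<partial>disc_area)"
  unfolding rtail_def by (intro nn_integral_mono) (auto split: split_indicator)

lemma rtail_wtail:
  assumes "radial_weight w" shows "rtail (\<lambda>z. ennreal (w z)) r = ennreal (wtail w r)"
  using rtail_le_integral[of "\<lambda>z. ennreal (w z)" r] radial_weight_nn_integral_finite[OF assms]
  by (auto simp: wtail_def ennreal_enn2real_if top_unique)

lemma wtail_nonneg: "0 \<le> wtail w r" by (simp add: wtail_def)

lemma wtail_antimono:
  assumes "radial_weight w" "r \<le> r'" shows "wtail w r' \<le> wtail w r"
  using rtail_antimono[OF assms(2), of "\<lambda>z. ennreal (w z)"] wtail_nonneg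
  by (simp add: rtail_wtail[OF assms(1)])

lemma wtail_borel_measurable:
  assumes w: "radial_weight w" shows "wtail w \<in> borel_measurable borel"
proof -
  have "mono (\<lambda>r. - wtail w r)" using wtail_antimono[OF w] by (auto simp: mono_def)
  then have "(\<lambda>r. - wtail w r) \<in> borel_measurable borel" by (rule borel_measurable_mono)
  then have "(\<lambda>r. - (- wtail w r)) \<in> borel_measurable borel" by (rule borel_measurable_uminus)
  then show ?thesis by simp
qed

lemma wtail_pos:
  assumes w: "radial_weight w" and r: "r < 1"
  shows "0 < wtail w r"
proof -
  \<comment> \<open>The lower bound of the area tail by the linear one carries the radius as a
    factor, so the radius is first moved away from 0.\<close>
  define s where "s = max r (1/2)"
  have s: "0 < s" "s < 1" "r \<le> s" using r by (auto simp: s_def)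
  have "0 < tail (\<lambda>z. ennreal (w z)) s"
  proof -
    have "\<forall>z\<in>unit_disc. 0 < tail (\<lambda>z. ennreal (w z)) (norm z)"
      by (rule radial_weightD(4)[OF w])
    from bspec[OF this, of "complex_of_real s"] show ?thesis using s by simp
  qed
  then have "0 < ennreal s * tail (\<lambda>z. ennreal (w z)) s" using s by (simp add: ennreal_zero_less_mult_iff)
  also have "\<dots> \<le> tail1 (\<lambda>z. ennreal (w z)) s"
    using s by (intro tail_bounds radial_weight_radial_fun w)
  finally have "0 < rtail (\<lambda>z. ennreal (w z)) s"
    using s by (subst rtail_eq_tail1) (auto intro: radial_weight_radial_fun w simp: ennreal_zero_less_mult_iff)
  then have "0 < wtail w s" by (simp add: rtail_wtail[OF w])
  then show ?thesis using wtail_antimono[OF w s(3)] by simp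
qed

section \<open>Doubling and decay of tails, uniformly on [0,1)\<close>

definition tail_doubling :: "(real \<Rightarrow> real) \<Rightarrow> bool" where
  "tail_doubling T \<longleftrightarrow> (\<exists>C>0. \<forall>r\<in>{0..<1}. T r \<le> C * T ((1 + r) / 2))"

text \<open>The iterated form of the condition of \<open>D_check\<close>: every ratio
  \<open>e\<close> is reached for a suitable \<open>M\<close>, so that the ratio can be prescribed
  where it is used.\<close>

definition tail_vanishing :: "(real \<Rightarrow> real) \<Rightarrow> bool" where
  "tail_vanishing T \<longleftrightarrow> (\<forall>e>0. \<exists>M>1. \<forall>r\<in>{0..<1}. T (1 - (1 - r) / M) \<le> e * T r)"

definition tail_fun :: "(real \<Rightarrow> real) \<Rightarrow> bool" where
  "tail_fun T \<longleftrightarrow> (\<forall>r. r < 1 \<longrightarrow> 0 < T r) \<and> antimono T"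

lemma tail_fun_wtail: "radial_weight w \<Longrightarrow> tail_fun (wtail w)"
  by (auto simp: tail_fun_def antimono_def wtail_pos wtail_antimono)

text \<open>Below \<open>r0\<close> monotonicity alone bounds the quotient, by T(0) / T((1+r0)/2);
  the maximum of both constants works on all of [0,1).\<close>

lemma tail_doublingI:
  assumes T: "tail_fun T" and C: "0 < C" and r0: "r0 < 1"
    and d: "\<And>r. r0 \<le> r \<Longrightarrow> r < 1 \<Longrightarrow> T r \<le> C * T ((1 + r) / 2)"
  shows "tail_doubling T"
proof -
  define C' where "C' = max C (T 0 / T ((1 + r0) / 2))"
  have p: "0 < T r" if "r < 1" for r using T that by (auto simp: tail_fun_def)
  have mono: "T r' \<le> T r" if "r \<le> r'" for r r' using T that by (auto simp: tail_fun_def antimono_def)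
  have "T r \<le> C' * T ((1 + r) / 2)" if r: "0 \<le> r" "r < 1" for r
  proof (cases "r0 \<le> r")
    case True
    then have "T r \<le> C * T ((1 + r) / 2)" using d r by auto
    also have "\<dots> \<le> C' * T ((1 + r) / 2)"
      using p[of "(1+r)/2"] r by (intro mult_right_mono) (auto simp: C'_def)
    finally show ?thesis .
  next
    case False
    have "T r \<le> T 0" using mono r by simp
    also have "\<dots> = T 0 / T ((1 + r0) / 2) * T ((1 + r0) / 2)" using p[of "(1+r0)/2"] r0 by simp
    also have "\<dots> \<le> C' * T ((1 + r) / 2)"
      using p[of "(1+r0)/2"] r0 False C by (intro mult_mono mono) (auto simp: C'_def le_max_iff_disj less_imp_le)
    finally show ?thesis .
  qed
  then show ?thesis unfolding tail_doubling_def using C by (intro exI[of _ C']) (auto simp: C'_def)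
qed

text \<open>Doubling is applied n times, with 2^n above \<open>M\<close>; n steps divide the
  distance to 1 by 2^n.\<close>

lemma tail_doubling_power:
  assumes T: "tail_fun T" and d: "tail_doubling T" and M: "1 \<le> M"
  shows "\<exists>c>0. \<forall>r\<in>{0..<1}. c * T r \<le> T (1 - (1 - r) / M)"
proof -
  obtain C where C: "0 < C" "\<And>r. 0 \<le> r \<Longrightarrow> r < 1 \<Longrightarrow> T r \<le> C * T ((1 + r) / 2)"
    using d by (auto simp: tail_doubling_def)
  have mono: "T r' \<le> T r" if "r \<le> r'" for r r' using T that by (auto simp: tail_fun_def antimono_def)
  have it: "0 \<le> r \<Longrightarrow> r < 1 \<Longrightarrow> T r \<le> C ^ n * T (1 - (1 - r) / 2 ^ n)" for n r
  proof (induction n)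
    case (Suc n)
    have r': "0 \<le> 1 - (1 - r) / 2 ^ n" "1 - (1 - r) / 2 ^ n < 1"
    proof -
      have "1 - r \<le> (1::real)" "(1::real) \<le> 2 ^ n" using Suc.prems by auto
      then have "1 - r \<le> 2 ^ n" by linarith
      then show "0 \<le> 1 - (1 - r) / 2 ^ n" by simp
      show "1 - (1 - r) / 2 ^ n < 1" using Suc.prems by simp
    qed
    have "T r \<le> C ^ n * T (1 - (1 - r) / 2 ^ n)" using Suc by simp
    also have "\<dots> \<le> C ^ n * (C * T ((1 + (1 - (1 - r) / 2 ^ n)) / 2))"
      using C(1) by (intro mult_left_mono C(2)[OF r']) auto
    also have "(1 + (1 - (1 - r) / 2 ^ n)) / 2 = 1 - (1 - r) / 2 ^ Suc n" by (simp add: field_simps)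
    finally show ?case by (simp add: mult_ac)
  qed simp
  obtain n where n: "M < 2 ^ n" using real_arch_pow[of 2 M] by auto
  have "(1 / C ^ n) * T r \<le> T (1 - (1 - r) / M)" if r: "0 \<le> r" "r < 1" for r
  proof -
    have "1 - (1 - r) / M \<le> 1 - (1 - r) / 2 ^ n"
      using n M r by (simp add: frac_le)
    then have "T r \<le> C ^ n * T (1 - (1 - r) / M)"
      using it[OF r, of n] mono C by (meson mult_left_mono order_trans zero_le_power less_imp_le)
    then show ?thesis using C by (simp add: field_simps)
  qed
  then show ?thesis using C by (intro exI[of _ "1 / C ^ n"]) auto
qed

lemma tail_vanishingI:
  assumes T: "tail_fun T" and th: "0 < th" "th < 1" and K: "1 < K" and r0: "0 \<le> r0" "r0 < 1"
    and d: "\<And>r. r0 \<le> r \<Longrightarrow> r < 1 \<Longrightarrow> T (1 - (1 - r) / K) \<le> th * T r"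
  shows "tail_vanishing T"
  unfolding tail_vanishing_def
proof (intro allI impI)
  fix e :: real assume e: "0 < e"
  have p: "0 < T r" if "r < 1" for r using T that by (auto simp: tail_fun_def)
  have mono: "T r' \<le> T r" if "r \<le> r'" for r r' using T that by (auto simp: tail_fun_def antimono_def)
  have it: "T (1 - (1 - r) / K ^ n) \<le> th ^ n * T r" if "r0 \<le> r" "r < 1" for n r
  proof (induction n)
    case (Suc n)
    have K1: "1 \<le> K ^ n" using K by simp
    have "(1 - r) / K ^ n \<le> 1 - r" using that K1 by (simp add: divide_le_eq mult_le_cancel_left1)
    then have r': "r0 \<le> 1 - (1 - r) / K ^ n" using that by simp
    have r'': "1 - (1 - r) / K ^ n < 1" using that K by simp
    have "T (1 - (1 - r) / K ^ Suc n) = T (1 - (1 - (1 - (1 - r) / K ^ n)) / K)" by (simp add: mult_ac)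
    also have "\<dots> \<le> th * T (1 - (1 - r) / K ^ n)" by (rule d[OF r' r''])
    also have "\<dots> \<le> th * (th ^ n * T r)" using th Suc by simp
    finally show ?case by simp
  qed simp
  \<comment> \<open>\<open>j\<close> steps bring even the point 0 beyond \<open>r0\<close>, where
    the hypothesis starts to apply; the remaining \<open>Suc i\<close> steps gain the factor
    \<open>th ^ Suc i\<close>, which is below \<open>e\<close>.\<close>
  obtain j where j: "1 / (1 - r0) < K ^ j" using real_arch_pow[OF K] by auto
  obtain i where i: "th ^ i < e" using real_arch_pow_inv[OF e th(2)] by auto
  have r0j: "r0 \<le> 1 - 1 / K ^ j" using j r0 K by (simp add: field_simps)
  have Kj: "1 < K ^ (Suc i + j)" by (rule one_less_power[OF K]) simp
  have "T (1 - (1 - r) / K ^ (Suc i + j)) \<le> e * T r" if r: "0 \<le> r" "r < 1" for r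
  proof (cases "r0 \<le> r")
    case True
    have "th ^ (Suc i + j) \<le> th ^ i" using th by (intro power_decreasing) auto
    then have "th ^ (Suc i + j) * T r \<le> e * T r" using i p[of r] r by (intro mult_right_mono) auto
    then show ?thesis using it[OF True r(2), of "Suc i + j"] by linarith
  next
    case False
    have "T (1 - (1 - r) / K ^ (Suc i + j)) \<le> T (1 - (1 - (1 - 1 / K ^ j)) / K ^ Suc i)"
      using r K by (intro mono) (simp add: field_simps power_add)
    also have "\<dots> \<le> th ^ Suc i * T (1 - 1 / K ^ j)"
      using r0j K by (intro it) auto
    also have "\<dots> \<le> e * T r"
    proof (rule mult_mono)
      have "th ^ Suc i \<le> th ^ i" using th by (intro power_decreasing) auto
      then show "th ^ Suc i \<le> e" using i by simp
      show "T (1 - 1 / K ^ j) \<le> T r" using False r0j by (intro mono) simp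
      show "0 \<le> T (1 - 1 / K ^ j)" using p[of "1 - 1 / K ^ j"] K by simp
    qed (use e in simp)
    finally show ?thesis .
  qed
  then show "\<exists>M>1. \<forall>r\<in>{0..<1}. T (1 - (1 - r) / M) \<le> e * T r"
    using Kj by (intro exI[of _ "K ^ (Suc i + j)"]) auto
qed

lemma at_left_1_obtain:
  assumes "\<forall>\<^sub>F r in at_left (1::real). P r" and "a < 1"
  obtains r0 where "a \<le> r0" "r0 < 1" "\<And>r. r0 \<le> r \<Longrightarrow> r < 1 \<Longrightarrow> P r"
proof -
  obtain b where b: "b < 1" "\<And>r. b < r \<Longrightarrow> r < 1 \<Longrightarrow> P r"
    using assms(1) by (auto simp: eventually_at_left_field)
  define r0 where "r0 = max a ((b + 1) / 2)"
  show thesis by (rule that[of r0]) (use b assms(2) in \<open>auto simp: r0_def\<close>)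
qed

text \<open>For radii above 1/2 the linear tail is at most twice \<open>tail1\<close>, so passing to
  area tails costs only a factor 2 in the doubling constant.\<close>

lemma D_hat_tail_doubling:
  assumes "w \<in> D_hat" shows "tail_doubling (wtail w)"
proof -
  let ?w = "\<lambda>z. ennreal (w z)"
  have w: "radial_weight w" using assms by (simp add: D_hat_def)
  obtain C where C: "C > 0" "\<forall>\<^sub>F r in at_left 1. tail ?w r \<le> ennreal C * tail ?w ((1 + r) / 2)"
    using assms by (auto simp: D_hat_def)
  obtain r0 where r0: "1/2 \<le> r0" "r0 < 1" and le: "\<And>r. r0 \<le> r \<Longrightarrow> r < 1 \<Longrightarrow> tail ?w r \<le> ennreal C * tail ?w ((1 + r) / 2)"
    using at_left_1_obtain[OF C(2), of "1/2"] by auto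
  show ?thesis
  proof (rule tail_doublingI[OF tail_fun_wtail[OF w], of "2 * C" r0])
    fix r assume r: "r0 \<le> r" "r < 1"
    let ?s = "(1 + r) / 2"
    note rf = radial_weight_radial_fun[OF w]
    have "tail1 ?w r \<le> tail ?w r" using r r0 by (intro tail_bounds rf) auto
    also have "\<dots> \<le> ennreal C * tail ?w ?s" using le r by simp
    also have "ennreal C * tail ?w ?s \<le> ennreal C * (2 * tail1 ?w ?s)"
    proof (rule mult_left_mono)
      have "ennreal (1/2) * tail ?w ?s \<le> ennreal ?s * tail ?w ?s"
        using r r0 by (intro mult_right_mono ennreal_leI) auto
      also have "\<dots> \<le> tail1 ?w ?s" using r r0 by (intro tail_bounds rf) auto
      finally have "2 * (ennreal (1/2) * tail ?w ?s) \<le> 2 * tail1 ?w ?s" by (intro mult_left_mono) auto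
      moreover have "2 * (ennreal (1/2) * tail ?w ?s) = tail ?w ?s"
        using ennreal_half_two[of "tail ?w ?s"] by (simp only: mult.left_commute)
      ultimately show "tail ?w ?s \<le> 2 * tail1 ?w ?s" by simp
    qed simp
    finally have "2 * tail1 ?w r \<le> 2 * (ennreal C * (2 * tail1 ?w ?s))"
      by (rule mult_left_mono) simp
    note h = this
    have e: "ennreal (2 * C) = 2 * ennreal C" using ennreal_mult'[of 2 C] by simp
    have "rtail ?w r \<le> ennreal (2 * C) * rtail ?w ?s"
    proof -
      have "rtail ?w r = 2 * tail1 ?w r" "rtail ?w ?s = 2 * tail1 ?w ?s"
        using r r0 by (auto intro!: rtail_eq_tail1 rf)
      with h e show ?thesis by (simp only: mult_ac)
    qed
    then show "wtail w r \<le> 2 * C * wtail w ?s"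
      using C(1) wtail_nonneg[of w ?s] by (simp add: rtail_wtail[OF w] ennreal_mult[symmetric])
  qed (use C r0 in auto)
qed

lemma D_hatI:
  assumes w: "radial_weight w" and d: "tail_doubling (wtail w)" shows "w \<in> D_hat"
proof -
  let ?w = "\<lambda>z. ennreal (w z)"
  note rf = radial_weight_radial_fun[OF w]
  obtain C where C: "0 < C" "\<And>r. 0 \<le> r \<Longrightarrow> r < 1 \<Longrightarrow> wtail w r \<le> C * wtail w ((1 + r) / 2)"
    using d by (auto simp: tail_doubling_def)
  have "tail ?w r \<le> ennreal (2 * C) * tail ?w ((1 + r) / 2)" if r: "1/2 < r" "r < 1" for r
  proof -
    let ?s = "(1 + r) / 2"
    have "ennreal (1/2) * tail ?w r \<le> ennreal r * tail ?w r"
      using r by (intro mult_right_mono ennreal_leI) auto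
    also have "\<dots> \<le> tail1 ?w r" using r by (intro tail_bounds rf) auto
    finally have "2 * (ennreal (1/2) * tail ?w r) \<le> 2 * tail1 ?w r" by (intro mult_left_mono) auto
    moreover have "2 * (ennreal (1/2) * tail ?w r) = tail ?w r"
      using ennreal_half_two[of "tail ?w r"] by (simp only: mult.left_commute)
    ultimately have "tail ?w r \<le> rtail ?w r" using r by (simp add: rtail_eq_tail1[OF rf])
    also have "rtail ?w r \<le> ennreal C * rtail ?w ?s"
      using C(2)[of r] r C(1) wtail_nonneg[of w] by (simp add: rtail_wtail[OF w] ennreal_mult[symmetric])
    also have "rtail ?w ?s = 2 * tail1 ?w ?s" using r by (simp add: rtail_eq_tail1[OF rf])
    also have "ennreal C * (2 * tail1 ?w ?s) \<le> ennreal C * (2 * tail ?w ?s)"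
      using r by (intro mult_left_mono tail_bounds rf) auto
    finally have "tail ?w r \<le> ennreal C * (2 * tail ?w ?s)" .
    moreover have "ennreal (2 * C) = 2 * ennreal C" using ennreal_mult'[of 2 C] by simp
    ultimately show ?thesis by (simp only: mult_ac)
  qed
  then have "\<forall>\<^sub>F r in at_left 1. tail ?w r \<le> ennreal (2 * C) * tail ?w ((1 + r) / 2)"
    by (auto simp: eventually_at_left_field intro!: exI[of _ "1/2"])
  then show ?thesis using C w unfolding D_hat_def by (auto intro!: exI[of _ "2 * C"])
qed

lemma D_check_tail_vanishing:
  assumes "w \<in> D_check" shows "tail_vanishing (wtail w)"
proof -
  let ?w = "\<lambda>z. ennreal (w z)"
  have w: "radial_weight w" using assms by (simp add: D_check_def)
  note rf = radial_weight_radial_fun[OF w]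
  obtain K C where K: "K > 1" "C > 1" "\<forall>\<^sub>F r in at_left 1. tail ?w r \<ge> ennreal C * tail ?w (1 - (1 - r) / K)"
    using assms by (auto simp: D_check_def)
  \<comment> \<open>A constant loss would be fatal here, since \<open>C\<close> may be close to 1.
    Comparing the two tails loses the factor r; for r above \<open>a\<close> the product
    \<open>a * C\<close>, which equals (1+C)/2, is still above 1.\<close>
  define a where "a = (1 + C) / (2 * C)"
  have a: "1/2 < a" "a < 1" "1 < a * C" using K by (auto simp: a_def field_simps)
  obtain r0 where r0: "a \<le> r0" "r0 < 1" and le: "\<And>r. r0 \<le> r \<Longrightarrow> r < 1 \<Longrightarrow> tail ?w r \<ge> ennreal C * tail ?w (1 - (1 - r) / K)"
    using at_left_1_obtain[OF K(3) a(2)] by auto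
  show ?thesis
  proof (rule tail_vanishingI[OF tail_fun_wtail[OF w], of "1 / (a * C)" K r0])
    fix r assume r: "r0 \<le> r" "r < 1"
    let ?s = "1 - (1 - r) / K"
    have s: "r \<le> ?s" "?s < 1"
    proof -
      have "(1 - r) / K \<le> (1 - r) / 1" using r K by (intro frac_le) auto
      then show "r \<le> ?s" by simp
      show "?s < 1" using r K by simp
    qed
    have "ennreal a * (ennreal C * tail1 ?w ?s) \<le> ennreal r * (ennreal C * tail ?w ?s)"
      using r r0 a s by (intro mult_mono ennreal_leI tail_bounds rf mult_left_mono) auto
    also have "\<dots> \<le> ennreal r * tail ?w r" using le r by (intro mult_left_mono) auto
    also have "\<dots> \<le> tail1 ?w r" using r r0 a by (intro tail_bounds rf) auto
    finally have "2 * (ennreal a * (ennreal C * tail1 ?w ?s)) \<le> 2 * tail1 ?w r" by (intro mult_left_mono) auto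
    then have "ennreal (a * C) * rtail ?w ?s \<le> rtail ?w r"
      using r r0 a s K by (simp add: rtail_eq_tail1[OF rf] ennreal_mult' mult_ac)
    then have "(a * C) * wtail w ?s \<le> wtail w r"
      using a wtail_nonneg[of w] K by (simp add: rtail_wtail[OF w] ennreal_mult[symmetric])
    then show "wtail w ?s \<le> 1 / (a * C) * wtail w r" using a K by (simp add: field_simps)
  qed (use a K r0 in \<open>auto simp: field_simps\<close>)
qed

section \<open>Moments and weighted tail integrals\<close>

text \<open>Layer-cake formula: both integrals are integrals over the levels t > 0 of the masses of
  superlevel sets, by Tonelli.\<close>

lemma nn_integral_le_of_superlevel:
  fixes X Y :: "'a \<Rightarrow> real"
  assumes M: "sigma_finite_measure M"
    and [measurable]: "w \<in> borel_measurable M" "X \<in> borel_measurable M" "Y \<in> borel_measurable M"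
    and le: "\<And>t. 0 < t \<Longrightarrow> (\<integral>\<^sup>+x. w x * indicator {x. t \<le> X x} x \<partial>M) \<le> C * (\<integral>\<^sup>+x. w x * indicator {x. t \<le> Y x} x \<partial>M)"
  shows "(\<integral>\<^sup>+x. w x * ennreal (X x) \<partial>M) \<le> C * (\<integral>\<^sup>+x. w x * ennreal (Y x) \<partial>M)"
proof -
  interpret sigma_finite_measure M by (rule M)
  interpret pair_sigma_finite M lborel by standard
  have LC: "(\<integral>\<^sup>+x. w x * ennreal (Z x) \<partial>M) = (\<integral>\<^sup>+t. (\<integral>\<^sup>+x. w x * indicator {x. t \<le> Z x} x \<partial>M) * indicator {0<..} t \<partial>lborel)"
    if [measurable]: "Z \<in> borel_measurable M" for Z :: "'a \<Rightarrow> real"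
  proof -
    have "(\<integral>\<^sup>+x. w x * ennreal (Z x) \<partial>M) = (\<integral>\<^sup>+x. (\<integral>\<^sup>+t. w x * indicator {0<..Z x} t \<partial>lborel) \<partial>M)"
    proof (rule nn_integral_cong)
      fix x
      have "emeasure lborel {0<..Z x} = ennreal (Z x)" by (cases "0 \<le> Z x") (auto simp: ennreal_neg)
      then show "w x * ennreal (Z x) = (\<integral>\<^sup>+t. w x * indicator {0<..Z x} t \<partial>lborel)"
        by (simp add: nn_integral_cmult)
    qed
    also have "\<dots> = (\<integral>\<^sup>+x. (\<integral>\<^sup>+t. w x * (indicator {t. t \<le> Z x} t * indicator {0<..} t) \<partial>lborel) \<partial>M)"
      by (intro nn_integral_cong) (auto split: split_indicator)
    also have "\<dots> = (\<integral>\<^sup>+t. (\<integral>\<^sup>+x. w x * (indicator {t. t \<le> Z x} t * indicator {0<..} t) \<partial>M) \<partial>lborel)"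
    proof (rule Fubini'[symmetric])
      have "(\<lambda>(x, t). w x * (if t \<le> Z x \<and> 0 < t then 1 else 0)) \<in> borel_measurable (M \<Otimes>\<^sub>M lborel)"
        by measurable
      also have "(\<lambda>(x, t). w x * (if t \<le> Z x \<and> 0 < t then 1 else 0)) = 
          (\<lambda>(x, t). w x * (indicator {t. t \<le> Z x} t * indicator {0<..} t))"
        by (auto simp: fun_eq_iff split: split_indicator)
      finally show "(\<lambda>(x, t). w x * (indicator {t. t \<le> Z x} t * indicator {0<..} t)) \<in> borel_measurable (M \<Otimes>\<^sub>M lborel)" .
    qed
    also have "\<dots> = (\<integral>\<^sup>+t. (\<integral>\<^sup>+x. w x * indicator {x. t \<le> Z x} x \<partial>M) * indicator {0<..} t \<partial>lborel)"
      by (intro nn_integral_cong) (auto split: split_indicator simp: indicator_def)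
    finally show ?thesis .
  qed
  have "(\<integral>\<^sup>+x. w x * ennreal (X x) \<partial>M) \<le> (\<integral>\<^sup>+t. C * ((\<integral>\<^sup>+x. w x * indicator {x. t \<le> Y x} x \<partial>M) * indicator {0<..} t) \<partial>lborel)"
    unfolding LC[OF assms(3)] by (intro nn_integral_mono) (use le in \<open>auto split: split_indicator\<close>)
  also have "\<dots> = C * (\<integral>\<^sup>+x. w x * ennreal (Y x) \<partial>M)"
    unfolding LC[OF assms(4)] 
  proof (rule nn_integral_cmult)
    have "(\<lambda>t. \<integral>\<^sup>+x. w x * (if t \<le> Y x then 1 else 0) \<partial>M) \<in> borel_measurable lborel"
      by measurable
    then have [measurable]: "(\<lambda>t. \<integral>\<^sup>+x. w x * indicator {x. t \<le> Y x} x \<partial>M) \<in> borel_measurable lborel"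
      by (simp add: indicator_def)
    show "(\<lambda>t. (\<integral>\<^sup>+x. w x * indicator {x. t \<le> Y x} x \<partial>M) * indicator {0<..} t) \<in> borel_measurable lborel"
      by measurable
  qed
  finally show ?thesis .
qed

definition wmom :: "(complex \<Rightarrow> real) \<Rightarrow> real \<Rightarrow> real" where
  "wmom w x = enn2real (rmom (\<lambda>z. ennreal (w z)) x)"

lemma wmom_nonneg: "0 \<le> wmom w x" by (simp add: wmom_def)

lemma norm_powr_le_1: "0 \<le> x \<Longrightarrow> norm (z::complex) \<le> 1 \<Longrightarrow> norm z powr x \<le> 1"
  using powr_mono2[of x "norm z" 1] by simp

lemma rmom_le_integral:
  assumes "0 \<le> x" shows "rmom w x \<le> (\<integral>\<^sup>+z. w z \<partial>disc_area)"
  unfolding rmom_def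
proof (rule nn_integral_mono)
  fix z assume "z \<in> space disc_area"
  then have "ennreal (norm z powr x) * w z \<le> 1 * w z"
    using norm_powr_le_1[OF assms, of z] by (intro mult_right_mono) auto
  then show "ennreal (norm z powr x) * w z \<le> w z" by simp
qed

lemma rmom_wmom:
  assumes "radial_weight w" "0 \<le> x" shows "rmom (\<lambda>z. ennreal (w z)) x = ennreal (wmom w x)"
  using rmom_le_integral[OF assms(2), of "\<lambda>z. ennreal (w z)"] radial_weight_nn_integral_finite[OF assms(1)]
  by (auto simp: wmom_def ennreal_enn2real_if top_unique)

lemma wmom_antimono:
  assumes w: "radial_weight w" and x: "0 \<le> x" "x \<le> y" shows "wmom w y \<le> wmom w x"
proof -
  have "rmom (\<lambda>z. ennreal (w z)) y \<le> rmom (\<lambda>z. ennreal (w z)) x"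
    unfolding rmom_def
  proof (intro nn_integral_mono mult_right_mono ennreal_leI)
    fix z assume "z \<in> space disc_area"
    then show "norm z powr y \<le> norm z powr x" using x by (intro powr_mono') auto
  qed simp
  then show ?thesis using x w wmom_nonneg[of w x] by (simp add: rmom_wmom)
qed

lemma wtail_le_wmom:
  assumes w: "radial_weight w" and r: "0 < r" and x: "0 \<le> x"
  shows "r powr x * wtail w r \<le> wmom w x"
proof -
  have [measurable]: "w \<in> borel_measurable disc_area" by (rule radial_weight_measurable[OF w])
  have "ennreal (r powr x) * rtail (\<lambda>z. ennreal (w z)) r \<le> rmom (\<lambda>z. ennreal (w z)) x"
    unfolding rtail_def rmom_def
  proof (subst nn_integral_cmult[symmetric])
    show "(\<integral>\<^sup>+z. ennreal (r powr x) * (ennreal (w z) * indicator {z. r \<le> norm z} z) \<partial>disc_area)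
      \<le> (\<integral>\<^sup>+z. ennreal (norm z powr x) * ennreal (w z) \<partial>disc_area)"
    proof (rule nn_integral_mono)
      fix z :: complex
      have "r \<le> norm z \<Longrightarrow> r powr x \<le> norm z powr x" using r x by (intro powr_mono2) auto
      then show "ennreal (r powr x) * (ennreal (w z) * indicator {z. r \<le> norm z} z) \<le> ennreal (norm z powr x) * ennreal (w z)"
        by (auto split: split_indicator intro!: mult_right_mono ennreal_leI)
    qed
  qed measurable
  then show ?thesis using wtail_nonneg[of w r] wmom_nonneg[of w x]
    by (simp add: rtail_wtail[OF w] rmom_wmom[OF w x] ennreal_mult[symmetric])
qed

lemma wmom_pos:
  assumes w: "radial_weight w" and x: "0 \<le> x" shows "0 < wmom w x"
proof -
  have "0 < (1/2) powr x * wtail w (1/2)" using wtail_pos[OF w, of "1/2"] by simp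
  with wtail_le_wmom[OF w _ x, of "1/2"] show ?thesis by linarith
qed

text \<open>Superlevel sets of |z|^x are the sets |z| \<ge> r. Doubling compares them with |z| \<ge>
  (1+r)/2, which are superlevel sets of a function bounded by |z|^(2x).\<close>

lemma wmom_doubling:
  assumes w: "radial_weight w" and d: "tail_doubling (wtail w)"
  shows "\<exists>C>0. \<forall>x\<ge>0. wmom w x \<le> C * wmom w (2 * x)"
proof -
  let ?w = "\<lambda>z. ennreal (w z)"
  have [measurable]: "w \<in> borel_measurable disc_area" by (rule radial_weight_measurable[OF w])
  obtain C where C: "0 < C" "\<And>r. 0 \<le> r \<Longrightarrow> r < 1 \<Longrightarrow> wtail w r \<le> C * wtail w ((1 + r) / 2)"
    using d by (auto simp: tail_doubling_def)
  have main: "wmom w x \<le> C * wmom w (2 * x)" if x: "0 < x" for x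
  proof -
    \<comment> \<open>\<open>Y z\<close> is at least r^x exactly if |z| \<ge> (1+r)/2, and 2|z| - 1
      \<le> |z|^2 bounds it by |z|^(2x).\<close>
    define Y where "Y z = max 0 (2 * norm z - 1) powr x" for z :: complex
    have [measurable]: "Y \<in> borel_measurable disc_area"
      unfolding Y_def by (rule borel_measurable_disc_area) measurable
    have "(\<integral>\<^sup>+z. ?w z * ennreal (norm z powr x) \<partial>disc_area) \<le> ennreal C * (\<integral>\<^sup>+z. ?w z * ennreal (Y z) \<partial>disc_area)"
    proof (rule nn_integral_le_of_superlevel)
      show "sigma_finite_measure disc_area" by unfold_locales
      fix t :: real assume t: "0 < t"
      define r where "r = t powr (1 / x)"
      have r: "0 < r" "r powr x = t" using t x by (auto simp: r_def powr_powr)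
      have iff: "t \<le> u powr x \<longleftrightarrow> r \<le> u" if "0 \<le> u" for u
      proof
        assume "r \<le> u" then show "t \<le> u powr x" using r x powr_mono2[of x r u] by simp
      next
        assume a: "t \<le> u powr x"
        show "r \<le> u"
        proof (rule ccontr)
          assume "\<not> r \<le> u"
          then have "u powr x < r powr x" using that x by (intro powr_less_mono2) auto
          then show False using a r by simp
        qed
      qed
      have 1: "(\<integral>\<^sup>+z. ?w z * indicator {z. t \<le> norm z powr x} z \<partial>disc_area) = rtail ?w r"
        unfolding rtail_def by (intro nn_integral_cong) (simp add: iff indicator_def)
      have 2: "(\<integral>\<^sup>+z. ?w z * indicator {z. t \<le> Y z} z \<partial>disc_area) = rtail ?w ((1 + r) / 2)"
      proof -
        have "t \<le> Y z \<longleftrightarrow> (1 + r) / 2 \<le> norm z" for z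
          unfolding Y_def using iff[of "max 0 (2 * norm z - 1)"] r by auto
        then show ?thesis unfolding rtail_def by simp
      qed
      have 3: "rtail ?w r \<le> ennreal C * rtail ?w ((1 + r) / 2)"
      proof (cases "r < 1")
        case True
        then show ?thesis using C(2)[of r] r C(1) wtail_nonneg[of w] 
          by (simp add: rtail_wtail[OF w] ennreal_mult[symmetric])
      next
        case False
        have "rtail ?w r = (\<integral>\<^sup>+z. 0 \<partial>disc_area)"
          unfolding rtail_def using False by (intro nn_integral_cong) (auto split: split_indicator)
        then show ?thesis by simp
      qed
      show "(\<integral>\<^sup>+z. ?w z * indicator {z. t \<le> norm z powr x} z \<partial>disc_area)
        \<le> ennreal C * (\<integral>\<^sup>+z. ?w z * indicator {z. t \<le> Y z} z \<partial>disc_area)"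
        unfolding 1 2 by (rule 3)
    qed (auto intro: borel_measurable_disc_area)
    also have "\<dots> \<le> ennreal C * (\<integral>\<^sup>+z. ?w z * ennreal (norm z powr (2 * x)) \<partial>disc_area)"
    proof (intro mult_left_mono nn_integral_mono ennreal_leI)
      fix z :: complex
      have "2 * norm z - 1 \<le> norm z powr 2"
        using zero_le_power2[of "norm z - 1"] by (simp add: power2_eq_square algebra_simps)
      then have "Y z \<le> (norm z powr 2) powr x"
        unfolding Y_def using x by (intro powr_mono2) auto
      then show "Y z \<le> norm z powr (2 * x)" by (simp only: powr_powr)
    qed simp_all
    finally have "rmom ?w x \<le> ennreal C * rmom ?w (2 * x)"
      unfolding rmom_def by (simp only: mult.commute)
    then show ?thesis using x C wmom_nonneg[of w] by (simp add: rmom_wmom[OF w] ennreal_mult[symmetric])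
  qed
  define C' where "C' = max C 1"
  have "wmom w x \<le> C' * wmom w (2 * x)" if "0 \<le> x" for x
  proof (cases "x = 0")
    case True
    have "1 * wmom w 0 \<le> C' * wmom w 0" by (intro mult_right_mono wmom_nonneg) (simp add: C'_def)
    then show ?thesis using True by simp
  next
    case False
    then have "wmom w x \<le> C * wmom w (2 * x)" using main that by simp
    also have "\<dots> \<le> C' * wmom w (2 * x)" by (intro mult_right_mono wmom_nonneg) (simp add: C'_def)
    finally show ?thesis .
  qed
  then show ?thesis by (intro exI[of _ C']) (auto simp: C'_def)
qed

text \<open>From one annulus to the next the factor (1-|z|)^(-k) grows by M^k while the tail shrinks
  by \<open>th\<close>. As \<open>th * M powr k < 1\<close>, the contributions of the annuli form a
  convergent geometric series dominated by the first.\<close>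

lemma weighted_tail_bound:
  assumes w: "radial_weight w" and M: "1 < M" and k: "0 \<le> k" and th: "0 < th" "th * M powr k < 1"
    and T: "\<And>r. 0 \<le> r \<Longrightarrow> r < 1 \<Longrightarrow> wtail w (1 - (1 - r) / M) \<le> th * wtail w r"
  shows "\<exists>C>0. \<forall>r\<in>{0..<1}. (\<integral>\<^sup>+z. ennreal (w z * (1 - norm z) powr (- k)) * indicator {z. r \<le> norm z} z \<partial>disc_area)
     \<le> ennreal (C * (wtail w r * (1 - r) powr (- k)))"
proof -
  have mw [measurable]: "w \<in> borel_measurable disc_area" by (rule radial_weight_measurable[OF w])
  \<comment> \<open>The fixed point of C = M^k + C th M^k, the recursion obtained by splitting off
    one annulus.\<close>
  define C where "C = M powr k / (1 - th * M powr k)"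
  have C: "0 < C" "M powr k + C * th * M powr k = C"
    using th M by (auto simp: C_def field_simps)
  \<comment> \<open>The truncation to n annuli starts the induction from the empty set and is
    removed by monotone convergence. The induction varies r, because splitting off the first annulus
    replaces r by \<open>r'\<close>.\<close>
  define f where "f r n z = ennreal (w z * (1 - norm z) powr (- k)) * indicator {z. r \<le> norm z \<and> norm z < 1 - (1 - r) / M ^ n} z" for r n z
  have fm [measurable]: "f r n \<in> borel_measurable disc_area" for r n
  proof -
    have "(\<lambda>z::complex. (1 - norm z) powr (- k)) \<in> borel_measurable disc_area"
      "(indicator {z. r \<le> norm z \<and> norm z < 1 - (1 - r) / M ^ n} :: complex \<Rightarrow> ennreal) \<in> borel_measurable disc_area"
      by (rule borel_measurable_disc_area, measurable)+
    then show ?thesis unfolding f_def by (intro borel_measurable_times_ennreal measurable_compose[OF _ measurable_ennreal] borel_measurable_times mw)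
  qed
  have bd: "0 \<le> r \<Longrightarrow> r < 1 \<Longrightarrow> (\<integral>\<^sup>+z. f r n z \<partial>disc_area) \<le> ennreal (C * (wtail w r * (1 - r) powr (- k)))" for r n
  proof (induction n arbitrary: r)
    case 0
    have "f r 0 z = 0" for z by (auto simp: f_def split: split_indicator)
    then show ?case by simp
  next
    case (Suc n)
    define r' where "r' = 1 - (1 - r) / M"
    have "(1 - r) / M \<le> (1 - r) / 1" using M Suc.prems by (intro frac_le) auto
    then have r': "0 \<le> r'" "r' < 1" using Suc.prems M by (auto simp: r'_def)
    have pw: "(1 - r') powr (- k) = M powr k * (1 - r) powr (- k)"
      using Suc.prems M by (simp add: r'_def powr_divide powr_minus field_simps)
    have e: "1 - (1 - r) / M ^ Suc n = 1 - (1 - r') / M ^ n" by (simp add: r'_def)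
    have "(\<integral>\<^sup>+z. f r (Suc n) z \<partial>disc_area) \<le> (\<integral>\<^sup>+z. ennreal ((1 - r') powr (- k)) * (ennreal (w z) * indicator {z. r \<le> norm z} z) + f r' n z \<partial>disc_area)"
    proof (rule nn_integral_mono)
      fix z assume z: "z \<in> space disc_area"
      have w0: "0 \<le> w z" using z radial_weight_nonneg[OF w, of z] by simp
      show "f r (Suc n) z \<le> ennreal ((1 - r') powr (- k)) * (ennreal (w z) * indicator {z. r \<le> norm z} z) + f r' n z"
      proof (cases "norm z < r'")
        case True
        have "(1 - norm z) powr (- k) \<le> (1 - r') powr (- k)" using True r' k by (intro powr_mono2') auto
        then have "ennreal (w z * (1 - norm z) powr (- k)) \<le> ennreal ((1 - r') powr (- k)) * ennreal (w z)"
          using w0 by (subst ennreal_mult[symmetric]) (auto simp: mult.commute intro!: ennreal_leI mult_left_mono)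
        then show ?thesis
          unfolding f_def by (auto split: split_indicator intro: add_increasing2)
      next
        case False
        then have "f r (Suc n) z \<le> f r' n z"
          unfolding f_def e by (auto split: split_indicator)
        then show ?thesis by (simp add: add_increasing)
      qed
    qed
    also have "\<dots> = ennreal ((1 - r') powr (- k)) * rtail (\<lambda>z. ennreal (w z)) r + (\<integral>\<^sup>+z. f r' n z \<partial>disc_area)"
    proof -
      have [measurable]: "(\<lambda>z. ennreal (w z) * indicator {z. r \<le> norm z} z) \<in> borel_measurable disc_area"
        by (intro borel_measurable_times_ennreal borel_measurable_disc_area[of "indicator _"]) measurable
      show ?thesis unfolding rtail_def by (subst nn_integral_add) (auto simp: nn_integral_cmult)
    qed
    also have "\<dots> \<le> ennreal ((1 - r') powr (- k)) * ennreal (wtail w r) + ennreal (C * (wtail w r' * (1 - r') powr (- k)))"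
      using Suc.IH[OF r'] by (intro add_mono) (simp_all add: rtail_wtail[OF w])
    also have "\<dots> = ennreal ((1 - r') powr (- k) * wtail w r + C * (wtail w r' * (1 - r') powr (- k)))"
      using C wtail_nonneg[of w] by (simp add: ennreal_mult ennreal_plus)
    also have "\<dots> \<le> ennreal (C * (wtail w r * (1 - r) powr (- k)))"
    proof (rule ennreal_leI)
      have "C * (wtail w r' * (1 - r') powr (- k)) \<le> C * (th * wtail w r * (1 - r') powr (- k))"
        using T[OF Suc.prems] C by (intro mult_left_mono mult_right_mono) (auto simp: r'_def)
      then have "(1 - r') powr (- k) * wtail w r + C * (wtail w r' * (1 - r') powr (- k))
         \<le> (1 - r') powr (- k) * wtail w r + C * (th * wtail w r * (1 - r') powr (- k))" by simp
      also have "\<dots> = (M powr k + C * th * M powr k) * (wtail w r * (1 - r) powr (- k))"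
        unfolding pw by (simp add: algebra_simps)
      finally show "(1 - r') powr (- k) * wtail w r + C * (wtail w r' * (1 - r') powr (- k)) \<le> C * (wtail w r * (1 - r) powr (- k))"
        using C by simp
    qed
    finally show ?case .
  qed
  have "(\<integral>\<^sup>+z. ennreal (w z * (1 - norm z) powr (- k)) * indicator {z. r \<le> norm z} z \<partial>disc_area)
     \<le> ennreal (C * (wtail w r * (1 - r) powr (- k)))" if r: "0 \<le> r" "r < 1" for r
  proof -
    have "(\<integral>\<^sup>+z. ennreal (w z * (1 - norm z) powr (- k)) * indicator {z. r \<le> norm z} z \<partial>disc_area) \<le> (\<integral>\<^sup>+z. (SUP n. f r n z) \<partial>disc_area)"
    proof (rule nn_integral_mono)
      fix z assume "z \<in> space disc_area"
      then have z: "norm z < 1" by simp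
      obtain n where n: "(1 - r) / (1 - norm z) < M ^ n" using real_arch_pow[OF M] by auto
      have "norm z < 1 - (1 - r) / M ^ n" using n z M by (simp add: field_simps)
      then have "ennreal (w z * (1 - norm z) powr (- k)) * indicator {z. r \<le> norm z} z = f r n z"
        unfolding f_def by (auto split: split_indicator)
      also have "\<dots> \<le> (SUP n. f r n z)" by (intro SUP_upper) simp
      finally show "ennreal (w z * (1 - norm z) powr (- k)) * indicator {z. r \<le> norm z} z \<le> (SUP n. f r n z)" .
    qed
    also have "\<dots> = (SUP n. \<integral>\<^sup>+z. f r n z \<partial>disc_area)"
    proof (rule nn_integral_monotone_convergence_SUP)
      show "incseq (f r)"
      proof (rule incseq_SucI, rule le_funI)
        fix n z
        have "(1 - r) / M ^ Suc n \<le> (1 - r) / M ^ n"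
          using r M by (intro divide_left_mono power_increasing) auto
        then show "f r n z \<le> f r (Suc n) z" unfolding f_def by (auto split: split_indicator)
      qed
    qed measurable
    also have "\<dots> \<le> ennreal (C * (wtail w r * (1 - r) powr (- k)))"
      using bd[OF r] by (intro SUP_least)
    finally show ?thesis .
  qed
  then show ?thesis using C by (intro exI[of _ C]) auto
qed

text \<open>By doubling, the denominator on a dyadic annulus is comparable to the tail at the inner
  radius, so w contributes a bounded amount there. What remains is a geometric sum of (1-|z|)^(-k),
  dominated by its last term since k > 0.\<close>

lemma weighted_head_bound:
  assumes w: "radial_weight w" and k: "0 < k" and d: "tail_doubling (wtail w)"
  shows "\<exists>C>0. \<forall>s\<in>{0..<1}. (\<integral>\<^sup>+z. ennreal (w z * (1 - norm z) powr (- k) / wtail w (norm z)) * indicator {z. norm z \<le> s} z \<partial>disc_area)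
     \<le> ennreal (C * (1 - s) powr (- k))"
proof -
  have mw [measurable]: "w \<in> borel_measurable disc_area" by (rule radial_weight_measurable[OF w])
  obtain c where c: "0 < c" "\<And>r. 0 \<le> r \<Longrightarrow> r < 1 \<Longrightarrow> c * wtail w r \<le> wtail w (1 - (1 - r) / 2)"
    using tail_doubling_power[OF tail_fun_wtail[OF w] d, of 2] by auto
  define A :: real where "A = 2 powr k"
  have A: "1 < A" using k by (simp add: A_def)
  \<comment> \<open>Chosen with D + A/c = D A: the bound D A^n up to the n-th dyadic radius plus the
    contribution A^(n+1)/c of the next annulus is D A^(n+1).\<close>
  define D where "D = A / (c * (A - 1))"
  have D: "0 < D" "D + A / c = D * A" using A c by (auto simp: D_def field_simps)
  define g where "g z = ennreal (w z * (1 - norm z) powr (- k) / wtail w (norm z))" for z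
  have pw: "(1 / 2 ^ n) powr (- k) = A ^ n" for n
  proof -
    have "(1 / 2 ^ n) powr (- k) = (2 powr real n) powr k" by (simp add: powr_divide powr_minus powr_realpow)
    also have "\<dots> = (2 powr k) powr real n" by (simp add: powr_powr mult.commute)
    also have "\<dots> = A ^ n" using A by (simp add: A_def powr_realpow)
    finally show ?thesis .
  qed
  have bd: "(\<integral>\<^sup>+z. g z * indicator {z. norm z < 1 - 1 / 2 ^ n} z \<partial>disc_area) \<le> ennreal (D * A ^ n)" for n
  proof (induction n)
    case 0
    have "(\<integral>\<^sup>+z. g z * indicator {z. norm z < 1 - 1 / 2 ^ 0} z \<partial>disc_area) = (\<integral>\<^sup>+z. 0 \<partial>disc_area)"
      by (intro nn_integral_cong) (auto split: split_indicator)
    then show ?case by simp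
  next
    case (Suc n)
    define r :: real where "r = 1 - 1 / 2 ^ n"
    define r' :: real where "r' = 1 - 1 / 2 ^ Suc n"
    have "(1::real) / 2 ^ n \<le> 1" by simp
    then have r: "0 \<le> r" "r < 1" "r' < 1" by (auto simp: r_def r'_def)
    have rr': "r' = 1 - (1 - r) / 2" by (simp add: r_def r'_def)
    have Tr: "0 < wtail w r" "0 < wtail w r'" using wtail_pos[OF w] r by auto
    define B where "B = A ^ Suc n / (c * wtail w r)"
    have B: "0 \<le> B" using A c Tr by (simp add: B_def)
    have pt: "g z * indicator {z. norm z < r'} z \<le> g z * indicator {z. norm z < r} z + ennreal B * (ennreal (w z) * indicator {z. r \<le> norm z} z)"
      if z: "z \<in> space disc_area" for z
    proof (cases "r \<le> norm z \<and> norm z < r'")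
      case True
      have w0: "0 \<le> w z" using z radial_weight_nonneg[OF w, of z] by simp
      have "(1 - norm z) powr (- k) \<le> (1 - r') powr (- k)" using True r k by (intro powr_mono2') auto
      also have "\<dots> = A ^ Suc n" using pw[of "Suc n"] by (simp add: r'_def)
      finally have 1: "(1 - norm z) powr (- k) \<le> A ^ Suc n" .
      have "c * wtail w r \<le> wtail w r'" unfolding rr' by (rule c(2)[OF r(1,2)])
      also have "\<dots> \<le> wtail w (norm z)" using True by (intro wtail_antimono[OF w]) auto
      finally have 2: "c * wtail w r \<le> wtail w (norm z)" .
      have "(1 - norm z) powr (- k) / wtail w (norm z) \<le> B"
        unfolding B_def using 1 2 c Tr A by (intro frac_le) auto
      then have "w z * ((1 - norm z) powr (- k) / wtail w (norm z)) \<le> w z * B" using w0 by (rule mult_left_mono)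
      then have "g z \<le> ennreal B * ennreal (w z)" unfolding g_def using w0 B
        by (subst ennreal_mult[symmetric]) (auto simp: mult.commute intro!: ennreal_leI)
      then show ?thesis using True by (simp add: add_increasing)
    next
      case False
      then show ?thesis by (auto split: split_indicator intro: add_increasing2)
    qed
    have gm: "(\<lambda>z. g z * indicator {z. norm z < r} z) \<in> borel_measurable disc_area"
    proof -
      have [measurable]: "wtail w \<in> borel_measurable borel" by (rule wtail_borel_measurable[OF w])
      have "(\<lambda>z::complex. (1 - norm z) powr (- k)) \<in> borel_measurable disc_area"
        "(\<lambda>z::complex. wtail w (norm z)) \<in> borel_measurable disc_area"
        "(indicator {z. norm z < r} :: complex \<Rightarrow> ennreal) \<in> borel_measurable disc_area"
        by (rule borel_measurable_disc_area, measurable)+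
      then show ?thesis unfolding g_def 
        by (intro borel_measurable_times_ennreal measurable_compose[OF _ measurable_ennreal] borel_measurable_times borel_measurable_divide mw)
    qed
    have [measurable]: "(\<lambda>z. ennreal (w z) * indicator {z. r \<le> norm z} z) \<in> borel_measurable disc_area"
      by (intro borel_measurable_times_ennreal borel_measurable_disc_area[of "indicator _"]) measurable
    have "(\<integral>\<^sup>+z. g z * indicator {z. norm z < r'} z \<partial>disc_area)
      \<le> (\<integral>\<^sup>+z. g z * indicator {z. norm z < r} z + ennreal B * (ennreal (w z) * indicator {z. r \<le> norm z} z) \<partial>disc_area)"
      by (rule nn_integral_mono) (rule pt)
    also have "\<dots> = (\<integral>\<^sup>+z. g z * indicator {z. norm z < r} z \<partial>disc_area) + ennreal B * rtail (\<lambda>z. ennreal (w z)) r"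
      unfolding rtail_def using gm by (subst nn_integral_add) (auto simp: nn_integral_cmult)
    also have "\<dots> \<le> ennreal (D * A ^ n) + ennreal B * ennreal (wtail w r)"
      using Suc by (intro add_mono) (simp_all add: rtail_wtail[OF w] r_def)
    also have "\<dots> = ennreal (D * A ^ n + B * wtail w r)"
      using D A B wtail_nonneg[of w r] by (simp add: ennreal_mult ennreal_plus)
    also have "D * A ^ n + B * wtail w r = A ^ n * (D + A / c)"
      using Tr c by (simp add: B_def field_simps)
    also have "\<dots> = D * A ^ Suc n" using D by simp
    finally show ?case by (simp add: r'_def)
  qed
  have "(\<integral>\<^sup>+z. g z * indicator {z. norm z \<le> s} z \<partial>disc_area) \<le> ennreal ((D * A) * (1 - s) powr (- k))" if s: "0 \<le> s" "s < 1" for s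
  proof -
    \<comment> \<open>Minimality puts 1 - s between 2^(-n) and 2^(-(n-1)), so passing from s to the
      next dyadic radius costs only the factor \<open>A\<close>.\<close>
    define n where "n = (LEAST n. 1 / (1 - s) < 2 ^ n)"
    have ex: "\<exists>n. 1 / (1 - s) < (2::real) ^ n" using real_arch_pow[of 2] by auto
    have n: "1 / (1 - s) < 2 ^ n" unfolding n_def using ex by (rule LeastI_ex)
    have "n \<noteq> 0" using n s by (intro notI) simp
    then obtain m where m: "n = Suc m" by (cases n) auto
    have "\<not> 1 / (1 - s) < 2 ^ m" using not_less_Least[of m "\<lambda>n. 1 / (1 - s) < 2 ^ n"] m by (simp add: n_def)
    then have m1: "1 - s \<le> 1 / 2 ^ m" using s by (simp add: field_simps)
    have "s < 1 - 1 / 2 ^ n" using n s by (simp add: field_simps)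
    then have "(\<integral>\<^sup>+z. g z * indicator {z. norm z \<le> s} z \<partial>disc_area) \<le> (\<integral>\<^sup>+z. g z * indicator {z. norm z < 1 - 1 / 2 ^ n} z \<partial>disc_area)"
      by (intro nn_integral_mono) (auto split: split_indicator)
    also have "\<dots> \<le> ennreal (D * A ^ n)" by (rule bd)
    also have "\<dots> \<le> ennreal ((D * A) * (1 - s) powr (- k))"
    proof (rule ennreal_leI)
      have "A ^ m \<le> (1 - s) powr (- k)"
        unfolding pw[symmetric] using m1 s k by (intro powr_mono2') auto
      then have "(D * A) * A ^ m \<le> (D * A) * (1 - s) powr (- k)" using D A by (intro mult_left_mono) auto
      then show "D * A ^ n \<le> (D * A) * (1 - s) powr (- k)" using m by (simp add: mult_ac)
    qed
    finally show ?thesis .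
  qed
  then show ?thesis using D A unfolding g_def by (intro exI[of _ "D * A"]) auto
qed

section \<open>The Bergman kernel\<close>

text \<open>Since \<open>wmom\<close> is twice the one-dimensional moment, this is \<open>1 / (2 \<omega>\<^bsub>2n+1\<^esub>)\<close>.\<close>

definition kcoeff :: "(complex \<Rightarrow> real) \<Rightarrow> nat \<Rightarrow> real" where
  "kcoeff w n = 1 / wmom w (2 * real n)"

text \<open>A function of one variable: the kernel at \<open>z\<close>, evaluated at
  \<open>y\<close>, is \<open>kser w (cnj z * y)\<close>.\<close>

definition kser :: "(complex \<Rightarrow> real) \<Rightarrow> complex \<Rightarrow> complex" where
  "kser w z = (\<Sum>n. of_real (kcoeff w n) * z ^ n)"

lemma kcoeff_pos: "radial_weight w \<Longrightarrow> 0 < kcoeff w n"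
  by (simp add: kcoeff_def wmom_pos)

lemma kcoeff_le:
  assumes w: "radial_weight w" and r: "0 < r" "r < 1"
  shows "kcoeff w n \<le> 1 / (r ^ (2 * n) * wtail w r)"
proof -
  have "r powr (2 * real n) = r ^ (2 * n)" using r powr_realpow[of r "2 * n"] by simp
  then have "r ^ (2 * n) * wtail w r \<le> wmom w (2 * real n)"
    using wtail_le_wmom[OF w r(1), of "2 * real n"] by simp
  then show ?thesis unfolding kcoeff_def
    using r wtail_pos[OF w r(2)] by (intro divide_left_mono) (auto intro!: mult_pos_pos wmom_pos w)
qed

text \<open>Bernoulli's inequality for 1 + (t-1)/4. With r = (3+t)/4 the factor t^n \<le> r^(4n)
  outweighs the r^(-2n) of \<open>kcoeff_le\<close> and leaves the convergent r^(2n).\<close>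

lemma rho_power_4:
  fixes t :: real assumes "0 \<le> t" "t < 1"
  shows "t \<le> ((3 + t) / 4) ^ 4"
  using Bernoulli_inequality[of "(t - 1) / 4" 4] assms by (simp add: field_simps)

lemma kcoeff_power_le:
  assumes w: "radial_weight w" and t: "0 \<le> t" "t < 1"
  shows "kcoeff w n * t ^ n \<le> (((3 + t) / 4) ^ 2) ^ n / wtail w ((3 + t) / 4)"
proof -
  define r where "r = (3 + t) / 4"
  have r: "0 < r" "r < 1" using t by (auto simp: r_def)
  have "t ^ n \<le> (r ^ 4) ^ n" using rho_power_4[OF t] t by (intro power_mono) (auto simp: r_def)
  then have "kcoeff w n * t ^ n \<le> 1 / (r ^ (2 * n) * wtail w r) * (r ^ 4) ^ n"
    using kcoeff_le[OF w r, of n] kcoeff_pos[OF w, of n] r t wtail_pos[OF w r(2)]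
    by (intro mult_mono) (auto intro: less_imp_le)
  also have "\<dots> = (r ^ 2) ^ n / wtail w r"
  proof -
    have "(r ^ 4) ^ n = r ^ (2 * n) * (r ^ 2) ^ n"
      by (simp flip: power_mult power_add)
    then show ?thesis using r by simp
  qed
  finally show ?thesis by (simp add: r_def)
qed

lemma summable_kcoeff:
  assumes w: "radial_weight w" and t: "0 \<le> t" "t < 1"
  shows "summable (\<lambda>n. kcoeff w n * t ^ n)"
proof (rule summable_comparison_test'[of _ 0])
  have "((3 + t) / 4) ^ 2 < 1" using t by (intro power_less_one_iff[THEN iffD2]) auto
  then show "summable (\<lambda>n. (((3 + t) / 4) ^ 2) ^ n / wtail w ((3 + t) / 4))"
    using t by (intro summable_divide summable_geometric) auto
  show "norm (kcoeff w n * t ^ n) \<le> (((3 + t) / 4) ^ 2) ^ n / wtail w ((3 + t) / 4)" for n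
    using kcoeff_power_le[OF w t, of n] kcoeff_pos[OF w, of n] t by (simp add: abs_mult)
qed

lemma kser_sums:
  assumes w: "radial_weight w" and z: "norm z < 1"
  shows "(\<lambda>n. of_real (kcoeff w n) * z ^ n) sums kser w z"
    and "norm (kser w z) \<le> (\<Sum>n. kcoeff w n * norm z ^ n)"
proof -
  have s: "summable (\<lambda>n. norm (complex_of_real (kcoeff w n) * z ^ n))"
    using summable_kcoeff[OF w, of "norm z"] z kcoeff_pos[OF w]
    by (simp add: norm_mult norm_power less_imp_le)
  show "(\<lambda>n. of_real (kcoeff w n) * z ^ n) sums kser w z"
    unfolding kser_def using summable_norm_cancel[OF s] by (rule summable_sums)
  show "norm (kser w z) \<le> (\<Sum>n. kcoeff w n * norm z ^ n)"
    using summable_norm[OF s] kcoeff_pos[OF w]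
    by (simp add: kser_def norm_mult norm_power less_imp_le)
qed

lemma kser_holomorphic: "radial_weight w \<Longrightarrow> kser w holomorphic_on ball 0 1"
  using kser_sums(1) by (intro power_series_holomorphic[where a="\<lambda>n. of_real (kcoeff w n)"]) simp

text \<open>A rotation by the angle pi/(n-k) turns g into -g and leaves the integral
  unchanged.\<close>

lemma integral_eq_0_of_rotation:
  fixes g :: "complex \<Rightarrow> complex"
  assumes g: "g \<in> borel_measurable disc_area" and ne: "n \<noteq> k"
    and rot: "\<And>c z. norm c = 1 \<Longrightarrow> norm z < 1 \<Longrightarrow> g (c * z) = c ^ n * cnj c ^ k * g z"
  shows "(\<integral>z. g z \<partial>disc_area) = 0"
proof -
  define th where "th = pi / (real n - real k)"
  define c where "c = cis th"
  have "c ^ n * cnj c ^ k = cis ((real n - real k) * th)"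
    by (simp add: c_def cis_cnj Complex.DeMoivre cis_mult algebra_simps)
  also have "(real n - real k) * th = pi" using ne by (simp add: th_def)
  finally have c: "c ^ n * cnj c ^ k = -1" "norm c = 1" by (simp_all add: c_def)
  have "(\<integral>z. g z \<partial>disc_area) = (\<integral>z. g (c * z) \<partial>disc_area)"
    by (rule integral_disc_rotation[OF c(2) g, symmetric])
  also have "\<dots> = (\<integral>z. - g z \<partial>disc_area)"
    using rot[OF c(2)] c(1) by (intro Bochner_Integration.integral_cong) simp_all
  also have "\<dots> = - (\<integral>z. g z \<partial>disc_area)" by simp
  finally show ?thesis by (simp add: eq_neg_iff_add_eq_0)
qed

lemma radial_weight_rotation:
  assumes "radial_weight w" "norm c = 1" "norm z < 1" shows "w (c * z) = w z"
  using bspec[OF radial_weightD(2)[OF assms(1)], of "c * z"] bspec[OF radial_weightD(2)[OF assms(1)], of z] assms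
  by (simp add: norm_mult)

lemma integrable_bounded_weight:
  fixes g :: "complex \<Rightarrow> complex"
  assumes w: "integrable disc_area (w :: complex \<Rightarrow> real)" and g: "g \<in> borel_measurable disc_area"
    and b: "\<And>z. norm z < 1 \<Longrightarrow> norm (g z) \<le> B"
  shows "integrable disc_area (\<lambda>z. g z * of_real (w z))"
proof (rule Bochner_Integration.integrable_bound)
  show "integrable disc_area (\<lambda>z. B * w z)" using w by simp
  have "w \<in> borel_measurable disc_area" using w by simp
  with g show "(\<lambda>z. g z * of_real (w z)) \<in> borel_measurable disc_area" by measurable
  show "AE z in disc_area. norm (g z * complex_of_real (w z)) \<le> norm (B * w z)"
  proof (rule AE_I2)
    fix z assume "z \<in> space disc_area"
    then have "norm z < 1" by simp
    from b[OF this] have "norm (g z) \<le> \<bar>B\<bar>" by linarith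
    then show "norm (g z * complex_of_real (w z)) \<le> norm (B * w z)"
      by (simp add: norm_mult abs_mult mult_right_mono)
  qed
qed

lemma AE_disc_area_nonzero: "AE z in disc_area. z \<noteq> 0"
proof -
  have "AE z in lebesgue. z \<noteq> (0::complex)" by (rule AE_completion) (rule AE_lborel_singleton)
  then show ?thesis
    unfolding disc_area_def by (subst AE_density) (auto simp: AE_restrict_space_iff)
qed

lemma integral_norm_power_weight:
  assumes w: "radial_weight w"
  shows "(\<integral>z. z ^ n * cnj z ^ n * of_real (w z) \<partial>disc_area) = of_real (wmom w (2 * real n))"
    and "integrable disc_area (\<lambda>z. norm z ^ (2 * n) * w z)"
proof -
  have mw [measurable]: "w \<in> borel_measurable disc_area" by (rule radial_weight_measurable[OF w])
  have [measurable]: "(\<lambda>z::complex. norm z ^ (2 * n)) \<in> borel_measurable disc_area"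
    by (rule borel_measurable_disc_area) measurable
  show int: "integrable disc_area (\<lambda>z. norm z ^ (2 * n) * w z)"
  proof (rule Bochner_Integration.integrable_bound[OF radial_weightD(3)[OF w]])
    show "AE z in disc_area. norm (norm z ^ (2 * n) * w z) \<le> norm (w z)"
      by (rule AE_I2) (simp add: abs_mult mult_left_le_one_le power_le_one)
  qed measurable
  have e: "z ^ n * cnj z ^ n = of_real (norm z ^ (2 * n))" for z :: complex
  proof -
    have "z ^ n * cnj z ^ n = (z * cnj z) ^ n" by (simp add: power_mult_distrib)
    then show ?thesis by (simp add: complex_norm_square[symmetric] power_mult)
  qed
  have "(\<integral>z. z ^ n * cnj z ^ n * of_real (w z) \<partial>disc_area) = (\<integral>z. complex_of_real (norm z ^ (2 * n) * w z) \<partial>disc_area)"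
    by (simp add: e)
  also have "\<dots> = of_real (\<integral>z. norm z ^ (2 * n) * w z \<partial>disc_area)" by (rule integral_of_real[OF int])
  also have "(\<integral>z. norm z ^ (2 * n) * w z \<partial>disc_area) = enn2real (\<integral>\<^sup>+z. ennreal (norm z ^ (2 * n) * w z) \<partial>disc_area)"
    by (rule integral_eq_nn_integral[OF borel_measurable_integrable[OF int]])
       (auto intro!: AE_I2 mult_nonneg_nonneg radial_weight_nonneg[OF w])
  also have "(\<integral>\<^sup>+z. ennreal (norm z ^ (2 * n) * w z) \<partial>disc_area) = rmom (\<lambda>z. ennreal (w z)) (2 * real n)"
  proof -
    have "(\<integral>\<^sup>+z. ennreal (norm z ^ (2 * n) * w z) \<partial>disc_area) = (\<integral>\<^sup>+z. ennreal (norm z ^ (2 * n)) * ennreal (w z) \<partial>disc_area)"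
      by (intro nn_integral_cong) (simp add: ennreal_mult radial_weight_nonneg[OF w])
    also have "\<dots> = rmom (\<lambda>z. ennreal (w z)) (2 * real n)"
      unfolding rmom_def
    proof (rule nn_integral_cong_AE)
      show "AE z in disc_area. ennreal (norm z ^ (2 * n)) * ennreal (w z) = ennreal (norm z powr (2 * real n)) * ennreal (w z)"
        using AE_disc_area_nonzero
      proof eventually_elim
        case (elim z)
        then show ?case using powr_realpow[of "norm z" "2 * n"] by simp
      qed
    qed
    finally show ?thesis .
  qed
  finally show "(\<integral>z. z ^ n * cnj z ^ n * of_real (w z) \<partial>disc_area) = of_real (wmom w (2 * real n))"
    by (simp add: wmom_def)
qed

text \<open>Integrability against w does not allow the Taylor series to be integrated termwise over
  the whole disc. It is integrated over |z| < \<open>R j\<close>, where it converges uniformly and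
  all terms but the n-th vanish by rotation; dominated convergence lets \<open>R j\<close> tend to
  1.\<close>

lemma holomorphic_coefficient_integral:
  assumes w: "radial_weight w" and f: "\<And>z. norm z < 1 \<Longrightarrow> (\<lambda>n. c n * z ^ n) sums f z"
    and int: "integrable disc_area (\<lambda>z. f z * of_real (w z))"
  shows "(\<integral>z. f z * cnj z ^ n * of_real (w z) \<partial>disc_area) = c n * of_real (wmom w (2 * real n))"
proof -
  have mw [measurable]: "w \<in> borel_measurable disc_area" by (rule radial_weight_measurable[OF w])
  have hol: "f holomorphic_on ball 0 1" using f by (intro power_series_holomorphic[where a=c]) simp
  then have mf [measurable]: "f \<in> borel_measurable disc_area"
    by (intro continuous_on_measurable_disc_area holomorphic_on_imp_continuous_on)
  define R where "R j = 1 - 1 / real (j + 2)" for j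
  have R: "0 < R j" "R j < 1" for j by (auto simp: R_def)
  have Rlim: "R \<longlonglongrightarrow> 1"
  proof -
    have "(\<lambda>j. 1 - 1 / real (j + 2)) \<longlonglongrightarrow> 1 - 0"
      by (intro tendsto_intros LIMSEQ_ignore_initial_segment[OF lim_1_over_n])
    then show ?thesis by (simp add: R_def[abs_def])
  qed
  define X where "X j z = (indicator {z. norm z < R j} z :: real)" for j and z :: complex
  have mX [measurable]: "X j \<in> borel_measurable disc_area" for j
    unfolding X_def by (rule borel_measurable_disc_area) measurable
  have [measurable]: "(\<lambda>z. cnj z) \<in> borel_measurable disc_area"
    by (intro continuous_on_measurable_disc_area continuous_intros)
  have Xlim: "(\<lambda>j. X j z) \<longlonglongrightarrow> 1" if "norm z < 1" for z
  proof -
    have "\<forall>\<^sub>F j in sequentially. norm z < R j" using Rlim that by (rule order_tendstoD)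
    then have "\<forall>\<^sub>F j in sequentially. X j z = 1" by eventually_elim (simp add: X_def)
    then show ?thesis by (rule tendsto_eventually)
  qed
  have X01: "0 \<le> X j z" "X j z \<le> 1" for j z by (auto simp: X_def split: split_indicator)
  have intn: "integrable disc_area (\<lambda>z. z ^ n * cnj z ^ k * of_real (w z))" for n k
  proof (rule integrable_bounded_weight[OF radial_weightD(3)[OF w], where B=1])
    show "norm (z ^ n * cnj z ^ k) \<le> 1" if "norm z < 1" for z
      using that by (simp add: norm_mult norm_power power_le_one mult_le_one)
  qed measurable
  have step: "(\<integral>z. X j z * (f z * cnj z ^ n * of_real (w z)) \<partial>disc_area) = c n * (\<integral>z. X j z * (z ^ n * cnj z ^ n * of_real (w z)) \<partial>disc_area)" for j
  proof -
    define h where "h k z = c k * (X j z * (z ^ k * cnj z ^ n * of_real (w z)))" for k z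
    have hint: "integrable disc_area (h k)" for k
    proof -
      have "integrable disc_area (\<lambda>z. X j z * (z ^ k * cnj z ^ n * of_real (w z)))"
        by (rule Bochner_Integration.integrable_bound[OF intn[of k n]])
           (use X01 in \<open>auto intro!: AE_I2 mult_left_le_one_le simp: norm_mult\<close>)
      then show ?thesis unfolding h_def by simp
    qed
    \<comment> \<open>Convergence at a radius beyond \<open>R j\<close> gives absolute convergence
      at \<open>R j\<close>, hence a summable majorant on the smaller disc.\<close>
    have "summable (\<lambda>k. c k * of_real ((1 + R j) / 2) ^ k)"
      using f[of "of_real ((1 + R j) / 2)"] R[of j] by (auto simp: sums_iff simp del: of_real_divide of_real_add)
    then have sm: "summable (\<lambda>k. norm (c k * of_real (R j) ^ k))"
      by (rule powser_insidea) (use R[of j] in \<open>simp add: norm_of_real del: of_real_divide of_real_add\<close>)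
    have hb: "norm (h k z) \<le> norm (c k * of_real (R j) ^ k) * w z" if z: "norm z < 1" for k z
    proof (cases "norm z < R j")
      case True
      have "norm z ^ k * norm z ^ n \<le> R j ^ k * 1"
        using True z R[of j] by (intro mult_mono power_mono power_le_one) auto
      then have "norm (c k) * (norm z ^ k * norm z ^ n) * w z \<le> norm (c k) * (R j ^ k * 1) * w z"
        by (intro mult_left_mono mult_right_mono radial_weight_nonneg[OF w z]) auto
      then show ?thesis using True R[of j] radial_weight_nonneg[OF w z]
        by (simp add: h_def X_def norm_mult norm_power mult_ac)
    next
      case False
      then show ?thesis using radial_weight_nonneg[OF w z] by (simp add: h_def X_def)
    qed
    have "(\<lambda>k. integral\<^sup>L disc_area (h k)) sums (\<integral>z. (\<Sum>k. h k z) \<partial>disc_area)"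
    proof (rule sums_integral[OF hint])
      show "AE z in disc_area. summable (\<lambda>k. norm (h k z))"
      proof (rule AE_I2)
        fix z assume "z \<in> space disc_area"
        then have z: "norm z < 1" by simp
        show "summable (\<lambda>k. norm (h k z))"
          by (rule summable_comparison_test'[OF summable_mult2[OF sm, of "w z"], of 0]) (use hb[OF z] in simp)
      qed
      show "summable (\<lambda>k. \<integral>z. norm (h k z) \<partial>disc_area)"
      proof (rule summable_comparison_test'[OF summable_mult2[OF sm, of "\<integral>z. w z \<partial>disc_area"], of 0])
        fix k
        have "(\<integral>z. norm (h k z) \<partial>disc_area) \<le> (\<integral>z. norm (c k * of_real (R j) ^ k) * w z \<partial>disc_area)"
          using hint[of k] radial_weightD(3)[OF w] hb by (intro integral_mono) auto
        then show "norm (\<integral>z. norm (h k z) \<partial>disc_area) \<le> norm (c k * of_real (R j) ^ k) * (\<integral>z. w z \<partial>disc_area)"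
          by (simp add: integral_nonneg_AE)
      qed
    qed
    moreover have "integral\<^sup>L disc_area (h k) = 0" if "k \<noteq> n" for k
    proof (rule integral_eq_0_of_rotation[OF _ that])
      show "h k \<in> borel_measurable disc_area" using hint[of k] by simp
      show "h k (a * z) = a ^ k * cnj a ^ n * h k z" if "norm a = 1" "norm z < 1" for a z
        using that radial_weight_rotation[OF w that] by (simp add: h_def X_def norm_mult power_mult_distrib indicator_def)
    qed
    then have "(\<lambda>k. integral\<^sup>L disc_area (h k)) sums integral\<^sup>L disc_area (h n)"
      using sums_finite[of "{n}" "\<lambda>k. integral\<^sup>L disc_area (h k)"] by simp
    ultimately have "(\<integral>z. (\<Sum>k. h k z) \<partial>disc_area) = integral\<^sup>L disc_area (h n)"
      by (rule sums_unique2)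
    moreover have "(\<integral>z. (\<Sum>k. h k z) \<partial>disc_area) = (\<integral>z. X j z * (f z * cnj z ^ n * of_real (w z)) \<partial>disc_area)"
    proof (rule Bochner_Integration.integral_cong)
      fix z assume "z \<in> space disc_area"
      then have "(\<lambda>k. c k * z ^ k) sums f z" using f by simp
      then have "(\<lambda>k. X j z * cnj z ^ n * of_real (w z) * (c k * z ^ k)) sums (X j z * cnj z ^ n * of_real (w z) * f z)"
        by (rule sums_mult)
      then show "(\<Sum>k. h k z) = X j z * (f z * cnj z ^ n * of_real (w z))"
        by (simp add: h_def sums_iff mult_ac)
    qed simp
    moreover have "integral\<^sup>L disc_area (h n) = c n * (\<integral>z. X j z * (z ^ n * cnj z ^ n * of_real (w z)) \<partial>disc_area)"
      unfolding h_def[abs_def] by (rule integral_mult_right_zero)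
    ultimately show ?thesis by simp
  qed
  have int2: "integrable disc_area (\<lambda>z. f z * cnj z ^ n * of_real (w z))"
  proof (rule Bochner_Integration.integrable_bound[OF int])
    show "AE z in disc_area. norm (f z * cnj z ^ n * of_real (w z)) \<le> norm (f z * of_real (w z))"
    proof (rule AE_I2)
      fix z assume "z \<in> space disc_area"
      then have "norm z ^ n \<le> 1" by (simp add: power_le_one)
      then have "(norm (f z) * \<bar>w z\<bar>) * norm z ^ n \<le> (norm (f z) * \<bar>w z\<bar>) * 1" by (intro mult_left_mono) auto
      then show "norm (f z * cnj z ^ n * of_real (w z)) \<le> norm (f z * of_real (w z))"
        by (simp add: norm_mult norm_power mult_ac)
    qed
  qed measurable
  have dc: "(\<lambda>j. \<integral>z. X j z * g z \<partial>disc_area) \<longlonglongrightarrow> (\<integral>z. g z \<partial>disc_area)"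
    if gi: "integrable disc_area g" for g :: "complex \<Rightarrow> complex"
  proof (rule integral_dominated_convergence[where w="\<lambda>z. norm (g z)"])
    show "AE z in disc_area. (\<lambda>j. X j z * g z) \<longlonglongrightarrow> g z"
    proof (rule AE_I2)
      fix z assume "z \<in> space disc_area"
      then have "(\<lambda>j. complex_of_real (X j z) * g z) \<longlonglongrightarrow> of_real 1 * g z"
        by (intro tendsto_intros Xlim) simp
      then show "(\<lambda>j. X j z * g z) \<longlonglongrightarrow> g z" by simp
    qed
    show "AE z in disc_area. norm (X j z * g z) \<le> norm (g z)" for j
      by (rule AE_I2) (use X01 in \<open>simp add: norm_mult mult_left_le_one_le\<close>)
    have "g \<in> borel_measurable disc_area" using gi by simp
    then show "(\<lambda>z. X j z * g z) \<in> borel_measurable disc_area" for j by measurable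
  qed (use gi in auto)
  have "(\<lambda>j. c n * (\<integral>z. X j z * (z ^ n * cnj z ^ n * of_real (w z)) \<partial>disc_area)) \<longlonglongrightarrow> c n * of_real (wmom w (2 * real n))"
    using dc[OF intn[of n n]] unfolding integral_norm_power_weight(1)[OF w] by (intro tendsto_intros)
  moreover have "(\<lambda>j. c n * (\<integral>z. X j z * (z ^ n * cnj z ^ n * of_real (w z)) \<partial>disc_area)) \<longlonglongrightarrow> (\<integral>z. f z * cnj z ^ n * of_real (w z) \<partial>disc_area)"
    using dc[OF int2] unfolding step .
  ultimately show ?thesis by (rule LIMSEQ_unique[symmetric])
qed

section \<open>The reproducing property and the identification of the kernel\<close>

lemma norm_mult_less_1: "norm (a::complex) < 1 \<Longrightarrow> norm b < 1 \<Longrightarrow> norm (a * b) < 1"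
  using mult_strict_mono[of "norm a" 1 "norm b" 1] by (simp add: norm_mult)

lemma kser_bound:
  assumes w: "radial_weight w" and z: "norm z < 1" and y: "norm y \<le> 1"
  shows "norm (kser w (z * y)) \<le> (\<Sum>n. kcoeff w n * norm z ^ n)"
proof -
  have le: "norm (z * y) \<le> norm z" using y by (simp add: norm_mult mult_left_le)
  then have lt: "norm (z * y) < 1" using z by linarith
  have "norm (kser w (z * y)) \<le> (\<Sum>n. kcoeff w n * norm (z * y) ^ n)" by (rule kser_sums(2)[OF w lt])
  also have "\<dots> \<le> (\<Sum>n. kcoeff w n * norm z ^ n)"
    using le lt z by (intro suminf_le mult_left_mono power_mono summable_kcoeff[OF w] less_imp_le[OF kcoeff_pos[OF w]]) auto
  finally show ?thesis .
qed

lemma kser_mult_holomorphic: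
  assumes w: "radial_weight w" and z: "norm z \<le> 1"
  shows "(\<lambda>y. kser w (z * y)) holomorphic_on ball 0 1"
proof -
  have "kser w \<circ> (\<lambda>y. z * y) holomorphic_on ball 0 1"
  proof (rule holomorphic_on_compose_gen[OF _ kser_holomorphic[OF w]])
    show "(*) z ` ball 0 1 \<subseteq> ball 0 1"
    proof (rule image_subsetI)
      fix y :: complex assume "y \<in> ball 0 1"
      then have "norm z * norm y \<le> 1 * norm y" "norm y < 1" using mult_right_mono[OF z, of "norm y"] by auto
      then show "z * y \<in> ball 0 1" by (simp add: norm_mult)
    qed
  qed (intro holomorphic_intros)
  then show ?thesis by (simp add: o_def)
qed

lemma kser_in_Bergman_space:
  assumes w: "radial_weight w" and z: "norm z < 1"
  shows "(\<lambda>y. kser w (z * y)) \<in> Bergman_space 2 w"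
proof -
  have mw [measurable]: "w \<in> borel_measurable disc_area" by (rule radial_weight_measurable[OF w])
  define B where "B = (\<Sum>n. kcoeff w n * norm z ^ n)"
  have hol: "(\<lambda>y. kser w (z * y)) holomorphic_on ball 0 1" using kser_mult_holomorphic[OF w] z by simp
  then have m: "(\<lambda>y. kser w (z * y)) \<in> borel_measurable disc_area"
    by (intro continuous_on_measurable_disc_area holomorphic_on_imp_continuous_on)
  have "(\<integral>\<^sup>+y. ennreal (norm (kser w (z * y)) powr 2 * w y) \<partial>disc_area) \<le> (\<integral>\<^sup>+y. ennreal (B^2) * ennreal (w y) \<partial>disc_area)"
  proof (rule nn_integral_mono)
    fix y assume "y \<in> space disc_area"
    then have y: "norm y < 1" by simp
    have "norm (kser w (z * y)) ^ 2 \<le> B ^ 2"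
      using kser_bound[OF w z, of y] y by (intro power_mono) (auto simp: B_def)
    then have "norm (kser w (z * y)) ^ 2 * w y \<le> B ^ 2 * w y"
      by (intro mult_right_mono radial_weight_nonneg[OF w y])
    then show "ennreal (norm (kser w (z * y)) powr 2 * w y) \<le> ennreal (B^2) * ennreal (w y)"
      using radial_weight_nonneg[OF w y] by (subst ennreal_mult[symmetric]) (auto intro!: ennreal_leI)
  qed
  also have "\<dots> < \<infinity>"
    using radial_weight_nn_integral_finite[OF w] by (subst nn_integral_cmult) (auto simp: ennreal_mult_less_top)
  finally show ?thesis using m hol by (simp add: Bergman_space_def Lp_def)
qed

lemma Bergman_space_2_integrable:
  assumes w: "radial_weight w" and f: "f \<in> Bergman_space 2 w"
  shows "integrable disc_area (\<lambda>z. f z * of_real (w z))"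
proof -
  have mw [measurable]: "w \<in> borel_measurable disc_area" by (rule radial_weight_measurable[OF w])
  have mf [measurable]: "f \<in> borel_measurable disc_area"
    and fin: "(\<integral>\<^sup>+z. ennreal (norm (f z) powr 2 * w z) \<partial>disc_area) < \<infinity>"
    using f by (auto simp: Bergman_space_def Lp_def)
  have i: "integrable disc_area (\<lambda>z. norm (f z) powr 2 * w z)"
  proof (rule integrableI_nonneg)
    show "AE z in disc_area. 0 \<le> norm (f z) powr 2 * w z" by (rule AE_I2) (simp add: radial_weight_nonneg[OF w])
    show "(\<lambda>z. norm (f z) powr 2 * w z) \<in> borel_measurable disc_area" by measurable
  qed (rule fin)
  show ?thesis
  proof (rule Bochner_Integration.integrable_bound[OF Bochner_Integration.integrable_add[OF i radial_weightD(3)[OF w]]])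
    show "AE z in disc_area. norm (f z * complex_of_real (w z)) \<le> norm (norm (f z) powr 2 * w z + w z)"
    proof (rule AE_I2)
      fix z assume "z \<in> space disc_area"
      then have w0: "0 \<le> w z" using radial_weight_nonneg[OF w] by simp
      have "2 * norm (f z) \<le> norm (f z) ^ 2 + 1" "0 \<le> norm (f z)"
        using zero_le_power2[of "norm (f z) - 1"] by (simp_all add: power2_diff) 
      then have "norm (f z) \<le> norm (f z) ^ 2 + 1" by linarith
      then have "norm (f z) * w z \<le> (norm (f z) ^ 2 + 1) * w z" using w0 by (rule mult_right_mono)
      then show "norm (f z * complex_of_real (w z)) \<le> norm (norm (f z) powr 2 * w z + w z)"
        using w0 by (simp add: norm_mult distrib_right)
    qed
  qed measurable
qed

text \<open>For fixed z the kernel series is dominated by the convergent sum of kcoeff |z|^n, so it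
  may be integrated termwise against any f integrable for w. Holomorphy is not assumed: the
  statement serves the reproducing formula and also the projections of the test functions.\<close>

lemma kser_integral_sums:
  assumes w: "radial_weight w" and z: "norm z < 1" and mf [measurable]: "f \<in> borel_measurable disc_area"
    and int: "integrable disc_area (\<lambda>y. f y * of_real (w y))"
  shows "(\<lambda>n. of_real (kcoeff w n) * z ^ n * (\<integral>y. f y * cnj y ^ n * of_real (w y) \<partial>disc_area))
    sums (\<integral>y. f y * cnj (kser w (cnj z * y)) * of_real (w y) \<partial>disc_area)"
proof -
  define I where "I = (\<integral>y. norm (f y * of_real (w y)) \<partial>disc_area)"
  define h where "h n y = of_real (kcoeff w n) * z ^ n * (f y * cnj y ^ n * of_real (w y))" for n y
  have mw [measurable]: "w \<in> borel_measurable disc_area" by (rule radial_weight_measurable[OF w])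
  have [measurable]: "(\<lambda>z. cnj z) \<in> borel_measurable disc_area"
    by (intro continuous_on_measurable_disc_area continuous_intros)
  have hm: "h n \<in> borel_measurable disc_area" for n unfolding h_def by measurable
  have hb: "norm (h n y) \<le> kcoeff w n * norm z ^ n * norm (f y * of_real (w y))" if "norm y < 1" for n y
  proof -
    have "(norm (f y) * \<bar>w y\<bar>) * norm y ^ n \<le> (norm (f y) * \<bar>w y\<bar>) * 1"
      using that by (intro mult_left_mono power_le_one) auto
    also have "\<dots> = norm (f y * of_real (w y))" by (simp add: norm_mult)
    finally have "kcoeff w n * norm z ^ n * ((norm (f y) * \<bar>w y\<bar>) * norm y ^ n) \<le> kcoeff w n * norm z ^ n * norm (f y * of_real (w y))"
      using kcoeff_pos[OF w, of n] by (intro mult_left_mono) auto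
    moreover have "norm (h n y) = kcoeff w n * norm z ^ n * ((norm (f y) * \<bar>w y\<bar>) * norm y ^ n)"
      using kcoeff_pos[OF w, of n] by (simp add: h_def norm_mult norm_power)
    ultimately show ?thesis by (simp only:)
  qed
  have hint: "integrable disc_area (h n)" for n
  proof (rule Bochner_Integration.integrable_bound[OF integrable_mult_right[OF integrable_norm[OF int], of "kcoeff w n * norm z ^ n"] hm])
    show "AE y in disc_area. norm (h n y) \<le> norm (kcoeff w n * norm z ^ n * norm (f y * of_real (w y)))"
      by (rule AE_I2, rule order_trans[OF hb]) auto
  qed
  have sm: "summable (\<lambda>n. kcoeff w n * norm z ^ n)" using summable_kcoeff[OF w, of "norm z"] z by simp
  have "(\<lambda>n. integral\<^sup>L disc_area (h n)) sums (\<integral>y. (\<Sum>n. h n y) \<partial>disc_area)"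
  proof (rule sums_integral[OF hint])
    show "AE y in disc_area. summable (\<lambda>n. norm (h n y))"
    proof (rule AE_I2)
      fix y assume "y \<in> space disc_area"
      then show "summable (\<lambda>n. norm (h n y))"
        by (intro summable_comparison_test'[OF summable_mult2[OF sm, of "norm (f y * of_real (w y))"], of 0]) (use hb[of y] in simp)
    qed
    show "summable (\<lambda>n. \<integral>y. norm (h n y) \<partial>disc_area)"
    proof (rule summable_comparison_test'[OF summable_mult2[OF sm, of I], of 0])
      fix n
      have "(\<integral>y. norm (h n y) \<partial>disc_area) \<le> (\<integral>y. kcoeff w n * norm z ^ n * norm (f y * of_real (w y)) \<partial>disc_area)"
        using hint[of n] int hb[of _ n] by (intro integral_mono) auto
      also have "\<dots> = kcoeff w n * norm z ^ n * I" unfolding I_def by (rule integral_mult_right_zero)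
      finally show "norm (\<integral>y. norm (h n y) \<partial>disc_area) \<le> kcoeff w n * norm z ^ n * I"
        by (simp add: integral_nonneg_AE)
    qed
  qed
  moreover have "integral\<^sup>L disc_area (h n) = of_real (kcoeff w n) * z ^ n * (\<integral>y. f y * cnj y ^ n * of_real (w y) \<partial>disc_area)" for n
    unfolding h_def[abs_def] by (rule integral_mult_right_zero)
  moreover have "(\<integral>y. (\<Sum>n. h n y) \<partial>disc_area) = (\<integral>y. f y * cnj (kser w (cnj z * y)) * of_real (w y) \<partial>disc_area)"
  proof (rule Bochner_Integration.integral_cong)
    fix y assume "y \<in> space disc_area"
    then have "norm (cnj z * y) < 1" using z by (intro norm_mult_less_1) auto
    from sums_cnj[THEN iffD2, OF kser_sums(1)[OF w this]]
    have "(\<lambda>n. of_real (kcoeff w n) * (z * cnj y) ^ n) sums cnj (kser w (cnj z * y))" by simp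
    then have "(\<lambda>n. f y * of_real (w y) * (of_real (kcoeff w n) * (z * cnj y) ^ n)) sums (f y * of_real (w y) * cnj (kser w (cnj z * y)))"
      by (rule sums_mult)
    then show "(\<Sum>n. h n y) = f y * cnj (kser w (cnj z * y)) * of_real (w y)"
      by (simp add: h_def sums_iff power_mult_distrib mult_ac)
  qed simp
  ultimately show ?thesis by simp
qed

text \<open>The integral against cnj(y)^n is the n-th Taylor coefficient times a moment, and
  \<open>kcoeff\<close> is the reciprocal of that moment.\<close>

lemma kser_reproducing:
  assumes w: "radial_weight w" and z: "norm z < 1" and f: "f \<in> Bergman_space 2 w"
  shows "(\<integral>y. f y * cnj (kser w (cnj z * y)) * of_real (w y) \<partial>disc_area) = f z"
proof -
  define c where "c n = (deriv ^^ n) f 0 / fact n" for n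
  have fs: "(\<lambda>n. c n * y ^ n) sums f y" if "norm y < 1" for y
    using holomorphic_power_series[of f 0 1 y] f that by (simp add: c_def Bergman_space_def)
  note int = Bergman_space_2_integrable[OF w f]
  have mf: "f \<in> borel_measurable disc_area" using f by (simp add: Bergman_space_def Lp_def)
  have "of_real (kcoeff w n) * z ^ n * (\<integral>y. f y * cnj y ^ n * of_real (w y) \<partial>disc_area) = c n * z ^ n" for n
    using holomorphic_coefficient_integral[OF w fs int, of n] wmom_pos[OF w, of "2 * real n"] by (simp add: kcoeff_def)
  with kser_integral_sums[OF w z mf int]
  have "(\<lambda>n. c n * z ^ n) sums (\<integral>y. f y * cnj (kser w (cnj z * y)) * of_real (w y) \<partial>disc_area)" by simp
  with fs[OF z] show ?thesis by (rule sums_unique2[symmetric])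
qed

text \<open>The series satisfies the property behind \<open>SOME\<close>, so the chosen function B
  does too. Testing B on the monomials determines all its Taylor coefficients, which proves equality
  on the disc.\<close>

lemma Bergman_kernel_eq:
  assumes w: "radial_weight w" and z: "norm z < 1" and y: "norm y < 1"
  shows "Bergman_kernel w z y = kser w (cnj z * y)"
proof -
  let ?P = "\<lambda>B. B \<in> Bergman_space 2 w \<and>
     (\<forall>f\<in>Bergman_space 2 w. f z = (\<integral>y. f y * cnj (B y) * of_real (w y) \<partial>disc_area))"
  define B where "B = Bergman_kernel w z"
  have "?P (\<lambda>y. kser w (cnj z * y))"
    using kser_reproducing[OF w z] kser_in_Bergman_space[OF w, of "cnj z"] z by simp
  then have "?P B" unfolding B_def Bergman_kernel_def by (rule someI[where P="?P"])
  then have B: "B \<in> Bergman_space 2 w"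
    "\<And>f. f \<in> Bergman_space 2 w \<Longrightarrow> f z = (\<integral>y. f y * cnj (B y) * of_real (w y) \<partial>disc_area)" by auto
  define d where "d n = (deriv ^^ n) B 0 / fact n" for n
  have Bs: "(\<lambda>n. d n * y ^ n) sums B y" if "norm y < 1" for y
    using holomorphic_power_series[of B 0 1 y] B(1) that by (simp add: d_def Bergman_space_def)
  have "d n = of_real (kcoeff w n) * cnj z ^ n" for n
  proof -
    have mono: "(\<lambda>y. y ^ n) \<in> Bergman_space 2 w"
    proof -
      have mw [measurable]: "w \<in> borel_measurable disc_area" by (rule radial_weight_measurable[OF w])
      have "(\<integral>\<^sup>+y. ennreal (norm (y ^ n) powr 2 * w y) \<partial>disc_area) \<le> (\<integral>\<^sup>+y. ennreal (w y) \<partial>disc_area)"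
      proof (intro nn_integral_mono ennreal_leI)
        fix y :: complex assume "y \<in> space disc_area"
        then have "norm (y ^ n) powr 2 \<le> 1" "0 \<le> w y"
          using radial_weight_nonneg[OF w, of y] by (auto simp: norm_power intro!: power_le_one)
        then show "norm (y ^ n) powr 2 * w y \<le> w y" using mult_right_mono[of "norm (y ^ n) powr 2" 1 "w y"] by simp
      qed
      then have "(\<integral>\<^sup>+y. ennreal (norm (y ^ n) powr 2 * w y) \<partial>disc_area) < \<infinity>"
        using radial_weight_nn_integral_finite[OF w] by (rule le_less_trans)
      then show ?thesis
        by (auto simp: Bergman_space_def Lp_def intro!: holomorphic_intros borel_measurable_disc_area)
    qed
    have "cnj (z ^ n) = cnj (\<integral>y. y ^ n * cnj (B y) * of_real (w y) \<partial>disc_area)" using B(2)[OF mono] by simp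
    also have "\<dots> = (\<integral>y. B y * cnj y ^ n * of_real (w y) \<partial>disc_area)"
      by (simp add: mult_ac flip: Bochner_Integration.integral_cnj)
    also have "\<dots> = d n * of_real (wmom w (2 * real n))"
      by (rule holomorphic_coefficient_integral[OF w Bs Bergman_space_2_integrable[OF w B(1)]])
    finally show ?thesis using wmom_pos[OF w, of "2 * real n"] by (simp add: kcoeff_def field_simps)
  qed
  then have "(\<lambda>n. of_real (kcoeff w n) * (cnj z * y) ^ n) sums B y"
    using Bs[OF y] by (simp add: power_mult_distrib mult_ac)
  moreover have "norm (cnj z * y) < 1" using z y by (intro norm_mult_less_1) auto
  ultimately show ?thesis using kser_sums(1)[OF w] sums_unique2 unfolding B_def by blast
qed

section \<open>Circle means of the kernel\<close>

lemma borel_measurable_sgn_complex [measurable]: "(sgn :: complex \<Rightarrow> complex) \<in> borel_measurable borel"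
proof -
  have "(\<lambda>z::complex. inverse (norm z) *\<^sub>R z) \<in> borel_measurable borel" by measurable
  then show ?thesis by (simp add: sgn_div_norm[abs_def])
qed

lemma sgn_rotation: "norm (c::complex) = 1 \<Longrightarrow> sgn (c * u) = c * sgn u"
  by (simp add: sgn_mult) (simp add: sgn_div_norm)

lemma norm_sgn_le_1: "norm (sgn (u::complex)) \<le> 1"
  by (simp add: norm_sgn)

text \<open>Under the area measure \<open>sgn u\<close> is uniformly distributed on the unit circle,
  so this is a circle mean; rotating by \<open>sgn xi\<close> shows that it depends on |xi|
  only.\<close>

lemma nn_integral_circle_mean:
  fixes G :: "complex \<Rightarrow> ennreal"
  assumes [measurable]: "G \<in> borel_measurable borel"
  shows "(\<integral>\<^sup>+u. G (xi * sgn u) \<partial>disc_area) = (\<integral>\<^sup>+u. G (of_real (norm xi) * sgn u) \<partial>disc_area)"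
proof (cases "xi = 0")
  case False
  define c where "c = sgn xi"
  have c: "norm c = 1" "xi = of_real (norm xi) * c" 
    using False by (simp add: c_def norm_sgn) (use False in \<open>simp add: c_def sgn_div_norm scaleR_conv_of_real\<close>)
  have "(\<integral>\<^sup>+u. G (of_real (norm xi) * sgn u) \<partial>disc_area) = (\<integral>\<^sup>+u. G (of_real (norm xi) * sgn (c * u)) \<partial>disc_area)"
    by (rule nn_integral_disc_rotation[OF c(1), symmetric]) (rule borel_measurable_disc_area, measurable)
  also have "\<dots> = (\<integral>\<^sup>+u. G (xi * sgn u) \<partial>disc_area)"
  proof (rule nn_integral_cong)
    fix u
    have "of_real (norm xi) * sgn (c * u) = (of_real (norm xi) * c) * sgn u"
      by (simp only: sgn_rotation[OF c(1)] mult.assoc)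
    then show "G (of_real (norm xi) * sgn (c * u)) = G (xi * sgn u)" using c(2) by simp
  qed
  finally show ?thesis by simp
qed simp

text \<open>For each u the rotation by \<open>sgn u\<close> leaves the integral unchanged. Averaging
  over u and exchanging the integrals produces the circle mean of G at radius |a||z|. The
  exceptional point u = 0, where \<open>sgn u\<close> is not unimodular, is null.\<close>

lemma nn_integral_disc_average:
  fixes G h :: "complex \<Rightarrow> ennreal"
  assumes G [measurable]: "G \<in> borel_measurable borel" and h [measurable]: "h \<in> borel_measurable disc_area"
    and rot: "\<And>c z. norm c = 1 \<Longrightarrow> norm z < 1 \<Longrightarrow> h (c * z) = h z"
  shows "(\<integral>\<^sup>+z. G (a * z) * h z \<partial>disc_area) = (\<integral>\<^sup>+z. (\<integral>\<^sup>+u. G (of_real (norm a * norm z) * sgn u) \<partial>disc_area) * h z \<partial>disc_area)"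
proof -
  interpret pair_sigma_finite disc_area disc_area by standard
  have mm: "(\<lambda>(u, z). G (a * (sgn u * z)) * h z) \<in> borel_measurable (disc_area \<Otimes>\<^sub>M disc_area)"
  proof -
    have [measurable]: "(\<lambda>x::complex. x) \<in> disc_area \<rightarrow>\<^sub>M borel" by (rule borel_measurable_disc_area) simp
    have 1: "(\<lambda>p::complex \<times> complex. fst p) \<in> borel_measurable (disc_area \<Otimes>\<^sub>M disc_area)"
      using measurable_comp[OF measurable_fst \<open>(\<lambda>x. x) \<in> disc_area \<rightarrow>\<^sub>M borel\<close>] by (simp add: o_def)
    have 2: "(\<lambda>p::complex \<times> complex. snd p) \<in> borel_measurable (disc_area \<Otimes>\<^sub>M disc_area)"
      using measurable_comp[OF measurable_snd \<open>(\<lambda>x. x) \<in> disc_area \<rightarrow>\<^sub>M borel\<close>] by (simp add: o_def)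
    have 3: "(\<lambda>p::complex \<times> complex. sgn (fst p)) \<in> borel_measurable (disc_area \<Otimes>\<^sub>M disc_area)"
      by (rule measurable_compose[OF 1]) measurable
    have 4: "(\<lambda>p. G (a * (sgn (fst p) * snd p))) \<in> borel_measurable (disc_area \<Otimes>\<^sub>M disc_area)"
      using 2 3 by (intro measurable_compose[OF _ G] borel_measurable_times) auto
    have 5: "(\<lambda>p. h (snd p)) \<in> borel_measurable (disc_area \<Otimes>\<^sub>M disc_area)"
      by (rule measurable_compose[OF measurable_snd h])
    show ?thesis using borel_measurable_times_ennreal[OF 4 5] by (simp add: case_prod_beta')
  qed
  have "(\<integral>\<^sup>+z. G (a * z) * h z \<partial>disc_area) = (\<integral>\<^sup>+u. (\<integral>\<^sup>+z. G (a * z) * h z \<partial>disc_area) \<partial>disc_area)"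
    by (simp add: emeasure_disc_area)
  also have "\<dots> = (\<integral>\<^sup>+u. (\<integral>\<^sup>+z. G (a * (sgn u * z)) * h z \<partial>disc_area) \<partial>disc_area)"
  proof (rule nn_integral_cong_AE)
    show "AE u in disc_area. (\<integral>\<^sup>+z. G (a * z) * h z \<partial>disc_area) = (\<integral>\<^sup>+z. G (a * (sgn u * z)) * h z \<partial>disc_area)"
      using AE_disc_area_nonzero
    proof eventually_elim
      case (elim u)
      then have c: "norm (sgn u) = 1" by (simp add: norm_sgn)
      have [measurable]: "(\<lambda>z. G (a * z)) \<in> borel_measurable disc_area" by (rule borel_measurable_disc_area) measurable
      have "(\<integral>\<^sup>+z. G (a * z) * h z \<partial>disc_area) = (\<integral>\<^sup>+z. G (a * (sgn u * z)) * h (sgn u * z) \<partial>disc_area)"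
        by (rule nn_integral_disc_rotation[OF c, symmetric]) measurable
      also have "\<dots> = (\<integral>\<^sup>+z. G (a * (sgn u * z)) * h z \<partial>disc_area)"
        by (intro nn_integral_cong) (simp add: rot[OF c])
      finally show ?case .
    qed
  qed
  also have "\<dots> = (\<integral>\<^sup>+z. (\<integral>\<^sup>+u. G (a * (sgn u * z)) * h z \<partial>disc_area) \<partial>disc_area)"
    by (rule Fubini'[OF mm, symmetric])
  also have "\<dots> = (\<integral>\<^sup>+z. (\<integral>\<^sup>+u. G (of_real (norm a * norm z) * sgn u) \<partial>disc_area) * h z \<partial>disc_area)"
  proof (rule nn_integral_cong)
    fix z
    have "(\<lambda>u. G (a * (sgn u * z))) \<in> borel_measurable disc_area" by (rule borel_measurable_disc_area) measurable
    then have "(\<integral>\<^sup>+u. G (a * (sgn u * z)) * h z \<partial>disc_area) = (\<integral>\<^sup>+u. G (a * (sgn u * z)) \<partial>disc_area) * h z"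
      by (rule nn_integral_multc)
    also have "(\<integral>\<^sup>+u. G (a * (sgn u * z)) \<partial>disc_area) = (\<integral>\<^sup>+u. G (a * z * sgn u) \<partial>disc_area)"
      by (simp only: mult_ac)
    also have "\<dots> = (\<integral>\<^sup>+u. G (of_real (norm (a * z)) * sgn u) \<partial>disc_area)"
      by (rule nn_integral_circle_mean[OF G])
    finally show "(\<integral>\<^sup>+u. G (a * (sgn u * z)) * h z \<partial>disc_area) = (\<integral>\<^sup>+u. G (of_real (norm a * norm z) * sgn u) \<partial>disc_area) * h z"
      by (simp only: norm_mult)
  qed
  finally show ?thesis .
qed

lemma sgn_power_orthonormal:
  shows "(\<integral>u. sgn u ^ n * cnj (sgn u) ^ k \<partial>disc_area) = (if n = k then 1 else 0)"
    and "integrable disc_area (\<lambda>u. sgn u ^ n * cnj (sgn u) ^ k)"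
proof -
  have m: "(\<lambda>u. sgn u ^ n * cnj (sgn u) ^ k) \<in> borel_measurable disc_area"
  proof -
    have "cnj \<in> borel_measurable borel" by (intro borel_measurable_continuous_onI continuous_intros)
    then have [measurable]: "(\<lambda>u. cnj (sgn u)) \<in> borel_measurable borel" by (rule measurable_compose[rotated]) measurable
    show ?thesis by (rule borel_measurable_disc_area) measurable
  qed
  show "integrable disc_area (\<lambda>u. sgn u ^ n * cnj (sgn u) ^ k)"
  proof (rule disc.integrable_const_bound[OF _ m, where B=1], rule AE_I2)
    fix u :: complex
    have "norm (sgn u) ^ n * norm (sgn u) ^ k \<le> 1 * 1"
      by (intro mult_mono power_le_one norm_sgn_le_1) auto
    then show "norm (sgn u ^ n * cnj (sgn u) ^ k) \<le> 1" by (simp add: norm_mult norm_power)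
  qed
  show "(\<integral>u. sgn u ^ n * cnj (sgn u) ^ k \<partial>disc_area) = (if n = k then 1 else 0)"
  proof (cases "n = k")
    case True
    have "(\<integral>u. sgn u ^ n * cnj (sgn u) ^ k \<partial>disc_area) = (\<integral>u. 1 \<partial>disc_area)"
    proof (rule integral_cong_AE[OF m])
      show "AE u in disc_area. sgn u ^ n * cnj (sgn u) ^ k = 1"
        using AE_disc_area_nonzero
      proof eventually_elim
        case (elim u)
        have "sgn u ^ n * cnj (sgn u) ^ k = (sgn u * cnj (sgn u)) ^ n" using True by (simp add: power_mult_distrib)
        also have "sgn u * cnj (sgn u) = 1" using elim by (simp add: complex_norm_square[symmetric] norm_sgn)
        finally show ?case by simp
      qed
    qed simp
    then show ?thesis using True by (simp add: measure_def emeasure_disc_area)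
  next
    case False
    then show ?thesis
      using integral_eq_0_of_rotation[OF m False] by (simp add: sgn_rotation power_mult_distrib mult_ac)
  qed
qed

text \<open>Orthonormality of the powers of \<open>sgn u\<close> gives equality for partial sums;
  Fatou's lemma passes to the limit, and one inequality is enough for the estimates.\<close>

lemma circle_mean_square_le:
  fixes g :: "complex \<Rightarrow> complex" and b :: "nat \<Rightarrow> complex"
  assumes t: "0 \<le> t" and g: "\<And>z. norm z \<le> t \<Longrightarrow> (\<lambda>n. b n * z ^ n) sums g z"
    and sm: "summable (\<lambda>n. (norm (b n) * t ^ n)\<^sup>2)"
  shows "(\<integral>\<^sup>+u. ennreal ((norm (g (of_real t * sgn u)))\<^sup>2) \<partial>disc_area) \<le> ennreal (\<Sum>n. (norm (b n) * t ^ n)\<^sup>2)"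
proof -
  define S where "S N u = (\<Sum>n<N. b n * (of_real t * sgn u) ^ n)" for N and u :: complex
  have [measurable]: "S N \<in> borel_measurable disc_area" for N
    unfolding S_def by (rule borel_measurable_disc_area) measurable
  have fin: "(\<integral>\<^sup>+u. ennreal ((norm (S N u))\<^sup>2) \<partial>disc_area) = ennreal (\<Sum>n<N. (norm (b n) * t ^ n)\<^sup>2)" for N
  proof -
    have e: "complex_of_real ((norm (S N u))\<^sup>2) = (\<Sum>n<N. \<Sum>k<N. (b n * of_real t ^ n * cnj (b k * of_real t ^ k)) * (sgn u ^ n * cnj (sgn u) ^ k))" for u
    proof -
      have "complex_of_real ((norm (S N u))\<^sup>2) = S N u * cnj (S N u)" by (rule complex_norm_square)
      also have "\<dots> = (\<Sum>n<N. \<Sum>k<N. (b n * (of_real t * sgn u) ^ n) * cnj (b k * (of_real t * sgn u) ^ k))"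
        by (simp only: S_def cnj_sum sum_product)
      finally show ?thesis by (simp add: power_mult_distrib mult_ac)
    qed
    have i1: "integrable disc_area (\<lambda>u. \<Sum>k<N. (b n * of_real t ^ n * cnj (b k * of_real t ^ k)) * (sgn u ^ n * cnj (sgn u) ^ k))" for n
      by (intro Bochner_Integration.integrable_sum integrable_mult_right sgn_power_orthonormal(2))
    have ci: "integrable disc_area (\<lambda>u. complex_of_real ((norm (S N u))\<^sup>2))"
      unfolding e by (intro Bochner_Integration.integrable_sum i1)
    have ri: "integrable disc_area (\<lambda>u. (norm (S N u))\<^sup>2)" using integrable_Re[OF ci] by simp
    have "complex_of_real (\<integral>u. (norm (S N u))\<^sup>2 \<partial>disc_area) = (\<integral>u. complex_of_real ((norm (S N u))\<^sup>2) \<partial>disc_area)"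
      by (rule integral_of_real[OF ri, symmetric])
    also have "\<dots> = (\<Sum>n<N. \<Sum>k<N. (b n * of_real t ^ n * cnj (b k * of_real t ^ k)) * (if n = k then 1 else 0))"
      unfolding e
      by (subst Bochner_Integration.integral_sum[OF i1], rule sum.cong[OF refl],
          subst Bochner_Integration.integral_sum)
         (auto intro!: integrable_mult_right sgn_power_orthonormal(2) simp: sgn_power_orthonormal(1))
    also have "\<dots> = (\<Sum>n<N. b n * of_real t ^ n * cnj (b n * of_real t ^ n))"
      by (intro sum.cong refl) (simp add: if_distrib cong: if_cong)
    also have "\<dots> = (\<Sum>n<N. complex_of_real ((norm (b n) * t ^ n)\<^sup>2))"
      using t by (intro sum.cong refl) (simp only: complex_norm_square[symmetric] norm_mult norm_power norm_of_real abs_of_nonneg)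
    finally have "complex_of_real (\<integral>u. (norm (S N u))\<^sup>2 \<partial>disc_area) = complex_of_real (\<Sum>n<N. (norm (b n) * t ^ n)\<^sup>2)" by simp
    then have "(\<integral>u. (norm (S N u))\<^sup>2 \<partial>disc_area) = (\<Sum>n<N. (norm (b n) * t ^ n)\<^sup>2)"
      by (simp only: of_real_eq_iff)
    then show ?thesis using nn_integral_eq_integral[OF ri] by simp
  qed
  have "(\<integral>\<^sup>+u. ennreal ((norm (g (of_real t * sgn u)))\<^sup>2) \<partial>disc_area) = (\<integral>\<^sup>+u. liminf (\<lambda>N. ennreal ((norm (S N u))\<^sup>2)) \<partial>disc_area)"
  proof (rule nn_integral_cong)
    fix u :: complex
    have "norm (of_real t * sgn u) \<le> t" using t norm_sgn_le_1[of u] by (simp add: norm_mult mult_left_le)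
    from g[OF this] have "(\<lambda>N. S N u) \<longlonglongrightarrow> g (of_real t * sgn u)" unfolding S_def sums_def .
    then have "(\<lambda>N. ennreal ((norm (S N u))\<^sup>2)) \<longlonglongrightarrow> ennreal ((norm (g (of_real t * sgn u)))\<^sup>2)"
      by (intro tendsto_ennrealI tendsto_intros)
    then show "ennreal ((norm (g (of_real t * sgn u)))\<^sup>2) = liminf (\<lambda>N. ennreal ((norm (S N u))\<^sup>2))"
      by (intro lim_imp_Liminf[symmetric]) auto
  qed
  also have "\<dots> \<le> liminf (\<lambda>N. \<integral>\<^sup>+u. ennreal ((norm (S N u))\<^sup>2) \<partial>disc_area)"
    by (rule nn_integral_liminf) measurable
  also have "\<dots> \<le> liminf (\<lambda>N::nat. ennreal (\<Sum>n. (norm (b n) * t ^ n)\<^sup>2))"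
    unfolding fin by (intro Liminf_mono always_eventually allI ennreal_leI sum_le_suminf sm) auto
  also have "\<dots> = ennreal (\<Sum>n. (norm (b n) * t ^ n)\<^sup>2)" by (intro Liminf_const) simp
  finally show ?thesis .
qed

section \<open>The derivative of the kernel and its circle means\<close>

definition kser' :: "(complex \<Rightarrow> real) \<Rightarrow> complex \<Rightarrow> complex" where
  "kser' w z = (\<Sum>n. of_real (real (Suc n) * kcoeff w (Suc n)) * z ^ n)"

text \<open>As pointwise sums of series both functions are Borel on the whole plane, including
  points without convergence, so they can be composed with Borel maps without restricting to the
  disc.\<close>

lemma kser_measurable [measurable]: "kser w \<in> borel_measurable borel" "kser' w \<in> borel_measurable borel"
  unfolding kser_def kser'_def by measurable

lemma kser'_sums:
  assumes w: "radial_weight w" and z: "norm z < 1"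
  shows "(\<lambda>n. of_real (real (Suc n) * kcoeff w (Suc n)) * z ^ n) sums kser' w z"
    and "(kser w has_field_derivative kser' w z) (at z)"
proof -
  obtain K where K: "norm z < K" "K < 1" using dense[OF z] by auto
  have "0 < K" using K norm_ge_zero[of z] by linarith
  then have K0: "norm (complex_of_real K) = K" by simp
  have sm: "summable (\<lambda>n. complex_of_real (kcoeff w n) * of_real K ^ n)"
    using kser_sums(1)[OF w, of "of_real K"] K K0 by (simp add: sums_iff)
  have d: "diffs (\<lambda>n. complex_of_real (kcoeff w n)) = (\<lambda>n. of_real (real (Suc n) * kcoeff w (Suc n)))"
    by (simp add: diffs_def fun_eq_iff)
  show "(kser w has_field_derivative kser' w z) (at z)"
    using termdiffs_strong[OF sm, of z] K K0 unfolding d kser_def[abs_def] kser'_def by simp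
  have "summable (\<lambda>n. diffs (\<lambda>n. complex_of_real (kcoeff w n)) n * z ^ n)"
  proof (rule termdiff_converges[of z 1])
    show "summable (\<lambda>n. complex_of_real (kcoeff w n) * x ^ n)" if "norm x < 1" for x
      using kser_sums(1)[OF w that] by (simp add: sums_iff)
  qed (rule z)
  then show "(\<lambda>n. of_real (real (Suc n) * kcoeff w (Suc n)) * z ^ n) sums kser' w z"
    unfolding d kser'_def by (rule summable_sums)
qed

text \<open>With m0, m1 the moments of orders 2n and 2n+2, the difference is 1/m1 + n(1/m1 - 1/m0),
  so n(m0 - m1) has to be bounded by a multiple of m0. A pointwise inequality bounds it by twice the
  moment of order n, and doubling of moments returns to order 2n.\<close>

lemma kcoeff_diff_bound:
  assumes w: "radial_weight w" and d: "tail_doubling (wtail w)"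
  shows "\<exists>C>0. \<forall>n. \<bar>real (Suc n) * kcoeff w (Suc n) - real n * kcoeff w n\<bar> \<le> C * kcoeff w (Suc n)"
proof -
  have [measurable]: "w \<in> borel_measurable disc_area" by (rule radial_weight_measurable[OF w])
  obtain C where C: "0 < C" "\<And>x. 0 \<le> x \<Longrightarrow> wmom w x \<le> C * wmom w (2 * x)"
    using wmom_doubling[OF w d] by auto
  \<comment> \<open>From n s^n \<le> 1 + s + ... + s^(n-1) follows n s^n (1-s) \<le> 1; multiply by
    (1+s) s^n.\<close>
  have pt: "real n * s ^ (2 * n) \<le> real n * s ^ (2 * n + 2) + 2 * s ^ n" if s: "0 \<le> s" "s \<le> 1" for s :: real and n
  proof -
    have "real n * s ^ n = (\<Sum>k<n. s ^ n)" by simp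
    also have "\<dots> \<le> (\<Sum>k<n. s ^ k)" using s by (intro sum_mono power_decreasing) auto
    finally have "(1 - s) * (real n * s ^ n) \<le> (1 - s) * (\<Sum>k<n. s ^ k)" using s by (intro mult_left_mono) auto
    also have "\<dots> = 1 - s ^ n" by (simp add: one_diff_power_eq)
    also have "\<dots> \<le> 1" using s by simp
    finally have 1: "(1 - s) * (real n * s ^ n) \<le> 1" .
    have "real n * s ^ (2 * n) - real n * s ^ (2 * n + 2) = ((1 + s) * s ^ n) * ((1 - s) * (real n * s ^ n))"
    proof -
      have "s ^ (2 * n) = s ^ n * s ^ n" by (simp add: mult_2 power_add)
      moreover have "s ^ (2 * n + 2) = s ^ n * s ^ n * (s * s)" by (simp add: mult_2 power_add)
      ultimately show ?thesis by (simp only:) (simp add: algebra_simps)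
    qed
    also have "\<dots> \<le> ((1 + s) * s ^ n) * 1" using 1 s by (intro mult_left_mono) auto
    also have "\<dots> \<le> 2 * s ^ n" using s by (simp add: mult_right_mono)
    finally show ?thesis by linarith
  qed
  have mom: "real n * wmom w (2 * real n) \<le> real n * wmom w (2 * real (Suc n)) + 2 * wmom w (real n)" for n
  proof -
    have [measurable]: "(\<lambda>z. ennreal (norm z powr x) * ennreal (w z)) \<in> borel_measurable disc_area" for x
      by (intro borel_measurable_times_ennreal borel_measurable_disc_area[of "\<lambda>z. ennreal (norm z powr x)"]) measurable
    have "ennreal (real n) * rmom (\<lambda>z. ennreal (w z)) (2 * real n) = (\<integral>\<^sup>+z. ennreal (real n) * (ennreal (norm z powr (2 * real n)) * ennreal (w z)) \<partial>disc_area)"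
      unfolding rmom_def by (rule nn_integral_cmult[symmetric]) measurable
    also have "\<dots> \<le> (\<integral>\<^sup>+z. ennreal (real n) * (ennreal (norm z powr (2 * real (Suc n))) * ennreal (w z)) + 2 * (ennreal (norm z powr real n) * ennreal (w z)) \<partial>disc_area)"
    proof (rule nn_integral_mono)
      fix z assume "z \<in> space disc_area"
      then have z: "norm z < 1" by simp
      have w0: "0 \<le> w z" by (rule radial_weight_nonneg[OF w z])
      have "real n * norm z powr (2 * real n) \<le> real n * norm z powr (2 * real (Suc n)) + 2 * norm z powr real n"
      proof (cases "z = 0")
        case False
        then show ?thesis using pt[of "norm z" n] z powr_realpow[of "norm z" "2 * n"] powr_realpow[of "norm z" "2 * n + 2"] powr_realpow[of "norm z" n]
          by (simp add: algebra_simps)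
      qed simp
      then have "real n * norm z powr (2 * real n) * w z \<le> (real n * norm z powr (2 * real (Suc n)) + 2 * norm z powr real n) * w z"
        using w0 by (rule mult_right_mono)
      then have "ennreal (real n * norm z powr (2 * real n) * w z) \<le> ennreal ((real n * norm z powr (2 * real (Suc n)) + 2 * norm z powr real n) * w z)"
        by (rule ennreal_leI)
      then show "ennreal (real n) * (ennreal (norm z powr (2 * real n)) * ennreal (w z)) \<le> ennreal (real n) * (ennreal (norm z powr (2 * real (Suc n))) * ennreal (w z)) + 2 * (ennreal (norm z powr real n) * ennreal (w z))"
        using w0 by (simp add: distrib_right ennreal_mult ennreal_plus mult.assoc del: of_nat_Suc)
    qed
    also have "\<dots> = ennreal (real n) * rmom (\<lambda>z. ennreal (w z)) (2 * real (Suc n)) + 2 * rmom (\<lambda>z. ennreal (w z)) (real n)"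
      unfolding rmom_def by (subst nn_integral_add) (auto simp: nn_integral_cmult)
    finally have "ennreal (real n * wmom w (2 * real n)) \<le> ennreal (real n * wmom w (2 * real (Suc n)) + 2 * wmom w (real n))"
      using wmom_nonneg[of w] by (simp add: rmom_wmom[OF w] ennreal_mult ennreal_plus del: of_nat_Suc)
    then show ?thesis by (subst (asm) ennreal_le_iff) (auto intro!: add_nonneg_nonneg mult_nonneg_nonneg wmom_nonneg)
  qed
  have "\<bar>real (Suc n) * kcoeff w (Suc n) - real n * kcoeff w n\<bar> \<le> (1 + 2 * C) * kcoeff w (Suc n)" for n
  proof -
    define m0 where "m0 = wmom w (2 * real n)"
    define m1 where "m1 = wmom w (2 * real (Suc n))"
    have p: "0 < m0" "0 < m1" unfolding m0_def m1_def by (auto intro!: wmom_pos[OF w])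
    have le: "m1 \<le> m0" unfolding m0_def m1_def by (intro wmom_antimono[OF w]) auto
    have "real n * m0 \<le> real n * m1 + 2 * (C * m0)"
      using mom[of n] C(2)[of "real n"] unfolding m0_def m1_def by linarith
    then have "real n * (m0 - m1) / (m0 * m1) \<le> 2 * C * m0 / (m0 * m1)"
      using p by (intro divide_right_mono) (auto simp: algebra_simps)
    then have 1: "real n * (1 / m1 - 1 / m0) \<le> 2 * C * (1 / m1)"
      using p by (simp add: field_simps)
    have 2: "0 \<le> real n * (1 / m1 - 1 / m0)" using p le by (intro mult_nonneg_nonneg) (auto simp: frac_le)
    have "real (Suc n) * (1 / m1) - real n * (1 / m0) = 1 / m1 + real n * (1 / m1 - 1 / m0)"
      by (simp add: algebra_simps)
    moreover have "0 \<le> 1 / m1" using p by simp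
    moreover have "(1 + 2 * C) * (1 / m1) = 1 / m1 + 2 * C * (1 / m1)" by (simp only: distrib_right mult_1)
    ultimately have "\<bar>real (Suc n) * (1 / m1) - real n * (1 / m0)\<bar> \<le> (1 + 2 * C) * (1 / m1)"
      using 1 2 by linarith
    then show ?thesis by (simp add: kcoeff_def m0_def m1_def)
  qed
  then show ?thesis using C by (intro exI[of _ "1 + 2 * C"]) auto
qed

text \<open>The coefficients of \<open>(1 - z) F'(z)\<close> are of the size of \<open>kcoeff w (n + 1)\<close>; the mean of \<open>|F'|\<close> is
  estimated by the Cauchy--Schwarz inequality for the product of this function with \<open>1 / (1 - z)\<close>.\<close>

lemma kser'_mean_bound:
  assumes w: "radial_weight w" and d: "tail_doubling (wtail w)"
  shows "\<exists>C>0. \<forall>t\<in>{0..<1}. (\<integral>\<^sup>+u. ennreal (norm (kser' w (of_real t * sgn u))) \<partial>disc_area) \<le> ennreal (C / ((1 - t) * wtail w t))"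
proof -
  obtain C where C: "0 < C" "\<And>n. \<bar>real (Suc n) * kcoeff w (Suc n) - real n * kcoeff w n\<bar> \<le> C * kcoeff w (Suc n)"
    using kcoeff_diff_bound[OF w d] by auto
  obtain c where c: "0 < c" "\<And>r. 0 \<le> r \<Longrightarrow> r < 1 \<Longrightarrow> c * wtail w r \<le> wtail w (1 - (1 - r) / 4)"
    using tail_doubling_power[OF tail_fun_wtail[OF w] d, of 4] by auto
  \<comment> \<open>One factor 2 comes from r^2 \<ge> 1/2, the other is the square root of the 4 in
    1/(1-r^4) \<le> 4/(1-t).\<close>
  define K where "K = 4 * C / c"
  have K: "0 < K" using C c by (simp add: K_def)
  define b where "b n = complex_of_real (real (Suc n) * kcoeff w (Suc n) - real n * kcoeff w n)" for n
  have "(\<integral>\<^sup>+u. ennreal (norm (kser' w (of_real t * sgn u))) \<partial>disc_area) \<le> ennreal (K / ((1 - t) * wtail w t))"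
    if t: "0 \<le> t" "t < 1" for t
  proof -
    \<comment> \<open>The distance of r to 1 is a quarter of that of t, so doubling compares the
      tails, while t \<le> r^4 absorbs the negative powers of r in \<open>kcoeff_le\<close>.\<close>
    define r where "r = (3 + t) / 4"
    have r: "3/4 \<le> r" "0 < r" "r < 1" "t \<le> r ^ 4" using t rho_power_4[OF t] by (auto simp: r_def)
    have Wt: "0 < wtail w t" by (rule wtail_pos[OF w t(2)])
    have Wr: "0 < wtail w r" by (rule wtail_pos[OF w r(3)])
    have r4: "r ^ 4 < 1" using r by (simp add: power_less_one_iff)
    have cW: "c * wtail w t \<le> wtail w r"
    proof -
      have "1 - (1 - t) / 4 = r" by (simp add: r_def field_simps)
      then show ?thesis using c(2)[OF t] by simp
    qed
    have trm: "(norm (b n) * t ^ n)\<^sup>2 \<le> (C / (r ^ 2 * wtail w r))\<^sup>2 * (r ^ 4) ^ n" for n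
    proof -
      have "norm (b n) \<le> C * kcoeff w (Suc n)" using C(2)[of n] unfolding b_def norm_of_real .
      also have "\<dots> \<le> C * (1 / (r ^ (2 * Suc n) * wtail w r))"
        using C by (intro mult_left_mono kcoeff_le[OF w r(2,3)]) auto
      also have "\<dots> = C / (r ^ 2 * wtail w r) * (1 / (r ^ 2) ^ n)"
      proof -
        have "r ^ (2 * Suc n) = (r ^ 2) ^ Suc n" by (rule power_mult)
        also have "\<dots> = r ^ 2 * (r ^ 2) ^ n" by simp
        finally have "r ^ (2 * Suc n) = r ^ 2 * (r ^ 2) ^ n" .
        then show ?thesis by (simp only:) (simp add: mult_ac)
      qed
      finally have 1: "norm (b n) \<le> C / (r ^ 2 * wtail w r) * (1 / (r ^ 2) ^ n)" .
      have "t ^ n \<le> (r ^ 4) ^ n" using t r by (intro power_mono) auto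
      also have "(r ^ 4) ^ n = (r ^ 2) ^ n * (r ^ 2) ^ n" 
      proof -
        have "r ^ 4 = r ^ 2 * r ^ 2" by (simp flip: power_add)
        then show ?thesis by (simp only: power_mult_distrib)
      qed
      finally have "norm (b n) * t ^ n \<le> (C / (r ^ 2 * wtail w r) * (1 / (r ^ 2) ^ n)) * ((r ^ 2) ^ n * (r ^ 2) ^ n)"
        using 1 C r Wr t by (intro mult_mono) auto
      also have "\<dots> = C / (r ^ 2 * wtail w r) * (r ^ 2) ^ n" using r by simp
      finally have "(norm (b n) * t ^ n)\<^sup>2 \<le> (C / (r ^ 2 * wtail w r) * (r ^ 2) ^ n)\<^sup>2"
        using t by (intro power_mono) auto
      also have "\<dots> = (C / (r ^ 2 * wtail w r))\<^sup>2 * (r ^ 4) ^ n"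
      proof -
        have "((r ^ 2) ^ n)\<^sup>2 = (r ^ 4) ^ n" by (simp add: power_mult[symmetric] mult.commute)
        then show ?thesis by (simp only: power_mult_distrib)
      qed
      finally show ?thesis .
    qed
    have sg: "summable (\<lambda>n. (C / (r ^ 2 * wtail w r))\<^sup>2 * (r ^ 4) ^ n)"
      using r4 r by (intro summable_mult summable_geometric) auto
    have sm: "summable (\<lambda>n. (norm (b n) * t ^ n)\<^sup>2)"
      by (rule summable_comparison_test'[OF sg, of 0]) (use trm in simp)
    have "(\<Sum>n. (norm (b n) * t ^ n)\<^sup>2) \<le> (\<Sum>n. (C / (r ^ 2 * wtail w r))\<^sup>2 * (r ^ 4) ^ n)"
      by (rule suminf_le[OF trm sm sg])
    also have "\<dots> = (C / (r ^ 2 * wtail w r))\<^sup>2 * (1 / (1 - r ^ 4))"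
      using r4 r by (subst suminf_mult) (auto intro: summable_geometric simp: suminf_geometric)
    also have "\<dots> \<le> (2 * C / (c * wtail w t))\<^sup>2 * (4 / (1 - t))"
    proof (intro mult_mono power_mono)
      have r2: "1/2 \<le> r ^ 2"
      proof -
        have "(3/4) ^ 2 \<le> r ^ 2" by (rule power_mono[OF r(1)]) simp
        moreover have "(3/4) ^ 2 = (9/16 :: real)" by (simp add: power2_eq_square)
        ultimately show ?thesis by linarith
      qed
      have "C / (r ^ 2 * wtail w r) \<le> C / ((1/2) * (c * wtail w t))"
        using r2 cW C(1) c(1) Wt Wr r(2) by (intro divide_left_mono mult_mono mult_pos_pos) auto
      then show "C / (r ^ 2 * wtail w r) \<le> 2 * C / (c * wtail w t)" by (simp add: mult.commute)
      have "r ^ 4 \<le> r ^ 1" using r by (intro power_decreasing) auto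
      then have "1 / (1 - r ^ 4) \<le> 1 / ((1 - t) / 4)"
        using t r4 by (intro divide_left_mono) (auto simp: r_def)
      then show "1 / (1 - r ^ 4) \<le> 4 / (1 - t)" by simp
    qed (use C(1) r(2) Wr r4 in simp_all)
    also have "\<dots> = K^2 / ((1 - t) * (wtail w t)^2)"
      by (simp add: K_def power_divide power_mult_distrib field_simps)
    finally have sb: "(\<Sum>n. (norm (b n) * t ^ n)\<^sup>2) \<le> K^2 / ((1 - t) * (wtail w t)^2)" .
    define g where "g z = (1 - z) * kser' w z" for z
    have gs: "(\<lambda>n. b n * z ^ n) sums g z" if "norm z \<le> t" for z
    proof -
      have z: "norm z < 1" using that t by simp
      note F = kser'_sums(1)[OF w z]
      have "(\<lambda>n. of_real (real (Suc n) * kcoeff w (Suc n)) * z ^ n * z) sums (kser' w z * z)"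
        by (rule sums_mult2[OF F])
      then have "(\<lambda>n. of_real (real (Suc n) * kcoeff w (Suc n)) * z ^ Suc n) sums (kser' w z * z)"
        by (simp add: mult_ac)
      \<comment> \<open>Multiplication by z shifts the index by one; the new term at index 0 has the
        factor \<open>real 0\<close>, so subtraction gives exactly the coefficients
        \<open>b\<close>.\<close>
      from sums_Suc[OF this[THEN sums_cong[THEN iffD1, rotated]], of "\<lambda>n. of_real (real n * kcoeff w n) * z ^ n"]
      have "(\<lambda>n. of_real (real n * kcoeff w n) * z ^ n) sums (kser' w z * z)" by simp
      from sums_diff[OF F this] show ?thesis by (simp add: b_def g_def algebra_simps del: of_nat_Suc)
    qed
    have G: "(\<integral>\<^sup>+u. ennreal ((norm (g (of_real t * sgn u)))\<^sup>2) \<partial>disc_area) \<le> ennreal (K^2 / ((1 - t) * (wtail w t)^2))"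
      using circle_mean_square_le[OF t(1) gs sm] sb by (meson ennreal_leI order_trans)
    have H: "(\<integral>\<^sup>+u. ennreal ((norm (1 / (1 - of_real t * sgn u)))\<^sup>2) \<partial>disc_area) \<le> ennreal (1 / (1 - t))"
    proof -
      have "t^2 < 1" using t by (intro power_less_one_iff[THEN iffD2]) auto
      moreover have "t^2 \<le> t" using t by (simp add: power2_eq_square mult_left_le)
      ultimately have t2: "t^2 < 1" "t^2 \<le> t" .
      have e: "(norm (1::complex) * t ^ n)\<^sup>2 = (t^2) ^ n" for n by (simp flip: power_mult add: mult.commute)
      have "(\<integral>\<^sup>+u. ennreal ((norm (1 / (1 - of_real t * sgn u)))\<^sup>2) \<partial>disc_area) \<le> ennreal (\<Sum>n. (norm (1::complex) * t ^ n)\<^sup>2)"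
      proof (rule circle_mean_square_le[where g="\<lambda>z. 1 / (1 - z)" and b="\<lambda>_. 1", OF t(1)])
        show "(\<lambda>n. 1 * z ^ n) sums (1 / (1 - z))" if "norm z \<le> t" for z :: complex
          using geometric_sums[of z] that t by simp
        show "summable (\<lambda>n. (norm (1::complex) * t ^ n)\<^sup>2)"
          unfolding e using t2 t by (intro summable_geometric) auto
      qed
      also have "(\<Sum>n. (norm (1::complex) * t ^ n)\<^sup>2) = 1 / (1 - t^2)"
        unfolding e using t2 t by (intro suminf_geometric) auto
      also have "ennreal (1 / (1 - t^2)) \<le> ennreal (1 / (1 - t))"
        using t2 t by (intro ennreal_leI divide_left_mono) auto
      finally show ?thesis .
    qed
    \<comment> \<open>The weight in Young's inequality that balances the two mean squares: each term
      then contributes half of the claimed bound.\<close>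
    define e where "e = wtail w t / K"
    have e: "0 < e" using Wt K by (simp add: e_def)
    have [measurable]: "g \<in> borel_measurable borel" unfolding g_def by measurable
    have m1: "(\<lambda>u. ennreal ((norm (g (of_real t * sgn u)))\<^sup>2)) \<in> borel_measurable disc_area"
      by (rule borel_measurable_disc_area) measurable
    have m2: "(\<lambda>u. ennreal ((norm (1 / (1 - of_real t * sgn u)))\<^sup>2)) \<in> borel_measurable disc_area"
      by (rule borel_measurable_disc_area) measurable
    have "(\<integral>\<^sup>+u. ennreal (norm (kser' w (of_real t * sgn u))) \<partial>disc_area)
       \<le> (\<integral>\<^sup>+u. ennreal (e/2) * ennreal ((norm (g (of_real t * sgn u)))\<^sup>2) + ennreal (1/(2*e)) * ennreal ((norm (1 / (1 - of_real t * sgn u)))\<^sup>2) \<partial>disc_area)"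
    proof (rule nn_integral_mono)
      fix u :: complex
      define z where "z = of_real t * sgn u"
      have "norm z \<le> t" using t norm_sgn_le_1[of u] by (simp add: z_def norm_mult mult_left_le)
      then have "z \<noteq> 1" using t by auto
      then have k: "kser' w z = g z * (1 / (1 - z))" by (simp add: g_def)
      define A where "A = norm (g z)"
      define B where "B = norm (1 / (1 - z))"
      have "0 \<le> (e * A - B)^2 / (2 * e)" using e by simp
      also have "(e * A - B)^2 / (2 * e) = e/2 * A^2 + 1/(2*e) * B^2 - A * B"
        using e by (simp add: power2_eq_square field_simps)
      finally have "A * B \<le> e/2 * A^2 + 1/(2*e) * B^2" by simp
      moreover have "norm (kser' w z) = A * B" unfolding k norm_mult A_def B_def ..
      ultimately have "ennreal (norm (kser' w z)) \<le> ennreal (e/2 * A^2 + 1/(2*e) * B^2)" by (simp only: ennreal_leI)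
      also have "\<dots> = ennreal (e/2) * ennreal (A^2) + ennreal (1/(2*e)) * ennreal (B^2)"
        using e by (simp add: ennreal_plus ennreal_mult[symmetric] del: ennreal_plus[symmetric])
      finally show "ennreal (norm (kser' w (of_real t * sgn u))) \<le> ennreal (e/2) * ennreal ((norm (g (of_real t * sgn u)))\<^sup>2) + ennreal (1/(2*e)) * ennreal ((norm (1 / (1 - of_real t * sgn u)))\<^sup>2)"
        unfolding A_def B_def z_def .
    qed
    also have "\<dots> = ennreal (e/2) * (\<integral>\<^sup>+u. ennreal ((norm (g (of_real t * sgn u)))\<^sup>2) \<partial>disc_area) + ennreal (1/(2*e)) * (\<integral>\<^sup>+u. ennreal ((norm (1 / (1 - of_real t * sgn u)))\<^sup>2) \<partial>disc_area)"
      using m1 m2 by (subst nn_integral_add) (auto simp: nn_integral_cmult)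
    also have "\<dots> \<le> ennreal (e/2) * ennreal (K^2 / ((1 - t) * (wtail w t)^2)) + ennreal (1/(2*e)) * ennreal (1 / (1 - t))"
      using G H by (intro add_mono mult_left_mono) auto
    also have "\<dots> = ennreal (e/2 * (K^2 / ((1 - t) * (wtail w t)^2)) + 1/(2*e) * (1 / (1 - t)))"
    proof -
      have p: "0 \<le> e/2" "0 \<le> K^2 / ((1 - t) * (wtail w t)^2)" "0 \<le> 1/(2*e)" "0 \<le> 1 / (1 - t)" using e t by auto
      show ?thesis
        by (simp only: ennreal_mult[OF p(1,2), symmetric] ennreal_mult[OF p(3,4), symmetric]
            ennreal_plus[OF mult_nonneg_nonneg[OF p(1,2)] mult_nonneg_nonneg[OF p(3,4)], symmetric])
    qed
    also have "e/2 * (K^2 / ((1 - t) * (wtail w t)^2)) + 1/(2*e) * (1 / (1 - t)) = K / ((1 - t) * wtail w t)"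
    proof -
      have "W / K / 2 * (K^2 / (d * W^2)) + 1/(2*(W / K)) * (1 / d) = K / (d * W)" if "0 < W" "0 < d" for W d
        using K that by (simp add: power2_eq_square field_simps)
      from this[OF Wt, of "1 - t"] t show ?thesis by (simp only: e_def diff_gt_0_iff_gt)
    qed
    finally show ?thesis .
  qed
  then show ?thesis using K by (intro exI[of _ K]) auto
qed

text \<open>Going back from x to y with 1 - y = M(1-x) at least doubles the tail. The part over
  [0,y] then contributes at most (M-1)/wtail(x) by induction, and so does the part over [y,x], whose
  length is (M-1)(1-x); together they reproduce the constant 2(M-1).\<close>

lemma head_integral_bound:
  assumes w: "radial_weight w" and M: "1 < M"
    and v: "\<And>r. 0 \<le> r \<Longrightarrow> r < 1 \<Longrightarrow> wtail w (1 - (1 - r) / M) \<le> wtail w r / 2"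
    and x: "0 \<le> x" "x < 1"
  shows "(\<integral>\<^sup>+t. ennreal (1 / ((1 - t) * wtail w t)) * indicator {0..x} t \<partial>lborel) \<le> ennreal (2 * (M - 1) / wtail w x)"
proof -
  define h where "h t = ennreal (1 / ((1 - t) * wtail w t))" for t
  have [measurable]: "wtail w \<in> borel_measurable borel" by (rule wtail_borel_measurable[OF w])
  have [measurable]: "h \<in> borel_measurable borel" unfolding h_def by measurable
  have piece: "(\<integral>\<^sup>+t. h t * indicator {y..x} t \<partial>lborel) \<le> ennreal ((x - y) / (1 - x) / wtail w x)"
    if y: "0 \<le> y" "y \<le> x" and x: "x < 1" for x y
  proof -
    have Wx: "0 < wtail w x" using wtail_pos[OF w x] .
    have "(\<integral>\<^sup>+t. h t * indicator {y..x} t \<partial>lborel) \<le> (\<integral>\<^sup>+t. ennreal (1 / ((1 - x) * wtail w x)) * indicator {y..x} t \<partial>lborel)"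
    proof (rule nn_integral_mono)
      fix t
      have "t \<le> x \<Longrightarrow> 1 / ((1 - t) * wtail w t) \<le> 1 / ((1 - x) * wtail w x)"
        using x Wx wtail_antimono[OF w, of t x] wtail_pos[OF w, of t]
        by (intro divide_left_mono mult_mono mult_pos_pos) auto
      then show "h t * indicator {y..x} t \<le> ennreal (1 / ((1 - x) * wtail w x)) * indicator {y..x} t"
        by (auto simp: h_def split: split_indicator intro!: ennreal_leI)
    qed
    also have "\<dots> = ennreal (1 / ((1 - x) * wtail w x)) * ennreal (x - y)"
      using y by (subst nn_integral_cmult_indicator) auto
    also have "\<dots> = ennreal ((x - y) / (1 - x) / wtail w x)"
      using x y Wx by (simp add: ennreal_mult[symmetric])
    finally show ?thesis .
  qed
  have ind: "0 \<le> x \<Longrightarrow> x \<le> 1 - 1 / M ^ n \<Longrightarrow> (\<integral>\<^sup>+t. h t * indicator {0..x} t \<partial>lborel) \<le> ennreal (2 * (M - 1) / wtail w x)" for n x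
  proof (induction n arbitrary: x)
    case 0
    then show ?case using piece[of 0 0] by simp
  next
    case (Suc n)
    have Mn: "0 < 1 / M ^ Suc n" using M by simp
    then have x1: "x < 1" using Suc.prems by linarith
    have Wx: "0 < wtail w x" using wtail_pos[OF w x1] .
    define y where "y = 1 - (1 - x) * M"
    show ?case
    proof (cases "0 \<le> y")
      case False
      then have "x / (1 - x) \<le> M - 1" using x1 by (simp add: y_def field_simps)
      then have "(x - 0) / (1 - x) / wtail w x \<le> 2 * (M - 1) / wtail w x"
        using Wx M by (intro divide_right_mono) auto
      then show ?thesis using piece[of 0 x] Suc.prems x1 by (meson ennreal_leI order_trans order_refl)
    next
      case True
      have yx: "y \<le> x"
      proof -
        have "(1 - x) * 1 \<le> (1 - x) * M" using M x1 by (intro mult_left_mono) auto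
        then show ?thesis by (simp add: y_def)
      qed
      have "1 / M ^ Suc n \<le> 1 - x" using Suc.prems by simp
      then have "1 / M ^ Suc n * M \<le> (1 - x) * M" using M by (intro mult_right_mono) auto
      then have yn: "y \<le> 1 - 1 / M ^ n" using M by (simp add: y_def)
      have "y < 1" using yx x1 by simp
      have Wy: "0 < wtail w y" using wtail_pos[OF w \<open>y < 1\<close>] .
      have "1 - (1 - y) / M = x" using M by (simp add: y_def)
      then have hx: "wtail w x \<le> wtail w y / 2" using v[OF True \<open>y < 1\<close>] by simp
      have "(\<integral>\<^sup>+t. h t * indicator {0..x} t \<partial>lborel) \<le> (\<integral>\<^sup>+t. h t * indicator {0..y} t + h t * indicator {y..x} t \<partial>lborel)"
        by (intro nn_integral_mono) (auto split: split_indicator)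
      also have "\<dots> = (\<integral>\<^sup>+t. h t * indicator {0..y} t \<partial>lborel) + (\<integral>\<^sup>+t. h t * indicator {y..x} t \<partial>lborel)"
        by (rule nn_integral_add) measurable
      also have "\<dots> \<le> ennreal (2 * (M - 1) / wtail w y) + ennreal ((x - y) / (1 - x) / wtail w x)"
        by (intro add_mono Suc.IH True yn piece yx x1)
      also have "\<dots> = ennreal (2 * (M - 1) / wtail w y + (x - y) / (1 - x) / wtail w x)"
        using M Wy Wx yx x1 by (intro ennreal_plus[symmetric]) auto
      also have "\<dots> \<le> ennreal (2 * (M - 1) / wtail w x)"
      proof (rule ennreal_leI)
        have "2 * (M - 1) / wtail w y \<le> 2 * (M - 1) / (2 * wtail w x)"
          using hx M Wx Wy by (intro divide_left_mono) auto
        moreover have "(x - y) / (1 - x) = M - 1" using x1 by (simp add: y_def field_simps)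
        moreover have "2 * (M - 1) / (2 * wtail w x) = (M - 1) / wtail w x" by (rule mult_divide_mult_cancel_left) simp
        moreover have "2 * (M - 1) / wtail w x = (M - 1) / wtail w x + (M - 1) / wtail w x"
          by (simp add: add_divide_distrib[symmetric])
        ultimately show "2 * (M - 1) / wtail w y + (x - y) / (1 - x) / wtail w x \<le> 2 * (M - 1) / wtail w x"
          by simp
      qed
      finally show ?thesis .
    qed
  qed
  obtain n where "1 / (1 - x) < M ^ n" using real_arch_pow[OF M] by auto
  then have "x \<le> 1 - 1 / M ^ n" using x M by (simp add: field_simps)
  then show ?thesis using ind[OF x(1)] by (simp add: h_def)
qed

text \<open>|F(xa)| is at most |F(0)| plus the integral of |F'(ta)| over t in [0,x]. Averaging over
  a and exchanging the integrals reduces the claim to \<open>kser'_mean_bound\<close> and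
  \<open>head_integral_bound\<close>.\<close>

lemma kser_mean_bound:
  assumes w: "radial_weight w" and d: "tail_doubling (wtail w)" and v: "tail_vanishing (wtail w)"
  shows "\<exists>C>0. \<forall>x\<in>{0..<1}. (\<integral>\<^sup>+u. ennreal (norm (kser w (of_real x * sgn u))) \<partial>disc_area) \<le> ennreal (C / wtail w x)"
proof -
  interpret pair_sigma_finite lborel disc_area by standard
  obtain C where C: "0 < C" "\<And>t. 0 \<le> t \<Longrightarrow> t < 1 \<Longrightarrow> (\<integral>\<^sup>+u. ennreal (norm (kser' w (of_real t * sgn u))) \<partial>disc_area) \<le> ennreal (C / ((1 - t) * wtail w t))"
    using kser'_mean_bound[OF w d] by auto
  obtain M where M: "1 < M" "\<And>r. 0 \<le> r \<Longrightarrow> r < 1 \<Longrightarrow> wtail w (1 - (1 - r) / M) \<le> wtail w r / 2"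
    using v[unfolded tail_vanishing_def, rule_format, of "1/2"] by auto
  obtain D where D: "0 < D" "\<And>r. 0 \<le> r \<Longrightarrow> r < 1 \<Longrightarrow> wtail w r \<le> D * wtail w ((1 + r) / 2)"
    using d by (auto simp: tail_doubling_def)
  have "(\<integral>\<^sup>+u. ennreal (norm (kser w (of_real x * sgn u))) \<partial>disc_area) \<le> ennreal ((D + C * (2 * (M - 1))) / wtail w x)"
    if x: "0 \<le> x" "x < 1" for x
  proof -
    have Wx: "0 < wtail w x" using wtail_pos[OF w x(2)] .
    have pt: "ennreal (norm (kser w (of_real x * sgn u))) \<le> ennreal (kcoeff w 0) + (\<integral>\<^sup>+t. ennreal (norm (kser' w (of_real t * sgn u))) * indicator {0..x} t \<partial>lborel)" for u
    proof -
      define a where "a = sgn u"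
      have na: "norm a \<le> 1" by (simp add: a_def norm_sgn_le_1)
      have inb: "norm (of_real t * a) < 1" if "0 \<le> t" "t \<le> x" for t
      proof -
        have "t * norm a \<le> t * 1" using that na by (intro mult_left_mono) auto
        then show ?thesis using that x by (simp add: norm_mult)
      qed
      have der: "((\<lambda>t. kser w (of_real t * a)) has_vector_derivative kser' w (of_real t * a) * a) (at t within {0..x})" if "0 \<le> t" "t \<le> x" for t
      proof -
        have "((\<lambda>s. of_real s * a) has_vector_derivative a) (at t within {0..x})"
          by (auto intro!: derivative_eq_intros)
        from field_vector_diff_chain_within[OF this, of "kser w" "kser' w (of_real t * a)"]
        show ?thesis using kser'_sums(2)[OF w inb[OF that]] 
          by (simp add: o_def has_field_derivative_at_within mult.commute)
      qed
      have cont: "continuous_on {0..x} (\<lambda>t. kser' w (of_real t * a) * a)"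
      proof -
        have "kser' w holomorphic_on ball 0 1"
          using kser'_sums(1)[OF w] by (intro power_series_holomorphic[where a="\<lambda>n. of_real (real (Suc n) * kcoeff w (Suc n))"]) simp
        then have 1: "continuous_on (ball 0 1) (kser' w)" by (rule holomorphic_on_imp_continuous_on)
        have 2: "continuous_on {0..x} (\<lambda>t. complex_of_real t * a)" by (intro continuous_intros)
        have 3: "(\<lambda>t. complex_of_real t * a) ` {0..x} \<subseteq> ball 0 1"
        proof (rule image_subsetI)
          fix t assume "t \<in> {0..x}"
          then show "complex_of_real t * a \<in> ball 0 1" using inb[of t] by (simp only: mem_ball_0 atLeastAtMost_iff)
        qed
        show ?thesis
          by (rule continuous_on_mult[OF continuous_on_compose2[OF 1 2 3] continuous_on_const])
      qed
      have "kser w (of_real x * a) - kser w (of_real 0 * a) = (\<integral>t. indicator {0..x} t *\<^sub>R (kser' w (of_real t * a) * a) \<partial>lborel)"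
        by (rule integral_FTC_Icc[OF x(1) der cont, symmetric])
      then have "kser w (of_real x * a) = kser w 0 + (\<integral>t. indicator {0..x} t *\<^sub>R (kser' w (of_real t * a) * a) \<partial>lborel)"
        by (simp add: algebra_simps)
      then have "norm (kser w (of_real x * a)) \<le> norm (kser w 0) + norm (\<integral>t. indicator {0..x} t *\<^sub>R (kser' w (of_real t * a) * a) \<partial>lborel)"
        by (simp add: norm_triangle_ineq)
      then have "ennreal (norm (kser w (of_real x * a))) \<le> ennreal (norm (kser w 0)) + ennreal (norm (\<integral>t. indicator {0..x} t *\<^sub>R (kser' w (of_real t * a) * a) \<partial>lborel))"
        by (simp flip: ennreal_plus)
      also have "\<dots> \<le> ennreal (norm (kser w 0)) + (\<integral>\<^sup>+t. ennreal (norm (indicator {0..x} t *\<^sub>R (kser' w (of_real t * a) * a))) \<partial>lborel)"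
        using borel_integrable_atLeastAtMost'[OF cont] 
        by (intro add_mono order_refl integral_norm_bound_ennreal) (simp add: set_integrable_def)
      also have "\<dots> \<le> ennreal (kcoeff w 0) + (\<integral>\<^sup>+t. ennreal (norm (kser' w (of_real t * sgn u))) * indicator {0..x} t \<partial>lborel)"
      proof (intro add_mono nn_integral_mono)
        have "kser w 0 = of_real (kcoeff w 0)"
          unfolding kser_def using powser_zero[of "\<lambda>n. complex_of_real (kcoeff w n)"] by simp
        then show "ennreal (norm (kser w 0)) \<le> ennreal (kcoeff w 0)" using kcoeff_pos[OF w, of 0] by simp
        fix t
        have "norm (kser' w (of_real t * a)) * norm a \<le> norm (kser' w (of_real t * a)) * 1" using na by (intro mult_left_mono) auto
        then show "ennreal (norm (indicator {0..x} t *\<^sub>R (kser' w (of_real t * a) * a))) \<le> ennreal (norm (kser' w (of_real t * sgn u))) * indicator {0..x} t"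
          by (auto simp: a_def norm_mult split: split_indicator intro!: ennreal_leI)
      qed
      finally show ?thesis by (simp add: a_def)
    qed
    have mm: "(\<lambda>(t, u). ennreal (norm (kser' w (of_real t * sgn u))) * indicator {0..x} t) \<in> borel_measurable (lborel \<Otimes>\<^sub>M disc_area)"
    proof -
      have i: "(\<lambda>x::complex. x) \<in> disc_area \<rightarrow>\<^sub>M borel" by (rule borel_measurable_disc_area) simp
      have 2: "(\<lambda>p::real \<times> complex. snd p) \<in> borel_measurable (lborel \<Otimes>\<^sub>M disc_area)"
        using measurable_comp[OF measurable_snd i] by (simp add: o_def)
      have 3: "(\<lambda>p::real \<times> complex. sgn (snd p)) \<in> borel_measurable (lborel \<Otimes>\<^sub>M disc_area)"
        by (rule measurable_compose[OF 2]) measurable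
      have 4: "(\<lambda>p::real \<times> complex. fst p) \<in> borel_measurable (lborel \<Otimes>\<^sub>M disc_area)" by measurable
      have "(\<lambda>p. kser' w (of_real (fst p) * sgn (snd p))) \<in> borel_measurable (lborel \<Otimes>\<^sub>M disc_area)"
        using 3 4 by (intro measurable_compose[OF _ kser_measurable(2)] borel_measurable_times borel_measurable_of_real) auto
      then show ?thesis using 4 by (simp add: case_prod_beta')
    qed
    have "(\<integral>\<^sup>+u. ennreal (norm (kser w (of_real x * sgn u))) \<partial>disc_area)
      \<le> (\<integral>\<^sup>+u. ennreal (kcoeff w 0) + (\<integral>\<^sup>+t. ennreal (norm (kser' w (of_real t * sgn u))) * indicator {0..x} t \<partial>lborel) \<partial>disc_area)"
      by (rule nn_integral_mono) (rule pt)
    also have "\<dots> = ennreal (kcoeff w 0) + (\<integral>\<^sup>+u. (\<integral>\<^sup>+t. ennreal (norm (kser' w (of_real t * sgn u))) * indicator {0..x} t \<partial>lborel) \<partial>disc_area)"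
    proof (subst nn_integral_add)
      show "(\<lambda>u. \<integral>\<^sup>+t. ennreal (norm (kser' w (of_real t * sgn u))) * indicator {0..x} t \<partial>lborel) \<in> borel_measurable disc_area"
        using measurable_pair_swap[OF mm]
        by (intro lborel.borel_measurable_nn_integral) (simp add: case_prod_beta')
    qed (auto simp: emeasure_disc_area)
    also have "\<dots> \<le> ennreal (kcoeff w 0) + ennreal C * ennreal (2 * (M - 1) / wtail w x)"
    proof (rule add_left_mono)
      have [measurable]: "wtail w \<in> borel_measurable borel" by (rule wtail_borel_measurable[OF w])
      have "(\<integral>\<^sup>+u. (\<integral>\<^sup>+t. ennreal (norm (kser' w (of_real t * sgn u))) * indicator {0..x} t \<partial>lborel) \<partial>disc_area)
        = (\<integral>\<^sup>+t. (\<integral>\<^sup>+u. ennreal (norm (kser' w (of_real t * sgn u))) * indicator {0..x} t \<partial>disc_area) \<partial>lborel)"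
        by (rule Fubini'[OF mm])
      also have "\<dots> \<le> (\<integral>\<^sup>+t. ennreal C * (ennreal (1 / ((1 - t) * wtail w t)) * indicator {0..x} t) \<partial>lborel)"
      proof (rule nn_integral_mono)
        fix t :: real
        show "(\<integral>\<^sup>+u. ennreal (norm (kser' w (of_real t * sgn u))) * indicator {0..x} t \<partial>disc_area) \<le> ennreal C * (ennreal (1 / ((1 - t) * wtail w t)) * indicator {0..x} t)"
        proof (cases "t \<in> {0..x}")
          case True
          then have t: "0 \<le> t" "t < 1" using x by auto
          have "0 < (1 - t) * wtail w t" using t wtail_pos[OF w t(2)] by simp
          then have "ennreal C * ennreal (1 / ((1 - t) * wtail w t)) = ennreal (C / ((1 - t) * wtail w t))"
            using C(1) by (subst ennreal_mult[symmetric]) auto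
          then show ?thesis using C(2)[OF t] True by simp
        qed simp
      qed
      also have "\<dots> = ennreal C * (\<integral>\<^sup>+t. (ennreal (1 / ((1 - t) * wtail w t)) * indicator {0..x} t) \<partial>lborel)"
        by (rule nn_integral_cmult) measurable
      also have "\<dots> \<le> ennreal C * ennreal (2 * (M - 1) / wtail w x)"
        by (intro mult_left_mono head_integral_bound[OF w M x]) auto
      finally show "(\<integral>\<^sup>+u. (\<integral>\<^sup>+t. ennreal (norm (kser' w (of_real t * sgn u))) * indicator {0..x} t \<partial>lborel) \<partial>disc_area)
         \<le> ennreal C * ennreal (2 * (M - 1) / wtail w x)" .
    qed
    also have "\<dots> = ennreal (kcoeff w 0 + C * (2 * (M - 1) / wtail w x))"
      using kcoeff_pos[OF w, of 0] C(1) M(1) Wx by (simp add: ennreal_mult[symmetric] ennreal_plus[symmetric] del: ennreal_plus)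
    also have "\<dots> \<le> ennreal ((D + C * (2 * (M - 1))) / wtail w x)"
    proof (rule ennreal_leI)
      \<comment> \<open>The radius (1+x)/2 in place of x stays positive even for x = 0; doubling
        leads back to x.\<close>
      have "wtail w ((1 + x) / 2) \<le> wmom w 0"
        using wtail_le_wmom[OF w, of "(1 + x) / 2" 0] x by simp
      then have "kcoeff w 0 \<le> 1 / wtail w ((1 + x) / 2)"
        unfolding kcoeff_def using wtail_pos[OF w, of "(1 + x) / 2"] x by (simp add: frac_le)
      also have "\<dots> \<le> D / wtail w x"
        using D(2)[OF x] Wx wtail_pos[OF w, of "(1 + x) / 2"] x by (simp add: field_simps)
      finally have "kcoeff w 0 \<le> D / wtail w x" .
      then show "kcoeff w 0 + C * (2 * (M - 1) / wtail w x) \<le> (D + C * (2 * (M - 1))) / wtail w x"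
        by (simp add: add_divide_distrib)
    qed
    finally show ?thesis .
  qed
  moreover have "0 < D + C * (2 * (M - 1))" using C(1) D(1) M(1) by (intro add_pos_pos mult_pos_pos) simp_all
  ultimately show ?thesis by (intro exI[of _ "D + C * (2 * (M - 1))"] conjI ballI) simp_all
qed

section \<open>Triples of weights\<close>

text \<open>Real bounds \<open>A\<close>, \<open>B\<close> stand in for the integrals, so that no
  powers of infinite values occur. The proof is Young's inequality after division by A^(1/p) and
  B^(1/q), the cases A = 0 and B = 0 being separate.\<close>

lemma nn_integral_Hoelder:
  fixes f g :: "'a \<Rightarrow> real"
  assumes pq: "1 < p" "1 < q" "1 / p + 1 / q = 1"
    and [measurable]: "f \<in> borel_measurable M" "g \<in> borel_measurable M"
    and nn: "AE x in M. 0 \<le> f x" "AE x in M. 0 \<le> g x"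
    and A: "(\<integral>\<^sup>+x. ennreal (f x powr p) \<partial>M) \<le> ennreal A" "0 \<le> A"
    and B: "(\<integral>\<^sup>+x. ennreal (g x powr q) \<partial>M) \<le> ennreal B" "0 \<le> B"
  shows "(\<integral>\<^sup>+x. ennreal (f x * g x) \<partial>M) \<le> ennreal (A powr (1/p) * B powr (1/q))"
proof -
  have zero: "AE x in M. h x = 0"
    if "(\<integral>\<^sup>+x. ennreal (h x powr r) \<partial>M) \<le> ennreal 0" and [measurable]: "h \<in> borel_measurable M" for h :: "'a \<Rightarrow> real" and r
  proof -
    have "(\<integral>\<^sup>+x. ennreal (h x powr r) \<partial>M) = 0" using that(1) by simp
    then have "AE x in M. ennreal (h x powr r) = 0" by (subst (asm) nn_integral_0_iff_AE) measurable
    then show ?thesis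
    proof eventually_elim
      case (elim x)
      then have "h x powr r = 0" using powr_ge_zero[of "h x" r] by (simp only: ennreal_eq_0_iff)
      then show ?case by simp
    qed
  qed
  show ?thesis
  proof (cases "A = 0 \<or> B = 0")
    case True
    then have "AE x in M. f x * g x = 0"
    proof
      assume "A = 0"
      with A zero[of f p] have "AE x in M. f x = 0" by simp
      then show ?thesis by eventually_elim simp
    next
      assume "B = 0"
      with B zero[of g q] have "AE x in M. g x = 0" by simp
      then show ?thesis by eventually_elim simp
    qed
    then have "AE x in M. ennreal (f x * g x) = 0" by eventually_elim auto
    then have "(\<integral>\<^sup>+x. ennreal (f x * g x) \<partial>M) = (\<integral>\<^sup>+x. 0 \<partial>M)" by (rule nn_integral_cong_AE)
    then show ?thesis by simp
  next
    case False
    then have pos: "0 < A" "0 < B" using A B by auto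
    define c where "c = A powr (1/p) * B powr (1/q)"
    have c: "0 < c" using pos by (simp add: c_def)
    have young: "f x * g x \<le> c / (p * A) * f x powr p + c / (q * B) * g x powr q" if "0 \<le> f x" "0 \<le> g x" for x
    proof -
      define a where "a = f x / A powr (1/p)"
      define b where "b = g x / B powr (1/q)"
      have ab: "0 \<le> a" "0 \<le> b" using that pos by (auto simp: a_def b_def)
      have "a * b \<le> a powr p / p + b powr q / q" by (rule Youngs_inequality[OF pq ab])
      moreover have "a powr p = f x powr p / A" "b powr q = g x powr q / B"
        using that pos pq by (simp_all add: a_def b_def powr_divide powr_powr)
      ultimately have "c * (a * b) \<le> c * (f x powr p / A / p + g x powr q / B / q)"
        using c by (intro mult_left_mono) auto
      moreover have "c * (a * b) = f x * g x" using pos by (simp add: a_def b_def c_def)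
      ultimately show ?thesis by (simp add: distrib_left mult.commute)
    qed
    have "(\<integral>\<^sup>+x. ennreal (f x * g x) \<partial>M) \<le> (\<integral>\<^sup>+x. ennreal (c / (p * A)) * ennreal (f x powr p) + ennreal (c / (q * B)) * ennreal (g x powr q) \<partial>M)"
    proof (rule nn_integral_mono_AE)
      show "AE x in M. ennreal (f x * g x) \<le> ennreal (c / (p * A)) * ennreal (f x powr p) + ennreal (c / (q * B)) * ennreal (g x powr q)"
        using nn
      proof eventually_elim
        case (elim x)
        have p': "0 \<le> c / (p * A)" "0 \<le> c / (q * B)" using c pos pq by auto
        have "ennreal (f x * g x) \<le> ennreal (c / (p * A) * f x powr p + c / (q * B) * g x powr q)"
          by (rule ennreal_leI[OF young[OF elim]])
        also have "\<dots> = ennreal (c / (p * A)) * ennreal (f x powr p) + ennreal (c / (q * B)) * ennreal (g x powr q)"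
          by (simp only: ennreal_mult[OF p'(1) powr_ge_zero] ennreal_mult[OF p'(2) powr_ge_zero]
              ennreal_plus[OF mult_nonneg_nonneg[OF p'(1) powr_ge_zero] mult_nonneg_nonneg[OF p'(2) powr_ge_zero]])
        finally show ?case .
      qed
    qed
    also have "\<dots> = ennreal (c / (p * A)) * (\<integral>\<^sup>+x. ennreal (f x powr p) \<partial>M) + ennreal (c / (q * B)) * (\<integral>\<^sup>+x. ennreal (g x powr q) \<partial>M)"
      by (subst nn_integral_add) (auto simp: nn_integral_cmult)
    also have "\<dots> \<le> ennreal (c / (p * A)) * ennreal A + ennreal (c / (q * B)) * ennreal B"
      by (intro add_mono mult_left_mono A B) auto
    also have "\<dots> = ennreal (c / (p * A) * A + c / (q * B) * B)"
      using c pos pq by (subst (1 2) ennreal_mult[symmetric]) (auto simp flip: ennreal_plus)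
    also have "c / (p * A) * A + c / (q * B) * B = c * (1 / p + 1 / q)"
      using pos by (simp add: distrib_left)
    also have "\<dots> = c" using pq by simp
    finally show ?thesis by (simp add: c_def)
  qed
qed

lemma wtail_diff:
  assumes w: "radial_weight w" and r: "r \<le> r'"
  shows "(\<integral>\<^sup>+z. ennreal (w z) * indicator {z. r \<le> norm z \<and> norm z < r'} z \<partial>disc_area) = ennreal (wtail w r - wtail w r')"
proof -
  have [measurable]: "w \<in> borel_measurable disc_area" by (rule radial_weight_measurable[OF w])
  have [measurable]: "(\<lambda>z. ennreal (w z) * indicator {z. r \<le> norm z \<and> norm z < r'} z) \<in> borel_measurable disc_area"
    "(\<lambda>z. ennreal (w z) * indicator {z. r' \<le> norm z} z) \<in> borel_measurable disc_area"
    by (intro borel_measurable_times_ennreal borel_measurable_disc_area[of "indicator _"], measurable)+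
  define I where "I = (\<integral>\<^sup>+z. ennreal (w z) * indicator {z. r \<le> norm z \<and> norm z < r'} z \<partial>disc_area)"
  have "rtail (\<lambda>z. ennreal (w z)) r = (\<integral>\<^sup>+z. ennreal (w z) * indicator {z. r \<le> norm z \<and> norm z < r'} z + ennreal (w z) * indicator {z. r' \<le> norm z} z \<partial>disc_area)"
    unfolding rtail_def using r by (intro nn_integral_cong) (auto split: split_indicator)
  also have "\<dots> = I + rtail (\<lambda>z. ennreal (w z)) r'"
    unfolding rtail_def I_def by (rule nn_integral_add) measurable
  finally have "ennreal (wtail w r) = I + ennreal (wtail w r')" by (simp add: rtail_wtail[OF w])
  then have "I = ennreal (wtail w r) - ennreal (wtail w r')" by simp
  then show ?thesis by (simp add: I_def ennreal_minus wtail_nonneg)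
qed

text \<open>The factorization is the link between the three weights, and it is invariant under
  exchanging (p, \<nu>) with (q, \<sigma>), see \<open>swap\<close>. It is only required almost
  everywhere, since the dual weight is replaced by a real function up to null sets.\<close>

locale weight_triple =
  fixes p q :: real and \<nu> \<sigma> \<omega> :: "complex \<Rightarrow> real"
  assumes p: "1 < p" and q: "1 < q" and pq: "1 / p + 1 / q = 1"
    and nu: "radial_weight \<nu>" and sigma: "radial_weight \<sigma>" and om: "radial_weight \<omega>"
    and factor: "AE z in disc_area. \<omega> z = \<nu> z powr (1/p) * \<sigma> z powr (1/q)"
begin

lemma swap: "weight_triple q p \<sigma> \<nu> \<omega>"
  by standard (use p q pq nu sigma om factor in \<open>auto simp: mult.commute add.commute\<close>)

lemma p_div_q: "p / q = p - 1"
proof -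
  have "p + q = p * q" using pq p q by (simp add: field_simps)
  then show ?thesis using q by (simp add: field_simps)
qed

lemma Hoelder:
  fixes \<phi> \<psi> :: "complex \<Rightarrow> real"
  assumes m: "\<phi> \<in> borel_measurable disc_area" "\<psi> \<in> borel_measurable disc_area"
    and nn: "\<And>z. 0 \<le> \<phi> z" "\<And>z. 0 \<le> \<psi> z"
    and A: "(\<integral>\<^sup>+z. ennreal (\<phi> z powr p * \<nu> z) \<partial>disc_area) \<le> ennreal A" "0 \<le> A"
    and B: "(\<integral>\<^sup>+z. ennreal (\<psi> z powr q * \<sigma> z) \<partial>disc_area) \<le> ennreal B" "0 \<le> B"
  shows "(\<integral>\<^sup>+z. ennreal (\<phi> z * \<psi> z * \<omega> z) \<partial>disc_area) \<le> ennreal (A powr (1/p) * B powr (1/q))"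
proof -
  note m[measurable] radial_weight_measurable[OF nu, measurable] radial_weight_measurable[OF sigma, measurable]
  have "(\<integral>\<^sup>+z. ennreal (\<phi> z * \<psi> z * \<omega> z) \<partial>disc_area) = (\<integral>\<^sup>+z. ennreal ((\<phi> z * \<nu> z powr (1/p)) * (\<psi> z * \<sigma> z powr (1/q))) \<partial>disc_area)"
  proof (rule nn_integral_cong_AE)
    show "AE z in disc_area. ennreal (\<phi> z * \<psi> z * \<omega> z) = ennreal ((\<phi> z * \<nu> z powr (1/p)) * (\<psi> z * \<sigma> z powr (1/q)))"
      using factor by eventually_elim (simp add: mult_ac)
  qed
  also have "\<dots> \<le> ennreal (A powr (1/p) * B powr (1/q))"
  proof (rule nn_integral_Hoelder[OF p q pq])
    have "(\<integral>\<^sup>+z. ennreal ((\<phi> z * \<nu> z powr (1/p)) powr p) \<partial>disc_area) = (\<integral>\<^sup>+z. ennreal (\<phi> z powr p * \<nu> z) \<partial>disc_area)"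
      using p nn radial_weight_nonneg[OF nu] by (intro nn_integral_cong) (simp add: powr_mult powr_powr)
    then show "(\<integral>\<^sup>+z. ennreal ((\<phi> z * \<nu> z powr (1/p)) powr p) \<partial>disc_area) \<le> ennreal A" using A by simp
    have "(\<integral>\<^sup>+z. ennreal ((\<psi> z * \<sigma> z powr (1/q)) powr q) \<partial>disc_area) = (\<integral>\<^sup>+z. ennreal (\<psi> z powr q * \<sigma> z) \<partial>disc_area)"
      using q nn radial_weight_nonneg[OF sigma] by (intro nn_integral_cong) (simp add: powr_mult powr_powr)
    then show "(\<integral>\<^sup>+z. ennreal ((\<psi> z * \<sigma> z powr (1/q)) powr q) \<partial>disc_area) \<le> ennreal B" using B by simp
  qed (use A B nn in auto)
  finally show ?thesis .
qed

text \<open>Hoelder's inequality for the indicator of an annulus. It turns a lower bound for the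
  mass of \<omega> in an annulus into one for \<sigma>, which is how decay passes to
  \<sigma>.\<close>

lemma annulus_Hoelder:
  assumes r: "r \<le> r'"
  shows "wtail \<omega> r - wtail \<omega> r' \<le> (wtail \<nu> r - wtail \<nu> r') powr (1/p) * (wtail \<sigma> r - wtail \<sigma> r') powr (1/q)"
proof -
  define X where "X = (indicator {z::complex. r \<le> norm z \<and> norm z < r'} :: complex \<Rightarrow> real)"
  have X: "X \<in> borel_measurable disc_area" unfolding X_def by (rule borel_measurable_disc_area) measurable
  have eq: "(\<integral>\<^sup>+z. ennreal (X z powr s * w z) \<partial>disc_area) = ennreal (wtail w r - wtail w r')"
    if "radial_weight w" for s w
    unfolding wtail_diff[OF that r, symmetric] X_def by (intro nn_integral_cong) (auto split: split_indicator)
  have pos: "0 \<le> wtail w r - wtail w r'" if "radial_weight w" for w using wtail_antimono[OF that r] by simp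
  have "(\<integral>\<^sup>+z. ennreal (X z * X z * \<omega> z) \<partial>disc_area) = ennreal (wtail \<omega> r - wtail \<omega> r')"
    unfolding eq[OF om, of 1, symmetric] X_def by (intro nn_integral_cong) (auto split: split_indicator)
  moreover have "(\<integral>\<^sup>+z. ennreal (X z * X z * \<omega> z) \<partial>disc_area) \<le> ennreal ((wtail \<nu> r - wtail \<nu> r') powr (1/p) * (wtail \<sigma> r - wtail \<sigma> r') powr (1/q))"
    by (rule Hoelder[OF X X]) (use eq[OF nu] eq[OF sigma] pos[OF nu] pos[OF sigma] in \<open>simp_all add: X_def\<close>)
  ultimately show ?thesis by (simp add: ennreal_le_iff)
qed

lemma tail_Hoelder: "wtail \<omega> r \<le> wtail \<nu> r powr (1/p) * wtail \<sigma> r powr (1/q)"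
proof (cases "r \<le> 1")
  case True
  have "wtail w 1 = 0" for w
  proof -
    have "rtail (\<lambda>z. ennreal (w z)) 1 = (\<integral>\<^sup>+z. 0 \<partial>disc_area)"
      unfolding rtail_def by (intro nn_integral_cong) (auto split: split_indicator)
    then show ?thesis by (simp add: wtail_def)
  qed
  then show ?thesis using annulus_Hoelder[OF True] by simp
next
  case False
  have "rtail (\<lambda>z. ennreal (\<omega> z)) r = (\<integral>\<^sup>+z. 0 \<partial>disc_area)"
    unfolding rtail_def using False by (intro nn_integral_cong) (auto split: split_indicator)
  then show ?thesis by (simp add: wtail_def)
qed

lemma moment_Hoelder:
  assumes a: "0 \<le> a" and b: "0 \<le> b"
  shows "wmom \<omega> (a + b) \<le> wmom \<nu> (a * p) powr (1/p) * wmom \<sigma> (b * q) powr (1/q)"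
proof -
  have m: "(\<lambda>z::complex. norm z powr x) \<in> borel_measurable disc_area" for x
    by (rule borel_measurable_disc_area) measurable
  have eq: "(\<integral>\<^sup>+z. ennreal (norm z powr x * w z) \<partial>disc_area) = ennreal (wmom w x)" if "radial_weight w" "0 \<le> x" for w x
    unfolding rmom_wmom[OF that, symmetric] rmom_def
    by (intro nn_integral_cong) (simp add: ennreal_mult radial_weight_nonneg[OF that(1)])
  have "(\<integral>\<^sup>+z. ennreal (norm z powr a * norm z powr b * \<omega> z) \<partial>disc_area) = ennreal (wmom \<omega> (a + b))"
    using eq[OF om, of "a + b"] a b by (simp add: powr_add)
  moreover have "(\<integral>\<^sup>+z. ennreal (norm z powr a * norm z powr b * \<omega> z) \<partial>disc_area) \<le> ennreal (wmom \<nu> (a * p) powr (1/p) * wmom \<sigma> (b * q) powr (1/q))"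
    by (rule Hoelder[OF m m])
       (use eq[OF nu, of "a * p"] eq[OF sigma, of "b * q"] a b p q wmom_nonneg in \<open>auto simp: powr_powr\<close>)
  ultimately show ?thesis by (simp add: ennreal_le_iff)
qed

section \<open>From moment growth to doubling, and the transfer of regularity\<close>

definition A_bound :: "real \<Rightarrow> bool" where
  "A_bound A \<longleftrightarrow> 0 < A \<and> (\<forall>r\<in>{0..<1}. wtail \<nu> r powr (1/p) * wtail \<sigma> r powr (1/q) \<le> A * wtail \<omega> r)"

text \<open>Orders k and 2k in Hoelder: doubling raises the order of the \<nu>-factor from k p to 2k
  p, after which both factors belong to the index 2k of the hypothesis, whose right side has order
  4k. Each iteration replaces one factor 3 by a factor 4.\<close>

lemma moment_growth:
  assumes dn: "tail_doubling (wtail \<nu>)"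
    and D: "0 < D" "\<And>n::nat. wmom \<nu> (real n * p) powr (1/p) * wmom \<sigma> (real n * q) powr (1/q) \<le> D * wmom \<omega> (2 * real n)"
  shows "\<exists>C\<ge>1. \<forall>N m::nat. wmom \<omega> (real (3 ^ N * m)) \<le> C ^ N * wmom \<omega> (real (4 ^ N * m))"
proof -
  obtain c where c: "0 < c" "\<And>x. 0 \<le> x \<Longrightarrow> wmom \<nu> x \<le> c * wmom \<nu> (2 * x)"
    using wmom_doubling[OF nu dn] by auto
  define C where "C = max 1 (c powr (1/p) * D)"
  have C: "1 \<le> C" by (simp add: C_def)
  have step: "wmom \<omega> (real (3 * k)) \<le> C * wmom \<omega> (real (4 * k))" for k
  proof -
    have "wmom \<omega> (real (3 * k)) = wmom \<omega> (real k + 2 * real k)" by simp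
    also have "\<dots> \<le> wmom \<nu> (real k * p) powr (1/p) * wmom \<sigma> (2 * real k * q) powr (1/q)"
      by (rule moment_Hoelder) auto
    also have "\<dots> \<le> (c * wmom \<nu> (2 * (real k * p))) powr (1/p) * wmom \<sigma> (2 * real k * q) powr (1/q)"
      using c(2)[of "real k * p"] p wmom_nonneg by (intro mult_right_mono powr_mono2) auto
    also have "\<dots> = c powr (1/p) * (wmom \<nu> (real (2 * k) * p) powr (1/p) * wmom \<sigma> (real (2 * k) * q) powr (1/q))"
      using c wmom_nonneg by (simp add: powr_mult mult_ac)
    also have "\<dots> \<le> c powr (1/p) * (D * wmom \<omega> (2 * real (2 * k)))"
      by (intro mult_left_mono D) auto
    also have "\<dots> = (c powr (1/p) * D) * wmom \<omega> (real (4 * k))" by simp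
    also have "\<dots> \<le> C * wmom \<omega> (real (4 * k))"
      by (intro mult_right_mono wmom_nonneg) (simp add: C_def)
    finally show ?thesis .
  qed
  have "wmom \<omega> (real (3 ^ N * m)) \<le> C ^ N * wmom \<omega> (real (4 ^ N * m))" for N m
  proof (induction N arbitrary: m)
    case (Suc N)
    have "wmom \<omega> (real (3 ^ Suc N * m)) \<le> C * wmom \<omega> (real (3 ^ N * (4 * m)))"
      using step[of "3 ^ N * m"] by (simp add: mult_ac)
    also have "\<dots> \<le> C * (C ^ N * wmom \<omega> (real (4 ^ N * (4 * m))))"
      using C by (intro mult_left_mono Suc) auto
    finally show ?case by (simp add: mult_ac)
  qed simp
  then show ?thesis using C by auto
qed

text \<open>Inside |z| < (1+r)/2 the integrand |z|^X, with X = 4^N m, is at most a tiny factor times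
  |z|^Y, with Y = 3^N m. By hypothesis \<open>g\<close> this part is at most half of the moment of
  order X and is absorbed on the left; the rest is the tail.\<close>

lemma moment_le_tail:
  fixes C :: real and N m :: nat
  assumes g: "wmom \<omega> (real (3 ^ N * m)) \<le> C ^ N * wmom \<omega> (real (4 ^ N * m))"
    and N: "C ^ N * exp (- ((4 ^ N - 3 ^ N) / 2)) \<le> 1 / 2"
    and m: "1 \<le> real m * (1 - r)" and r: "0 \<le> r" "r < 1"
  shows "wmom \<omega> (real (4 ^ N * m)) \<le> 2 * wtail \<omega> ((1 + r) / 2)"
proof -
  define \<rho> where "\<rho> = (1 + r) / 2"
  define X where "X = real (4 ^ N * m)"
  define Y where "Y = real (3 ^ N * m)"
  have rho: "0 < \<rho>" "\<rho> < 1" using r by (auto simp: \<rho>_def)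
  have XY: "0 \<le> Y" "0 \<le> X - Y"
  proof -
    have "(3::real) ^ N \<le> 4 ^ N" by (intro power_mono) auto
    then show "0 \<le> X - Y" "0 \<le> Y" by (auto simp: X_def Y_def intro!: mult_right_mono)
  qed
  have [measurable]: "\<omega> \<in> borel_measurable disc_area" by (rule radial_weight_measurable[OF om])
  have m1: "(\<lambda>z. ennreal (norm z powr Y) * ennreal (\<omega> z)) \<in> borel_measurable disc_area"
    by (intro borel_measurable_times_ennreal borel_measurable_disc_area[of "\<lambda>z. ennreal (norm z powr _)"]) measurable
  have m2: "(\<lambda>z. ennreal (\<omega> z) * indicator {z. \<rho> \<le> norm z} z) \<in> borel_measurable disc_area"
    by (intro borel_measurable_times_ennreal borel_measurable_disc_area[of "indicator _"]) measurable
  have "rmom (\<lambda>z. ennreal (\<omega> z)) X \<le> (\<integral>\<^sup>+z. ennreal (\<rho> powr (X - Y)) * (ennreal (norm z powr Y) * ennreal (\<omega> z)) + ennreal (\<omega> z) * indicator {z. \<rho> \<le> norm z} z \<partial>disc_area)"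
    unfolding rmom_def
  proof (rule nn_integral_mono)
    fix z assume "z \<in> space disc_area"
    then have z: "norm z < 1" by simp
    show "ennreal (norm z powr X) * ennreal (\<omega> z) \<le> ennreal (\<rho> powr (X - Y)) * (ennreal (norm z powr Y) * ennreal (\<omega> z)) + ennreal (\<omega> z) * indicator {z. \<rho> \<le> norm z} z"
    proof (cases "\<rho> \<le> norm z")
      case True
      have "ennreal (norm z powr X) * ennreal (\<omega> z) \<le> 1 * ennreal (\<omega> z)"
        using norm_powr_le_1[of X z] z XY by (intro mult_right_mono) auto
      then show ?thesis using True by (simp add: add_increasing)
    next
      case False
      have "norm z powr X = norm z powr (X - Y) * norm z powr Y" by (simp flip: powr_add)
      also have "\<dots> \<le> \<rho> powr (X - Y) * norm z powr Y"
        using False XY by (intro mult_right_mono powr_mono2) auto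
      finally have "ennreal (norm z powr X) * ennreal (\<omega> z) \<le> ennreal (\<rho> powr (X - Y) * norm z powr Y) * ennreal (\<omega> z)"
        by (intro mult_right_mono ennreal_leI) auto
      then show ?thesis using False by (simp add: ennreal_mult mult.assoc)
    qed
  qed
  also have "\<dots> = ennreal (\<rho> powr (X - Y)) * rmom (\<lambda>z. ennreal (\<omega> z)) Y + rtail (\<lambda>z. ennreal (\<omega> z)) \<rho>"
    unfolding rmom_def rtail_def using m1 m2 by (subst nn_integral_add) (auto simp: nn_integral_cmult)
  finally have "ennreal (wmom \<omega> X) \<le> ennreal (\<rho> powr (X - Y)) * ennreal (wmom \<omega> Y) + ennreal (wtail \<omega> \<rho>)"
    using XY by (simp add: rmom_wmom[OF om] rtail_wtail[OF om])
  also have "\<dots> = ennreal (\<rho> powr (X - Y) * wmom \<omega> Y + wtail \<omega> \<rho>)"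
    using wmom_nonneg[of \<omega> Y] wtail_nonneg[of \<omega> \<rho>] by (simp add: ennreal_mult)
  finally have 1: "wmom \<omega> X \<le> \<rho> powr (X - Y) * wmom \<omega> Y + wtail \<omega> \<rho>"
    using wmom_nonneg[of \<omega> Y] wtail_nonneg[of \<omega> \<rho>] by (subst (asm) ennreal_le_iff) auto
  have "\<rho> powr (X - Y) \<le> exp (- ((4 ^ N - 3 ^ N) / 2))"
  proof -
    have "ln \<rho> \<le> \<rho> - 1" using rho by (intro ln_le_minus_one)
    then have "(X - Y) * ln \<rho> \<le> (X - Y) * (- ((1 - r) / 2))"
      using XY by (intro mult_left_mono) (auto simp: \<rho>_def field_simps)
    also have "\<dots> = - ((4 ^ N - 3 ^ N) / 2 * (real m * (1 - r)))"
    proof -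
      define a :: real where "a = 4 ^ N - 3 ^ N"
      have e: "X - Y = a * real m" by (simp add: X_def Y_def a_def algebra_simps)
      show ?thesis unfolding e a_def[symmetric] by simp
    qed
    also have "\<dots> \<le> - ((4 ^ N - 3 ^ N) / 2 * 1)"
    proof -
      have "(3::real) ^ N \<le> 4 ^ N" by (intro power_mono) auto
      then have "(4 ^ N - 3 ^ N) / 2 * 1 \<le> (4 ^ N - 3 ^ N) / 2 * (real m * (1 - r))"
        using m by (intro mult_left_mono) auto
      then show ?thesis by linarith
    qed
    finally show ?thesis using rho by (simp add: powr_def)
  qed
  then have "\<rho> powr (X - Y) * wmom \<omega> Y \<le> exp (- ((4 ^ N - 3 ^ N) / 2)) * (C ^ N * wmom \<omega> X)"
    using g wmom_nonneg[of \<omega> Y] unfolding X_def[symmetric] Y_def[symmetric] by (intro mult_mono) auto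
  also have "\<dots> = (C ^ N * exp (- ((4 ^ N - 3 ^ N) / 2))) * wmom \<omega> X" by (simp only: mult_ac)
  also have "\<dots> \<le> 1 / 2 * wmom \<omega> X" by (intro mult_right_mono N wmom_nonneg)
  finally show ?thesis using 1 by (simp add: X_def \<rho>_def)
qed

text \<open>For m about 1/(1-r) the power r^m is bounded below, so tails at r are controlled by
  moments of order comparable to m, and \<open>moment_le_tail\<close> returns to tails. Doubling
  uses the orders 3^N m and 4^N m; the A-bound uses the hypothesis at n with 2n = 4^N m.\<close>

lemma doubling_and_A_bound:
  assumes dn: "tail_doubling (wtail \<nu>)"
    and D: "0 < D" "\<And>n::nat. wmom \<nu> (real n * p) powr (1/p) * wmom \<sigma> (real n * q) powr (1/q) \<le> D * wmom \<omega> (2 * real n)"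
  shows "tail_doubling (wtail \<omega>)" and "\<exists>A. A_bound A"
proof -
  obtain C where C: "1 \<le> C" and g: "\<And>N m::nat. wmom \<omega> (real (3 ^ N * m)) \<le> C ^ N * wmom \<omega> (real (4 ^ N * m))"
    using moment_growth[OF dn D] by auto
  \<comment> \<open>The exponent (4^N - 3^N)/2 is at least 4^N/8, hence at least N^2/8, which
    exceeds N (ln C + ln 2) for this choice.\<close>
  obtain N :: nat where N: "8 * (ln C + ln 2) < real N" using reals_Archimedean2 by blast
  have N0: "0 < N" 
  proof -
    have "0 \<le> ln C" "0 < ln (2::real)" using C by simp_all
    then have "0 < 8 * (ln C + ln (2::real))" by (intro mult_pos_pos add_nonneg_pos) simp_all
    then have "0 < real N" using N by (rule order.strict_trans)
    then show ?thesis by simp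
  qed
  have small: "C ^ N * exp (- ((4 ^ N - 3 ^ N) / 2)) \<le> 1 / 2"
  proof -
    have a: "real N * real N \<le> 4 ^ N"
    proof -
      have "real N \<le> 2 ^ N" by (simp add: of_nat_less_two_power less_imp_le)
      then have "real N * real N \<le> 2 ^ N * 2 ^ N" by (intro mult_mono) auto
      also have "\<dots> = (4::real) ^ N" by (simp flip: power_mult_distrib)
      finally show ?thesis .
    qed
    have b: "(3::real) ^ N \<le> 3 / 4 * 4 ^ N"
    proof -
      obtain n where n: "N = Suc n" using N0 by (cases N) auto
      have "(3::real) ^ n \<le> 4 ^ n" by (intro power_mono) auto
      then show ?thesis using n by simp
    qed
    have "real N * (ln C + ln 2) \<le> real N * (real N / 8)" using N by (intro mult_left_mono) auto
    moreover have "ln 2 \<le> real N * ln 2" using N0 by simp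
    moreover have "real N * (ln C + ln 2) = real N * ln C + real N * ln 2" by (rule distrib_left)
    ultimately have "real N * ln C + ln 2 \<le> real N * real N / 8" by linarith
    also have "\<dots> \<le> 4 ^ N / 8" by (rule divide_right_mono[OF a]) simp
    also have "\<dots> = (4 ^ N - 3 / 4 * 4 ^ N) / 2" by simp
    also have "\<dots> \<le> (4 ^ N - 3 ^ N) / 2" by (intro divide_right_mono diff_left_mono b) simp
    finally have "real N * ln C + ln 2 \<le> (4 ^ N - 3 ^ N) / 2" .
    moreover have "x - z \<le> - l" if "x + l \<le> z" for x l z :: real using that by linarith
    ultimately have "real N * ln C - (4 ^ N - 3 ^ N) / 2 \<le> - ln 2" by blast
    then have e: "exp (real N * ln C - (4 ^ N - 3 ^ N) / 2) \<le> exp (- ln 2)" by (simp only: exp_le_cancel_iff)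
    have "C ^ N = exp (real N * ln C)" using C by (simp add: exp_of_nat_mult)
    then have "C ^ N * exp (- ((4 ^ N - 3 ^ N) / 2)) = exp (real N * ln C - (4 ^ N - 3 ^ N) / 2)"
      by (simp only: mult_exp_exp diff_conv_add_uminus)
    also note e
    also have "exp (- ln 2) = (1 / 2 :: real)" by (simp add: exp_minus)
    finally show ?thesis .
  qed
  have main: "\<exists>m::nat. wmom \<omega> (real (4 ^ N * m)) \<le> 2 * wtail \<omega> ((1 + r) / 2) \<and> exp (-4) \<le> r powr (real m)"
    if r: "1/2 \<le> r" "r < 1" for r
  proof -
    \<comment> \<open>Then 1 \<le> m(1-r), and m \<le> 2/(1-r) together with -ln r \<le> 2(1-r)
      gives r^m \<ge> exp(-4).\<close>
    define m where "m = nat \<lceil>1 / (1 - r)\<rceil>"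
    have p1: "1 \<le> 1 / (1 - r)" using r by simp
    have m: "1 / (1 - r) \<le> real m" "real m \<le> 2 / (1 - r)"
    proof -
      show "1 / (1 - r) \<le> real m" unfolding m_def by linarith
      have "real m \<le> 1 / (1 - r) + 1" unfolding m_def using p1 by linarith
      then show "real m \<le> 2 / (1 - r)" using p1 by simp
    qed
    have "1 \<le> real m * (1 - r)" using m(1) r by (simp add: field_simps)
    then have "wmom \<omega> (real (4 ^ N * m)) \<le> 2 * wtail \<omega> ((1 + r) / 2)"
      using r by (intro moment_le_tail[OF g small]) auto
    moreover have "exp (-4) \<le> r powr (real m)"
    proof -
      have "- ln r = ln (1 / r)" using r by (simp add: ln_div)
      also have "\<dots> \<le> 1 / r - 1" using r by (intro ln_le_minus_one) auto
      also have "\<dots> = (1 - r) / r" using r by (simp add: field_simps)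
      also have "\<dots> \<le> (1 - r) / (1/2)" using r by (intro divide_left_mono) auto
      finally have "- ln r \<le> 2 * (1 - r)" by simp
      then have "real m * (- ln r) \<le> 2 / (1 - r) * (2 * (1 - r))"
        using m r by (intro mult_mono) auto
      also have "\<dots> = 4"
      proof -
        have *: "2 / d * (2 * d) = 4" if "d \<noteq> 0" for d :: real using that by simp
        show ?thesis by (rule *) (use r in simp)
      qed
      finally show ?thesis using r by (simp add: powr_def)
    qed
    ultimately show ?thesis by blast
  qed
  have low: "exp (-4) ^ k \<le> r powr (real (k * m))" if r: "0 < r" and le: "exp (-4) \<le> r powr (real m)" for r and k m :: nat
  proof -
    have "exp (-4) ^ k \<le> (r powr (real m)) ^ k" by (rule power_mono[OF le]) simp
    also have "\<dots> = r powr (real (k * m))"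
      using r powr_realpow[of "r powr (real m)" k] by (simp add: powr_powr mult.commute)
    finally show ?thesis .
  qed
  show "tail_doubling (wtail \<omega>)"
  proof (rule tail_doublingI[OF tail_fun_wtail[OF om], of "2 * C ^ N / exp (-4) ^ (3 ^ N)" "1/2"])
    fix r :: real assume r: "1/2 \<le> r" "r < 1"
    obtain m :: nat where m: "wmom \<omega> (real (4 ^ N * m)) \<le> 2 * wtail \<omega> ((1 + r) / 2)" "exp (-4) \<le> r powr (real m)"
      using main[OF r] by auto
    have "exp (-4) ^ (3 ^ N) * wtail \<omega> r \<le> r powr (real (3 ^ N * m)) * wtail \<omega> r"
      by (intro mult_right_mono low m wtail_nonneg) (use r in simp)
    also have "\<dots> \<le> wmom \<omega> (real (3 ^ N * m))" using r by (intro wtail_le_wmom[OF om]) auto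
    also have "\<dots> \<le> C ^ N * wmom \<omega> (real (4 ^ N * m))" by (rule g)
    also have "\<dots> \<le> C ^ N * (2 * wtail \<omega> ((1 + r) / 2))" using C by (intro mult_left_mono m) auto
    finally show "wtail \<omega> r \<le> 2 * C ^ N / exp (-4) ^ (3 ^ N) * wtail \<omega> ((1 + r) / 2)"
      by (simp add: field_simps)
  qed (use C in auto)
  define A1 where "A1 = 2 * D / exp (-4) ^ (4 ^ N)"
  \<comment> \<open>Covers r < 1/2, where all tails are bounded above and below by their values at 0
    and 1/2.\<close>
  define A2 where "A2 = wtail \<nu> 0 powr (1/p) * wtail \<sigma> 0 powr (1/q) / wtail \<omega> (1/2)"
  have A1: "0 < A1" using D by (simp add: A1_def)
  have "wtail \<nu> r powr (1/p) * wtail \<sigma> r powr (1/q) \<le> max A1 A2 * wtail \<omega> r" if r0: "0 \<le> r" "r < 1" for r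
  proof (cases "1/2 \<le> r")
    case True
    obtain m :: nat where m: "wmom \<omega> (real (4 ^ N * m)) \<le> 2 * wtail \<omega> ((1 + r) / 2)" "exp (-4) \<le> r powr (real m)"
      using main[OF True r0(2)] by auto
    obtain N' where N': "N = Suc N'" using N0 by (cases N) auto
    \<comment> \<open>Half of 4^N m, an integer because N > 0.\<close>
    define n where "n = 2 * 4 ^ N' * m"
    have n: "2 * real n = real (4 ^ N * m)" by (simp add: n_def N')
    have part: "r powr (real n) * wtail w r powr (1/s) \<le> wmom w (real n * s) powr (1/s)" if "radial_weight w" "1 < s" for w s
    proof -
      have "(r powr (real n * s) * wtail w r) powr (1/s) \<le> wmom w (real n * s) powr (1/s)"
        using that True wtail_le_wmom[OF that(1), of r "real n * s"] wtail_nonneg[of w r] by (intro powr_mono2) auto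
      then show ?thesis using that True wtail_nonneg[of w r] by (simp add: powr_mult powr_powr)
    qed
    have "r powr (real (4 ^ N * m)) = r powr (real n) * r powr (real n)" using n by (simp flip: powr_add)
    then have "r powr (real (4 ^ N * m)) * (wtail \<nu> r powr (1/p) * wtail \<sigma> r powr (1/q))
       = (r powr (real n) * wtail \<nu> r powr (1/p)) * (r powr (real n) * wtail \<sigma> r powr (1/q))" by (simp only: mult_ac)
    also have "\<dots> \<le> wmom \<nu> (real n * p) powr (1/p) * wmom \<sigma> (real n * q) powr (1/q)"
      by (intro mult_mono part nu sigma p q) auto
    also have "\<dots> \<le> D * wmom \<omega> (2 * real n)" by (rule D)
    also have "\<dots> \<le> D * (2 * wtail \<omega> ((1 + r) / 2))" unfolding n using D m by (intro mult_left_mono) auto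
    also have "\<dots> \<le> D * (2 * wtail \<omega> r)" using D r0 by (intro mult_left_mono wtail_antimono[OF om]) auto
    finally have 1: "r powr (real (4 ^ N * m)) * (wtail \<nu> r powr (1/p) * wtail \<sigma> r powr (1/q)) \<le> D * (2 * wtail \<omega> r)" .
    have "exp (-4) ^ (4 ^ N) * (wtail \<nu> r powr (1/p) * wtail \<sigma> r powr (1/q)) \<le> r powr (real (4 ^ N * m)) * (wtail \<nu> r powr (1/p) * wtail \<sigma> r powr (1/q))"
      by (intro mult_right_mono low m) (use True in auto)
    with 1 have "exp (-4) ^ (4 ^ N) * (wtail \<nu> r powr (1/p) * wtail \<sigma> r powr (1/q)) \<le> D * (2 * wtail \<omega> r)" by linarith
    then have "wtail \<nu> r powr (1/p) * wtail \<sigma> r powr (1/q) \<le> A1 * wtail \<omega> r" by (simp add: A1_def field_simps)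
    also have "\<dots> \<le> max A1 A2 * wtail \<omega> r" by (intro mult_right_mono wtail_nonneg) simp
    finally show ?thesis .
  next
    case False
    have W: "0 < wtail \<omega> (1/2)" by (rule wtail_pos[OF om]) simp
    have "wtail \<nu> r powr (1/p) * wtail \<sigma> r powr (1/q) \<le> wtail \<nu> 0 powr (1/p) * wtail \<sigma> 0 powr (1/q)"
      using r0 p q by (intro mult_mono powr_mono2 wtail_antimono nu sigma wtail_nonneg) auto
    also have "\<dots> = A2 * wtail \<omega> (1/2)" using W by (simp add: A2_def)
    also have "\<dots> \<le> max A1 A2 * wtail \<omega> r"
      using False A1 by (intro mult_mono wtail_antimono[OF om] wtail_nonneg) (auto simp: le_max_iff_disj)
    finally show ?thesis .
  qed
  then have "A_bound (max A1 A2)" using A1 by (simp add: A_bound_def less_max_iff_disj)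
  then show "\<exists>A. A_bound A" by blast
qed

text \<open>\<open>tail_Hoelder\<close> and the A-bound make the tail of \<omega> comparable to the
  product of the powers of the other two. Decay of \<nu> thus passes to \<omega>; doubling of
  \<omega> passes to \<sigma> after cancelling the tail of \<nu>; decay of \<sigma> follows from
  that of \<omega> through annuli.\<close>

lemma A_bound_consequences:
  assumes A: "A_bound A" and d: "tail_doubling (wtail \<omega>)" and v: "tail_vanishing (wtail \<nu>)"
  shows "tail_vanishing (wtail \<omega>)" "tail_doubling (wtail \<sigma>)" "tail_vanishing (wtail \<sigma>)"
proof -
  have A0: "0 < A" and Ab: "\<And>r. 0 \<le> r \<Longrightarrow> r < 1 \<Longrightarrow> wtail \<nu> r powr (1/p) * wtail \<sigma> r powr (1/q) \<le> A * wtail \<omega> r"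
    using A by (auto simp: A_bound_def)
  have pos: "0 < wtail \<nu> r" "0 < wtail \<sigma> r" "0 < wtail \<omega> r" if "r < 1" for r
    using wtail_pos[OF _ that] nu sigma om by auto
  have next_r: "0 \<le> 1 - (1 - r) / M" "r \<le> 1 - (1 - r) / M" "1 - (1 - r) / M < 1" if "1 < M" "0 \<le> r" "r < 1" for r M :: real
  proof -
    have "(1 - r) / M \<le> (1 - r) / 1" using that by (intro frac_le) auto
    then show "0 \<le> 1 - (1 - r) / M" "r \<le> 1 - (1 - r) / M" using that by auto
    show "1 - (1 - r) / M < 1" using that by simp
  qed
  show vo: "tail_vanishing (wtail \<omega>)"
    unfolding tail_vanishing_def
  proof (intro allI impI)
    fix e :: real assume e: "0 < e"
    \<comment> \<open>Its p-th root is e/A, which compensates the constant \<open>A\<close> lost on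
      the way back to \<omega>.\<close>
    define e' where "e' = (e / A) powr p"
    have e': "0 < e'" "e' powr (1/p) = e / A" using e A0 p by (auto simp: e'_def powr_powr)
    obtain M where M: "1 < M" "\<And>r. 0 \<le> r \<Longrightarrow> r < 1 \<Longrightarrow> wtail \<nu> (1 - (1 - r) / M) \<le> e' * wtail \<nu> r"
      using v[unfolded tail_vanishing_def, rule_format, OF e'(1)] by auto
    have "wtail \<omega> (1 - (1 - r) / M) \<le> e * wtail \<omega> r" if r: "0 \<le> r" "r < 1" for r
    proof -
      let ?s = "1 - (1 - r) / M"
      have "wtail \<omega> ?s \<le> wtail \<nu> ?s powr (1/p) * wtail \<sigma> ?s powr (1/q)" by (rule tail_Hoelder)
      also have "\<dots> \<le> (e' * wtail \<nu> r) powr (1/p) * wtail \<sigma> r powr (1/q)"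
        using M(2)[OF r] p q next_r[OF M(1) r] wtail_antimono[OF sigma, of r ?s] wtail_nonneg
        by (intro mult_mono powr_mono2) auto
      also have "\<dots> = e / A * (wtail \<nu> r powr (1/p) * wtail \<sigma> r powr (1/q))"
        using e' wtail_nonneg[of \<nu> r] by (simp add: powr_mult)
      also have "\<dots> \<le> e / A * (A * wtail \<omega> r)" using e A0 by (intro mult_left_mono Ab r) auto
      also have "\<dots> = e * wtail \<omega> r" using A0 by simp
      finally show ?thesis .
    qed
    then show "\<exists>M>1. \<forall>r\<in>{0..<1}. wtail \<omega> (1 - (1 - r) / M) \<le> e * wtail \<omega> r"
      using M(1) by (intro exI[of _ M]) simp
  qed
  obtain C where C: "0 < C" "\<And>r. 0 \<le> r \<Longrightarrow> r < 1 \<Longrightarrow> wtail \<omega> r \<le> C * wtail \<omega> ((1 + r) / 2)"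
    using d by (auto simp: tail_doubling_def)
  show "tail_doubling (wtail \<sigma>)"
    unfolding tail_doubling_def
  proof (intro exI[of _ "(A * C) powr q"] conjI ballI)
    fix r :: real assume "r \<in> {0..<1}"
    then have r: "0 \<le> r" "r < 1" by auto
    let ?s = "(1 + r) / 2"
    have s: "r \<le> ?s" "?s < 1" using r by auto
    have "wtail \<nu> ?s powr (1/p) * wtail \<sigma> r powr (1/q) \<le> wtail \<nu> r powr (1/p) * wtail \<sigma> r powr (1/q)"
      using p s wtail_antimono[OF nu s(1)] wtail_nonneg by (intro mult_right_mono powr_mono2) auto
    also have "\<dots> \<le> A * wtail \<omega> r" by (rule Ab[OF r])
    also have "\<dots> \<le> A * (C * wtail \<omega> ?s)" using A0 by (intro mult_left_mono C r) auto
    also have "\<dots> \<le> A * (C * (wtail \<nu> ?s powr (1/p) * wtail \<sigma> ?s powr (1/q)))"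
      using A0 C(1) by (intro mult_left_mono tail_Hoelder) auto
    finally have "wtail \<nu> ?s powr (1/p) * wtail \<sigma> r powr (1/q) \<le> wtail \<nu> ?s powr (1/p) * (A * C * wtail \<sigma> ?s powr (1/q))"
      by (simp only: mult_ac)
    then have "wtail \<sigma> r powr (1/q) \<le> A * C * wtail \<sigma> ?s powr (1/q)"
      using pos(1)[OF s(2)] by (simp add: mult_le_cancel_left_pos)
    then have "(wtail \<sigma> r powr (1/q)) powr q \<le> (A * C * wtail \<sigma> ?s powr (1/q)) powr q"
      using q by (intro powr_mono2) auto
    then show "wtail \<sigma> r \<le> (A * C) powr q * wtail \<sigma> ?s"
      using q A0 C(1) wtail_nonneg[of \<sigma>] by (simp add: powr_mult powr_powr)
  qed (use A0 C in simp)
  obtain M where M: "1 < M" "\<And>r. 0 \<le> r \<Longrightarrow> r < 1 \<Longrightarrow> wtail \<omega> (1 - (1 - r) / M) \<le> 1/2 * wtail \<omega> r"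
    using vo[unfolded tail_vanishing_def, rule_format, of "1/2"] by auto
  \<comment> \<open>The annulus carries at least the fraction 1/B of the tail of \<sigma>; the
    maximum with 2 keeps 1 - 1/B strictly between 0 and 1.\<close>
  define B where "B = max 2 ((2 * A) powr q)"
  have B: "2 \<le> B" "(2 * A) powr q \<le> B" by (auto simp: B_def)
  show "tail_vanishing (wtail \<sigma>)"
  proof (rule tail_vanishingI[OF tail_fun_wtail[OF sigma], of "1 - 1 / B" M 0])
    fix r :: real assume r: "0 \<le> r" "r < 1"
    let ?s = "1 - (1 - r) / M"
    note s = next_r[OF M(1) r]
    have dS: "0 \<le> wtail \<sigma> r - wtail \<sigma> ?s" using wtail_antimono[OF sigma s(2)] by simp
    \<comment> \<open>By the choice of \<open>M\<close> at least half of the tail of \<omega> at r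
      lies in the annulus from r to \<open>?s\<close>, so the annulus mass of \<sigma> cannot be
      small.\<close>
    have "wtail \<nu> r powr (1/p) * wtail \<sigma> r powr (1/q) \<le> A * wtail \<omega> r" by (rule Ab[OF r])
    also have "\<dots> \<le> A * (2 * (wtail \<omega> r - wtail \<omega> ?s))"
      using A0 M(2)[OF r] by (intro mult_left_mono) auto
    also have "\<dots> \<le> A * (2 * ((wtail \<nu> r - wtail \<nu> ?s) powr (1/p) * (wtail \<sigma> r - wtail \<sigma> ?s) powr (1/q)))"
      using A0 by (intro mult_left_mono annulus_Hoelder s) auto
    also have "\<dots> \<le> A * (2 * (wtail \<nu> r powr (1/p) * (wtail \<sigma> r - wtail \<sigma> ?s) powr (1/q)))"
      using A0 p wtail_antimono[OF nu s(2)] wtail_nonneg[of \<nu> ?s] by (intro mult_left_mono mult_right_mono powr_mono2) auto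
    finally have "wtail \<nu> r powr (1/p) * wtail \<sigma> r powr (1/q) \<le> wtail \<nu> r powr (1/p) * (2 * A * (wtail \<sigma> r - wtail \<sigma> ?s) powr (1/q))"
      by (simp only: mult_ac)
    then have "wtail \<sigma> r powr (1/q) \<le> 2 * A * (wtail \<sigma> r - wtail \<sigma> ?s) powr (1/q)"
      using pos(1)[OF r(2)] by (simp add: mult_le_cancel_left_pos)
    then have "(wtail \<sigma> r powr (1/q)) powr q \<le> (2 * A * (wtail \<sigma> r - wtail \<sigma> ?s) powr (1/q)) powr q"
      using q by (intro powr_mono2) auto
    then have "wtail \<sigma> r \<le> (2 * A) powr q * (wtail \<sigma> r - wtail \<sigma> ?s)"
      using q A0 dS wtail_nonneg[of \<sigma> r] by (simp add: powr_mult powr_powr)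
    also have "\<dots> \<le> B * (wtail \<sigma> r - wtail \<sigma> ?s)" using B dS by (intro mult_right_mono) auto
    finally have "B * wtail \<sigma> ?s \<le> (B - 1) * wtail \<sigma> r" by (simp add: algebra_simps)
    then show "wtail \<sigma> ?s \<le> (1 - 1 / B) * wtail \<sigma> r" using B by (simp add: field_simps)
  qed (use B M in auto)
qed

end

section \<open>Schur's test\<close>

text \<open>The coefficients are real. This makes the modulus of the kernel symmetric in its two
  variables, as the second Schur condition requires.\<close>

lemma kser_cnj:
  assumes w: "radial_weight w" and z: "norm z < 1"
  shows "kser w (cnj z) = cnj (kser w z)"
proof -
  have "(\<lambda>n. cnj (of_real (kcoeff w n) * z ^ n)) sums cnj (kser w z)"
    using kser_sums(1)[OF w z] by (simp only: sums_cnj)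
  then have "(\<lambda>n. of_real (kcoeff w n) * cnj z ^ n) sums cnj (kser w z)" by simp
  moreover have "(\<lambda>n. of_real (kcoeff w n) * cnj z ^ n) sums kser w (cnj z)"
    by (rule kser_sums(1)[OF w]) (use z in simp)
  ultimately show ?thesis using sums_unique2 by blast
qed

text \<open>Since h is rotation invariant, the kernel may be replaced by its circle mean at radius
  |a||z|. That radius is below both |a| and |z|, so monotonicity of the tail bounds the mean by C
  over the tail at whichever of the two is convenient.\<close>

lemma kernel_average_bound:
  fixes h :: "complex \<Rightarrow> ennreal"
  assumes w: "radial_weight w" and C: "0 \<le> C"
    and J: "\<And>x. 0 \<le> x \<Longrightarrow> x < 1 \<Longrightarrow> (\<integral>\<^sup>+u. ennreal (norm (kser w (of_real x * sgn u))) \<partial>disc_area) \<le> ennreal (C / wtail w x)"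
    and h [measurable]: "h \<in> borel_measurable disc_area"
    and rot: "\<And>c z. norm c = 1 \<Longrightarrow> norm z < 1 \<Longrightarrow> h (c * z) = h z"
    and a: "norm a < 1"
  shows "(\<integral>\<^sup>+z. ennreal (norm (kser w (a * z))) * (h z * indicator {z. norm a \<le> norm z} z) \<partial>disc_area)
      \<le> ennreal (C / wtail w (norm a)) * (\<integral>\<^sup>+z. h z * indicator {z. norm a \<le> norm z} z \<partial>disc_area)" (is ?A)
    and "(\<integral>\<^sup>+z. ennreal (norm (kser w (a * z))) * (h z * indicator {z. norm z \<le> norm a} z) \<partial>disc_area)
      \<le> ennreal C * (\<integral>\<^sup>+z. ennreal (1 / wtail w (norm z)) * (h z * indicator {z. norm z \<le> norm a} z) \<partial>disc_area)" (is ?B)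
proof -
  have [measurable]: "(indicator {z::complex. norm a \<le> norm z} :: complex \<Rightarrow> ennreal) \<in> borel_measurable disc_area"
    "(indicator {z::complex. norm z \<le> norm a} :: complex \<Rightarrow> ennreal) \<in> borel_measurable disc_area"
    by (rule borel_measurable_disc_area, measurable)+
  have Gm: "(\<lambda>z. ennreal (norm (kser w z))) \<in> borel_measurable borel" by measurable
  have J': "(\<integral>\<^sup>+u. ennreal (norm (kser w (of_real (norm a * norm z) * sgn u))) \<partial>disc_area) \<le> ennreal (C / wtail w (norm b))"
    if z: "norm z < 1" and b: "b = a \<or> b = z" for z b :: complex
  proof -
    have le: "norm a * norm z \<le> norm b" using a z b by (auto simp: mult_left_le mult_left_le_one_le)
    have b1: "norm b < 1" using a z b by auto
    have "(\<integral>\<^sup>+u. ennreal (norm (kser w (of_real (norm a * norm z) * sgn u))) \<partial>disc_area) \<le> ennreal (C / wtail w (norm a * norm z))"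
      by (rule J) (use le b1 in auto)
    also have "\<dots> \<le> ennreal (C / wtail w (norm b))"
      using C wtail_antimono[OF w le] wtail_pos[OF w b1] by (intro ennreal_leI divide_left_mono) auto
    finally show ?thesis .
  qed
  have "(\<integral>\<^sup>+z. ennreal (norm (kser w (a * z))) * (h z * indicator {z. norm a \<le> norm z} z) \<partial>disc_area)
     = (\<integral>\<^sup>+z. (\<integral>\<^sup>+u. ennreal (norm (kser w (of_real (norm a * norm z) * sgn u))) \<partial>disc_area) * (h z * indicator {z. norm a \<le> norm z} z) \<partial>disc_area)"
    by (rule nn_integral_disc_average[OF Gm]) (auto simp: rot norm_mult indicator_def)
  also have "\<dots> \<le> (\<integral>\<^sup>+z. ennreal (C / wtail w (norm a)) * (h z * indicator {z. norm a \<le> norm z} z) \<partial>disc_area)"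
    by (intro nn_integral_mono mult_right_mono J') auto
  also have "\<dots> = ennreal (C / wtail w (norm a)) * (\<integral>\<^sup>+z. h z * indicator {z. norm a \<le> norm z} z \<partial>disc_area)"
    by (rule nn_integral_cmult) measurable
  finally show ?A .
  have [measurable]: "(\<lambda>z. wtail w (norm z)) \<in> borel_measurable disc_area"
    by (intro borel_measurable_disc_area measurable_compose[OF _ wtail_borel_measurable[OF w]]) measurable
  have "(\<integral>\<^sup>+z. ennreal (norm (kser w (a * z))) * (h z * indicator {z. norm z \<le> norm a} z) \<partial>disc_area)
     = (\<integral>\<^sup>+z. (\<integral>\<^sup>+u. ennreal (norm (kser w (of_real (norm a * norm z) * sgn u))) \<partial>disc_area) * (h z * indicator {z. norm z \<le> norm a} z) \<partial>disc_area)"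
    by (rule nn_integral_disc_average[OF Gm]) (auto simp: rot norm_mult indicator_def)
  also have "\<dots> \<le> (\<integral>\<^sup>+z. ennreal C * (ennreal (1 / wtail w (norm z)) * (h z * indicator {z. norm z \<le> norm a} z)) \<partial>disc_area)"
  proof (rule nn_integral_mono)
    fix z assume "z \<in> space disc_area"
    then have z: "norm z < 1" by simp
    have "ennreal (C / wtail w (norm z)) = ennreal C * ennreal (1 / wtail w (norm z))"
      using C wtail_nonneg[of w "norm z"] by (subst ennreal_mult[symmetric]) auto
    then have "(\<integral>\<^sup>+u. ennreal (norm (kser w (of_real (norm a * norm z) * sgn u))) \<partial>disc_area) \<le> ennreal C * ennreal (1 / wtail w (norm z))"
      using J'[OF z, of z] by simp
    from mult_right_mono[OF this zero_le, of "h z * indicator {z. norm z \<le> norm a} z"]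
    show "(\<integral>\<^sup>+u. ennreal (norm (kser w (of_real (norm a * norm z) * sgn u))) \<partial>disc_area) * (h z * indicator {z. norm z \<le> norm a} z)
       \<le> ennreal C * (ennreal (1 / wtail w (norm z)) * (h z * indicator {z. norm z \<le> norm a} z))"
      by (simp only: mult.assoc)
  qed
  also have "\<dots> = ennreal C * (\<integral>\<^sup>+z. ennreal (1 / wtail w (norm z)) * (h z * indicator {z. norm z \<le> norm a} z) \<partial>disc_area)"
    by (rule nn_integral_cmult) measurable
  finally show ?B .
qed

lemma measurable_disc_section:
  assumes "(\<lambda>(z, y). K z y) \<in> borel_measurable (disc_area \<Otimes>\<^sub>M disc_area)" "norm z < 1"
  shows "K z \<in> borel_measurable disc_area"
  using measurable_Pair2[OF assms(1), of z] assms(2) by simp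

text \<open>The product of two completed measures is not complete, so joint measurability is
  obtained by composing Borel functions with the two coordinates.\<close>

lemma kernel_measurable:
  "(\<lambda>(z, y). kser w (cnj z * y)) \<in> borel_measurable (disc_area \<Otimes>\<^sub>M disc_area)"
  "(\<lambda>(z, y). norm z) \<in> borel_measurable (disc_area \<Otimes>\<^sub>M disc_area)"
  "(\<lambda>(z, y). norm y) \<in> borel_measurable (disc_area \<Otimes>\<^sub>M disc_area)"
proof -
  have i: "(\<lambda>x::complex. x) \<in> disc_area \<rightarrow>\<^sub>M borel" by (rule borel_measurable_disc_area) simp
  have 1: "(\<lambda>p::complex \<times> complex. fst p) \<in> borel_measurable (disc_area \<Otimes>\<^sub>M disc_area)"
    using measurable_comp[OF measurable_fst i] by (simp add: o_def)
  have 2: "(\<lambda>p::complex \<times> complex. snd p) \<in> borel_measurable (disc_area \<Otimes>\<^sub>M disc_area)"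
    using measurable_comp[OF measurable_snd i] by (simp add: o_def)
  have c: "cnj \<in> borel_measurable borel" by (intro borel_measurable_continuous_onI continuous_intros)
  have "(\<lambda>p::complex \<times> complex. cnj (fst p)) \<in> borel_measurable (disc_area \<Otimes>\<^sub>M disc_area)"
    by (rule measurable_compose[OF 1 c])
  then have "(\<lambda>p. kser w (cnj (fst p) * snd p)) \<in> borel_measurable (disc_area \<Otimes>\<^sub>M disc_area)"
    using 2 by (intro measurable_compose[OF _ kser_measurable(1)] borel_measurable_times)
  then show "(\<lambda>(z, y). kser w (cnj z * y)) \<in> borel_measurable (disc_area \<Otimes>\<^sub>M disc_area)"
    by (simp add: case_prod_beta')
  show "(\<lambda>(z, y). norm z) \<in> borel_measurable (disc_area \<Otimes>\<^sub>M disc_area)"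
    "(\<lambda>(z, y). norm y) \<in> borel_measurable (disc_area \<Otimes>\<^sub>M disc_area)"
    using measurable_compose[OF 1 borel_measurable_norm] measurable_compose[OF 2 borel_measurable_norm] by (simp_all add: case_prod_beta')
qed

text \<open>Such a pair serves for the half \<open>|z| \<le> |\<zeta>|\<close> of the kernel. For the other half the test functions
  are a pair for \<open>(q, \<sigma>, \<nu>)\<close> with \<open>u\<close> and \<open>v\<close> interchanged.\<close>

definition Schur_pair :: "real \<Rightarrow> real \<Rightarrow> (complex \<Rightarrow> real) \<Rightarrow> (complex \<Rightarrow> real) \<Rightarrow> (complex \<Rightarrow> real) \<Rightarrow> real \<Rightarrow> (real \<Rightarrow> real) \<Rightarrow> (real \<Rightarrow> real) \<Rightarrow> bool" where
  "Schur_pair p q \<nu> \<sigma> \<omega> C u v \<longleftrightarrow> u \<in> borel_measurable borel \<and> v \<in> borel_measurable borel \<and>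
     (\<forall>r\<in>{0..<1}. 0 < u r \<and> 0 < v r) \<and> 0 < C \<and>
     (\<forall>r\<in>{0..<1}. (\<integral>\<^sup>+z. ennreal (u (norm z) powr q * \<sigma> z) * indicator {z. r \<le> norm z} z \<partial>disc_area) \<le> ennreal (C * (wtail \<omega> r * v r powr q))) \<and>
     (\<forall>s\<in>{0..<1}. (\<integral>\<^sup>+z. ennreal (1 / wtail \<omega> (norm z)) * (ennreal (v (norm z) powr p * \<nu> z) * indicator {z. norm z \<le> s} z) \<partial>disc_area) \<le> ennreal (C * u s powr p))"

context weight_triple begin

text \<open>u is a small negative power of 1 - r and v is forced by the first condition, see
  \<open>vq\<close>. The second condition then reduces by the A-bound to the integral in
  \<open>weighted_head_bound\<close>.\<close>

lemma Schur_pair_exists: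
  assumes A: "A_bound A" and dn: "tail_doubling (wtail \<nu>)" and vs: "tail_vanishing (wtail \<sigma>)"
  shows "\<exists>C u v. Schur_pair p q \<nu> \<sigma> \<omega> C u v"
proof -
  have A0: "0 < A" and Ab: "\<And>r. 0 \<le> r \<Longrightarrow> r < 1 \<Longrightarrow> wtail \<nu> r powr (1/p) * wtail \<sigma> r powr (1/q) \<le> A * wtail \<omega> r"
    using A by (auto simp: A_bound_def)
  have pos: "0 < wtail \<nu> r" "0 < wtail \<sigma> r" "0 < wtail \<omega> r" if "r < 1" for r
    using wtail_pos[OF _ that] nu sigma om by auto
  obtain M where M: "1 < M" "\<And>r. 0 \<le> r \<Longrightarrow> r < 1 \<Longrightarrow> wtail \<sigma> (1 - (1 - r) / M) \<le> 1/4 * wtail \<sigma> r"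
    using vs[unfolded tail_vanishing_def, rule_format, of "1/4"] by auto
  \<comment> \<open>With the ratio 1/4 this gives (1/4) M^k = 1/2, as needed in
    \<open>weighted_tail_bound\<close>.\<close>
  define k where "k = ln 2 / ln M"
  have k: "0 < k" "M powr k = 2" using M by (auto simp: k_def powr_def)
  define kk where "kk = k * p / q"
  have kk: "0 < kk" using k p q by (simp add: kk_def)
  obtain C1 where C1: "0 < C1" "\<And>r. 0 \<le> r \<Longrightarrow> r < 1 \<Longrightarrow> (\<integral>\<^sup>+z. ennreal (\<sigma> z * (1 - norm z) powr (- k)) * indicator {z. r \<le> norm z} z \<partial>disc_area)
     \<le> ennreal (C1 * (wtail \<sigma> r * (1 - r) powr (- k)))"
    using weighted_tail_bound[OF sigma M(1), of k "1/4"] M(2) k by auto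
  obtain C2 where C2: "0 < C2" "\<And>s. 0 \<le> s \<Longrightarrow> s < 1 \<Longrightarrow> (\<integral>\<^sup>+z. ennreal (\<nu> z * (1 - norm z) powr (- kk) / wtail \<nu> (norm z)) * indicator {z. norm z \<le> s} z \<partial>disc_area)
     \<le> ennreal (C2 * (1 - s) powr (- kk))"
    using weighted_head_bound[OF nu kk dn] by auto
  define u where "u r = (1 - r) powr (- k / q)" for r :: real
  \<comment> \<open>The q-th power of v times the tail of \<omega> is the tail of \<sigma> times
    (1-r)^(-k), exactly the bound that \<open>weighted_tail_bound\<close> supplies.\<close>
  define v where "v r = (wtail \<sigma> r / wtail \<omega> r) powr (1/q) * (1 - r) powr (- k / q)" for r
  have uq: "u r powr q = (1 - r) powr (- k)" and up: "u r powr p = (1 - r) powr (- kk)" for r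
    using q by (simp_all add: u_def powr_powr kk_def)
  have vq: "v r powr q = wtail \<sigma> r / wtail \<omega> r * (1 - r) powr (- k)" for r
    using q wtail_nonneg[of \<sigma> r] wtail_nonneg[of \<omega> r] by (simp add: v_def powr_mult powr_powr)
  \<comment> \<open>The A-bound raised to the power p; since p = p/q + 1, the division by the tail
    of \<omega> completes its power p/q to p.\<close>
  have vp: "v r powr p / wtail \<omega> r \<le> A powr p * ((1 - r) powr (- kk) / wtail \<nu> r)" if r: "0 \<le> r" "r < 1" for r
  proof -
    note P = pos[OF r(2)]
    have "(wtail \<nu> r powr (1/p) * wtail \<sigma> r powr (1/q)) powr p \<le> (A * wtail \<omega> r) powr p"
      using Ab[OF r] p by (intro powr_mono2) auto
    then have 1: "wtail \<nu> r * wtail \<sigma> r powr (p/q) \<le> A powr p * wtail \<omega> r powr p"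
      using P A0 p by (simp add: powr_mult powr_powr)
    have pq1: "p = p / q + 1" using p_div_q by simp
    have "wtail \<omega> r powr p = wtail \<omega> r powr (p/q + 1)" using pq1 by (rule arg_cong)
    also have "\<dots> = wtail \<omega> r powr (p/q) * wtail \<omega> r" using P by (simp add: powr_add)
    finally have 2: "wtail \<omega> r powr p = wtail \<omega> r powr (p/q) * wtail \<omega> r" .
    have "v r powr p = (wtail \<sigma> r powr (p/q) / wtail \<omega> r powr (p/q)) * (1 - r) powr (- kk)"
      using P r by (simp add: v_def powr_mult powr_powr powr_divide kk_def)
    then have "v r powr p / wtail \<omega> r = wtail \<sigma> r powr (p/q) / wtail \<omega> r powr p * (1 - r) powr (- kk)"
      by (simp add: 2)
    also have "\<dots> \<le> A powr p / wtail \<nu> r * (1 - r) powr (- kk)"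
      using 1 P by (intro mult_right_mono) (auto simp: field_simps)
    finally show ?thesis by simp
  qed
  define C where "C = max C1 (A powr p * C2)"
  have C: "0 < C" "C1 \<le> C" "A powr p * C2 \<le> C" using C1 by (auto simp: C_def)
  have [measurable]: "wtail \<sigma> \<in> borel_measurable borel" "wtail \<omega> \<in> borel_measurable borel" "wtail \<nu> \<in> borel_measurable borel"
    using wtail_borel_measurable sigma om nu by auto
  have "Schur_pair p q \<nu> \<sigma> \<omega> C u v"
    unfolding Schur_pair_def
  proof (intro conjI ballI)
    show "u \<in> borel_measurable borel" "v \<in> borel_measurable borel" unfolding u_def v_def by measurable
    show "0 < C" by (rule C)
    fix r :: real assume "r \<in> {0..<1}"
    then have r: "0 \<le> r" "r < 1" by auto
    note P = pos[OF r(2)]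
    show "0 < u r" "0 < v r" using P r by (simp_all add: u_def v_def)
    have "(\<integral>\<^sup>+z. ennreal (u (norm z) powr q * \<sigma> z) * indicator {z. r \<le> norm z} z \<partial>disc_area) \<le> ennreal (C1 * (wtail \<sigma> r * (1 - r) powr (- k)))"
      using C1(2)[OF r] by (simp only: uq mult.commute)
    also have "\<dots> \<le> ennreal (C * (wtail \<omega> r * v r powr q))"
    proof (rule ennreal_leI)
      have "wtail \<omega> r * v r powr q = wtail \<sigma> r * (1 - r) powr (- k)" unfolding vq using P by simp
      then show "C1 * (wtail \<sigma> r * (1 - r) powr (- k)) \<le> C * (wtail \<omega> r * v r powr q)"
        using C P by (simp add: mult_right_mono)
    qed
    finally show "(\<integral>\<^sup>+z. ennreal (u (norm z) powr q * \<sigma> z) * indicator {z. r \<le> norm z} z \<partial>disc_area) \<le> ennreal (C * (wtail \<omega> r * v r powr q))" .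
    have m: "(\<lambda>z. ennreal (\<nu> z * (1 - norm z) powr (- kk) / wtail \<nu> (norm z)) * indicator {z. norm z \<le> r} z) \<in> borel_measurable disc_area"
    proof -
      have "(\<lambda>z::complex. (1 - norm z) powr (- kk)) \<in> borel_measurable disc_area" "(\<lambda>z::complex. wtail \<nu> (norm z)) \<in> borel_measurable disc_area"
        "(indicator {z. norm z \<le> r} :: complex \<Rightarrow> ennreal) \<in> borel_measurable disc_area"
        by (rule borel_measurable_disc_area, measurable)+
      then show ?thesis
        by (intro borel_measurable_times_ennreal measurable_compose[OF _ measurable_ennreal] borel_measurable_times borel_measurable_divide radial_weight_measurable[OF nu])
    qed
    have "(\<integral>\<^sup>+z. ennreal (1 / wtail \<omega> (norm z)) * (ennreal (v (norm z) powr p * \<nu> z) * indicator {z. norm z \<le> r} z) \<partial>disc_area)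
      \<le> (\<integral>\<^sup>+z. ennreal (A powr p) * (ennreal (\<nu> z * (1 - norm z) powr (- kk) / wtail \<nu> (norm z)) * indicator {z. norm z \<le> r} z) \<partial>disc_area)"
    proof (rule nn_integral_mono)
      fix z assume "z \<in> space disc_area"
      then have z: "norm z < 1" by simp
      have n0: "0 \<le> \<nu> z" by (rule radial_weight_nonneg[OF nu z])
      have "1 / wtail \<omega> (norm z) * (v (norm z) powr p * \<nu> z) = v (norm z) powr p / wtail \<omega> (norm z) * \<nu> z" by simp
      also have "\<dots> \<le> A powr p * ((1 - norm z) powr (- kk) / wtail \<nu> (norm z)) * \<nu> z"
        using vp[OF norm_ge_zero z] n0 by (rule mult_right_mono)
      also have "\<dots> = A powr p * (\<nu> z * (1 - norm z) powr (- kk) / wtail \<nu> (norm z))" by simp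
      finally have "ennreal (1 / wtail \<omega> (norm z)) * ennreal (v (norm z) powr p * \<nu> z) \<le> ennreal (A powr p) * ennreal (\<nu> z * (1 - norm z) powr (- kk) / wtail \<nu> (norm z))"
        using n0 wtail_nonneg by (subst (1 2) ennreal_mult[symmetric]) (auto intro!: ennreal_leI)
      then show "ennreal (1 / wtail \<omega> (norm z)) * (ennreal (v (norm z) powr p * \<nu> z) * indicator {z. norm z \<le> r} z)
        \<le> ennreal (A powr p) * (ennreal (\<nu> z * (1 - norm z) powr (- kk) / wtail \<nu> (norm z)) * indicator {z. norm z \<le> r} z)"
        by (auto split: split_indicator)
    qed
    also have "\<dots> = ennreal (A powr p) * (\<integral>\<^sup>+z. ennreal (\<nu> z * (1 - norm z) powr (- kk) / wtail \<nu> (norm z)) * indicator {z. norm z \<le> r} z \<partial>disc_area)"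
      by (rule nn_integral_cmult[OF m])
    also have "\<dots> \<le> ennreal (A powr p) * ennreal (C2 * (1 - r) powr (- kk))"
      by (intro mult_left_mono C2 r) auto
    also have "\<dots> = ennreal (A powr p * C2 * u r powr p)"
      unfolding up using C2(1) by (subst ennreal_mult[symmetric]) (auto simp: mult.assoc)
    also have "\<dots> \<le> ennreal (C * u r powr p)" using C by (intro ennreal_leI mult_right_mono) auto
    finally show "(\<integral>\<^sup>+z. ennreal (1 / wtail \<omega> (norm z)) * (ennreal (v (norm z) powr p * \<nu> z) * indicator {z. norm z \<le> r} z) \<partial>disc_area) \<le> ennreal (C * u r powr p)" .
  qed
  then show ?thesis by blast
qed

text \<open>Write K f as the product of K^(1/p) f / u and K^(1/q) u and apply Hoelder: the second
  factor is controlled by condition \<open>1\<close>, the first by Tonelli and condition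
  \<open>2\<close>. \<open>enn2real\<close> sends an infinite inner integral to 0, which is harmless
  for an upper bound; where finiteness matters it is proved separately.\<close>

lemma Schur_test:
  fixes K :: "complex \<Rightarrow> complex \<Rightarrow> real" and u v :: "real \<Rightarrow> real"
  assumes K [measurable]: "(\<lambda>(z, y). K z y) \<in> borel_measurable (disc_area \<Otimes>\<^sub>M disc_area)"
    and K0: "\<And>z y. 0 \<le> K z y"
    and uv [measurable]: "u \<in> borel_measurable borel" "v \<in> borel_measurable borel"
    and uvpos: "\<And>r. 0 \<le> r \<Longrightarrow> r < 1 \<Longrightarrow> 0 < u r" "\<And>r. 0 \<le> r \<Longrightarrow> r < 1 \<Longrightarrow> 0 < v r"
    and C: "0 < C1" "0 < C2"
    and 1: "\<And>z. norm z < 1 \<Longrightarrow> (\<integral>\<^sup>+y. ennreal (K z y * (u (norm y) powr q * \<sigma> y)) \<partial>disc_area) \<le> ennreal (C1 * v (norm z) powr q)"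
    and 2: "\<And>y. norm y < 1 \<Longrightarrow> (\<integral>\<^sup>+z. ennreal (K z y * (v (norm z) powr p * \<nu> z)) \<partial>disc_area) \<le> ennreal (C2 * u (norm y) powr p)"
    and f [measurable]: "f \<in> borel_measurable disc_area" and f0: "\<And>y. 0 \<le> f y"
  shows "(\<integral>\<^sup>+z. ennreal (enn2real (\<integral>\<^sup>+y. ennreal (K z y * f y * \<omega> y) \<partial>disc_area) powr p * \<nu> z) \<partial>disc_area)
    \<le> ennreal (C1 powr (p/q) * C2) * (\<integral>\<^sup>+y. ennreal (f y powr p * \<nu> y) \<partial>disc_area)"
proof -
  interpret P2: pair_sigma_finite disc_area disc_area by standard
  note radial_weight_measurable[OF nu, measurable] radial_weight_measurable[OF sigma, measurable] radial_weight_measurable[OF om, measurable]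
  have un [measurable]: "(\<lambda>z::complex. u (norm z)) \<in> borel_measurable disc_area" "(\<lambda>z::complex. v (norm z)) \<in> borel_measurable disc_area"
    by (rule borel_measurable_disc_area, measurable)+
  have Kz: "K z \<in> borel_measurable disc_area" if "norm z < 1" for z
    using measurable_Pair2[OF K, of z] that by simp
  define G where "G y = f y powr p * u (norm y) powr (- p) * \<nu> y" for y
  have Gm [measurable]: "G \<in> borel_measurable disc_area" unfolding G_def by measurable
  have G0: "0 \<le> G y" if "norm y < 1" for y using radial_weight_nonneg[OF nu that] by (simp add: G_def)
  define I where "I z = (\<integral>\<^sup>+y. ennreal (K z y * G y) \<partial>disc_area)" for z
  have pt: "ennreal (enn2real (\<integral>\<^sup>+y. ennreal (K z y * f y * \<omega> y) \<partial>disc_area) powr p * \<nu> z) \<le> ennreal (C1 powr (p/q)) * (ennreal (v (norm z) powr p * \<nu> z) * I z)"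
    if z: "norm z < 1" for z
  proof (cases "\<nu> z = 0")
    case False
    then have n0: "0 < \<nu> z" using radial_weight_nonneg[OF nu z] by simp
    have v0: "0 < v (norm z)" by (rule uvpos(2)) (use z in auto)
    note [measurable] = Kz[OF z]
    show ?thesis
    proof (cases "I z = \<infinity>")
      case True
      have "ennreal (C1 powr (p/q)) * (ennreal (v (norm z) powr p * \<nu> z) * I z) = \<infinity>"
        using True n0 v0 C by (simp add: ennreal_mult_top)
      then show ?thesis by simp
    next
      case False
      define i where "i = enn2real (I z)"
      have i: "I z = ennreal i" "0 \<le> i" using False by (auto simp: i_def ennreal_enn2real_if)
      define \<phi> where "\<phi> y = K z y powr (1/p) * f y * u (norm y) powr (-1)" for y
      define \<psi> where "\<psi> y = K z y powr (1/q) * u (norm y) powr 1" for y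
      have "(\<integral>\<^sup>+y. ennreal (K z y * f y * \<omega> y) \<partial>disc_area) = (\<integral>\<^sup>+y. ennreal (\<phi> y * \<psi> y * \<omega> y) \<partial>disc_area)"
      proof (rule nn_integral_cong)
        fix y assume "y \<in> space disc_area"
        then have y: "norm y < 1" by simp
        have u0: "0 < u (norm y)" by (rule uvpos(1)) (use y in auto)
        have "K z y powr (1/p) * K z y powr (1/q) = K z y"
          using pq K0[of z y] by (simp add: powr_add[symmetric])
        moreover have "\<phi> y * \<psi> y = (K z y powr (1/p) * K z y powr (1/q)) * f y * (u (norm y) powr (-1) * u (norm y) powr 1)"
          by (simp add: \<phi>_def \<psi>_def mult_ac)
        moreover have "u (norm y) powr (-1) * u (norm y) powr 1 = 1" using u0 by (simp flip: powr_add)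
        ultimately show "ennreal (K z y * f y * \<omega> y) = ennreal (\<phi> y * \<psi> y * \<omega> y)" by simp
      qed
      also have "\<dots> \<le> ennreal (i powr (1/p) * (C1 * v (norm z) powr q) powr (1/q))"
      proof (rule Hoelder)
        show "\<phi> \<in> borel_measurable disc_area" "\<psi> \<in> borel_measurable disc_area" unfolding \<phi>_def \<psi>_def by measurable
        show "0 \<le> \<phi> y" "0 \<le> \<psi> y" for y using f0 by (simp_all add: \<phi>_def \<psi>_def)
        have "(\<integral>\<^sup>+y. ennreal (\<phi> y powr p * \<nu> y) \<partial>disc_area) = I z"
          unfolding I_def
        proof (rule nn_integral_cong)
          fix y assume "y \<in> space disc_area"
          then have y: "norm y < 1" by simp
          have *: "(a * b * c) powr p = a powr p * b powr p * c powr p" if "0 \<le> a" "0 \<le> b" "0 \<le> c" for a b c :: real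
            using that by (simp add: powr_mult)
          have "\<phi> y powr p = (K z y powr (1/p)) powr p * f y powr p * (u (norm y) powr (-1)) powr p"
            unfolding \<phi>_def by (rule *) (simp_all add: f0)
          also have "(K z y powr (1/p)) powr p = K z y" using p K0 by (simp add: powr_powr)
          also have "(u (norm y) powr (-1)) powr p = u (norm y) powr (-p)" unfolding powr_powr by simp
          finally show "ennreal (\<phi> y powr p * \<nu> y) = ennreal (K z y * G y)"
            by (simp add: G_def mult_ac)
        qed
        then show "(\<integral>\<^sup>+y. ennreal (\<phi> y powr p * \<nu> y) \<partial>disc_area) \<le> ennreal i" using i by simp
        have "(\<integral>\<^sup>+y. ennreal (\<psi> y powr q * \<sigma> y) \<partial>disc_area) = (\<integral>\<^sup>+y. ennreal (K z y * (u (norm y) powr q * \<sigma> y)) \<partial>disc_area)"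
        proof (rule nn_integral_cong)
          fix y assume "y \<in> space disc_area"
          then have "0 < u (norm y)" by (intro uvpos(1)) auto
          then show "ennreal (\<psi> y powr q * \<sigma> y) = ennreal (K z y * (u (norm y) powr q * \<sigma> y))"
            using q K0 by (simp add: \<psi>_def powr_mult powr_powr mult_ac)
        qed
        then show "(\<integral>\<^sup>+y. ennreal (\<psi> y powr q * \<sigma> y) \<partial>disc_area) \<le> ennreal (C1 * v (norm z) powr q)" using 1[OF z] by simp
      qed (use i C in auto)
      finally have "enn2real (\<integral>\<^sup>+y. ennreal (K z y * f y * \<omega> y) \<partial>disc_area) \<le> i powr (1/p) * (C1 * v (norm z) powr q) powr (1/q)"
        using i C by (intro enn2real_leI) auto
      then have "enn2real (\<integral>\<^sup>+y. ennreal (K z y * f y * \<omega> y) \<partial>disc_area) powr p \<le> (i powr (1/p) * (C1 * v (norm z) powr q) powr (1/q)) powr p"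
        using p by (intro powr_mono2) auto
      also have "\<dots> = i * (C1 powr (p/q) * v (norm z) powr p)"
        using p q i C v0 by (simp add: powr_mult powr_powr)
      finally have "enn2real (\<integral>\<^sup>+y. ennreal (K z y * f y * \<omega> y) \<partial>disc_area) powr p * \<nu> z \<le> i * (C1 powr (p/q) * v (norm z) powr p) * \<nu> z"
        using n0 by (intro mult_right_mono) auto
      also have "\<dots> = C1 powr (p/q) * ((v (norm z) powr p * \<nu> z) * i)" by (simp only: mult_ac)
      finally have "ennreal (enn2real (\<integral>\<^sup>+y. ennreal (K z y * f y * \<omega> y) \<partial>disc_area) powr p * \<nu> z) \<le> ennreal (C1 powr (p/q) * ((v (norm z) powr p * \<nu> z) * i))"
        by (rule ennreal_leI)
      also have "\<dots> = ennreal (C1 powr (p/q)) * (ennreal (v (norm z) powr p * \<nu> z) * I z)"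
        using i n0 by (simp add: ennreal_mult)
      finally show ?thesis .
    qed
  qed simp
  have Km: "(\<lambda>(z, y). ennreal (K z y * G y) * ennreal (v (norm z) powr p * \<nu> z)) \<in> borel_measurable (disc_area \<Otimes>\<^sub>M disc_area)"
    by measurable
  have Im [measurable]: "I \<in> borel_measurable disc_area" unfolding I_def by measurable
  have "(\<integral>\<^sup>+z. ennreal (enn2real (\<integral>\<^sup>+y. ennreal (K z y * f y * \<omega> y) \<partial>disc_area) powr p * \<nu> z) \<partial>disc_area)
     \<le> (\<integral>\<^sup>+z. ennreal (C1 powr (p/q)) * (ennreal (v (norm z) powr p * \<nu> z) * I z) \<partial>disc_area)"
    by (rule nn_integral_mono) (simp add: pt)
  also have "\<dots> = ennreal (C1 powr (p/q)) * (\<integral>\<^sup>+z. ennreal (v (norm z) powr p * \<nu> z) * I z \<partial>disc_area)"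
    by (rule nn_integral_cmult) measurable
  also have "(\<integral>\<^sup>+z. ennreal (v (norm z) powr p * \<nu> z) * I z \<partial>disc_area)
     = (\<integral>\<^sup>+z. (\<integral>\<^sup>+y. ennreal (K z y * G y) * ennreal (v (norm z) powr p * \<nu> z) \<partial>disc_area) \<partial>disc_area)"
  proof (rule nn_integral_cong)
    fix z assume "z \<in> space disc_area"
    then have [measurable]: "K z \<in> borel_measurable disc_area" using Kz by simp
    have "(\<integral>\<^sup>+y. ennreal (K z y * G y) * ennreal (v (norm z) powr p * \<nu> z) \<partial>disc_area) = I z * ennreal (v (norm z) powr p * \<nu> z)"
      unfolding I_def by (rule nn_integral_multc) measurable
    then show "ennreal (v (norm z) powr p * \<nu> z) * I z = (\<integral>\<^sup>+y. ennreal (K z y * G y) * ennreal (v (norm z) powr p * \<nu> z) \<partial>disc_area)"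
      by (simp add: mult.commute)
  qed
  also have "\<dots> = (\<integral>\<^sup>+y. (\<integral>\<^sup>+z. ennreal (K z y * G y) * ennreal (v (norm z) powr p * \<nu> z) \<partial>disc_area) \<partial>disc_area)"
    by (rule P2.Fubini'[OF Km, symmetric])
  also have "\<dots> \<le> (\<integral>\<^sup>+y. ennreal C2 * ennreal (f y powr p * \<nu> y) \<partial>disc_area)"
  proof (rule nn_integral_mono)
    fix y assume "y \<in> space disc_area"
    then have y: "norm y < 1" by simp
    have u0: "0 < u (norm y)" by (rule uvpos(1)) (use y in auto)
    have [measurable]: "(\<lambda>z. K z y) \<in> borel_measurable disc_area"
      using measurable_Pair1[OF K, of y] y by simp
    have "(\<integral>\<^sup>+z. ennreal (K z y * G y) * ennreal (v (norm z) powr p * \<nu> z) \<partial>disc_area)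
       = (\<integral>\<^sup>+z. ennreal (G y) * ennreal (K z y * (v (norm z) powr p * \<nu> z)) \<partial>disc_area)"
    proof (rule nn_integral_cong)
      fix z assume "z \<in> space disc_area"
      then have n0: "0 \<le> \<nu> z" using radial_weight_nonneg[OF nu] by simp
      have "ennreal (K z y * G y) * ennreal (v (norm z) powr p * \<nu> z) = ennreal ((K z y * G y) * (v (norm z) powr p * \<nu> z))"
        using K0 G0[OF y] n0 by (intro ennreal_mult[symmetric] mult_nonneg_nonneg) auto
      also have "(K z y * G y) * (v (norm z) powr p * \<nu> z) = G y * (K z y * (v (norm z) powr p * \<nu> z))" by (simp only: mult_ac)
      also have "ennreal \<dots> = ennreal (G y) * ennreal (K z y * (v (norm z) powr p * \<nu> z))"
        using K0 G0[OF y] n0 by (intro ennreal_mult mult_nonneg_nonneg) auto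
      finally show "ennreal (K z y * G y) * ennreal (v (norm z) powr p * \<nu> z) = ennreal (G y) * ennreal (K z y * (v (norm z) powr p * \<nu> z))" .
    qed
    also have "\<dots> = ennreal (G y) * (\<integral>\<^sup>+z. ennreal (K z y * (v (norm z) powr p * \<nu> z)) \<partial>disc_area)"
      by (rule nn_integral_cmult) measurable
    also have "\<dots> \<le> ennreal (G y) * ennreal (C2 * u (norm y) powr p)" by (intro mult_left_mono 2 y) auto
    also have "\<dots> = ennreal (G y * (C2 * u (norm y) powr p))" using C G0[OF y] by (intro ennreal_mult[symmetric]) auto
    also have "G y * (C2 * u (norm y) powr p) = C2 * (f y powr p * \<nu> y) * (u (norm y) powr (-p) * u (norm y) powr p)"
      by (simp add: G_def mult_ac)
    also have "u (norm y) powr (-p) * u (norm y) powr p = 1" using u0 by (simp flip: powr_add)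
    also have "ennreal (C2 * (f y powr p * \<nu> y) * 1) = ennreal C2 * ennreal (f y powr p * \<nu> y)"
      using C radial_weight_nonneg[OF nu y] by (simp add: ennreal_mult)
    finally show "(\<integral>\<^sup>+z. ennreal (K z y * G y) * ennreal (v (norm z) powr p * \<nu> z) \<partial>disc_area) \<le> ennreal C2 * ennreal (f y powr p * \<nu> y)" .
  qed
  also have "\<dots> = ennreal C2 * (\<integral>\<^sup>+y. ennreal (f y powr p * \<nu> y) \<partial>disc_area)"
    by (rule nn_integral_cmult) measurable
  finally have "(\<integral>\<^sup>+z. ennreal (enn2real (\<integral>\<^sup>+y. ennreal (K z y * f y * \<omega> y) \<partial>disc_area) powr p * \<nu> z) \<partial>disc_area)
     \<le> ennreal (C1 powr (p/q)) * (ennreal C2 * (\<integral>\<^sup>+y. ennreal (f y powr p * \<nu> y) \<partial>disc_area))"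
    by (simp add: mult_left_mono)
  then show ?thesis using C by (simp add: ennreal_mult mult.assoc)
qed

text \<open>Hoelder against the constant 1, as \<sigma> has finite mass. Since each kernel section
  is bounded, this yields the well-definedness of the maximal projection.\<close>

lemma nn_integral_om_finite:
  assumes f: "f \<in> borel_measurable disc_area" "\<And>y. 0 \<le> f y"
    and fin: "(\<integral>\<^sup>+y. ennreal (f y powr p * \<nu> y) \<partial>disc_area) < \<infinity>"
  shows "(\<integral>\<^sup>+y. ennreal (f y * \<omega> y) \<partial>disc_area) < \<infinity>"
proof -
  have "(\<integral>\<^sup>+y. ennreal (f y * 1 * \<omega> y) \<partial>disc_area) \<le> ennreal (enn2real (\<integral>\<^sup>+y. ennreal (f y powr p * \<nu> y) \<partial>disc_area) powr (1/p) * enn2real (\<integral>\<^sup>+y. ennreal (\<sigma> y) \<partial>disc_area) powr (1/q))"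
    by (rule Hoelder)
       (use f fin radial_weight_nn_integral_finite[OF sigma] in \<open>simp_all add: ennreal_enn2real_if less_top\<close>)
  then show ?thesis by (simp add: le_less_trans)
qed

text \<open>The regularity transferred to \<omega> and \<sigma> provides the circle mean bound of
  the kernel and, via \<open>swap\<close>, Schur pairs for both orders of the weights; each half of
  the kernel is tested with its own pair.\<close>

lemma maximal_operator_bound:
  assumes A: "A_bound A" and d: "tail_doubling (wtail \<omega>)"
    and dn: "tail_doubling (wtail \<nu>)" and vn: "tail_vanishing (wtail \<nu>)"
  shows "\<exists>C>0. \<forall>f\<in>borel_measurable disc_area. (\<forall>y. 0 \<le> f y) \<longrightarrow> (\<integral>\<^sup>+y. ennreal (f y powr p * \<nu> y) \<partial>disc_area) < \<infinity> \<longrightarrow>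
    (\<integral>\<^sup>+z. ennreal (enn2real (\<integral>\<^sup>+y. ennreal (norm (kser \<omega> (cnj z * y)) * f y * \<omega> y) \<partial>disc_area) powr p * \<nu> z) \<partial>disc_area)
    \<le> ennreal C * (\<integral>\<^sup>+y. ennreal (f y powr p * \<nu> y) \<partial>disc_area)"
proof -
  interpret S: weight_triple q p \<sigma> \<nu> \<omega> by (rule swap)
  note vo = A_bound_consequences(1)[OF A d vn] and ds = A_bound_consequences(2)[OF A d vn] and vs = A_bound_consequences(3)[OF A d vn]
  have A': "S.A_bound A" using A by (simp add: S.A_bound_def A_bound_def mult.commute)
  obtain C1 u v where P1: "Schur_pair p q \<nu> \<sigma> \<omega> C1 u v" using Schur_pair_exists[OF A dn vs] by blast
  obtain C2 u' v' where P2: "Schur_pair q p \<sigma> \<nu> \<omega> C2 u' v'" using S.Schur_pair_exists[OF A' ds vn] by blast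
  obtain C0 where C0: "0 < C0" and J: "\<And>x. 0 \<le> x \<Longrightarrow> x < 1 \<Longrightarrow> (\<integral>\<^sup>+u. ennreal (norm (kser \<omega> (of_real x * sgn u))) \<partial>disc_area) \<le> ennreal (C0 / wtail \<omega> x)"
    using kser_mean_bound[OF om d vo] by auto
  note m = kernel_measurable(1)[of \<omega>] kernel_measurable(2,3)
  define k where "k z y = norm (kser \<omega> (cnj z * y))" for z y
  \<comment> \<open>The diagonal |z| = |y| belongs to both halves, so \<open>k\<close> is at most
    the sum of \<open>K1\<close> and \<open>K2\<close>.\<close>
  define K1 where "K1 z y = k z y * (if norm z \<le> norm y then 1 else 0)" for z y
  define K2 where "K2 z y = k z y * (if norm y \<le> norm z then 1 else 0)" for z y
  have k0: "0 \<le> k z y" for z y by (simp add: k_def)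
  have K0: "0 \<le> K1 z y" "0 \<le> K2 z y" for z y by (simp_all add: K1_def K2_def k_def)
  have mk: "(\<lambda>(z, y). k z y) \<in> borel_measurable (disc_area \<Otimes>\<^sub>M disc_area)"
    using measurable_compose[OF m(1) borel_measurable_norm] by (simp add: k_def case_prod_beta')
  have mK: "(\<lambda>(z, y). K1 z y) \<in> borel_measurable (disc_area \<Otimes>\<^sub>M disc_area)" "(\<lambda>(z, y). K2 z y) \<in> borel_measurable (disc_area \<Otimes>\<^sub>M disc_area)"
  proof -
    have [measurable]: "(\<lambda>p. k (fst p) (snd p)) \<in> borel_measurable (disc_area \<Otimes>\<^sub>M disc_area)"
      "(\<lambda>p::complex \<times> complex. norm (fst p)) \<in> borel_measurable (disc_area \<Otimes>\<^sub>M disc_area)"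
      "(\<lambda>p::complex \<times> complex. norm (snd p)) \<in> borel_measurable (disc_area \<Otimes>\<^sub>M disc_area)"
      using mk m(2,3) by (simp_all only: case_prod_beta')
    have "(\<lambda>p. k (fst p) (snd p) * (if norm (fst p) \<le> norm (snd p) then 1 else 0)) \<in> borel_measurable (disc_area \<Otimes>\<^sub>M disc_area)"
      "(\<lambda>p. k (fst p) (snd p) * (if norm (snd p) \<le> norm (fst p) then 1 else 0)) \<in> borel_measurable (disc_area \<Otimes>\<^sub>M disc_area)"
      by measurable
    then show "(\<lambda>(z, y). K1 z y) \<in> borel_measurable (disc_area \<Otimes>\<^sub>M disc_area)" "(\<lambda>(z, y). K2 z y) \<in> borel_measurable (disc_area \<Otimes>\<^sub>M disc_area)"
      by (simp_all only: K1_def K2_def case_prod_beta')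
  qed
  have ksym: "k z y = norm (kser \<omega> (cnj y * z))" if "norm z < 1" "norm y < 1" for z y
  proof -
    have "norm (cnj z * y) < 1" using that by (intro norm_mult_less_1) auto
    from kser_cnj[OF om this] have "kser \<omega> (cnj y * z) = cnj (kser \<omega> (cnj z * y))" by (simp add: mult.commute)
    then show ?thesis by (simp add: k_def)
  qed
  have hm: "(\<lambda>y. ennreal (g (norm y) powr s * w y)) \<in> borel_measurable disc_area"
    and hr: "norm c = 1 \<Longrightarrow> norm z < 1 \<Longrightarrow> ennreal (g (norm (c * z)) powr s * w (c * z)) = ennreal (g (norm z) powr s * w z)"
    if g: "g \<in> borel_measurable borel" and w: "radial_weight w" for g :: "real \<Rightarrow> real" and w s c z
  proof -
    have 1: "(\<lambda>y::complex. g (norm y)) \<in> borel_measurable disc_area"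
      by (intro borel_measurable_disc_area measurable_compose[OF _ g]) measurable
    show "(\<lambda>y. ennreal (g (norm y) powr s * w y)) \<in> borel_measurable disc_area"
      using 1 radial_weight_measurable[OF w] by measurable
    show "norm c = 1 \<Longrightarrow> norm z < 1 \<Longrightarrow> ennreal (g (norm (c * z)) powr s * w (c * z)) = ennreal (g (norm z) powr s * w z)"
      using radial_weight_rotation[OF w] by (simp add: norm_mult)
  qed
  \<comment> \<open>Over |y| \<ge> |a| the reciprocal tail at |a| comes out of the integral and
    cancels against the tail in the first condition of a Schur pair. In \<open>estB\<close>, over
    |y| \<le> |a|, the reciprocal tail at |y| stays inside, as in the second condition.\<close>
  have estA: "(\<integral>\<^sup>+y. ennreal ((norm (kser \<omega> (a * y)) * (if norm a \<le> norm y then 1 else 0)) * (g (norm y) powr s * w y)) \<partial>disc_area) \<le> ennreal (C0 * C * V)"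
    if g: "g \<in> borel_measurable borel" and w: "radial_weight w" and a: "norm a < 1" and CV: "0 \<le> C" "0 \<le> V"
      and le: "(\<integral>\<^sup>+z. ennreal (g (norm z) powr s * w z) * indicator {z. norm a \<le> norm z} z \<partial>disc_area) \<le> ennreal (C * (wtail \<omega> (norm a) * V))"
    for g w a s C V
  proof -
    have "(\<integral>\<^sup>+y. ennreal ((norm (kser \<omega> (a * y)) * (if norm a \<le> norm y then 1 else 0)) * (g (norm y) powr s * w y)) \<partial>disc_area)
       = (\<integral>\<^sup>+y. ennreal (norm (kser \<omega> (a * y))) * (ennreal (g (norm y) powr s * w y) * indicator {z. norm a \<le> norm z} y) \<partial>disc_area)"
      by (intro nn_integral_cong) (simp add: ennreal_mult' indicator_def)
    also have "\<dots> \<le> ennreal (C0 / wtail \<omega> (norm a)) * (\<integral>\<^sup>+z. ennreal (g (norm z) powr s * w z) * indicator {z. norm a \<le> norm z} z \<partial>disc_area)"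
      using C0 by (intro kernel_average_bound(1)[OF om _ J hm[OF g w] hr[OF g w] a]) auto
    also have "\<dots> \<le> ennreal (C0 / wtail \<omega> (norm a)) * ennreal (C * (wtail \<omega> (norm a) * V))"
      by (intro mult_left_mono le) simp
    also have "\<dots> = ennreal (C0 * C * V)"
      using C0 CV wtail_pos[OF om a] by (subst ennreal_mult[symmetric]) (auto simp: field_simps)
    finally show ?thesis .
  qed
  have estB: "(\<integral>\<^sup>+y. ennreal ((norm (kser \<omega> (a * y)) * (if norm y \<le> norm a then 1 else 0)) * (g (norm y) powr s * w y)) \<partial>disc_area) \<le> ennreal (C0 * C * V)"
    if g: "g \<in> borel_measurable borel" and w: "radial_weight w" and a: "norm a < 1" and CV: "0 \<le> C" "0 \<le> V"
      and le: "(\<integral>\<^sup>+z. ennreal (1 / wtail \<omega> (norm z)) * (ennreal (g (norm z) powr s * w z) * indicator {z. norm z \<le> norm a} z) \<partial>disc_area) \<le> ennreal (C * V)"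
    for g w a s C V
  proof -
    have "(\<integral>\<^sup>+y. ennreal ((norm (kser \<omega> (a * y)) * (if norm y \<le> norm a then 1 else 0)) * (g (norm y) powr s * w y)) \<partial>disc_area)
       = (\<integral>\<^sup>+y. ennreal (norm (kser \<omega> (a * y))) * (ennreal (g (norm y) powr s * w y) * indicator {z. norm z \<le> norm a} y) \<partial>disc_area)"
      by (intro nn_integral_cong) (simp add: ennreal_mult' indicator_def)
    also have "\<dots> \<le> ennreal C0 * (\<integral>\<^sup>+z. ennreal (1 / wtail \<omega> (norm z)) * (ennreal (g (norm z) powr s * w z) * indicator {z. norm z \<le> norm a} z) \<partial>disc_area)"
      using C0 by (intro kernel_average_bound(2)[OF om _ J hm[OF g w] hr[OF g w] a]) auto
    also have "\<dots> \<le> ennreal C0 * ennreal (C * V)" by (intro mult_left_mono le) simp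
    also have "\<dots> = ennreal (C0 * C * V)"
      using C0 CV by (subst ennreal_mult[symmetric]) (auto simp: mult.assoc)
    finally show ?thesis .
  qed
  have D1: "u \<in> borel_measurable borel" "v \<in> borel_measurable borel" "0 < C1"
    "\<And>r. 0 \<le> r \<Longrightarrow> r < 1 \<Longrightarrow> 0 < u r" "\<And>r. 0 \<le> r \<Longrightarrow> r < 1 \<Longrightarrow> 0 < v r"
    "\<And>r. 0 \<le> r \<Longrightarrow> r < 1 \<Longrightarrow> (\<integral>\<^sup>+z. ennreal (u (norm z) powr q * \<sigma> z) * indicator {z. r \<le> norm z} z \<partial>disc_area) \<le> ennreal (C1 * (wtail \<omega> r * v r powr q))"
    "\<And>r. 0 \<le> r \<Longrightarrow> r < 1 \<Longrightarrow> (\<integral>\<^sup>+z. ennreal (1 / wtail \<omega> (norm z)) * (ennreal (v (norm z) powr p * \<nu> z) * indicator {z. norm z \<le> r} z) \<partial>disc_area) \<le> ennreal (C1 * u r powr p)"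
    using P1 unfolding Schur_pair_def by simp_all
  have D2: "u' \<in> borel_measurable borel" "v' \<in> borel_measurable borel" "0 < C2"
    "\<And>r. 0 \<le> r \<Longrightarrow> r < 1 \<Longrightarrow> 0 < u' r" "\<And>r. 0 \<le> r \<Longrightarrow> r < 1 \<Longrightarrow> 0 < v' r"
    "\<And>r. 0 \<le> r \<Longrightarrow> r < 1 \<Longrightarrow> (\<integral>\<^sup>+z. ennreal (u' (norm z) powr p * \<nu> z) * indicator {z. r \<le> norm z} z \<partial>disc_area) \<le> ennreal (C2 * (wtail \<omega> r * v' r powr p))"
    "\<And>r. 0 \<le> r \<Longrightarrow> r < 1 \<Longrightarrow> (\<integral>\<^sup>+z. ennreal (1 / wtail \<omega> (norm z)) * (ennreal (v' (norm z) powr q * \<sigma> z) * indicator {z. norm z \<le> r} z) \<partial>disc_area) \<le> ennreal (C2 * u' r powr q)"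
    using P2 unfolding Schur_pair_def by simp_all
  have swapK: "(\<integral>\<^sup>+z. ennreal (K z y * h z) \<partial>disc_area) = (\<integral>\<^sup>+z. ennreal ((norm (kser \<omega> (cnj y * z)) * i z y) * h z) \<partial>disc_area)"
    if y: "norm y < 1" and K: "\<And>z. K z y = k z y * i z y" for K i :: "complex \<Rightarrow> complex \<Rightarrow> real" and h y
    by (intro nn_integral_cong) (simp add: K ksym y)
  define B1 where "B1 = (C0 * C1) powr (p/q) * (C0 * C1)"
  define B2 where "B2 = (C0 * C2) powr (p/q) * (C0 * C2)"
  have B: "0 < B1" "0 < B2" using C0 D1(3) D2(3) by (simp_all add: B1_def B2_def)
  have T1: "(\<integral>\<^sup>+z. ennreal (enn2real (\<integral>\<^sup>+y. ennreal (K1 z y * f y * \<omega> y) \<partial>disc_area) powr p * \<nu> z) \<partial>disc_area)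
      \<le> ennreal B1 * (\<integral>\<^sup>+y. ennreal (f y powr p * \<nu> y) \<partial>disc_area)"
    if f: "f \<in> borel_measurable disc_area" "\<And>y. 0 \<le> f y" for f
    unfolding B1_def
  proof (rule Schur_test[OF mK(1) K0(1) D1(1,2,4,5) _ _ _ _ f])
    show "(\<integral>\<^sup>+y. ennreal (K1 z y * (u (norm y) powr q * \<sigma> y)) \<partial>disc_area) \<le> ennreal (C0 * C1 * v (norm z) powr q)" if "norm z < 1" for z
      using estA[OF D1(1) sigma, of "cnj z" C1 "v (norm z) powr q" q] D1(3) D1(6)[of "norm z"] that
      by (simp add: K1_def k_def)
    show "(\<integral>\<^sup>+z. ennreal (K1 z y * (v (norm z) powr p * \<nu> z)) \<partial>disc_area) \<le> ennreal (C0 * C1 * u (norm y) powr p)" if "norm y < 1" for y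
      unfolding swapK[OF that, of K1 "\<lambda>z y. if norm z \<le> norm y then 1 else 0", OF K1_def]
      using estB[OF D1(2) nu, of "cnj y" C1 "u (norm y) powr p" p] D1(3) D1(7)[of "norm y"] that by simp
  qed (use C0 D1(3) in auto)
  have T2: "(\<integral>\<^sup>+z. ennreal (enn2real (\<integral>\<^sup>+y. ennreal (K2 z y * f y * \<omega> y) \<partial>disc_area) powr p * \<nu> z) \<partial>disc_area)
      \<le> ennreal B2 * (\<integral>\<^sup>+y. ennreal (f y powr p * \<nu> y) \<partial>disc_area)"
    if f: "f \<in> borel_measurable disc_area" "\<And>y. 0 \<le> f y" for f
    unfolding B2_def
  \<comment> \<open>Here v' takes the part of u and u' that of v, because the pair belongs to the
    exchanged triple.\<close>
  proof (rule Schur_test[OF mK(2) K0(2) D2(2,1,5,4) _ _ _ _ f])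
    show "(\<integral>\<^sup>+y. ennreal (K2 z y * (v' (norm y) powr q * \<sigma> y)) \<partial>disc_area) \<le> ennreal (C0 * C2 * u' (norm z) powr q)" if "norm z < 1" for z
      using estB[OF D2(2) sigma, of "cnj z" C2 "u' (norm z) powr q" q] D2(3) D2(7)[of "norm z"] that
      by (simp add: K2_def k_def)
    show "(\<integral>\<^sup>+z. ennreal (K2 z y * (u' (norm z) powr p * \<nu> z)) \<partial>disc_area) \<le> ennreal (C0 * C2 * v' (norm y) powr p)" if "norm y < 1" for y
      unfolding swapK[OF that, of K2 "\<lambda>z y. if norm y \<le> norm z then 1 else 0", OF K2_def]
      using estA[OF D2(1) nu, of "cnj y" C2 "v' (norm y) powr p" p] D2(3) D2(6)[of "norm y"] that by simp
  qed (use C0 D2(3) in auto)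
  have "(\<integral>\<^sup>+z. ennreal (enn2real (\<integral>\<^sup>+y. ennreal (k z y * f y * \<omega> y) \<partial>disc_area) powr p * \<nu> z) \<partial>disc_area)
      \<le> ennreal (2 powr p * (B1 + B2)) * (\<integral>\<^sup>+y. ennreal (f y powr p * \<nu> y) \<partial>disc_area)"
    if f: "f \<in> borel_measurable disc_area" "\<And>y. 0 \<le> f y" and fin: "(\<integral>\<^sup>+y. ennreal (f y powr p * \<nu> y) \<partial>disc_area) < \<infinity>" for f
  proof -
    note f(1)[measurable] radial_weight_measurable[OF om, measurable] radial_weight_measurable[OF nu, measurable] mK[measurable] mk[measurable]
    define F1 where "F1 z = (\<integral>\<^sup>+y. ennreal (K1 z y * f y * \<omega> y) \<partial>disc_area)" for z
    define F2 where "F2 z = (\<integral>\<^sup>+y. ennreal (K2 z y * f y * \<omega> y) \<partial>disc_area)" for z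
    have [measurable]: "F1 \<in> borel_measurable disc_area" "F2 \<in> borel_measurable disc_area"
      unfolding F1_def F2_def by measurable
    have pt: "ennreal (enn2real (\<integral>\<^sup>+y. ennreal (k z y * f y * \<omega> y) \<partial>disc_area) powr p * \<nu> z)
       \<le> ennreal (2 powr p) * (ennreal (enn2real (F1 z) powr p * \<nu> z) + ennreal (enn2real (F2 z) powr p * \<nu> z))"
      if z: "norm z < 1" for z
    proof -
      note [measurable] = measurable_disc_section[OF mK(1) z] measurable_disc_section[OF mK(2) z] measurable_disc_section[OF mk z]
      have n0: "0 \<le> \<nu> z" by (rule radial_weight_nonneg[OF nu z])
      define Bz where "Bz = (\<Sum>n. kcoeff \<omega> n * norm (cnj z) ^ n)"
      have kb: "k z y \<le> Bz" if "norm y < 1" for y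
        unfolding k_def Bz_def by (rule kser_bound[OF om]) (use z that in auto)
      \<comment> \<open>\<open>enn2real\<close> is monotone and additive only on finite values, so
        both halves must be finite before they are added.\<close>
      have fink: "(\<integral>\<^sup>+y. ennreal (K z y * f y * \<omega> y) \<partial>disc_area) < \<infinity>"
        if Kk: "\<And>y. K z y \<le> k z y" for K :: "complex \<Rightarrow> complex \<Rightarrow> real"
      proof -
        have Bz0: "0 \<le> Bz" using kb[of 0] k0[of z 0] by simp
        have "(\<integral>\<^sup>+y. ennreal (K z y * f y * \<omega> y) \<partial>disc_area) \<le> (\<integral>\<^sup>+y. ennreal Bz * ennreal (f y * \<omega> y) \<partial>disc_area)"
        proof (rule nn_integral_mono)
          fix y assume "y \<in> space disc_area"
          then have y: "norm y < 1" by simp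
          have "K z y * (f y * \<omega> y) \<le> Bz * (f y * \<omega> y)"
            using f(2)[of y] radial_weight_nonneg[OF om y] kb[OF y] Kk[of y] by (intro mult_right_mono) auto
          then show "ennreal (K z y * f y * \<omega> y) \<le> ennreal Bz * ennreal (f y * \<omega> y)"
            using Bz0 f(2)[of y] radial_weight_nonneg[OF om y] by (subst ennreal_mult[symmetric]) (auto simp: mult.assoc intro!: ennreal_leI)
        qed
        also have "\<dots> = ennreal Bz * (\<integral>\<^sup>+y. ennreal (f y * \<omega> y) \<partial>disc_area)" by (rule nn_integral_cmult) measurable
        also have "\<dots> < \<infinity>" using nn_integral_om_finite[OF f fin] by (simp add: ennreal_mult_less_top)
        finally show ?thesis .
      qed
      have fF: "F1 z < \<infinity>" "F2 z < \<infinity>"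
        unfolding F1_def F2_def by (rule fink, simp add: K1_def K2_def k0)+
      have "(\<integral>\<^sup>+y. ennreal (k z y * f y * \<omega> y) \<partial>disc_area) \<le> (\<integral>\<^sup>+y. ennreal (K1 z y * f y * \<omega> y) + ennreal (K2 z y * f y * \<omega> y) \<partial>disc_area)"
      proof (rule nn_integral_mono)
        fix y
        show "ennreal (k z y * f y * \<omega> y) \<le> ennreal (K1 z y * f y * \<omega> y) + ennreal (K2 z y * f y * \<omega> y)"
          by (cases "norm z \<le> norm y") (simp_all add: K1_def K2_def)
      qed
      also have "\<dots> = F1 z + F2 z" unfolding F1_def F2_def by (rule nn_integral_add) measurable
      finally have "enn2real (\<integral>\<^sup>+y. ennreal (k z y * f y * \<omega> y) \<partial>disc_area) \<le> enn2real (F1 z + F2 z)"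
        using fF by (intro enn2real_mono) auto
      also have "\<dots> = enn2real (F1 z) + enn2real (F2 z)" using fF by (simp add: enn2real_plus)
      finally have "enn2real (\<integral>\<^sup>+y. ennreal (k z y * f y * \<omega> y) \<partial>disc_area) powr p \<le> (enn2real (F1 z) + enn2real (F2 z)) powr p"
        using p by (intro powr_mono2) auto
      \<comment> \<open>A crude substitute for convexity: the sum is at most twice the maximum,
        whose p-th power is at most the sum of the p-th powers.\<close>
      also have "\<dots> \<le> (2 * max (enn2real (F1 z)) (enn2real (F2 z))) powr p"
        using p by (intro powr_mono2) auto
      also have "\<dots> = 2 powr p * max (enn2real (F1 z)) (enn2real (F2 z)) powr p"
        by (simp add: powr_mult le_max_iff_disj)
      also have "\<dots> \<le> 2 powr p * (enn2real (F1 z) powr p + enn2real (F2 z) powr p)"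
        by (intro mult_left_mono) (auto simp: max_def)
      finally have "enn2real (\<integral>\<^sup>+y. ennreal (k z y * f y * \<omega> y) \<partial>disc_area) powr p * \<nu> z \<le> 2 powr p * (enn2real (F1 z) powr p + enn2real (F2 z) powr p) * \<nu> z"
        using n0 by (rule mult_right_mono)
      also have "\<dots> = 2 powr p * (enn2real (F1 z) powr p * \<nu> z + enn2real (F2 z) powr p * \<nu> z)" by (simp add: algebra_simps)
      finally have "ennreal (enn2real (\<integral>\<^sup>+y. ennreal (k z y * f y * \<omega> y) \<partial>disc_area) powr p * \<nu> z) \<le> ennreal (2 powr p * (enn2real (F1 z) powr p * \<nu> z + enn2real (F2 z) powr p * \<nu> z))"
        by (rule ennreal_leI)
      also have "\<dots> = ennreal (2 powr p) * (ennreal (enn2real (F1 z) powr p * \<nu> z) + ennreal (enn2real (F2 z) powr p * \<nu> z))"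
        using n0 by (simp add: ennreal_mult)
      finally show ?thesis .
    qed
    have "(\<integral>\<^sup>+z. ennreal (enn2real (\<integral>\<^sup>+y. ennreal (k z y * f y * \<omega> y) \<partial>disc_area) powr p * \<nu> z) \<partial>disc_area)
      \<le> (\<integral>\<^sup>+z. ennreal (2 powr p) * (ennreal (enn2real (F1 z) powr p * \<nu> z) + ennreal (enn2real (F2 z) powr p * \<nu> z)) \<partial>disc_area)"
      by (rule nn_integral_mono) (simp add: pt)
    also have "\<dots> = ennreal (2 powr p) * (\<integral>\<^sup>+z. ennreal (enn2real (F1 z) powr p * \<nu> z) + ennreal (enn2real (F2 z) powr p * \<nu> z) \<partial>disc_area)"
      by (rule nn_integral_cmult) measurable
    also have "(\<integral>\<^sup>+z. ennreal (enn2real (F1 z) powr p * \<nu> z) + ennreal (enn2real (F2 z) powr p * \<nu> z) \<partial>disc_area) =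
      (\<integral>\<^sup>+z. ennreal (enn2real (F1 z) powr p * \<nu> z) \<partial>disc_area) + (\<integral>\<^sup>+z. ennreal (enn2real (F2 z) powr p * \<nu> z) \<partial>disc_area)"
      by (rule nn_integral_add) measurable
    finally have "(\<integral>\<^sup>+z. ennreal (enn2real (\<integral>\<^sup>+y. ennreal (k z y * f y * \<omega> y) \<partial>disc_area) powr p * \<nu> z) \<partial>disc_area)
      \<le> ennreal (2 powr p) * ((\<integral>\<^sup>+z. ennreal (enn2real (F1 z) powr p * \<nu> z) \<partial>disc_area) + (\<integral>\<^sup>+z. ennreal (enn2real (F2 z) powr p * \<nu> z) \<partial>disc_area))" .
    also have "\<dots> \<le> ennreal (2 powr p) * (ennreal B1 * (\<integral>\<^sup>+y. ennreal (f y powr p * \<nu> y) \<partial>disc_area) + ennreal B2 * (\<integral>\<^sup>+y. ennreal (f y powr p * \<nu> y) \<partial>disc_area))"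
      unfolding F1_def F2_def by (intro mult_left_mono add_mono T1 T2 f) simp
    also have "\<dots> = ennreal (2 powr p * (B1 + B2)) * (\<integral>\<^sup>+y. ennreal (f y powr p * \<nu> y) \<partial>disc_area)"
      using B by (simp add: ennreal_mult ennreal_plus distrib_right mult.assoc)
    finally show ?thesis .
  qed
  moreover have "0 < 2 powr p * (B1 + B2)" using B by simp
  ultimately show ?thesis unfolding k_def by blast
qed

end

section \<open>The dual weight\<close>

text \<open>The real-valued substitute for \<open>dual_weight\<close>: the two agree almost everywhere as soon as \<open>dual_weight\<close> is
  integrable, because \<open>\<omega>\<close> then vanishes almost everywhere on \<open>\<nu> = 0\<close>.\<close>

definition sdual :: "real \<Rightarrow> (complex \<Rightarrow> real) \<Rightarrow> (complex \<Rightarrow> real) \<Rightarrow> complex \<Rightarrow> real" where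
  "sdual p \<omega> \<nu> z = (if \<nu> z = 0 then 0 else (\<omega> z / \<nu> z powr (1 / p)) powr conj_exp p)"

lemma conj_exp_props:
  assumes "1 < p" shows "1 < conj_exp p" "1 / p + 1 / conj_exp p = 1" "p * (conj_exp p - 1) = conj_exp p"
  using assms by (simp_all add: conj_exp_def field_simps)

lemma dual_weight_radial_fun:
  assumes w: "radial_weight \<omega>" and n: "radial_weight \<nu>"
  shows "radial_fun (dual_weight p \<omega> \<nu>)"
proof (rule radial_funI)
  note radial_weight_measurable[OF w, measurable] radial_weight_measurable[OF n, measurable]
  show "dual_weight p \<omega> \<nu> \<in> borel_measurable disc_area"
    unfolding dual_weight_def[abs_def] by measurable
  fix z :: complex assume z: "norm z < 1"
  have "\<omega> (of_real (norm z)) = \<omega> z" "\<nu> (of_real (norm z)) = \<nu> z"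
    using bspec[OF radial_weightD(2)[OF w], of z] bspec[OF radial_weightD(2)[OF n], of z] z by simp_all
  then show "dual_weight p \<omega> \<nu> (of_real (norm z)) = dual_weight p \<omega> \<nu> z" by (simp add: dual_weight_def)
qed

lemma AE_dual_weight:
  assumes "AE z in disc_area. \<nu> z = 0 \<longrightarrow> \<omega> z = 0"
  shows "AE z in disc_area. dual_weight p \<omega> \<nu> z = ennreal (sdual p \<omega> \<nu> z)"
  using assms by eventually_elim (simp add: dual_weight_def sdual_def)

text \<open>\<open>dual_weight\<close> is infinite precisely where \<nu> vanishes and \<omega> does
  not, so its integrability makes that set null.\<close>

lemma AE_dual_weight_finite:
  assumes w: "radial_weight \<omega>" and n: "radial_weight \<nu>"
    and fin: "(\<integral>\<^sup>+z. dual_weight p \<omega> \<nu> z \<partial>disc_area) < \<infinity>"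
  shows "AE z in disc_area. \<nu> z = 0 \<longrightarrow> \<omega> z = 0"
proof -
  have "AE z in disc_area. dual_weight p \<omega> \<nu> z \<noteq> \<infinity>"
    using radial_funD(1)[OF dual_weight_radial_fun[OF w n]] fin by (intro nn_integral_noteq_infinite) auto
  then show ?thesis by eventually_elim (auto simp: dual_weight_def split: if_splits)
qed

lemma sdual_powr:
  assumes p: "1 < p" and nn: "0 \<le> \<omega> z" "\<nu> z = 0 \<longrightarrow> \<omega> z = 0" "0 \<le> \<nu> z"
  shows "\<omega> z = \<nu> z powr (1/p) * sdual p \<omega> \<nu> z powr (1 / conj_exp p)"
  using nn conj_exp_props(1)[OF p] by (auto simp: sdual_def powr_powr)

text \<open>The point at issue is that \<open>sdual\<close> is itself a radial weight: it inherits
  integrability from \<open>dual_weight\<close>, and positivity of its tails from \<omega> through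
  the factorization.\<close>

lemma weight_triple_sdual:
  assumes p: "1 < p" and w: "radial_weight \<omega>" and n: "radial_weight \<nu>"
    and fin: "(\<integral>\<^sup>+z. dual_weight p \<omega> \<nu> z \<partial>disc_area) < \<infinity>"
  shows "weight_triple p (conj_exp p) \<nu> (sdual p \<omega> \<nu>) \<omega>"
proof -
  let ?s = "sdual p \<omega> \<nu>"
  note AE0 = AE_dual_weight_finite[OF w n fin]
  note AEd = AE_dual_weight[OF AE0, of p]
  note radial_weight_measurable[OF w, measurable] radial_weight_measurable[OF n, measurable]
  have sm [measurable]: "?s \<in> borel_measurable disc_area" unfolding sdual_def[abs_def] by measurable
  have s0: "0 \<le> ?s z" for z by (simp add: sdual_def)
  have sr: "?s (of_real (norm z)) = ?s z" if z: "norm z < 1" for z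
  proof -
    have "\<omega> (of_real (norm z)) = \<omega> z" "\<nu> (of_real (norm z)) = \<nu> z"
      using bspec[OF radial_weightD(2)[OF w], of z] bspec[OF radial_weightD(2)[OF n], of z] z by simp_all
    then show ?thesis by (simp add: sdual_def)
  qed
  have srf: "radial_fun (\<lambda>z. ennreal (?s z))" by (rule radial_funI) (measurable, simp add: sr)
  have factor: "AE z in disc_area. \<omega> z = \<nu> z powr (1/p) * ?s z powr (1 / conj_exp p)"
    using AE0 AE_space
  proof eventually_elim
    case (elim z)
    then show ?case using radial_weight_nonneg[OF w] radial_weight_nonneg[OF n] by (intro sdual_powr p) auto
  qed
  have int: "integrable disc_area ?s"
  proof (rule integrableI_nonneg[OF sm])
    show "AE z in disc_area. 0 \<le> ?s z" using s0 by simp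
    have "(\<integral>\<^sup>+z. ennreal (?s z) \<partial>disc_area) = (\<integral>\<^sup>+z. dual_weight p \<omega> \<nu> z \<partial>disc_area)"
      using AEd by (intro nn_integral_cong_AE) (elim AE_mp, simp)
    then show "(\<integral>\<^sup>+z. ennreal (?s z) \<partial>disc_area) < \<infinity>" using fin by simp
  qed
  \<comment> \<open>If the tail vanished, \<open>sdual\<close> would be 0 almost everywhere beyond
    r, and by the factorization so would \<omega>.\<close>
  have tpos: "0 < tail (\<lambda>z. ennreal (?s z)) r" if r: "0 < r" "r < 1" for r
  proof (rule ccontr)
    assume "\<not> 0 < tail (\<lambda>z. ennreal (?s z)) r"
    then have "tail (\<lambda>z. ennreal (?s z)) r = 0" by simp
    then have "tail1 (\<lambda>z. ennreal (?s z)) r = 0" using tail_bounds(2)[OF srf r(1)] by simp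
    then have "rtail (\<lambda>z. ennreal (?s z)) r = 0" using rtail_eq_tail1[OF srf, of r] r by simp
    moreover have im: "(indicator {z::complex. r \<le> norm z} :: complex \<Rightarrow> ennreal) \<in> borel_measurable disc_area"
      by (rule borel_measurable_disc_area) measurable
    ultimately have "AE z in disc_area. ennreal (?s z) * indicator {z. r \<le> norm z} z = 0"
      unfolding rtail_def by (subst (asm) nn_integral_0_iff_AE) auto
    with factor have "AE z in disc_area. ennreal (\<omega> z) * indicator {z. r \<le> norm z} z = 0"
    proof eventually_elim
      case (elim z)
      show ?case
      proof (cases "r \<le> norm z")
        case True
        then have "ennreal (?s z) = 0" using elim(2) by simp
        then have "?s z = 0" using s0[of z] by (simp add: ennreal_eq_0_iff)
        then show ?thesis using elim(1) by simp
      qed simp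
    qed
    then have "rtail (\<lambda>z. ennreal (\<omega> z)) r = (\<integral>\<^sup>+z. 0 \<partial>disc_area)"
      unfolding rtail_def by (rule nn_integral_cong_AE)
    then show False using wtail_pos[OF w r(2)] by (simp add: wtail_def)
  qed
  have "radial_weight ?s"
    unfolding radial_weight_def
  proof (intro conjI ballI)
    fix z :: complex assume "z \<in> unit_disc"
    then have z: "norm z < 1" by simp
    show "0 \<le> ?s z" by (rule s0)
    show "?s z = ?s (of_real (norm z))" by (rule sr[OF z, symmetric])
    define r where "r = max (norm z) (1/2)"
    have r: "0 < r" "r < 1" "norm z \<le> r" using z by (auto simp: r_def)
    have "0 < tail (\<lambda>z. ennreal (?s z)) r" by (rule tpos[OF r(1,2)])
    also have "\<dots> \<le> tail (\<lambda>z. ennreal (?s z)) (norm z)"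
      unfolding tail_def using r by (intro nn_integral_mono) (auto split: split_indicator)
    finally show "0 < tail (\<lambda>z. ennreal (?s z)) (norm z)" .
  qed (rule int)
  then show ?thesis
    by unfold_locales (use p conj_exp_props[OF p] n w factor in auto)
qed

section \<open>The two constants in terms of real moments and tails\<close>

lemma epowr_ennreal: "0 \<le> x \<Longrightarrow> epowr (ennreal x) a = ennreal (x powr a)"
  by (simp add: epowr_def)

lemma half_eqI:
  assumes "2 * X = ennreal a" shows "X = ennreal (a / 2)"
proof -
  have "X = ennreal (1/2) * (2 * X)" by (rule ennreal_half_two[symmetric])
  also have "\<dots> = ennreal (1/2 * a)" unfolding assms by (rule ennreal_mult'[symmetric]) simp
  finally show ?thesis by simp
qed

text \<open>Area quantities are twice the linear ones. As 1/p + 1/q = 1, the numerator loses the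
  same factor 2 as the denominator, so the quotient is unchanged.\<close>

lemma constant_term:
  assumes pq: "1 / p + 1 / q = 1" and nn: "0 \<le> a" "0 \<le> b" "0 < c"
    and X: "2 * X = ennreal a" and Y: "2 * Y = ennreal b" and Z: "2 * Z = ennreal c"
  shows "epowr X (1/p) * epowr Y (1/q) / Z = ennreal (a powr (1/p) * b powr (1/q) / c)"
proof -
  have "epowr X (1/p) * epowr Y (1/q) / Z = ennreal ((a/2) powr (1/p) * (b/2) powr (1/q) / (c/2))"
    using nn unfolding half_eqI[OF X] half_eqI[OF Y] half_eqI[OF Z]
    by (simp add: epowr_ennreal divide_ennreal flip: ennreal_mult)
  also have "(a/2) powr (1/p) * (b/2) powr (1/q) = a powr (1/p) * b powr (1/q) / (2 powr (1/p) * 2 powr (1/q))"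
    using nn by (simp add: powr_divide)
  also have "2 powr (1/p) * 2 powr (1/q) = (2::real)" using pq by (simp flip: powr_add)
  finally show ?thesis using nn by simp
qed

context
  fixes p :: real and \<omega> \<nu> :: "complex \<Rightarrow> real"
  assumes p: "1 < p" and w: "radial_weight \<omega>" and n: "radial_weight \<nu>"
begin

lemma D_const_term:
  assumes fin: "(\<integral>\<^sup>+z. dual_weight p \<omega> \<nu> z \<partial>disc_area) < \<infinity>"
  shows "epowr (moment (\<lambda>z. ennreal (\<nu> z)) (real k * p + 1)) (1 / p) *
     epowr (moment (dual_weight p \<omega> \<nu>) (real k * conj_exp p + 1)) (1 / conj_exp p) /
     moment (\<lambda>z. ennreal (\<omega> z)) (2 * real k + 1)
   = ennreal (wmom \<nu> (real k * p) powr (1/p) * wmom (sdual p \<omega> \<nu>) (real k * conj_exp p) powr (1 / conj_exp p) / wmom \<omega> (2 * real k))"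
proof (rule constant_term[OF conj_exp_props(2)[OF p] wmom_nonneg wmom_nonneg])
  interpret weight_triple p "conj_exp p" \<nu> "sdual p \<omega> \<nu>" \<omega> by (rule weight_triple_sdual[OF p w n fin])
  show "0 < wmom \<omega> (2 * real k)" by (rule wmom_pos[OF w]) simp
  show "2 * moment (\<lambda>z. ennreal (\<nu> z)) (real k * p + 1) = ennreal (wmom \<nu> (real k * p))"
    using p by (subst rmom_eq_moment[symmetric, OF radial_weight_radial_fun[OF n]]) (simp add: rmom_wmom[OF n])
  show "2 * moment (\<lambda>z. ennreal (\<omega> z)) (2 * real k + 1) = ennreal (wmom \<omega> (2 * real k))"
    by (subst rmom_eq_moment[symmetric, OF radial_weight_radial_fun[OF w]]) (simp add: rmom_wmom[OF w])
  have "rmom (dual_weight p \<omega> \<nu>) (real k * conj_exp p) = rmom (\<lambda>z. ennreal (sdual p \<omega> \<nu> z)) (real k * conj_exp p)"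
    unfolding rmom_def using AE_dual_weight[OF AE_dual_weight_finite[OF w n fin], of p]
    by (intro nn_integral_cong_AE) (elim AE_mp, simp)
  then show "2 * moment (dual_weight p \<omega> \<nu>) (real k * conj_exp p + 1) = ennreal (wmom (sdual p \<omega> \<nu>) (real k * conj_exp p))"
    using q by (subst rmom_eq_moment[symmetric, OF dual_weight_radial_fun[OF w n]]) (simp add: rmom_wmom[OF sigma])
qed

lemma A_const_term:
  assumes fin: "(\<integral>\<^sup>+z. dual_weight p \<omega> \<nu> z \<partial>disc_area) < \<infinity>" and r: "0 \<le> r" "r < 1"
  shows "epowr (tail1 (\<lambda>z. ennreal (\<nu> z)) r) (1 / p) * epowr (tail1 (dual_weight p \<omega> \<nu>) r) (1 / conj_exp p) /
     tail1 (\<lambda>z. ennreal (\<omega> z)) r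
   = ennreal (wtail \<nu> r powr (1/p) * wtail (sdual p \<omega> \<nu>) r powr (1 / conj_exp p) / wtail \<omega> r)"
proof (rule constant_term[OF conj_exp_props(2)[OF p] wtail_nonneg wtail_nonneg])
  interpret weight_triple p "conj_exp p" \<nu> "sdual p \<omega> \<nu>" \<omega> by (rule weight_triple_sdual[OF p w n fin])
  show "0 < wtail \<omega> r" by (rule wtail_pos[OF w r(2)])
  show "2 * tail1 (\<lambda>z. ennreal (\<nu> z)) r = ennreal (wtail \<nu> r)"
    using r by (subst rtail_eq_tail1[symmetric, OF radial_weight_radial_fun[OF n]]) (simp_all add: rtail_wtail[OF n])
  show "2 * tail1 (\<lambda>z. ennreal (\<omega> z)) r = ennreal (wtail \<omega> r)"
    using r by (subst rtail_eq_tail1[symmetric, OF radial_weight_radial_fun[OF w]]) (simp_all add: rtail_wtail[OF w])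
  have "rtail (dual_weight p \<omega> \<nu>) r = rtail (\<lambda>z. ennreal (sdual p \<omega> \<nu> z)) r"
    unfolding rtail_def using AE_dual_weight[OF AE_dual_weight_finite[OF w n fin], of p]
    by (intro nn_integral_cong_AE) (elim AE_mp, simp)
  then show "2 * tail1 (dual_weight p \<omega> \<nu>) r = ennreal (wtail (sdual p \<omega> \<nu>) r)"
    using r by (subst rtail_eq_tail1[symmetric, OF dual_weight_radial_fun[OF w n]]) (simp_all add: rtail_wtail[OF sigma])
qed

text \<open>The first factor is nonzero and the denominator finite, so an infinite second factor
  would survive in the quotient. This is how finiteness of a constant makes the dual weight
  integrable.\<close>

lemma epowr_quotient_finite:
  assumes lt: "epowr X a * epowr Y b / Z < \<infinity>" and X: "0 < X" "X < \<infinity>" and Z: "Z < \<infinity>"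
  shows "Y < \<infinity>"
proof (rule ccontr)
  assume "\<not> Y < \<infinity>"
  then have "epowr Y b = \<infinity>" by (simp add: epowr_def less_top)
  moreover have "epowr X a \<noteq> 0"
  proof -
    have "0 < enn2real X" using X by (simp add: enn2real_positive_iff)
    then show ?thesis by (simp add: epowr_def ennreal_eq_0_iff)
  qed
  ultimately have "epowr X a * epowr Y b / Z = \<infinity>" using Z by (simp add: ennreal_mult_top divide_ennreal_def ennreal_top_mult ennreal_inverse_eq_0_iff)
  then show False using lt by simp
qed

text \<open>The term of index 0 contains the total mass of the dual weight.\<close>

lemma dual_weight_finite_of_D_const:
  assumes D: "D_const p \<omega> \<nu> < \<infinity>"
  shows "(\<integral>\<^sup>+z. dual_weight p \<omega> \<nu> z \<partial>disc_area) < \<infinity>"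
proof -
  have m: "2 * moment (\<lambda>z. ennreal (\<nu> z)) 1 = ennreal (wmom \<nu> 0)" "2 * moment (\<lambda>z. ennreal (\<omega> z)) 1 = ennreal (wmom \<omega> 0)"
    using rmom_eq_moment[OF radial_weight_radial_fun[OF n], of 0] rmom_eq_moment[OF radial_weight_radial_fun[OF w], of 0]
    by (simp_all add: rmom_wmom[OF n] rmom_wmom[OF w])
  have "epowr (moment (\<lambda>z. ennreal (\<nu> z)) 1) (1 / p) * epowr (moment (dual_weight p \<omega> \<nu>) 1) (1 / conj_exp p) / moment (\<lambda>z. ennreal (\<omega> z)) 1 \<le> D_const p \<omega> \<nu>"
    unfolding D_const_def by (rule SUP_upper2[of 0]) simp_all
  then have lt: "epowr (moment (\<lambda>z. ennreal (\<nu> z)) 1) (1 / p) * epowr (moment (dual_weight p \<omega> \<nu>) 1) (1 / conj_exp p) / moment (\<lambda>z. ennreal (\<omega> z)) 1 < \<infinity>"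
    using D by (rule le_less_trans)
  have "0 < moment (\<lambda>z. ennreal (\<nu> z)) 1" "moment (\<lambda>z. ennreal (\<nu> z)) 1 < \<infinity>" "moment (\<lambda>z. ennreal (\<omega> z)) 1 < \<infinity>"
    unfolding half_eqI[OF m(1)] half_eqI[OF m(2)] using wmom_pos[OF n, of 0] by simp_all
  from epowr_quotient_finite[OF lt this] have "moment (dual_weight p \<omega> \<nu>) 1 < \<infinity>" .
  then have "rmom (dual_weight p \<omega> \<nu>) 0 < \<infinity>"
    using rmom_eq_moment[OF dual_weight_radial_fun[OF w n], of p 0] by (simp add: ennreal_mult_less_top)
  moreover have "rmom (dual_weight p \<omega> \<nu>) 0 = (\<integral>\<^sup>+z. dual_weight p \<omega> \<nu> z \<partial>disc_area)"
    unfolding rmom_def using AE_disc_area_nonzero by (intro nn_integral_cong_AE) (elim AE_mp, simp)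
  ultimately show ?thesis by simp
qed

text \<open>The radius r = 0 contributes the total mass of the dual weight.\<close>

lemma dual_weight_finite_of_A_const:
  assumes A: "A_const p \<omega> \<nu> < \<infinity>"
  shows "(\<integral>\<^sup>+z. dual_weight p \<omega> \<nu> z \<partial>disc_area) < \<infinity>"
proof -
  have m: "2 * tail1 (\<lambda>z. ennreal (\<nu> z)) 0 = ennreal (wtail \<nu> 0)" "2 * tail1 (\<lambda>z. ennreal (\<omega> z)) 0 = ennreal (wtail \<omega> 0)"
    using rtail_eq_tail1[OF radial_weight_radial_fun[OF n], of 0] rtail_eq_tail1[OF radial_weight_radial_fun[OF w], of 0]
    by (simp_all add: rtail_wtail[OF n] rtail_wtail[OF w])
  have "epowr (tail1 (\<lambda>z. ennreal (\<nu> z)) 0) (1 / p) * epowr (tail1 (dual_weight p \<omega> \<nu>) 0) (1 / conj_exp p) / tail1 (\<lambda>z. ennreal (\<omega> z)) 0 \<le> A_const p \<omega> \<nu>"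
    unfolding A_const_def by (rule SUP_upper) simp
  then have lt: "epowr (tail1 (\<lambda>z. ennreal (\<nu> z)) 0) (1 / p) * epowr (tail1 (dual_weight p \<omega> \<nu>) 0) (1 / conj_exp p) / tail1 (\<lambda>z. ennreal (\<omega> z)) 0 < \<infinity>"
    using A by (rule le_less_trans)
  have "0 < tail1 (\<lambda>z. ennreal (\<nu> z)) 0" "tail1 (\<lambda>z. ennreal (\<nu> z)) 0 < \<infinity>" "tail1 (\<lambda>z. ennreal (\<omega> z)) 0 < \<infinity>"
    unfolding half_eqI[OF m(1)] half_eqI[OF m(2)] using wtail_pos[OF n, of 0] by simp_all
  from epowr_quotient_finite[OF lt this] have "tail1 (dual_weight p \<omega> \<nu>) 0 < \<infinity>" .
  then have "rtail (dual_weight p \<omega> \<nu>) 0 < \<infinity>"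
    using rtail_eq_tail1[OF dual_weight_radial_fun[OF w n], of 0 p] by (simp add: ennreal_mult_less_top)
  then show ?thesis by (simp add: rtail_def)
qed

lemma D_const_finiteI:
  assumes fin: "(\<integral>\<^sup>+z. dual_weight p \<omega> \<nu> z \<partial>disc_area) < \<infinity>"
    and D: "\<And>k::nat. wmom \<nu> (real k * p) powr (1/p) * wmom (sdual p \<omega> \<nu>) (real k * conj_exp p) powr (1 / conj_exp p) \<le> D * wmom \<omega> (2 * real k)"
  shows "D_const p \<omega> \<nu> < \<infinity>"
proof -
  have "D_const p \<omega> \<nu> \<le> ennreal D"
    unfolding D_const_def D_const_term[OF fin]
  proof (intro SUP_least ennreal_leI)
    fix k :: nat
    show "wmom \<nu> (real k * p) powr (1/p) * wmom (sdual p \<omega> \<nu>) (real k * conj_exp p) powr (1 / conj_exp p) / wmom \<omega> (2 * real k) \<le> D"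
      using D[of k] wmom_pos[OF w, of "2 * real k"] by (simp add: pos_divide_le_eq)
  qed
  then show ?thesis by (rule le_less_trans) simp
qed

lemma D_const_imp_A_const:
  assumes D: "D_const p \<omega> \<nu> < \<infinity>" and dn: "tail_doubling (wtail \<nu>)"
  shows "A_const p \<omega> \<nu> < \<infinity>" "\<omega> \<in> D_hat"
proof -
  note fin = dual_weight_finite_of_D_const[OF D]
  interpret weight_triple p "conj_exp p" \<nu> "sdual p \<omega> \<nu>" \<omega> by (rule weight_triple_sdual[OF p w n fin])
  define d where "d = enn2real (D_const p \<omega> \<nu>) + 1"
  have d: "0 < d" by (simp add: d_def add_nonneg_pos)
  have "wmom \<nu> (real k * p) powr (1/p) * wmom (sdual p \<omega> \<nu>) (real k * conj_exp p) powr (1 / conj_exp p) \<le> d * wmom \<omega> (2 * real k)" for k :: nat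
  proof -
    have "ennreal (wmom \<nu> (real k * p) powr (1/p) * wmom (sdual p \<omega> \<nu>) (real k * conj_exp p) powr (1 / conj_exp p) / wmom \<omega> (2 * real k)) \<le> D_const p \<omega> \<nu>"
      unfolding D_const_term[OF fin, symmetric] unfolding D_const_def by (rule SUP_upper) simp
    also have "\<dots> = ennreal (enn2real (D_const p \<omega> \<nu>))" using D by (simp add: ennreal_enn2real_if less_top)
    also have "\<dots> \<le> ennreal d" by (intro ennreal_leI) (simp add: d_def)
    finally have "wmom \<nu> (real k * p) powr (1/p) * wmom (sdual p \<omega> \<nu>) (real k * conj_exp p) powr (1 / conj_exp p) / wmom \<omega> (2 * real k) \<le> d"
      using d by (subst (asm) ennreal_le_iff) auto
    then show ?thesis using wmom_pos[OF w, of "2 * real k"] by (simp add: pos_divide_le_eq)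
  qed
  note main = doubling_and_A_bound[OF dn d this]
  show "\<omega> \<in> D_hat" by (rule D_hatI[OF w main(1)])
  obtain A where A: "A_bound A" using main(2) by blast
  have "A_const p \<omega> \<nu> \<le> ennreal A"
    unfolding A_const_def
  proof (rule SUP_least)
    fix r :: real assume "r \<in> {0..<1}"
    then have r: "0 \<le> r" "r < 1" by auto
    have "wtail \<nu> r powr (1/p) * wtail (sdual p \<omega> \<nu>) r powr (1 / conj_exp p) / wtail \<omega> r \<le> A"
      using A r wtail_pos[OF w r(2)] by (simp add: A_bound_def pos_divide_le_eq)
    then show "epowr (tail1 (\<lambda>z. ennreal (\<nu> z)) r) (1 / p) * epowr (tail1 (dual_weight p \<omega> \<nu>) r) (1 / conj_exp p) / tail1 (\<lambda>z. ennreal (\<omega> z)) r \<le> ennreal A"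
      unfolding A_const_term[OF fin r] by (rule ennreal_leI)
  qed
  then show "A_const p \<omega> \<nu> < \<infinity>" by (rule le_less_trans) simp
qed

lemma A_const_imp_A_bound:
  assumes A: "A_const p \<omega> \<nu> < \<infinity>"
  shows "\<exists>a. weight_triple.A_bound p (conj_exp p) \<nu> (sdual p \<omega> \<nu>) \<omega> a"
proof -
  note fin = dual_weight_finite_of_A_const[OF A]
  interpret weight_triple p "conj_exp p" \<nu> "sdual p \<omega> \<nu>" \<omega> by (rule weight_triple_sdual[OF p w n fin])
  define a where "a = enn2real (A_const p \<omega> \<nu>) + 1"
  have a: "0 < a" by (simp add: a_def add_nonneg_pos)
  have "wtail \<nu> r powr (1/p) * wtail (sdual p \<omega> \<nu>) r powr (1 / conj_exp p) \<le> a * wtail \<omega> r" if r: "0 \<le> r" "r < 1" for r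
  proof -
    have "ennreal (wtail \<nu> r powr (1/p) * wtail (sdual p \<omega> \<nu>) r powr (1 / conj_exp p) / wtail \<omega> r) \<le> A_const p \<omega> \<nu>"
      unfolding A_const_term[OF fin r, symmetric] unfolding A_const_def by (rule SUP_upper) (use r in simp)
    also have "\<dots> = ennreal (enn2real (A_const p \<omega> \<nu>))" using A by (simp add: ennreal_enn2real_if less_top)
    also have "\<dots> \<le> ennreal a" by (intro ennreal_leI) (simp add: a_def)
    finally have "wtail \<nu> r powr (1/p) * wtail (sdual p \<omega> \<nu>) r powr (1 / conj_exp p) / wtail \<omega> r \<le> a"
      using a by (subst (asm) ennreal_le_iff) auto
    then show ?thesis using wtail_pos[OF w r(2)] by (simp add: pos_divide_le_eq)
  qed
  then have "A_bound a" using a by (simp add: A_bound_def)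
  then show ?thesis by blast
qed

end

section \<open>Boundedness of the projections\<close>

lemma integrable_times_bounded:
  fixes F g :: "complex \<Rightarrow> complex"
  assumes F: "integrable disc_area F" and g: "g \<in> borel_measurable disc_area"
    and b: "\<And>z. norm z < 1 \<Longrightarrow> norm (g z) \<le> B"
  shows "integrable disc_area (\<lambda>z. F z * g z)"
proof (rule Bochner_Integration.integrable_bound)
  show "integrable disc_area (\<lambda>z. B * norm (F z))" using F by simp
  have "F \<in> borel_measurable disc_area" using F by simp
  with g show "(\<lambda>z. F z * g z) \<in> borel_measurable disc_area" by measurable
  show "AE z in disc_area. norm (F z * g z) \<le> norm (B * norm (F z))"
  proof (rule AE_I2)
    fix z assume "z \<in> space disc_area"
    then have "norm z < 1" by simp
    from b[OF this] have "norm (g z) \<le> \<bar>B\<bar>" by linarith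
    then have "norm (F z) * norm (g z) \<le> norm (F z) * \<bar>B\<bar>" by (intro mult_left_mono) auto
    then show "norm (F z * g z) \<le> norm (B * norm (F z))" by (simp add: norm_mult abs_mult mult.commute)
  qed
qed

lemma Lp_norm_nonneg: "0 \<le> Lp_norm p w f" by (simp add: Lp_norm_def)

lemma Lp_norm_eq:
  assumes n: "radial_weight \<nu>" and f: "f \<in> borel_measurable disc_area"
  shows "Lp_norm p \<nu> f = enn2real (\<integral>\<^sup>+z. ennreal (norm (f z) powr p * \<nu> z) \<partial>disc_area) powr (1/p)"
proof -
  note f[measurable] radial_weight_measurable[OF n, measurable]
  have "(\<integral>z. norm (f z) powr p * \<nu> z \<partial>disc_area) = enn2real (\<integral>\<^sup>+z. ennreal (norm (f z) powr p * \<nu> z) \<partial>disc_area)"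
    by (rule integral_eq_nn_integral) (measurable, auto intro!: AE_I2 mult_nonneg_nonneg radial_weight_nonneg[OF n])
  then show ?thesis by (simp add: Lp_norm_def)
qed

lemma Lp_bound:
  assumes n: "radial_weight \<nu>" and p: "1 < p" and g: "g \<in> borel_measurable disc_area" and f: "f \<in> Lp p \<nu>" and C: "0 \<le> C"
    and le: "(\<integral>\<^sup>+z. ennreal (norm (g z) powr p * \<nu> z) \<partial>disc_area) \<le> ennreal C * (\<integral>\<^sup>+z. ennreal (norm (f z) powr p * \<nu> z) \<partial>disc_area)"
  shows "g \<in> Lp p \<nu>" "Lp_norm p \<nu> g \<le> C powr (1/p) * Lp_norm p \<nu> f"
proof -
  have fm: "f \<in> borel_measurable disc_area" and fin: "(\<integral>\<^sup>+z. ennreal (norm (f z) powr p * \<nu> z) \<partial>disc_area) < \<infinity>"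
    using f by (auto simp: Lp_def)
  have lt: "ennreal C * (\<integral>\<^sup>+z. ennreal (norm (f z) powr p * \<nu> z) \<partial>disc_area) < \<infinity>"
    using fin by (simp add: ennreal_mult_less_top)
  with le have "(\<integral>\<^sup>+z. ennreal (norm (g z) powr p * \<nu> z) \<partial>disc_area) < \<infinity>" by (rule le_less_trans)
  then show "g \<in> Lp p \<nu>" using g by (simp add: Lp_def)
  have "enn2real (\<integral>\<^sup>+z. ennreal (norm (g z) powr p * \<nu> z) \<partial>disc_area) \<le> enn2real (ennreal C * (\<integral>\<^sup>+z. ennreal (norm (f z) powr p * \<nu> z) \<partial>disc_area))"
    using le lt by (intro enn2real_mono) auto
  also have "\<dots> = C * enn2real (\<integral>\<^sup>+z. ennreal (norm (f z) powr p * \<nu> z) \<partial>disc_area)"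
    using C by (simp add: enn2real_mult)
  finally have "enn2real (\<integral>\<^sup>+z. ennreal (norm (g z) powr p * \<nu> z) \<partial>disc_area) powr (1/p) \<le> (C * enn2real (\<integral>\<^sup>+z. ennreal (norm (f z) powr p * \<nu> z) \<partial>disc_area)) powr (1/p)"
    using p by (intro powr_mono2) auto
  then show "Lp_norm p \<nu> g \<le> C powr (1/p) * Lp_norm p \<nu> f"
    using C by (simp add: Lp_norm_eq[OF n g] Lp_norm_eq[OF n fm] powr_mult)
qed

text \<open>On the disc the chosen kernel may be replaced by the explicit series, in the values of
  the projections and in the integrability that defines them.\<close>

lemma projection_kernel_form:
  assumes w: "radial_weight \<omega>" and z: "norm z < 1"
  shows "Bergman_projection \<omega> f z = (\<integral>y. f y * cnj (kser \<omega> (cnj z * y)) * of_real (\<omega> y) \<partial>disc_area)"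
    and "maximal_Bergman_projection \<omega> f z = (\<integral>y. f y * of_real (norm (kser \<omega> (cnj z * y))) * of_real (\<omega> y) \<partial>disc_area)"
    and "integrable disc_area (\<lambda>y. f y * cnj (Bergman_kernel \<omega> z y) * of_real (\<omega> y)) \<longleftrightarrow> integrable disc_area (\<lambda>y. f y * cnj (kser \<omega> (cnj z * y)) * of_real (\<omega> y))"
    and "integrable disc_area (\<lambda>y. f y * of_real (norm (Bergman_kernel \<omega> z y)) * of_real (\<omega> y)) \<longleftrightarrow> integrable disc_area (\<lambda>y. f y * of_real (norm (kser \<omega> (cnj z * y))) * of_real (\<omega> y))"
  unfolding Bergman_projection_def maximal_Bergman_projection_def
  by (intro Bochner_Integration.integral_cong Bochner_Integration.integrable_cong refl; simp add: Bergman_kernel_eq[OF w z])+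

lemma kser_section_measurable:
  assumes "norm z < 1" shows "(\<lambda>y. kser \<omega> (cnj z * y)) \<in> borel_measurable disc_area"
  by (intro borel_measurable_disc_area measurable_compose[OF _ kser_measurable(1)]) measurable

lemma projection_measurable:
  assumes w: "radial_weight \<omega>" and f: "f \<in> borel_measurable disc_area"
  shows "Bergman_projection \<omega> f \<in> borel_measurable disc_area" "maximal_Bergman_projection \<omega> f \<in> borel_measurable disc_area"
proof -
  note [measurable] = f radial_weight_measurable[OF w]
  have "(\<lambda>p. kser \<omega> (cnj (fst p) * snd p)) \<in> borel_measurable (disc_area \<Otimes>\<^sub>M disc_area)"
    using kernel_measurable(1)[of \<omega>] by (simp only: case_prod_beta')
  moreover have "cnj \<in> borel_measurable borel" by (intro borel_measurable_continuous_onI continuous_intros)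
  ultimately have [measurable]: "(\<lambda>p. kser \<omega> (cnj (fst p) * snd p)) \<in> borel_measurable (disc_area \<Otimes>\<^sub>M disc_area)"
    "(\<lambda>p. cnj (kser \<omega> (cnj (fst p) * snd p))) \<in> borel_measurable (disc_area \<Otimes>\<^sub>M disc_area)"
    by (auto intro: measurable_compose)
  have f2 [measurable]: "(\<lambda>p. f (snd p)) \<in> borel_measurable (disc_area \<Otimes>\<^sub>M disc_area)"
    "(\<lambda>p. \<omega> (snd p)) \<in> borel_measurable (disc_area \<Otimes>\<^sub>M disc_area)"
    by measurable
  have "(\<lambda>z. \<integral>y. f y * cnj (kser \<omega> (cnj z * y)) * of_real (\<omega> y) \<partial>disc_area) \<in> borel_measurable disc_area"
    by (rule disc.borel_measurable_lebesgue_integral, unfold case_prod_beta') measurable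
  then show "Bergman_projection \<omega> f \<in> borel_measurable disc_area"
    by (subst measurable_cong[OF projection_kernel_form(1)[OF w]]) simp_all
  have "(\<lambda>z. \<integral>y. f y * of_real (norm (kser \<omega> (cnj z * y))) * of_real (\<omega> y) \<partial>disc_area) \<in> borel_measurable disc_area"
    by (rule disc.borel_measurable_lebesgue_integral, unfold case_prod_beta') measurable
  then show "maximal_Bergman_projection \<omega> f \<in> borel_measurable disc_area"
    by (subst measurable_cong[OF projection_kernel_form(2)[OF w]]) simp_all
qed

text \<open>The operator bound concerns nonnegative functions and is applied to |f|. Membership of f
  in \<open>Lp p \<nu>\<close> makes f integrable against \<omega>, and the bounded kernel sections
  then give well-definedness.\<close>

lemma maximal_projection_bounded:
  assumes p: "1 < p" and w: "radial_weight \<omega>" and n: "radial_weight \<nu>"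
    and dn: "tail_doubling (wtail \<nu>)" and vn: "tail_vanishing (wtail \<nu>)"
    and A: "A_const p \<omega> \<nu> < \<infinity>" and d: "tail_doubling (wtail \<omega>)"
  shows "bounded_on_Lp p \<nu> (maximal_Bergman_projection_defined \<omega>) (maximal_Bergman_projection \<omega>)"
proof -
  interpret weight_triple p "conj_exp p" \<nu> "sdual p \<omega> \<nu>" \<omega>
    by (rule weight_triple_sdual[OF p w n dual_weight_finite_of_A_const[OF p w n A]])
  obtain a where a: "A_bound a" using A_const_imp_A_bound[OF p w n A] by blast
  obtain C where C: "0 < C" and bd: "\<And>f. f \<in> borel_measurable disc_area \<Longrightarrow> (\<forall>y. 0 \<le> f y) \<Longrightarrow> (\<integral>\<^sup>+y. ennreal (f y powr p * \<nu> y) \<partial>disc_area) < \<infinity> \<Longrightarrow>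
    (\<integral>\<^sup>+z. ennreal (enn2real (\<integral>\<^sup>+y. ennreal (norm (kser \<omega> (cnj z * y)) * f y * \<omega> y) \<partial>disc_area) powr p * \<nu> z) \<partial>disc_area)
    \<le> ennreal C * (\<integral>\<^sup>+y. ennreal (f y powr p * \<nu> y) \<partial>disc_area)"
    using maximal_operator_bound[OF a d dn vn] by blast
  let ?T = "maximal_Bergman_projection \<omega>"
  have main: "maximal_Bergman_projection_defined \<omega> f \<and> ?T f \<in> Lp p \<nu> \<and> Lp_norm p \<nu> (?T f) \<le> C powr (1/p) * Lp_norm p \<nu> f"
    if f: "f \<in> Lp p \<nu>" for f
  proof -
    have fm [measurable]: "f \<in> borel_measurable disc_area" and fin: "(\<integral>\<^sup>+z. ennreal (norm (f z) powr p * \<nu> z) \<partial>disc_area) < \<infinity>"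
      using f by (auto simp: Lp_def)
    note [measurable] = radial_weight_measurable[OF w]
    have int: "integrable disc_area (\<lambda>y. f y * of_real (\<omega> y))"
    proof (rule integrableI_bounded)
      have "(\<integral>\<^sup>+y. ennreal (norm (f y * of_real (\<omega> y))) \<partial>disc_area) = (\<integral>\<^sup>+y. ennreal (norm (f y) * \<omega> y) \<partial>disc_area)"
        by (intro nn_integral_cong) (simp add: norm_mult radial_weight_nonneg[OF w])
      then show "(\<integral>\<^sup>+y. ennreal (norm (f y * of_real (\<omega> y))) \<partial>disc_area) < \<infinity>"
        using nn_integral_om_finite[of "\<lambda>y. norm (f y)"] fin by simp
    qed measurable
    have intz: "integrable disc_area (\<lambda>y. f y * of_real (norm (kser \<omega> (cnj z * y))) * of_real (\<omega> y))" if z: "norm z < 1" for z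
    proof -
      have "integrable disc_area (\<lambda>y. f y * of_real (\<omega> y) * of_real (norm (kser \<omega> (cnj z * y))))"
      proof (rule integrable_times_bounded[OF int])
        show "(\<lambda>y. complex_of_real (norm (kser \<omega> (cnj z * y)))) \<in> borel_measurable disc_area"
          using kser_section_measurable[OF z, of \<omega>] by measurable
        show "norm (complex_of_real (norm (kser \<omega> (cnj z * y)))) \<le> (\<Sum>n. kcoeff \<omega> n * norm (cnj z) ^ n)" if "norm y < 1" for y
          using kser_bound[OF w, of "cnj z" y] z that by simp
      qed
      then show ?thesis by (simp add: mult_ac)
    qed
    have wd: "maximal_Bergman_projection_defined \<omega> f"
      unfolding maximal_Bergman_projection_defined_def using intz projection_kernel_form(4)[OF w] by simp
    have pt: "norm (?T f z) \<le> enn2real (\<integral>\<^sup>+y. ennreal (norm (kser \<omega> (cnj z * y)) * norm (f y) * \<omega> y) \<partial>disc_area)"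
      if z: "norm z < 1" for z
    proof -
      let ?h = "\<lambda>y. f y * of_real (norm (kser \<omega> (cnj z * y))) * of_real (\<omega> y)"
      have e: "(\<integral>\<^sup>+y. ennreal (norm (?h y)) \<partial>disc_area) = (\<integral>\<^sup>+y. ennreal (norm (kser \<omega> (cnj z * y)) * norm (f y) * \<omega> y) \<partial>disc_area)"
        by (intro nn_integral_cong) (simp add: norm_mult radial_weight_nonneg[OF w] mult_ac)
      have "ennreal (norm (?T f z)) \<le> (\<integral>\<^sup>+y. ennreal (norm (?h y)) \<partial>disc_area)"
        unfolding projection_kernel_form(2)[OF w z] by (rule integral_norm_bound_ennreal[OF intz[OF z]])
      moreover have "(\<integral>\<^sup>+y. ennreal (norm (?h y)) \<partial>disc_area) < \<infinity>"
        using intz[OF z] by (simp add: integrable_iff_bounded)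
      ultimately have "enn2real (ennreal (norm (?T f z))) \<le> enn2real (\<integral>\<^sup>+y. ennreal (norm (?h y)) \<partial>disc_area)"
        by (intro enn2real_mono) auto
      then show ?thesis unfolding e by simp
    qed
    have "(\<integral>\<^sup>+z. ennreal (norm (?T f z) powr p * \<nu> z) \<partial>disc_area)
       \<le> (\<integral>\<^sup>+z. ennreal (enn2real (\<integral>\<^sup>+y. ennreal (norm (kser \<omega> (cnj z * y)) * norm (f y) * \<omega> y) \<partial>disc_area) powr p * \<nu> z) \<partial>disc_area)"
      using p by (intro nn_integral_mono ennreal_leI mult_right_mono powr_mono2 pt radial_weight_nonneg[OF n]) auto
    also have "\<dots> \<le> ennreal C * (\<integral>\<^sup>+y. ennreal (norm (f y) powr p * \<nu> y) \<partial>disc_area)"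
      by (rule bd) (use fin in auto)
    finally show ?thesis
      using wd Lp_bound[OF n p projection_measurable(2)[OF w fm] f less_imp_le[OF C]] by blast
  qed
  then show ?thesis unfolding bounded_on_Lp_def by blast
qed

text \<open>The hypothesis is applied to |f|, which has the same norm as f: it yields absolute
  integrability of the projection integral and dominates its modulus pointwise.\<close>

lemma projection_bounded_of_maximal:
  assumes p: "1 < p" and w: "radial_weight \<omega>" and n: "radial_weight \<nu>"
    and b: "bounded_on_Lp p \<nu> (maximal_Bergman_projection_defined \<omega>) (maximal_Bergman_projection \<omega>)"
  shows "bounded_on_Lp p \<nu> (Bergman_projection_defined \<omega>) (Bergman_projection \<omega>)"
proof -
  let ?T = "maximal_Bergman_projection \<omega>"
  let ?P = "Bergman_projection \<omega>"
  obtain C where C: "\<And>f. f \<in> Lp p \<nu> \<Longrightarrow> Lp_norm p \<nu> (?T f) \<le> C * Lp_norm p \<nu> f"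
    and wdT: "\<And>f. f \<in> Lp p \<nu> \<Longrightarrow> maximal_Bergman_projection_defined \<omega> f" and T: "\<And>f. f \<in> Lp p \<nu> \<Longrightarrow> ?T f \<in> Lp p \<nu>"
    using b unfolding bounded_on_Lp_def by blast
  have main: "Bergman_projection_defined \<omega> f \<and> ?P f \<in> Lp p \<nu> \<and> Lp_norm p \<nu> (?P f) \<le> C * Lp_norm p \<nu> f"
    if f: "f \<in> Lp p \<nu>" for f
  proof -
    have fm [measurable]: "f \<in> borel_measurable disc_area" using f by (auto simp: Lp_def)
    note [measurable] = radial_weight_measurable[OF w]
    define g where "g y = complex_of_real (norm (f y))" for y
    have gm: "g \<in> borel_measurable disc_area" unfolding g_def by measurable
    have ng: "norm (g y) = norm (f y)" for y by (simp add: g_def)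
    have g: "g \<in> Lp p \<nu>" using f gm by (simp add: Lp_def ng)
    have gn: "Lp_norm p \<nu> g = Lp_norm p \<nu> f" by (simp add: Lp_norm_def ng)
    have intg: "integrable disc_area (\<lambda>y. g y * of_real (norm (kser \<omega> (cnj z * y))) * of_real (\<omega> y))" if z: "norm z < 1" for z
      unfolding projection_kernel_form(4)[OF w z, symmetric]
      by (rule bspec[OF wdT[OF g, unfolded maximal_Bergman_projection_defined_def]]) (simp add: z)
    have intP: "integrable disc_area (\<lambda>y. f y * cnj (kser \<omega> (cnj z * y)) * of_real (\<omega> y))" if z: "norm z < 1" for z
    proof (rule Bochner_Integration.integrable_bound[OF intg[OF z]])
      have "cnj \<in> borel_measurable borel" by (intro borel_measurable_continuous_onI continuous_intros)
      then have [measurable]: "(\<lambda>y. cnj (kser \<omega> (cnj z * y))) \<in> borel_measurable disc_area"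
        by (rule measurable_compose[OF kser_section_measurable[OF z]])
      show "(\<lambda>y. f y * cnj (kser \<omega> (cnj z * y)) * of_real (\<omega> y)) \<in> borel_measurable disc_area" by measurable
    qed (simp add: norm_mult ng)
    have wd: "Bergman_projection_defined \<omega> f"
      unfolding Bergman_projection_defined_def using intP projection_kernel_form(3)[OF w] by simp
    have pt: "norm (?P f z) \<le> norm (?T g z)" if z: "norm z < 1" for z
    proof -
      let ?r = "\<lambda>y. norm (f y) * norm (kser \<omega> (cnj z * y)) * \<omega> y"
      have "norm (?P f z) \<le> (\<integral>y. norm (f y * cnj (kser \<omega> (cnj z * y)) * of_real (\<omega> y)) \<partial>disc_area)"
        unfolding projection_kernel_form(1)[OF w z] by (rule integral_norm_bound)
      also have "\<dots> = (\<integral>y. ?r y \<partial>disc_area)"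
        by (intro Bochner_Integration.integral_cong) (simp_all add: norm_mult radial_weight_nonneg[OF w])
      also have "\<dots> \<le> norm (complex_of_real (\<integral>y. ?r y \<partial>disc_area))" by simp
      also have "complex_of_real (\<integral>y. ?r y \<partial>disc_area) = (\<integral>y. complex_of_real (?r y) \<partial>disc_area)"
      proof (rule integral_of_real[symmetric])
        have "integrable disc_area (\<lambda>y. complex_of_real (?r y))" using intg[OF z] by (simp add: g_def)
        then show "integrable disc_area ?r" using integrable_Re by fastforce
      qed
      also have "\<dots> = ?T g z" unfolding projection_kernel_form(2)[OF w z] by (simp add: g_def)
      finally show ?thesis .
    qed
    have "(\<integral>\<^sup>+z. ennreal (norm (?P f z) powr p * \<nu> z) \<partial>disc_area) \<le> ennreal 1 * (\<integral>\<^sup>+z. ennreal (norm (?T g z) powr p * \<nu> z) \<partial>disc_area)"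
      using p unfolding ennreal_1 mult_1 by (intro nn_integral_mono ennreal_leI mult_right_mono powr_mono2 pt radial_weight_nonneg[OF n]) auto
    from Lp_bound[OF n p projection_measurable(1)[OF w fm] T[OF g] _ this]
    have "?P f \<in> Lp p \<nu>" "Lp_norm p \<nu> (?P f) \<le> Lp_norm p \<nu> (?T g)" by simp_all
    then show ?thesis using wd C[OF g] unfolding gn by auto
  qed
  then show ?thesis unfolding bounded_on_Lp_def by blast
qed

text \<open>The function contains only the angular frequency n, so in the termwise integrated kernel
  series all other terms vanish by rotation. In the surviving term sgn(y) cnj(y) = |y| removes the
  angle.\<close>

lemma projection_monomial:
  fixes h :: "complex \<Rightarrow> real"
  assumes w: "radial_weight \<omega>" and z: "norm z < 1" and h [measurable]: "h \<in> borel_measurable disc_area"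
    and rot: "\<And>c y. norm c = 1 \<Longrightarrow> norm y < 1 \<Longrightarrow> h (c * y) = h y"
    and int: "integrable disc_area (\<lambda>y. h y * \<omega> y)"
  shows "Bergman_projection \<omega> (\<lambda>y. sgn y ^ n * of_real (h y)) z
    = of_real (kcoeff \<omega> n) * z ^ n * of_real (\<integral>y. h y * norm y ^ n * \<omega> y \<partial>disc_area)"
proof -
  let ?f = "\<lambda>y. sgn y ^ n * complex_of_real (h y)"
  note [measurable] = radial_weight_measurable[OF w]
  have [measurable]: "(\<lambda>y::complex. sgn y ^ n) \<in> borel_measurable disc_area" "(\<lambda>y::complex. norm y) \<in> borel_measurable disc_area"
    by (rule borel_measurable_disc_area, measurable)+
  have [measurable]: "(\<lambda>y. cnj y) \<in> borel_measurable disc_area"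
    by (intro continuous_on_measurable_disc_area continuous_intros)
  have fi: "integrable disc_area (\<lambda>y. ?f y * of_real (\<omega> y))"
  proof (rule Bochner_Integration.integrable_bound[OF int])
    show "AE y in disc_area. norm (?f y * of_real (\<omega> y)) \<le> norm (h y * \<omega> y)"
    proof (rule AE_I2)
      fix y :: complex
      have "norm (sgn y) ^ n * (\<bar>h y\<bar> * \<bar>\<omega> y\<bar>) \<le> 1 * (\<bar>h y\<bar> * \<bar>\<omega> y\<bar>)"
        by (intro mult_right_mono power_le_one norm_sgn_le_1) auto
      then show "norm (?f y * of_real (\<omega> y)) \<le> norm (h y * \<omega> y)" by (simp add: norm_mult norm_power abs_mult mult.assoc)
    qed
  qed measurable
  have hi: "integrable disc_area (\<lambda>y. h y * norm y ^ n * \<omega> y)"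
  proof (rule Bochner_Integration.integrable_bound[OF int])
    show "AE y in disc_area. norm (h y * norm y ^ n * \<omega> y) \<le> norm (h y * \<omega> y)"
    proof (rule AE_I2)
      fix y assume "y \<in> space disc_area"
      then have "norm y ^ n * (\<bar>h y\<bar> * \<bar>\<omega> y\<bar>) \<le> 1 * (\<bar>h y\<bar> * \<bar>\<omega> y\<bar>)"
        by (intro mult_right_mono power_le_one) auto
      then show "norm (h y * norm y ^ n * \<omega> y) \<le> norm (h y * \<omega> y)" by (simp add: abs_mult mult_ac)
    qed
  qed measurable
  define t where "t k = of_real (kcoeff \<omega> k) * z ^ k * (\<integral>y. ?f y * cnj y ^ k * of_real (\<omega> y) \<partial>disc_area)" for k
  have "t sums Bergman_projection \<omega> ?f z"
    unfolding t_def projection_kernel_form(1)[OF w z] by (rule kser_integral_sums[OF w z _ fi]) measurable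
  moreover have "t k = 0" if "k \<noteq> n" for k
  proof -
    have "(\<integral>y. ?f y * cnj y ^ k * of_real (\<omega> y) \<partial>disc_area) = 0"
    proof (rule integral_eq_0_of_rotation[where n=n and k=k])
      show "?f (c * y) * cnj (c * y) ^ k * of_real (\<omega> (c * y)) = c ^ n * cnj c ^ k * (?f y * cnj y ^ k * of_real (\<omega> y))"
        if "norm c = 1" "norm y < 1" for c y
        using that rot[OF that] radial_weight_rotation[OF w that] by (simp add: sgn_rotation power_mult_distrib)
    qed (use that in \<open>measurable, simp\<close>)
    then show ?thesis by (simp add: t_def)
  qed
  then have "t sums t n" using sums_finite[of "{n}" t] by simp
  ultimately have "Bergman_projection \<omega> ?f z = t n" by (rule sums_unique2)
  also have "(\<integral>y. ?f y * cnj y ^ n * of_real (\<omega> y) \<partial>disc_area) = (\<integral>y. complex_of_real (h y * norm y ^ n * \<omega> y) \<partial>disc_area)"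
  proof (rule Bochner_Integration.integral_cong[OF refl])
    fix y :: complex
    have "sgn y * cnj y = of_real (norm y)"
    proof (cases "y = 0")
      case False
      have "sgn y * cnj y = (y * cnj y) / of_real (norm y)" by (simp add: sgn_div_norm scaleR_conv_of_real divide_inverse)
      also have "\<dots> = of_real (norm y)" using False by (simp add: complex_norm_square[symmetric] power2_eq_square)
      finally show ?thesis .
    qed simp
    then have "sgn y ^ n * cnj y ^ n = of_real (norm y ^ n)" by (simp flip: power_mult_distrib)
    then show "?f y * cnj y ^ n * of_real (\<omega> y) = complex_of_real (h y * norm y ^ n * \<omega> y)"
      by (simp add: mult_ac)
  qed
  then have "t n = of_real (kcoeff \<omega> n) * z ^ n * (\<integral>y. complex_of_real (h y * norm y ^ n * \<omega> y) \<partial>disc_area)"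
    by (simp only: t_def)
  also have "(\<integral>y. complex_of_real (h y * norm y ^ n * \<omega> y) \<partial>disc_area) = of_real (\<integral>y. h y * norm y ^ n * \<omega> y \<partial>disc_area)"
    by (rule integral_of_real[OF hi])
  finally show ?thesis .
qed

text \<open>The projection of the test function is a multiple of z^k, whose norm is the p-th root of
  the \<nu>-moment of order k p; boundedness of the projection thus becomes an inequality between
  numbers.\<close>

lemma projection_test_bound:
  fixes h :: "complex \<Rightarrow> real"
  assumes p: "1 < p" and w: "radial_weight \<omega>" and n: "radial_weight \<nu>"
    and C: "0 \<le> C" "\<And>f. f \<in> Lp p \<nu> \<Longrightarrow> Lp_norm p \<nu> (Bergman_projection \<omega> f) \<le> C * Lp_norm p \<nu> f"
    and h [measurable]: "h \<in> borel_measurable disc_area" and h0: "\<And>y. 0 \<le> h y"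
    and rot: "\<And>c y. norm c = 1 \<Longrightarrow> norm y < 1 \<Longrightarrow> h (c * y) = h y"
    and int: "integrable disc_area (\<lambda>y. h y * \<omega> y)"
    and B: "(\<integral>\<^sup>+y. ennreal (h y powr p * \<nu> y) \<partial>disc_area) \<le> ennreal B" "0 \<le> B"
  shows "kcoeff \<omega> k * (\<integral>y. h y * norm y ^ k * \<omega> y \<partial>disc_area) * wmom \<nu> (real k * p) powr (1/p) \<le> C * B powr (1/p)"
proof -
  let ?f = "\<lambda>y. sgn y ^ k * complex_of_real (h y)"
  define m where "m = kcoeff \<omega> k * (\<integral>y. h y * norm y ^ k * \<omega> y \<partial>disc_area)"
  have m0: "0 \<le> m"
    unfolding m_def using kcoeff_pos[OF w, of k]
    by (intro mult_nonneg_nonneg integral_nonneg_AE AE_I2) (auto intro!: mult_nonneg_nonneg h0 radial_weight_nonneg[OF w])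
  have fm: "?f \<in> borel_measurable disc_area"
  proof -
    have [measurable]: "(\<lambda>y::complex. sgn y ^ k) \<in> borel_measurable disc_area"
      by (rule borel_measurable_disc_area) measurable
    show ?thesis by measurable
  qed
  \<comment> \<open>\<open>sgn 0\<close> is 0, so the modulus may drop below h at the origin; the
    inequality is all that is needed.\<close>
  have fB: "(\<integral>\<^sup>+y. ennreal (norm (?f y) powr p * \<nu> y) \<partial>disc_area) \<le> ennreal B"
  proof (rule order_trans[OF nn_integral_mono B(1)])
    fix y assume "y \<in> space disc_area"
    then have n0: "0 \<le> \<nu> y" using radial_weight_nonneg[OF n] by simp
    have "norm (sgn y) ^ k * h y \<le> 1 * h y" by (intro mult_right_mono power_le_one norm_sgn_le_1 h0) auto
    then have "norm (?f y) \<le> h y" using h0[of y] by (simp add: norm_mult norm_power)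
    then have "norm (?f y) powr p \<le> h y powr p" using p by (intro powr_mono2) auto
    then show "ennreal (norm (?f y) powr p * \<nu> y) \<le> ennreal (h y powr p * \<nu> y)"
      using n0 by (intro ennreal_leI mult_right_mono)
  qed
  have fL: "?f \<in> Lp p \<nu>" using fm le_less_trans[OF fB ennreal_less_top] by (simp add: Lp_def)
  have fN: "Lp_norm p \<nu> ?f \<le> B powr (1/p)"
  proof -
    have "enn2real (\<integral>\<^sup>+y. ennreal (norm (?f y) powr p * \<nu> y) \<partial>disc_area) \<le> B" using fB B(2) by (rule enn2real_leI[rotated])
    then show ?thesis unfolding Lp_norm_eq[OF n fm] using p by (intro powr_mono2) auto
  qed
  have "(\<integral>\<^sup>+z. ennreal (norm (Bergman_projection \<omega> ?f z) powr p * \<nu> z) \<partial>disc_area) = (\<integral>\<^sup>+z. ennreal (m powr p) * (ennreal (norm z powr (real k * p)) * ennreal (\<nu> z)) \<partial>disc_area)"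
  proof (rule nn_integral_cong_AE)
    show "AE z in disc_area. ennreal (norm (Bergman_projection \<omega> ?f z) powr p * \<nu> z) = ennreal (m powr p) * (ennreal (norm z powr (real k * p)) * ennreal (\<nu> z))"
      using AE_disc_area_nonzero AE_space
    proof eventually_elim
      case (elim z)
      then have z: "norm z < 1" "z \<noteq> 0" by auto
      have n0: "0 \<le> \<nu> z" by (rule radial_weight_nonneg[OF n z(1)])
      have "Bergman_projection \<omega> ?f z = of_real m * z ^ k"
        using projection_monomial[OF w z(1) h rot int, of k] by (simp add: m_def mult_ac)
      then have "norm (Bergman_projection \<omega> ?f z) = m * norm z powr real k"
        using m0 z powr_realpow[of "norm z" k] by (simp add: norm_mult norm_power)
      then have "norm (Bergman_projection \<omega> ?f z) powr p = m powr p * norm z powr (real k * p)"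
        using m0 by (simp add: powr_mult powr_powr)
      then show ?case using n0 by (simp add: ennreal_mult mult.assoc)
    qed
  qed
  also have "\<dots> = ennreal (m powr p) * rmom (\<lambda>z. ennreal (\<nu> z)) (real k * p)"
  proof -
    note [measurable] = radial_weight_measurable[OF n]
    have [measurable]: "(\<lambda>z::complex. norm z powr (real k * p)) \<in> borel_measurable disc_area"
      by (rule borel_measurable_disc_area) measurable
    show ?thesis unfolding rmom_def by (rule nn_integral_cmult) measurable
  qed
  also have "\<dots> = ennreal (m powr p * wmom \<nu> (real k * p))"
    using p wmom_nonneg by (simp add: rmom_wmom[OF n] ennreal_mult)
  finally have e: "(\<integral>\<^sup>+z. ennreal (norm (Bergman_projection \<omega> ?f z) powr p * \<nu> z) \<partial>disc_area) = ennreal (m powr p * wmom \<nu> (real k * p))" .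
  have "m * wmom \<nu> (real k * p) powr (1/p) = Lp_norm p \<nu> (Bergman_projection \<omega> ?f)"
    unfolding Lp_norm_eq[OF n projection_measurable(1)[OF w fm]] e
    using p m0 wmom_nonneg[of \<nu> "real k * p"] by (simp add: powr_mult powr_powr)
  also have "\<dots> \<le> C * Lp_norm p \<nu> ?f" by (rule C(2)[OF fL])
  also have "\<dots> \<le> C * B powr (1/p)" by (rule mult_left_mono[OF fN C(1)])
  finally show ?thesis by (simp add: m_def)
qed

text \<open>Equality case of Hoelder, read with t = |y|^k, u = \<omega> and v = \<nu> at a point:
  for h = (t u / v)^(q-1) the quantities h t u and h^p v coincide and equal t^q times the dual
  weight.\<close>

lemma sdual_extremal:
  assumes p: "1 < p" and t: "0 < t" and nu: "0 < v" and om: "0 \<le> u"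
  shows "(t * u / v) powr (conj_exp p - 1) * t * u = t powr conj_exp p * (u / v powr (1/p)) powr conj_exp p"
    and "((t * u / v) powr (conj_exp p - 1)) powr p * v = (t * u / v) powr (conj_exp p - 1) * t * u"
proof -
  define q where "q = conj_exp p"
  have q: "1 < q" "(q - 1) * p = q" "1 / p * q = q - 1"
    using conj_exp_props[OF p] p by (auto simp: q_def mult.commute conj_exp_def field_simps)
  have q1: "x powr (q - 1) * x = x powr q" if "0 \<le> x" for x
    using powr_mult_base[OF that, of "q - 1"] by (simp add: mult.commute)
  have "(t * u / v) powr (q - 1) * t * u = ((t * u) powr (q - 1) * (t * u)) / v powr (q - 1)"
    using t nu om by (simp add: powr_divide)
  also have "\<dots> = (t * u) powr q / v powr (q - 1)" using q1[of "t * u"] t om by simp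
  also have "\<dots> = t powr q * (u powr q / v powr (1 / p * q))"
    using t om unfolding q(3) by (simp add: powr_mult)
  also have "\<dots> = t powr q * (u / v powr (1/p)) powr q"
    using nu om by (simp add: powr_divide powr_powr)
  finally show "(t * u / v) powr (conj_exp p - 1) * t * u = t powr conj_exp p * (u / v powr (1/p)) powr conj_exp p"
    by (simp add: q_def)
  have "((t * u / v) powr (q - 1)) powr p * v = (t * u / v) powr (q - 1) * (t * u / v) * v"
    using q1[of "t * u / v"] t nu om by (simp add: powr_powr q(2))
  then show "((t * u / v) powr (conj_exp p - 1)) powr p * v = (t * u / v) powr (conj_exp p - 1) * t * u"
    using nu by (simp add: q_def)
qed

text \<open>Testing with the extremal function bounds each \<sigma>-moment. The integrability of the
  dual weight is part of the conclusion, so \<open>sdual\<close> is handled by extended integrals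
  until order 0 has been bounded.\<close>

lemma D_const_finite_of_projection_bounded:
  assumes p: "1 < p" and w: "radial_weight \<omega>" and n: "radial_weight \<nu>"
    and b: "bounded_on_Lp p \<nu> (Bergman_projection_defined \<omega>) (Bergman_projection \<omega>)"
  shows "D_const p \<omega> \<nu> < \<infinity>"
proof -
  define q where "q = conj_exp p"
  note q = conj_exp_props[OF p, folded q_def]
  obtain C1 where C1: "\<And>f. f \<in> Lp p \<nu> \<Longrightarrow> Lp_norm p \<nu> (Bergman_projection \<omega> f) \<le> C1 * Lp_norm p \<nu> f"
    using b unfolding bounded_on_Lp_def by blast
  define C where "C = \<bar>C1\<bar>"
  have C: "0 \<le> C" "\<And>f. f \<in> Lp p \<nu> \<Longrightarrow> Lp_norm p \<nu> (Bergman_projection \<omega> f) \<le> C * Lp_norm p \<nu> f"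
  proof -
    show "0 \<le> C" by (simp add: C_def)
    fix f assume "f \<in> Lp p \<nu>"
    then have "Lp_norm p \<nu> (Bergman_projection \<omega> f) \<le> C1 * Lp_norm p \<nu> f" by (rule C1)
    also have "\<dots> \<le> C * Lp_norm p \<nu> f" unfolding C_def by (intro mult_right_mono Lp_norm_nonneg) simp
    finally show "Lp_norm p \<nu> (Bergman_projection \<omega> f) \<le> C * Lp_norm p \<nu> f" .
  qed
  note [measurable] = radial_weight_measurable[OF w] radial_weight_measurable[OF n]
  have nm [measurable]: "(\<lambda>y::complex. norm y) \<in> borel_measurable disc_area"
    by (rule borel_measurable_disc_area) measurable
  have bounded_int: "integrable disc_area (\<lambda>y. h y * \<omega> y)"
    if hm [measurable]: "h \<in> borel_measurable disc_area" and hB: "\<And>y. norm y < 1 \<Longrightarrow> \<bar>h y\<bar> \<le> B" for h :: "complex \<Rightarrow> real" and B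
  proof (rule Bochner_Integration.integrable_bound)
    show "integrable disc_area (\<lambda>y. B * \<omega> y)" using radial_weightD(3)[OF w] by simp
    show "AE y in disc_area. norm (h y * \<omega> y) \<le> norm (B * \<omega> y)"
    proof (rule AE_I2)
      fix y assume "y \<in> space disc_area"
      then have "\<bar>h y\<bar> \<le> \<bar>B\<bar>" using hB[of y] by simp
      then show "norm (h y * \<omega> y) \<le> norm (B * \<omega> y)" by (simp add: abs_mult mult_right_mono)
    qed
  qed measurable
  have AE0: "AE z in disc_area. \<nu> z = 0 \<longrightarrow> \<omega> z = 0"
  proof -
    \<comment> \<open>A test function of norm zero in \<open>Lp p \<nu>\<close>: its projection must
      have norm zero, which forces \<omega> to vanish almost everywhere where \<nu> does.\<close>
    define h where "h y = (if \<nu> y = 0 then 1 else 0 :: real)" for y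
    have hm [measurable]: "h \<in> borel_measurable disc_area" unfolding h_def by measurable
    have int: "integrable disc_area (\<lambda>y. h y * \<omega> y)" by (rule bounded_int[OF hm, of 1]) (simp add: h_def)
    have z: "(\<integral>\<^sup>+y. ennreal (h y powr p * \<nu> y) \<partial>disc_area) \<le> ennreal 0"
      by (rule order_trans[OF nn_integral_mono[where v="\<lambda>_. 0"]]) (auto simp: h_def)
    have "kcoeff \<omega> 0 * (\<integral>y. h y * norm y ^ 0 * \<omega> y \<partial>disc_area) * wmom \<nu> (real 0 * p) powr (1/p) \<le> C * 0 powr (1/p)"
    proof (rule projection_test_bound[OF p w n C hm _ _ int z])
      show "h (c * y) = h y" if "norm c = 1" "norm y < 1" for c y
        using radial_weight_rotation[OF n that] by (simp add: h_def)
    qed (simp_all add: h_def)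
    then have le: "(kcoeff \<omega> 0 * wmom \<nu> 0 powr (1/p)) * (\<integral>y. h y * \<omega> y \<partial>disc_area) \<le> 0" by (simp add: mult_ac)
    have c: "0 < kcoeff \<omega> 0 * wmom \<nu> 0 powr (1/p)" using kcoeff_pos[OF w, of 0] wmom_pos[OF n, of 0] by simp
    have le0: "(\<integral>y. h y * \<omega> y \<partial>disc_area) \<le> 0"
    proof (rule ccontr)
      assume "\<not> (\<integral>y. h y * \<omega> y \<partial>disc_area) \<le> 0"
      then have "0 < (\<integral>y. h y * \<omega> y \<partial>disc_area)" by (simp only: not_le)
      show False using leD[OF le] mult_pos_pos[OF c \<open>0 < (\<integral>y. h y * \<omega> y \<partial>disc_area)\<close>] by (rule notE)
    qed
    have nn: "AE y in disc_area. 0 \<le> h y * \<omega> y"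
      by (rule AE_I2) (simp add: h_def radial_weight_nonneg[OF w])
    from le0 integral_nonneg_AE[OF nn] have "(\<integral>y. h y * \<omega> y \<partial>disc_area) = 0" by simp
    then have "AE y in disc_area. h y * \<omega> y = 0" using integral_nonneg_eq_0_iff_AE[OF int nn] by simp
    then show ?thesis by eventually_elim (auto simp: h_def split: if_splits)
  qed
  \<comment> \<open>The bound to be shown for the q-th root of the \<sigma>-moment of order k q.
    Multiplied by the root of the \<nu>-moment it leaves C / kcoeff, which is C times the
    \<omega>-moment of order 2k.\<close>
  define L where "L k = C / (kcoeff \<omega> k * wmom \<nu> (real k * p) powr (1/p))" for k
  have kp: "0 < kcoeff \<omega> k * wmom \<nu> (real k * p) powr (1/p)" for k
    using kcoeff_pos[OF w, of k] wmom_pos[OF n, of "real k * p"] p by simp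
  have L0: "0 \<le> L k" for k using C(1) kp[of k] by (simp add: L_def)
  have s_mom: "rmom (\<lambda>z. ennreal (sdual p \<omega> \<nu> z)) (real k * q) \<le> ennreal (L k powr q)" for k
  proof -
    \<comment> \<open>The extremal function cut off where \<omega>/\<nu> exceeds j: it is then
      bounded, hence integrable against \<omega>, although nothing is known about the dual weight
      yet.\<close>
    define h where "h j y = (if \<nu> y \<noteq> 0 \<and> \<omega> y \<le> real j * \<nu> y then (norm y ^ k * \<omega> y / \<nu> y) powr (q - 1) else 0)" for j :: nat and y
    have hm [measurable]: "h j \<in> borel_measurable disc_area" for j unfolding h_def by measurable
    define F where "F j y = ennreal (h j y * norm y ^ k * \<omega> y)" for j y
    have Fm [measurable]: "F j \<in> borel_measurable disc_area" for j unfolding F_def by measurable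
    have hb: "\<bar>h j y\<bar> \<le> real j powr (q - 1)" if y: "norm y < 1" for j y
    proof (cases "\<nu> y \<noteq> 0 \<and> \<omega> y \<le> real j * \<nu> y")
      case True
      have "0 \<le> \<omega> y" "0 < \<nu> y" using radial_weight_nonneg[OF w y] radial_weight_nonneg[OF n y] True by auto
      then have "norm y ^ k * (\<omega> y / \<nu> y) \<le> 1 * real j"
        using True y by (intro mult_mono power_le_one) (auto simp: pos_divide_le_eq)
      then have "(norm y ^ k * \<omega> y / \<nu> y) powr (q - 1) \<le> real j powr (q - 1)"
        using q \<open>0 \<le> \<omega> y\<close> \<open>0 < \<nu> y\<close> by (intro powr_mono2) auto
      then show ?thesis using True by (simp add: h_def)
    qed (auto simp: h_def)
    have bound: "(\<integral>\<^sup>+y. F j y \<partial>disc_area) \<le> ennreal (L k powr q)" for j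
    proof -
      have int: "integrable disc_area (\<lambda>y. h j y * \<omega> y)" by (rule bounded_int[OF hm hb])
      have int': "integrable disc_area (\<lambda>y. h j y * norm y ^ k * \<omega> y)"
      proof (rule bounded_int[of "\<lambda>y. h j y * norm y ^ k" "real j powr (q - 1)"])
        show "\<bar>h j y * norm y ^ k\<bar> \<le> real j powr (q - 1)" if y: "norm y < 1" for y
        proof -
          have "\<bar>h j y\<bar> * norm y ^ k \<le> real j powr (q - 1) * 1"
            using hb[OF y] y by (intro mult_mono power_le_one) auto
          then show ?thesis by (simp add: abs_mult)
        qed
      qed measurable
      define m where "m = (\<integral>y. h j y * norm y ^ k * \<omega> y \<partial>disc_area)"
      have nn: "AE y in disc_area. 0 \<le> h j y * norm y ^ k * \<omega> y"
        by (rule AE_I2) (simp add: h_def radial_weight_nonneg[OF w])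
      have m0: "0 \<le> m" unfolding m_def by (rule integral_nonneg_AE[OF nn])
      have Fm: "(\<integral>\<^sup>+y. F j y \<partial>disc_area) = ennreal m"
        unfolding F_def m_def by (rule nn_integral_eq_integral[OF int' nn])
      have hp: "(\<integral>\<^sup>+y. ennreal (h j y powr p * \<nu> y) \<partial>disc_area) \<le> ennreal m"
        unfolding Fm[symmetric]
      proof (rule order_trans[OF nn_integral_mono_AE order_refl])
        show "AE y in disc_area. ennreal (h j y powr p * \<nu> y) \<le> F j y"
          using AE_disc_area_nonzero AE_space
        proof eventually_elim
          case (elim y)
          then have y: "norm y < 1" "0 < norm y ^ k" by auto
          show ?case
          proof (cases "\<nu> y \<noteq> 0 \<and> \<omega> y \<le> real j * \<nu> y")
            case True
            then have "0 < \<nu> y" using radial_weight_nonneg[OF n y(1)] by simp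
            then show ?thesis
              using True sdual_extremal(2)[OF p y(2) _ radial_weight_nonneg[OF w y(1)], of "\<nu> y"] by (simp add: F_def h_def q_def)
          qed (auto simp: F_def h_def)
        qed
      qed
      have "kcoeff \<omega> k * m * wmom \<nu> (real k * p) powr (1/p) \<le> C * m powr (1/p)"
        unfolding m_def
      proof (rule projection_test_bound[OF p w n C hm _ _ int])
        show "0 \<le> h j y" for y by (simp add: h_def)
        show "h j (c * y) = h j y" if "norm c = 1" "norm y < 1" for c y
          using radial_weight_rotation[OF n that] radial_weight_rotation[OF w that] that(1) by (simp add: h_def norm_mult)
      qed (use hp m0 in \<open>simp_all add: m_def\<close>)
      then have "m * (kcoeff \<omega> k * wmom \<nu> (real k * p) powr (1/p)) \<le> C * m powr (1/p)" by (simp only: mult_ac)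
      \<comment> \<open>The cutoff makes m finite; dividing by m^(1/p) gives a bound independent of
        j, so that the cutoff can be removed by monotone convergence.\<close>
      then have mL: "m \<le> L k * m powr (1/p)" using kp[of k] by (simp add: L_def pos_le_divide_eq)
      have "m \<le> L k powr q"
      proof (cases "m = 0")
        case False
        then have mp: "0 < m" using m0 by simp
        have "m = m powr (1/p + 1/q)" using mp q(2) by simp
        also have "\<dots> = m powr (1/p) * m powr (1/q)" by (rule powr_add)
        finally have "m powr (1/p) * m powr (1/q) \<le> m powr (1/p) * L k" using mL by (simp add: mult.commute)
        then have "m powr (1/q) \<le> L k" using mp by (simp add: mult_le_cancel_left_pos)
        then have "(m powr (1/q)) powr q \<le> L k powr q" using q by (intro powr_mono2) auto
        then show ?thesis using q mp by (simp add: powr_powr)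
      qed simp
      then show ?thesis unfolding Fm by (rule ennreal_leI)
    qed
    have "rmom (\<lambda>z. ennreal (sdual p \<omega> \<nu> z)) (real k * q) \<le> (\<integral>\<^sup>+y. (SUP j. F j y) \<partial>disc_area)"
      unfolding rmom_def
    proof (rule nn_integral_mono_AE)
      show "AE y in disc_area. ennreal (norm y powr (real k * q)) * ennreal (sdual p \<omega> \<nu> y) \<le> (SUP j. F j y)"
        using AE_disc_area_nonzero AE_space
      proof eventually_elim
        case (elim y)
        then have y: "norm y < 1" "0 < norm y" "0 < norm y ^ k" by auto
        show ?case
        proof (cases "\<nu> y = 0")
          case False
          then have v: "0 < \<nu> y" using radial_weight_nonneg[OF n y(1)] by simp
          note u = radial_weight_nonneg[OF w y(1)]
          obtain j :: nat where "\<omega> y / \<nu> y \<le> real j" using real_arch_simple by blast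
          then have j: "\<omega> y \<le> real j * \<nu> y" using v by (simp add: pos_divide_le_eq)
          have "norm y powr (real k * q) = (norm y ^ k) powr q"
            using y powr_realpow[of "norm y" k] by (simp add: powr_powr[symmetric])
          then have "norm y powr (real k * q) * sdual p \<omega> \<nu> y = h j y * norm y ^ k * \<omega> y"
            using sdual_extremal(1)[OF p y(3) v u] j False by (simp add: h_def sdual_def q_def)
          then have "ennreal (norm y powr (real k * q)) * ennreal (sdual p \<omega> \<nu> y) = F j y"
            by (simp add: F_def sdual_def flip: ennreal_mult)
          also have "\<dots> \<le> (SUP j. F j y)" by (rule SUP_upper) simp
          finally show ?thesis .
        qed (simp add: sdual_def)
      qed
    qed
    also have "\<dots> = (SUP j. \<integral>\<^sup>+y. F j y \<partial>disc_area)"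
    proof (rule nn_integral_monotone_convergence_SUP_AE)
      fix i :: nat
      show "AE y in disc_area. F i y \<le> F (Suc i) y"
        using AE_space
      proof eventually_elim
        case (elim y)
        then have y: "norm y < 1" by simp
        have "\<omega> y \<le> real i * \<nu> y \<Longrightarrow> \<omega> y \<le> real (Suc i) * \<nu> y"
          using radial_weight_nonneg[OF n y] by (simp add: distrib_right)
        then have "h i y \<le> h (Suc i) y" by (auto simp: h_def simp del: of_nat_Suc)
        then show ?case unfolding F_def
          using radial_weight_nonneg[OF w y] by (intro ennreal_leI mult_right_mono) auto
      qed
    qed measurable
    also have "\<dots> \<le> ennreal (L k powr q)" by (rule SUP_least) (rule bound)
    finally show ?thesis .
  qed
  have fin: "(\<integral>\<^sup>+z. dual_weight p \<omega> \<nu> z \<partial>disc_area) < \<infinity>"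
  proof -
    have "(\<integral>\<^sup>+z. dual_weight p \<omega> \<nu> z \<partial>disc_area) = rmom (\<lambda>z. ennreal (sdual p \<omega> \<nu> z)) (real 0 * q)"
      unfolding rmom_def
    proof (rule nn_integral_cong_AE)
      show "AE z in disc_area. dual_weight p \<omega> \<nu> z = ennreal (norm z powr (real 0 * q)) * ennreal (sdual p \<omega> \<nu> z)"
        using AE_dual_weight[OF AE0, of p] AE_disc_area_nonzero by eventually_elim simp
    qed
    also have "\<dots> < \<infinity>" using s_mom[of 0] by (rule le_less_trans) simp
    finally show ?thesis .
  qed
  interpret weight_triple p q \<nu> "sdual p \<omega> \<nu>" \<omega> unfolding q_def by (rule weight_triple_sdual[OF p w n fin])
  show ?thesis
  proof (rule D_const_finiteI[OF p w n fin, of C], fold q_def)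
    fix k :: nat
    have "ennreal (wmom (sdual p \<omega> \<nu>) (real k * q)) \<le> ennreal (L k powr q)"
      using s_mom[of k] q by (simp add: rmom_wmom[OF sigma])
    then have "wmom (sdual p \<omega> \<nu>) (real k * q) \<le> L k powr q" by (subst (asm) ennreal_le_iff) auto
    then have "wmom (sdual p \<omega> \<nu>) (real k * q) powr (1/q) \<le> (L k powr q) powr (1/q)"
      using q wmom_nonneg by (intro powr_mono2) auto
    also have "\<dots> = L k" using q L0 by (simp add: powr_powr)
    finally have "wmom \<nu> (real k * p) powr (1/p) * wmom (sdual p \<omega> \<nu>) (real k * q) powr (1/q) \<le> wmom \<nu> (real k * p) powr (1/p) * L k"
      by (intro mult_left_mono) auto
    also have "\<dots> = C * wmom \<omega> (2 * real k)"
      using wmom_pos[OF n, of "real k * p"] wmom_pos[OF w, of "2 * real k"] p by (simp add: L_def kcoeff_def)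
    finally show "wmom \<nu> (real k * p) powr (1/p) * wmom (sdual p \<omega> \<nu>) (real k * q) powr (1/q) \<le> C * wmom \<omega> (2 * real k)" .
  qed
qed

theorem theorem2:
  fixes \<omega> \<nu> :: "complex \<Rightarrow> real" and p :: real
  assumes "radial_weight \<omega>" and "\<nu> \<in> D_class" and "1 < p"
  shows
    "(bounded_on_Lp p \<nu> (Bergman_projection_defined \<omega>) (Bergman_projection \<omega>)
        \<longleftrightarrow> bounded_on_Lp p \<nu> (maximal_Bergman_projection_defined \<omega>) (maximal_Bergman_projection \<omega>)) \<and>
     (bounded_on_Lp p \<nu> (maximal_Bergman_projection_defined \<omega>) (maximal_Bergman_projection \<omega>)
        \<longleftrightarrow> D_const p \<omega> \<nu> < \<infinity>) \<and>
     (D_const p \<omega> \<nu> < \<infinity> \<longleftrightarrow> A_const p \<omega> \<nu> < \<infinity> \<and> \<omega> \<in> D_hat)"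
proof -
  note w = assms(1) and p = assms(3)
  have n: "radial_weight \<nu>" "tail_doubling (wtail \<nu>)" "tail_vanishing (wtail \<nu>)"
    using assms(2) D_hat_tail_doubling D_check_tail_vanishing by (auto simp: D_class_def D_hat_def)
  note mb = maximal_projection_bounded[OF p w n] and pb = projection_bounded_of_maximal[OF p w n(1)]
    and Df = D_const_finite_of_projection_bounded[OF p w n(1)] and DA = D_const_imp_A_const[OF p w n(1) _ n(2)]
  \<comment> \<open>The cycle (iv) to (ii) to (i) to (iii) to (iv) yields all three
    equivalences.\<close>
  show ?thesis using mb pb Df DA D_hat_tail_doubling by blast
qed

end
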